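(* Let $\mathbb{K}$ be a field of characteristic $p>0$ that contains all roots of $1$. Let $A$ be a (central) division algebra over $\mathbb{K}$ of dimension $n^2$, and let $X$ be the corresponding Severi--Brauer variety. Write $n=n'p^m$ for some non-negative integers $m$ and $n'$ such that $n'$ is coprime to $p$. Then every finite subgroup $G\subset\operatorname{Aut}(X)$ is a semi-direct product $G=H\rtimes S$ of its normal subgroup $H$ whose order is coprime to $p$ and is less than or equal to ${n'}^{2(n-1)}$, and an abelian $p$-group $S$ of exponent less than or equal to $p^m$.
   Context: A field $\mathbb{K}$ contains all roots of $1$ if for every positive integer $n$ the polynomial $x^n-1$ splits completely in $\mathbb{K}[x]$. The Severi--Brauer variety corresponding to a central simple algebra $A$ of dimension $n^2$ over $\mathbb{K}$ is the $(n-1)$-dimensional variety parametrizing right ideals of $A$ of dimension $n$; it is a form of $\mathbb{P}^{n-1}$. $\operatorname{Aut}(X)$ is the group of automorphisms over $\mathbb{K}$. *)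

theory Defs
  imports
    "HOL-Algebra.Algebraic_Closure_Type"
    "HOL-Algebra.Bij"
    "HOL-Algebra.Coset"
    "HOL-Library.FuncSet"
    "HOL-Library.Function_Algebras"
    "HOL-Library.Multiset"
    "HOL-Computational_Algebra.Computational_Algebra"
    "Jordan_Normal_Form.Determinant"
begin

section \<open>Fields, algebras and groups\<close>

definition contains_all_roots_of_unity :: "'k::field itself \<Rightarrow> bool" where
  "contains_all_roots_of_unity _ \<longleftrightarrow>
     (\<forall>N>0. \<exists>R::'k multiset. monom 1 N - 1 = (\<Prod>r\<in>#R. [:-r, 1:]))"

locale central_division_algebra = vector_space scale
  for scale :: "'k::field \<Rightarrow> 'a::division_ring \<Rightarrow> 'a" +
  assumes scale_mult_left: "scale c x * y = scale c (x * y)"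
    and scale_mult_right: "x * scale c y = scale c (x * y)"
    and center_eq: "{z. \<forall>x. z * x = x * z} = range (\<lambda>c. scale c 1)"
    and finite_dimensional: "\<exists>B. finite B \<and> span B = UNIV"

definition is_basis :: "('k::field \<Rightarrow> 'a::ab_group_add \<Rightarrow> 'a) \<Rightarrow> 'a set \<Rightarrow> bool" where
  "is_basis scale B \<longleftrightarrow> \<not> module.dependent scale B \<and> module.span scale B = UNIV"

definition internal_semidirect_product :: "('g, 'b) monoid_scheme \<Rightarrow> 'g set \<Rightarrow> 'g set \<Rightarrow> bool" where
  "internal_semidirect_product G H S \<longleftrightarrow>
     H \<lhd> G \<and> subgroup S G \<and> H \<inter> S = {\<one>\<^bsub>G\<^esub>} \<and> H <#>\<^bsub>G\<^esub> S = carrier G"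

definition group_exp :: "('g, 'b) monoid_scheme \<Rightarrow> nat" where
  "group_exp G = (LEAST e. e > 0 \<and> (\<forall>x\<in>carrier G. x [^]\<^bsub>G\<^esub> e = \<one>\<^bsub>G\<^esub>))"


section \<open>Projective geometry over a field that need not be algebraically closed\<close>

text \<open>
  A (geometrically reduced) projective variety over \<open>\<bbbK>\<close> is given by its set \<open>Y\<close> of points over
  the algebraic closure together with a map \<open>\<phi>\<close> choosing homogeneous coordinates, indexed by \<open>T\<close>,
  of each point. Topology and regular functions are those over \<open>\<bbbK>\<close>: only forms with
  coefficients in \<open>\<bbbK>\<close> are used. As regular functions are allowed to take values in the algebraic
  closure, this is the \<open>\<bbbK>\<close>-structure of the variety (also for imperfect \<open>\<bbbK>\<close>), and a morphism
  over \<open>\<bbbK>\<close> is a continuous map that pulls regular functions back to regular functions.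
\<close>

text \<open>Forms of degree \<open>d\<close> with coefficients in \<open>\<bbbK>\<close>, as functions on the points with coordinates
  in the algebraic closure; since the latter is infinite, no information is lost.\<close>

inductive form ::
  "'i set \<Rightarrow> nat \<Rightarrow> (('i \<Rightarrow> 'k::field alg_closure) \<Rightarrow> 'k alg_closure) \<Rightarrow> bool" for T where
  const: "form T 0 (\<lambda>_. to_ac c)"
| coord: "i \<in> T \<Longrightarrow> form T 1 (\<lambda>v. v i)"
| add: "form T d P \<Longrightarrow> form T d Q \<Longrightarrow> form T d (\<lambda>v. P v + Q v)"
| mult: "form T d P \<Longrightarrow> form T e Q \<Longrightarrow> form T (d + e) (\<lambda>v. P v * Q v)"

definition zariski_open ::
  "'i set \<Rightarrow> ('x \<Rightarrow> 'i \<Rightarrow> 'k::field alg_closure) \<Rightarrow> 'x set \<Rightarrow> 'x set \<Rightarrow> bool" where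
  "zariski_open T \<phi> Y U \<longleftrightarrow>
     (\<exists>Fs. (\<forall>F\<in>Fs. \<exists>d. form T d F) \<and> U = Y - {x\<in>Y. \<forall>F\<in>Fs. F (\<phi> x) = 0})"

definition regular_on ::
  "'i set \<Rightarrow> ('x \<Rightarrow> 'i \<Rightarrow> 'k::field alg_closure) \<Rightarrow> 'x set \<Rightarrow> 'x set \<Rightarrow> ('x \<Rightarrow> 'k alg_closure) \<Rightarrow> bool"
  where
  "regular_on T \<phi> Y U g \<longleftrightarrow>
     (\<forall>x\<in>U. \<exists>V d P Q. zariski_open T \<phi> Y V \<and> x \<in> V \<and> V \<subseteq> U \<and> form T d P \<and> form T d Q \<and>
        (\<forall>y\<in>V. Q (\<phi> y) \<noteq> 0 \<and> g y = P (\<phi> y) / Q (\<phi> y)))"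

definition endomorphism ::
  "'i set \<Rightarrow> ('x \<Rightarrow> 'i \<Rightarrow> 'k::field alg_closure) \<Rightarrow> 'x set \<Rightarrow> ('x \<Rightarrow> 'x) \<Rightarrow> bool" where
  "endomorphism T \<phi> Y f \<longleftrightarrow> f \<in> Y \<rightarrow> Y \<and>
     (\<forall>U. zariski_open T \<phi> Y U \<longrightarrow>
        zariski_open T \<phi> Y {x\<in>Y. f x \<in> U} \<and>
        (\<forall>g. regular_on T \<phi> Y U g \<longrightarrow> regular_on T \<phi> Y {x\<in>Y. f x \<in> U} (\<lambda>x. g (f x))))"

definition Aut_variety ::
  "'i set \<Rightarrow> ('x \<Rightarrow> 'i \<Rightarrow> 'k::field alg_closure) \<Rightarrow> 'x set \<Rightarrow> ('x \<Rightarrow> 'x) monoid" where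
  "Aut_variety T \<phi> Y = (BijGroup Y)
     \<lparr>carrier := {f \<in> Bij Y. endomorphism T \<phi> Y f \<and> endomorphism T \<phi> Y (inv_into Y f)}\<rparr>"

lemma endomorphism_cong:
  assumes "endomorphism T \<phi> Y f" "\<And>x. x \<in> Y \<Longrightarrow> f x = g x"
  shows "endomorphism T \<phi> Y g"
proof -
  have *: "{x\<in>Y. f x \<in> U} = {x\<in>Y. g x \<in> U}" for U
    using assms(2) by auto
  have **: "regular_on T \<phi> Y {x\<in>Y. g x \<in> U} (\<lambda>x. h (f x)) \<Longrightarrow>
        regular_on T \<phi> Y {x\<in>Y. g x \<in> U} (\<lambda>x. h (g x))" for U and h :: "_ \<Rightarrow> 'c alg_closure"
    unfolding regular_on_def
  proof (intro ballI, goal_cases)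
    case (1 x)
    then obtain V d P Q where V: "zariski_open T \<phi> Y V" "x \<in> V" "V \<subseteq> {x\<in>Y. g x \<in> U}"
        "form T d P" "form T d Q" "\<forall>y\<in>V. Q (\<phi> y) \<noteq> 0 \<and> h (f y) = P (\<phi> y) / Q (\<phi> y)"
      by blast
    moreover have "\<forall>y\<in>V. Q (\<phi> y) \<noteq> 0 \<and> h (g y) = P (\<phi> y) / Q (\<phi> y)"
      using V(3,6) assms(2) by fastforce
    ultimately show ?case by blast
  qed
  show ?thesis
    using assms ** unfolding endomorphism_def * by (auto simp: Pi_iff)
qed

lemma endomorphism_comp:
  assumes f: "endomorphism T \<phi> Y f" and g: "endomorphism T \<phi> Y g"
  shows "endomorphism T \<phi> Y (\<lambda>x. g (f x))"
proof -
  have *: "{x\<in>Y. f x \<in> {y\<in>Y. g y \<in> U}} = {x\<in>Y. g (f x) \<in> U}" for U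
    using f unfolding endomorphism_def by (auto simp: Pi_iff)
  have 1: "zariski_open T \<phi> Y {x\<in>Y. g x \<in> U}"
    "\<And>h. regular_on T \<phi> Y U h \<Longrightarrow> regular_on T \<phi> Y {x\<in>Y. g x \<in> U} (\<lambda>x. h (g x))"
    if "zariski_open T \<phi> Y U" for U
    using g that unfolding endomorphism_def by auto
  have 2: "zariski_open T \<phi> Y {x\<in>Y. f x \<in> U}"
    "\<And>h. regular_on T \<phi> Y U h \<Longrightarrow> regular_on T \<phi> Y {x\<in>Y. f x \<in> U} (\<lambda>x. h (f x))"
    if "zariski_open T \<phi> Y U" for U
    using f that unfolding endomorphism_def by auto
  show ?thesis unfolding endomorphism_def
  proof (intro conjI allI impI)
    show "(\<lambda>x. g (f x)) \<in> Y \<rightarrow> Y"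
      using f g unfolding endomorphism_def by (auto simp: Pi_iff)
    fix U assume U: "zariski_open T \<phi> Y U"
    show "zariski_open T \<phi> Y {x\<in>Y. g (f x) \<in> U}"
      using 2(1)[OF 1(1)[OF U]] unfolding * .
    fix h assume "regular_on T \<phi> Y U h"
    from 2(2)[OF 1(1)[OF U] 1(2)[OF U this]]
    show "regular_on T \<phi> Y {x\<in>Y. g (f x) \<in> U} (\<lambda>x. h (g (f x)))" unfolding * .
  qed
qed

lemma endomorphism_id: "endomorphism T \<phi> Y (\<lambda>x. x)"
proof -
  have "U \<subseteq> Y" if "zariski_open T \<phi> Y U" for U
    using that unfolding zariski_open_def by auto
  then have "{x\<in>Y. x \<in> U} = U" if "zariski_open T \<phi> Y U" for U
    using that by blast
  then show ?thesis unfolding endomorphism_def by simp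
qed

lemma subgroup_Aut_variety: "subgroup (carrier (Aut_variety T \<phi> Y)) (BijGroup Y)"
proof (rule group.subgroupI[OF group_BijGroup])
  let ?A = "carrier (Aut_variety T \<phi> Y)"
  have A: "?A = {f \<in> Bij Y. endomorphism T \<phi> Y f \<and> endomorphism T \<phi> Y (inv_into Y f)}"
    by (simp add: Aut_variety_def)
  show "?A \<subseteq> carrier (BijGroup Y)" by (auto simp: A BijGroup_def)
  have "inv_into Y (\<lambda>x\<in>Y. x) x = x" if "x \<in> Y" for x
    using that f_inv_into_f[of x "\<lambda>x\<in>Y. x" Y] inv_into_into[of x "\<lambda>x\<in>Y. x" Y] by simp
  then have "endomorphism T \<phi> Y (inv_into Y (\<lambda>x\<in>Y. x))"
    by (intro endomorphism_cong[OF endomorphism_id]) simp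
  moreover have "endomorphism T \<phi> Y (\<lambda>x\<in>Y. x)"
    by (intro endomorphism_cong[OF endomorphism_id]) simp
  ultimately have "(\<lambda>x\<in>Y. x) \<in> ?A" by (simp add: A id_Bij)
  then show "?A \<noteq> {}" by blast
  fix f assume f: "f \<in> ?A"
  then have fB: "bij_betw f Y Y" "f \<in> Bij Y" by (auto simp: A Bij_def)
  define h where "h = (\<lambda>x\<in>Y. inv_into Y f x)"
  have hB: "h \<in> Bij Y" using fB restrict_inv_into_Bij by (simp add: h_def)
  have hi: "inv_into Y h x = f x" if "x \<in> Y" for x
  proof (rule inv_into_f_eq)
    show "inj_on h Y" using hB by (simp add: Bij_def bij_betw_def)
    show "f x \<in> Y" using fB that bij_betwE by blast
    show "h (f x) = x" using \<open>f x \<in> Y\<close> fB that by (simp add: h_def bij_betw_inv_into_left)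
  qed
  have fE: "endomorphism T \<phi> Y f" "endomorphism T \<phi> Y (inv_into Y f)"
    using f by (auto simp: A)
  have "endomorphism T \<phi> Y h"
    by (rule endomorphism_cong[OF fE(2)]) (simp add: h_def)
  moreover have "endomorphism T \<phi> Y (inv_into Y h)"
    by (rule endomorphism_cong[OF fE(1)]) (simp add: hi)
  ultimately have "h \<in> ?A" using hB by (simp add: A)
  then show "inv\<^bsub>BijGroup Y\<^esub> f \<in> ?A"
    using fB(2) by (simp add: inv_BijGroup h_def)
  fix g assume g: "g \<in> ?A"
  then have gB: "bij_betw g Y Y" "g \<in> Bij Y" by (auto simp: A Bij_def)
  have gE: "endomorphism T \<phi> Y g" "endomorphism T \<phi> Y (inv_into Y g)"
    using g by (auto simp: A)
  have cB: "compose Y f g \<in> Bij Y" using fB gB compose_Bij by blast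
  have ci: "inv_into Y (compose Y f g) x = inv_into Y g (inv_into Y f x)" if "x \<in> Y" for x
  proof (rule inv_into_f_eq)
    show "inj_on (compose Y f g) Y" using cB by (simp add: Bij_def bij_betw_def)
    have fx: "inv_into Y f x \<in> Y" by (rule Bij_inv_into_mem[OF fB(2) that])
    show gx: "inv_into Y g (inv_into Y f x) \<in> Y" by (rule Bij_inv_into_mem[OF gB(2) fx])
    show "compose Y f g (inv_into Y g (inv_into Y f x)) = x"
      using fB gB fx gx that by (simp add: compose_def bij_betw_inv_into_right)
  qed
  have "endomorphism T \<phi> Y (compose Y f g)"
    by (rule endomorphism_cong[OF endomorphism_comp[OF gE(1) fE(1)]]) (simp add: compose_def)
  moreover have "endomorphism T \<phi> Y (inv_into Y (compose Y f g))"
    by (rule endomorphism_cong[OF endomorphism_comp[OF fE(2) gE(2)]]) (simp add: ci)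
  ultimately show "f \<otimes>\<^bsub>BijGroup Y\<^esub> g \<in> ?A"
    using cB fB gB by (simp add: A BijGroup_def)
qed

lemma group_Aut_variety: "group (Aut_variety T \<phi> Y)"
  using group.subgroup_imp_group[OF group_BijGroup subgroup_Aut_variety[of T \<phi> Y]]
  by (simp add: Aut_variety_def)


section \<open>Severi--Brauer varieties\<close>

text \<open>
  The scalar extension of an algebra \<open>A\<close> to the algebraic closure: fixing a finite basis \<open>B\<close> of
  \<open>A\<close>, its elements are the families of coefficients indexed by \<open>B\<close> (functions vanishing off
  \<open>B\<close>), and the multiplication is given by the structure constants of \<open>A\<close>.
\<close>

abbreviation fun_scale :: "'l::field \<Rightarrow> ('a \<Rightarrow> 'l) \<Rightarrow> 'a \<Rightarrow> 'l" where
  "fun_scale c x \<equiv> (\<lambda>b. c * x b)"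

lemma vector_space_fun_scale: "vector_space fun_scale"
  by unfold_locales (auto simp: algebra_simps)

definition ext_carrier :: "'a set \<Rightarrow> ('a \<Rightarrow> 'k::field alg_closure) set" where
  "ext_carrier B = {x. \<forall>b. b \<notin> B \<longrightarrow> x b = 0}"

definition ext_mult :: "('k::field \<Rightarrow> 'a::ring_1 \<Rightarrow> 'a) \<Rightarrow> 'a set \<Rightarrow>
    ('a \<Rightarrow> 'k alg_closure) \<Rightarrow> ('a \<Rightarrow> 'k alg_closure) \<Rightarrow> 'a \<Rightarrow> 'k alg_closure" where
  "ext_mult scale B x y =
     (\<lambda>c. \<Sum>a\<in>B. \<Sum>b\<in>B. x a * y b * to_ac (module.representation scale B (a * b) c))"

definition SB_points :: "('k::field \<Rightarrow> 'a::ring_1 \<Rightarrow> 'a) \<Rightarrow> 'a set \<Rightarrow> nat \<Rightarrow>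
    ('a \<Rightarrow> 'k alg_closure) set set" where
  "SB_points scale B n = {I. I \<subseteq> ext_carrier B \<and> module.subspace fun_scale I \<and>
     (\<forall>x\<in>I. \<forall>y\<in>ext_carrier B. ext_mult scale B x y \<in> I) \<and> vector_space.dim fun_scale I = n}"

text \<open>
  Pluecker coordinates of an \<open>n\<close>-dimensional subspace, indexed by all \<open>n\<close>-tuples of elements of
  \<open>B\<close>: the \<open>n \<times> n\<close> minors of the matrix whose rows are the vectors of an ordered basis of the
  subspace. The choice of that basis only affects them by a common nonzero factor.
\<close>

definition ordered_basis :: "nat \<Rightarrow> ('a \<Rightarrow> 'l::field) set \<Rightarrow> nat \<Rightarrow> 'a \<Rightarrow> 'l" where
  "ordered_basis n I = (SOME w. inj_on w {..<n} \<and> \<not> module.dependent fun_scale (w ` {..<n}) \<and>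
     module.span fun_scale (w ` {..<n}) = I)"

definition plucker :: "nat \<Rightarrow> ('a \<Rightarrow> 'l::field) set \<Rightarrow> (nat \<Rightarrow> 'a) \<Rightarrow> 'l" where
  "plucker n I J = det (mat n n (\<lambda>(i, j). ordered_basis n I i (J j)))"

text \<open>The group of automorphisms over \<open>\<bbbK>\<close> of the Severi--Brauer variety of right ideals of
  dimension \<open>n\<close>, with the projective structure induced from the Grassmannian.\<close>

definition SB_Aut :: "('k::field \<Rightarrow> 'a::ring_1 \<Rightarrow> 'a) \<Rightarrow> 'a set \<Rightarrow> nat \<Rightarrow>
    (('a \<Rightarrow> 'k alg_closure) set \<Rightarrow> ('a \<Rightarrow> 'k alg_closure) set) monoid" where
  "SB_Aut scale B n = Aut_variety ({..<n} \<rightarrow>\<^sub>E B) (plucker n) (SB_points scale B n)"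

end

theory Submission
  imports Defs "HOL-Algebra.Sylow" "Jordan_Normal_Form.Char_Poly"
begin

text \<open>
  Over the algebraic closure, \<open>A\<close> becomes the algebra of endomorphisms of an \<open>n\<close>-dimensional space
  \<open>V\<close>, and the points of \<open>X\<close> are the lines of \<open>V\<close>. An automorphism of \<open>X\<close> restricts to polynomial maps
  of lines and planes; coprime representations by homogeneous polynomials have degree one, so it lifts to
  a linear map \<open>u\<close> of \<open>V\<close>. It is defined over \<open>\<bbbK>\<close>, which at the eigenvectors of an element of \<open>A\<close> with \<open>n\<close>
  distinct eigenvalues gives linear equations for \<open>u\<close> with coefficients in \<open>\<bbbK>\<close>; applying a \<open>\<bbbK>\<close>-linear
  functional to \<open>u\<close>, one finds that \<open>u\<close> is a multiple of an element of \<open>A\<close>. So \<open>G\<close> embeds into the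
  multiplicative group of \<open>A\<close> modulo that of \<open>\<bbbK>\<close>.

  There, the transfer shows that a commutator of lifts is a root of unity up to scalars, hence central, so
  \<open>G\<close> is abelian and splits into its parts \<open>H\<close> of order prime to \<open>p\<close> and \<open>S\<close> of \<open>p\<close>-power order. Lifts of the
  elements of \<open>H\<close> are linearly independent and span a subalgebra, whence \<open>|H|\<close> divides the dimension of \<open>A\<close>
  and is at most the square of \<open>n'\<close>. Lifts of elements of \<open>S\<close> are purely inseparable, and the degree of
  such an element divides \<open>n\<close>.
\<close>

section \<open>Division algebras and their multiplication operators\<close>

text \<open>In its place, proportionality conditions on u are evaluated at all n roots of the
  minimal polynomial of one separable element. They are linear in u with coefficients polynomial
  over \<open>K\<close> in the root; reduced modulo that polynomial they become equations over
  \<open>K\<close> and survive a \<open>K\<close>-linear functional. The functional is 1 on a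
  nonzero coordinate of u, so the image is not 0. The separable element comes from density of
  rational points: a field of positive characteristic containing all roots of unity is infinite. The
  other obstacle is that an automorphism is known only through local formulas. Unique factorisation
  glues them into one coprime formula, and three variables suffice to see lines and planes. Its
  degree cannot be found by multiplying degrees of a map and its inverse, since the image of a plane
  is not known to be a plane; instead the inverse is pulled back along a cone over the image of a
  line, with a weighted scaling that ties the degree to that of the identity.\<close>

context finite_dimensional_vector_space
begin

lemma dim_direct_sum:
  assumes S: "subspace S" and T: "subspace T" and ST: "S \<inter> T = {0}"
  shows "dim {s + t |s t. s \<in> S \<and> t \<in> T} = dim S + dim T"
proof -
  obtain b1 where b1: "b1 \<subseteq> S" "independent b1" "S \<subseteq> span b1" "card b1 = dim S"
    using basis_exists by blast
  obtain b2 where b2: "b2 \<subseteq> T" "independent b2" "T \<subseteq> span b2" "card b2 = dim T"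
    using basis_exists by blast
  have fin: "finite b1" "finite b2" using b1 b2 finiteI_independent by auto
  have "0 \<notin> b1" using b1(2) dependent_zero by metis
  moreover have "b1 \<inter> b2 \<subseteq> {0}" using b1(1) b2(1) ST by auto
  ultimately have disj: "b1 \<inter> b2 = {}" by auto
  have "independent (b1 \<union> b2)"
  proof (rule independent_if_scalars_zero)
    show "finite (b1 \<union> b2)" using fin by simp
    fix f x assume s: "(\<Sum>x\<in>b1 \<union> b2. scale (f x) x) = 0" and x: "x \<in> b1 \<union> b2"
    have eq: "(\<Sum>x\<in>b1. scale (f x) x) = - (\<Sum>x\<in>b2. scale (f x) x)"
      using s unfolding sum.union_disjoint[OF fin disj] by (simp add: eq_neg_iff_add_eq_0)
    have "(\<Sum>x\<in>b1. scale (f x) x) \<in> S"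
      using S b1(1) by (intro subspace_sum subspace_scale) auto
    moreover have "- (\<Sum>x\<in>b2. scale (f x) x) \<in> T"
      using T b2(1) by (intro subspace_sum subspace_scale subspace_neg) auto
    ultimately have "(\<Sum>x\<in>b1. scale (f x) x) \<in> S \<inter> T" unfolding eq by blast
    then have "(\<Sum>x\<in>b1. scale (f x) x) = 0" unfolding ST by simp
    moreover from this have "(\<Sum>x\<in>b2. scale (f x) x) = 0" using eq by simp
    ultimately show "f x = 0"
      using independentD[OF b1(2) fin(1) subset_refl, of f x] independentD[OF b2(2) fin(2) subset_refl, of f x] x
      by blast
  qed
  moreover have "{s + t |s t. s \<in> S \<and> t \<in> T} = span (b1 \<union> b2)"
    unfolding span_Un span_subspace[OF b1(1,3) S] span_subspace[OF b2(1,3) T] ..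
  ultimately show ?thesis
    using dim_span_eq_card_independent[of "b1 \<union> b2"] card_Un_disjoint[OF fin disj] b1(4) b2(4) by simp
qed

lemma dim_linear_image:
  assumes "Vector_Spaces.linear scale scale f" and "inj_on f S" and "subspace S"
  shows "dim (f ` S) = dim S"
proof -
  interpret p: finite_dimensional_vector_space_pair_1 scale Basis scale
    by unfold_locales
  have "span S = S" using assms(3) by (simp only: span_eq_iff)
  then show ?thesis using p.dim_image_eq[OF assms(1), of S] assms(2) by metis
qed

end

context central_division_algebra
begin

text \<open>A basis fixed as a constant, because the locale of finite-dimensional spaces interpreted
  below takes its basis as a parameter.\<close>

definition some_basis :: "'a set" where
  "some_basis = (SOME B. finite B \<and> independent B \<and> span B = UNIV)"

lemma some_basis: "finite some_basis" "independent some_basis" "span some_basis = UNIV"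
proof -
  obtain B where B: "finite B" "span B = UNIV" using finite_dimensional by blast
  obtain C where "C \<subseteq> B" "independent C" "B \<subseteq> span C"
    using maximal_independent_subset by blast
  then have "finite C \<and> independent C \<and> span C = UNIV"
    using B by (metis finite_subset span_mono span_span top.extremum_unique)
  then have "\<exists>B. finite B \<and> independent B \<and> span B = UNIV" by blast
  from someI_ex[OF this] show "finite some_basis" "independent some_basis" "span some_basis = UNIV"
    by (auto simp: some_basis_def)
qed

end

sublocale central_division_algebra \<subseteq> finite_dimensional_vector_space scale some_basis
  using some_basis by unfold_locales auto

context central_division_algebra
begin

lemma scale_one_commute: "scale c 1 * x = x * scale c 1"
  by (simp add: scale_mult_left scale_mult_right)

lemma centralD: "(\<And>x. z * x = x * z) \<Longrightarrow> \<exists>c. z = scale c 1"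
  using center_eq by blast

lemma linear_mult_left: "Vector_Spaces.linear scale scale (\<lambda>y. x * y)"
  by unfold_locales (auto simp: distrib_left scale_mult_right)

lemma linear_mult_right: "Vector_Spaces.linear scale scale (\<lambda>y. y * x)"
  by unfold_locales (auto simp: distrib_right scale_mult_left)

lemma scale_eq_one_iff: "scale c 1 = scale d 1 \<longleftrightarrow> c = d"
  by (metis scale_cancel_right zero_neq_one)

section \<open>Subalgebras of a division algebra and divisibility of dimensions\<close>

definition is_subalg :: "'a set \<Rightarrow> bool" where
  "is_subalg D \<longleftrightarrow> subspace D \<and> 1 \<in> D \<and> (\<forall>x\<in>D. \<forall>y\<in>D. x * y \<in> D)"

text \<open>Left multiplication by \<open>x\<close> maps the finite-dimensional space
  \<open>D\<close> injectively into itself, hence onto itself, so it reaches 1.\<close>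

lemma is_subalg_inverse:
  assumes D: "is_subalg D" and x: "x \<in> D" "x \<noteq> 0"
  shows "inverse x \<in> D"
proof -
  have sD: "subspace D" using D by (simp add: is_subalg_def)
  have "dim ((\<lambda>y. x * y) ` D) = dim D"
    by (rule dim_linear_image[OF linear_mult_left _ sD]) (use x in \<open>auto simp: inj_on_def\<close>)
  moreover have "(\<lambda>y. x * y) ` D \<subseteq> D" using D x by (auto simp: is_subalg_def)
  moreover have "subspace ((\<lambda>y. x * y) ` D)"
    using module_hom.subspace_image linear_mult_left sD module_hom_iff_linear by blast
  ultimately have "(\<lambda>y. x * y) ` D = D"
    using subspace_dim_equal[of "(\<lambda>y. x * y) ` D" D] sD by simp
  moreover have "1 \<in> D" using D by (simp add: is_subalg_def)
  ultimately obtain y where "y \<in> D" "1 = x * y" by blast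
  then show ?thesis using inverse_unique[of x y] by simp
qed

text \<open>\<open>D\<close> is a division algebra, so a nonzero \<open>d * x\<close> in
  \<open>W\<close> would bring \<open>x\<close> itself into \<open>W\<close>: the sum of
  \<open>W\<close> and \<open>D x\<close> is direct. This is one step in growing a basis of a left
  \<open>D\<close>-space.\<close>

lemma adjoin:
  assumes D: "is_subalg D" and W: "subspace W" "\<And>d w. d \<in> D \<Longrightarrow> w \<in> W \<Longrightarrow> d * w \<in> W" and x: "x \<notin> W"
  defines "W' \<equiv> {w + d |w d. w \<in> W \<and> d \<in> (\<lambda>d. d * x) ` D}"
  shows "subspace W'" "\<And>d w. d \<in> D \<Longrightarrow> w \<in> W' \<Longrightarrow> d * w \<in> W'" "dim W' = dim W + dim D"
proof -
  have sD: "subspace D" using D by (simp add: is_subalg_def)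
  have x0: "x \<noteq> 0" using x W(1) subspace_0 by auto
  have s: "subspace ((\<lambda>d. d * x) ` D)"
    using module_hom.subspace_image linear_mult_right sD module_hom_iff_linear by blast
  have "W \<inter> (\<lambda>d. d * x) ` D = {0}"
  proof (intro equalityI subsetI)
    fix y assume y: "y \<in> W \<inter> (\<lambda>d. d * x) ` D"
    then obtain d where d: "d \<in> D" "y = d * x" by auto
    have "d = 0"
    proof (rule ccontr)
      assume "d \<noteq> 0"
      then have "inverse d * y \<in> W" using W(2) is_subalg_inverse[OF D d(1)] y by blast
      then show False using x d(2) \<open>d \<noteq> 0\<close> by (simp flip: mult.assoc)
    qed
    then show "y \<in> {0}" using d by simp
  qed (use W(1) s subspace_0 in auto)
  then have "dim W' = dim W + dim ((\<lambda>d. d * x) ` D)"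
    unfolding W'_def by (rule dim_direct_sum[OF W(1) s])
  moreover have "dim ((\<lambda>d. d * x) ` D) = dim D"
    by (rule dim_linear_image[OF linear_mult_right _ sD]) (use x0 in \<open>auto simp: inj_on_def\<close>)
  ultimately show "dim W' = dim W + dim D" by simp
  show "subspace W'" unfolding W'_def by (rule subspace_sums[OF W(1) s])
  fix d w assume "d \<in> D" "w \<in> W'"
  then obtain w0 d0 where *: "w0 \<in> W" "d0 \<in> D" "w = w0 + d0 * x" unfolding W'_def by auto
  then have "d * w = d * w0 + (d * d0) * x" by (simp add: distrib_left mult.assoc)
  moreover have "d * d0 \<in> D" using D * \<open>d \<in> D\<close> by (simp add: is_subalg_def)
  ultimately show "d * w \<in> W'" unfolding W'_def using W(2)[OF \<open>d \<in> D\<close> *(1)] by blast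
qed

text \<open>A left space over the division algebra \<open>D\<close> is free: growing a subspace from
  0 by \<open>adjoin\<close> adds \<open>dim D\<close> at every step until \<open>V\<close> is
  exhausted.\<close>

lemma dim_dvd:
  assumes D: "is_subalg D" and V: "subspace V" "\<And>d v. d \<in> D \<Longrightarrow> v \<in> V \<Longrightarrow> d * v \<in> V"
  shows "dim D dvd dim V"
proof -
  have D0: "dim D > 0"
  proof -
    have "1 \<in> D" using D by (simp add: is_subalg_def)
    then have "\<not> D \<subseteq> {0}" by auto
    then show ?thesis by (simp add: zero_less_iff_neq_zero)
  qed
  have "dim D dvd dim V" if "subspace W" "\<And>d w. d \<in> D \<Longrightarrow> w \<in> W \<Longrightarrow> d * w \<in> W"
    "W \<subseteq> V" "dim D dvd dim W" for W
    using that
  proof (induction "dim V - dim W" arbitrary: W rule: less_induct)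
    case less
    show ?case
    proof (cases "W = V")
      case False
      then obtain x where x: "x \<in> V" "x \<notin> W" using less.prems(3) by auto
      define W' where "W' = {w + d |w d. w \<in> W \<and> d \<in> (\<lambda>d. d * x) ` D}"
      note adj = adjoin[OF D less.prems(1,2) x(2), folded W'_def]
      have W'V: "W' \<subseteq> V"
        using V x less.prems(3) unfolding W'_def by (auto intro!: subspace_add)
      then have "dim W + dim D \<le> dim V" using adj(3) dim_subset by metis
      then show ?thesis
        using less.hyps[of W'] adj W'V less.prems(4) D0 by simp
    qed (use less.prems in simp)
  qed
  from this[of "{0}"] show ?thesis using V subspace_0 by auto
qed

end

section \<open>The algebra of two-sided multiplication operators and its density\<close>

inductive mult_operator :: "('a::ring_1 \<Rightarrow> 'a) \<Rightarrow> bool" where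
  ident: "mult_operator (\<lambda>x. x)"
| left: "mult_operator T \<Longrightarrow> mult_operator (\<lambda>x. c * T x)"
| right: "mult_operator T \<Longrightarrow> mult_operator (\<lambda>x. T x * c)"
| add: "mult_operator T \<Longrightarrow> mult_operator U \<Longrightarrow> mult_operator (\<lambda>x. T x + U x)"

lemma mult_operator_diff:
  assumes "mult_operator T" "mult_operator U"
  shows "mult_operator (\<lambda>x. T x - U x)"
  using mult_operator.add[OF assms(1) mult_operator.left[OF assms(2), of "-1"]] by simp

context central_division_algebra
begin

lemma mult_operator_linear: "mult_operator T \<Longrightarrow> Vector_Spaces.linear scale scale T"
proof (induction rule: mult_operator.induct)
  case ident show ?case by (simp add: Vector_Spaces.linear_iff vector_space_axioms)
qed (simp_all add: Vector_Spaces.linear_iff distrib_left distrib_right scale_mult_left scale_mult_right algebra_simps scale_right_distrib)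

lemma mult_operator_scale: "mult_operator T \<Longrightarrow> T (scale c x) = scale c (T x)"
  using mult_operator_linear by (simp add: Vector_Spaces.linear_iff)

lemma mult_operator_diff_arg:
  fixes T :: "'a \<Rightarrow> 'a"
  shows "mult_operator T \<Longrightarrow> T (x - y) = T x - T y"
  using mult_operator_linear[of T] Vector_Spaces.linear.axioms(3)[of scale scale T] module_hom.diff by blast

lemma mult_operator_span:
  assumes "mult_operator T" "\<And>s. s \<in> S \<Longrightarrow> T s = 0" "x \<in> span S"
  shows "T x = 0"
  using module_hom.eq_0_on_span[of scale scale T S x] mult_operator_linear[OF assms(1)] assms(2,3)
  by (auto simp: module_hom_iff_linear)

lemma mult_operator_normalise:
  fixes T :: "'a \<Rightarrow> 'a"
  assumes "mult_operator T" "T s \<noteq> 0" "\<And>x. x \<in> S \<Longrightarrow> T x = 0"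
  shows "\<exists>U. mult_operator U \<and> U s = 1 \<and> (\<forall>x\<in>S. U x = 0)"
  using mult_operator.left[OF assms(1), of "inverse (T s)"] assms(2,3)
  by (intro exI[of _ "\<lambda>x. inverse (T s) * T x"]) simp

text \<open>Jacobson density for A as a module over the multiplication operators, whose commutant is
  the centre. If every operator killing \<open>insert b S\<close> killed \<open>s\<close>, an
  operator \<open>Tb\<close> dual to \<open>b\<close> would have a central value c at
  \<open>s\<close>, and then no operator killing \<open>S\<close> could be nonzero at s - c b,
  against the induction hypothesis.\<close>

lemma density:
  assumes "finite S" "s \<notin> span S"
  shows "\<exists>T. mult_operator T \<and> T s = 1 \<and> (\<forall>x\<in>S. T x = 0)"
  using assms
proof (induction S arbitrary: s rule: finite_induct)
  case empty
  then have "s \<noteq> 0" by simp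
  then show ?case using mult_operator_normalise[OF mult_operator.ident, of s "{}"] by simp
next
  case (insert b S)
  show ?case
  proof (cases "b \<in> span S")
    case True
    then have "s \<notin> span S" using insert.prems span_redundant by blast
    then obtain T where T: "mult_operator T" "T s = 1" "\<forall>x\<in>S. T x = 0" using insert.IH by blast
    then have "T b = 0" using mult_operator_span[of T S b] True by blast
    then show ?thesis using T by blast
  next
    case False
    then obtain Tb where Tb: "mult_operator Tb" "Tb b = 1" "\<forall>x\<in>S. Tb x = 0"
      using insert.IH by blast
    show ?thesis
    proof (rule ccontr)
      assume no: "\<not> ?thesis"
      have kill: "T s = 0" if "mult_operator T" "\<forall>x\<in>insert b S. T x = 0" for T
        using mult_operator_normalise[OF that(1), of s "insert b S"] no that(2) by blast
      \<comment> \<open>The operator sending x to \<open>Tb x * y - y * Tb x\<close> kills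
        \<open>S\<close>, and also \<open>b\<close> because \<open>Tb b = 1\<close>; so it kills
        \<open>s\<close>.\<close>
      have "Tb s * y = y * Tb s" for y
      proof -
        have "mult_operator (\<lambda>x. Tb x * y - y * Tb x)"
          by (intro mult_operator_diff mult_operator.left mult_operator.right Tb(1))
        then have "Tb s * y - y * Tb s = 0" by (rule kill) (use Tb in auto)
        then show ?thesis by simp
      qed
      then obtain c where c: "Tb s = scale c 1" using centralD by blast
      have "s - scale c b \<notin> span S"
        using insert.prems span_insert[of b S] by auto
      then obtain T where T: "mult_operator T" "T (s - scale c b) = 1" "\<forall>x\<in>S. T x = 0"
        using insert.IH by blast
      have "mult_operator (\<lambda>x. T x - T b * Tb x)"
        by (intro mult_operator_diff mult_operator.left Tb(1) T(1))
      then have "T s - T b * Tb s = 0" by (rule kill) (use Tb T in auto)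
      then have "T (s - scale c b) = 0"
        using c by (simp add: mult_operator_diff_arg[OF T(1)] mult_operator_scale[OF T(1)] scale_mult_right)
      then show False using T(2) by simp
    qed
  qed
qed

text \<open>This is injectivity of the map from A \<otimes> A^op to the linear maps of A. A relation
  valid for every \<open>x\<close> stays valid when one multiplication operator is applied to all
  \<open>c i\<close>; an operator dual to \<open>c j\<close> then isolates
  \<open>b j\<close>.\<close>

lemma independent_two_sided:
  assumes "finite I" "inj_on c I" "independent (c ` I)" "\<And>x. (\<Sum>i\<in>I. b i * x * c i) = 0" "j \<in> I"
  shows "b j = 0"
proof -
  have "c j \<notin> span (c ` I - {c j})" using assms(3,5) dependent_def by blast
  then obtain T where T: "mult_operator T" "T (c j) = 1" "\<forall>x\<in>c ` I - {c j}. T x = 0"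
    using density[of "c ` I - {c j}"] assms(1) by blast
  have *: "(\<Sum>i\<in>I. b i * x * U (c i)) = 0" if "mult_operator U" for U x
    using that
  proof (induction arbitrary: x rule: mult_operator.induct)
    case ident show ?case by (rule assms(4))
  next
    case (left T d) then show ?case using left.IH[of "x * d"] by (simp add: mult.assoc)
  next
    case (right T d)
    have "(\<Sum>i\<in>I. b i * x * (T (c i) * d)) = (\<Sum>i\<in>I. b i * x * T (c i)) * d"
      by (simp add: sum_distrib_right mult.assoc)
    then show ?case using right.IH[of x] by simp
  next
    case (add T U) then show ?case by (simp add: distrib_left sum.distrib)
  qed
  have "(\<Sum>i\<in>I. b i * T (c i)) = (\<Sum>i\<in>I. if i = j then b j else 0)"
  proof (rule sum.cong[OF refl])
    fix i assume "i \<in> I"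
    then show "b i * T (c i) = (if i = j then b j else 0)"
      using T assms(2,5) by (cases "i = j") (auto simp: inj_on_def)
  qed
  then show ?thesis using *[OF T(1), of 1] assms(1,5) by simp
qed

section \<open>Purely inseparable elements\<close>

definition ad :: "'a \<Rightarrow> 'a \<Rightarrow> 'a" where
  "ad a x = a * x - x * a"

text \<open>\<open>ad a\<close> is the difference of the left and right multiplications by
  \<open>a\<close>, which commute, so the binomial expansion applies.\<close>

lemma ad_power:
  "(ad a ^^ k) x = (\<Sum>i\<le>k. of_int ((-1)^i * of_nat (k choose i)) * a ^ (k - i) * x * a ^ i)"
proof (induction k)
  case 0 show ?case by simp
next
  case (Suc k)
  define g :: "nat \<Rightarrow> nat \<Rightarrow> 'a" where "g m i = of_int ((-1)^i * of_nat (m choose i))" for m i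
  have com: "y * g m i = g m i * y" for y m i unfolding g_def by (rule mult_of_int_commute[symmetric])
  have "(ad a ^^ Suc k) x = ad a (\<Sum>i\<le>k. g k i * a ^ (k - i) * x * a ^ i)"
    using Suc by (simp add: g_def)
  also have "\<dots> = (\<Sum>i\<le>k. g k i * a ^ (Suc k - i) * x * a ^ i) - (\<Sum>i\<le>k. g k i * a ^ (k - i) * x * a ^ Suc i)"
  proof -
    have "a * (g k i * a ^ (k - i) * x * a ^ i) = g k i * a ^ (Suc k - i) * x * a ^ i" if "i \<le> k" for i
      using that by (simp add: Suc_diff_le mult.assoc flip: com)
    moreover have "g k i * a ^ (k - i) * x * a ^ i * a = g k i * a ^ (k - i) * x * a ^ Suc i" for i
      by (simp add: mult.assoc power_commutes)
    ultimately show ?thesis by (simp add: ad_def sum_distrib_left sum_distrib_right)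
  qed
  also have "(\<Sum>i\<le>k. g k i * a ^ (Suc k - i) * x * a ^ i) = (\<Sum>i\<le>Suc k. g k i * a ^ (Suc k - i) * x * a ^ i)"
    by (simp add: g_def binomial_eq_0)
  also have "\<dots> = a ^ Suc k * x + (\<Sum>i\<le>k. g k (Suc i) * a ^ (k - i) * x * a ^ Suc i)"
    by (subst sum.atMost_Suc_shift) (simp add: g_def)
  also have "a ^ Suc k * x + (\<Sum>i\<le>k. g k (Suc i) * a ^ (k - i) * x * a ^ Suc i)
       - (\<Sum>i\<le>k. g k i * a ^ (k - i) * x * a ^ Suc i)
     = a ^ Suc k * x + (\<Sum>i\<le>k. (g k (Suc i) - g k i) * a ^ (k - i) * x * a ^ Suc i)"
    by (simp add: sum_subtractf algebra_simps)
  also have "(\<lambda>i. g k (Suc i) - g k i) = (\<lambda>i. g (Suc k) (Suc i))"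
    by (auto simp: g_def fun_eq_iff algebra_simps)
  also have "a ^ Suc k * x + (\<Sum>i\<le>k. g (Suc k) (Suc i) * a ^ (k - i) * x * a ^ Suc i)
     = (\<Sum>i\<le>Suc k. g (Suc k) i * a ^ (Suc k - i) * x * a ^ i)"
    by (subst sum.atMost_Suc_shift) (simp add: g_def)
  finally show ?case by (simp add: g_def)
qed

lemma scale_of_nat: "scale (of_nat m) 1 = of_nat m"
  by (induction m) (auto simp: scale_left_distrib)

lemma CHAR_zero: "of_nat CHAR('k) = (0 :: 'a)"
  using scale_of_nat[of "CHAR('k)"] by simp

text \<open>The inner binomial coefficients vanish in characteristic p. For p = 2 the last sign is
  right because 1 = -1.\<close>

lemma ad_power_p:
  assumes "prime CHAR('k)"
  shows "ad a ^^ CHAR('k) = ad (a ^ CHAR('k))"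
proof
  fix x
  define p where "p = CHAR('k)"
  have p: "prime p" "of_nat p = (0::'a)" using assms CHAR_zero by (auto simp: p_def)
  have z: "of_int ((-1)^i * of_nat (p choose i)) = (0::'a)" if "i \<noteq> 0" "i \<noteq> p" "i \<le> p" for i
  proof -
    have "p dvd (p choose i)" using that p(1) by (intro dvd_choose_prime) auto
    then obtain c where "p choose i = p * c" by auto
    then show ?thesis using p(2) by simp
  qed
  have p0: "0 \<noteq> p" using p(1) by auto
  have "(ad a ^^ p) x = (\<Sum>i\<in>{0,p}. of_int ((-1)^i * of_nat (p choose i)) * a ^ (p - i) * x * a ^ i)"
    unfolding ad_power by (rule sum.mono_neutral_right) (use z in auto)
  also have "\<dots> = a ^ p * x + (-1)^p * (x * a ^ p)" using p0 by (simp add: mult.assoc)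
  also have "(-1)^p = (-1 :: 'a)"
  proof (cases "p = 2")
    case True
    then have "(1::'a) + 1 = 0" using p(2) by simp
    then show ?thesis using True by (simp add: eq_neg_iff_add_eq_0)
  next
    case False
    then have "odd p" using p(1) prime_odd_nat by (metis nat_less_le prime_ge_2_nat)
    then show ?thesis by simp
  qed
  finally show "(ad a ^^ CHAR('k)) x = ad (a ^ CHAR('k)) x" by (simp add: ad_def[of "a ^ CHAR('k)"] p_def)
qed

lemma ad_power_prime_power:
  assumes "prime CHAR('k)"
  shows "ad a ^^ (CHAR('k) ^ r) = ad (a ^ (CHAR('k) ^ r))"
proof (induction r)
  case (Suc r)
  have "ad a ^^ (CHAR('k) ^ Suc r) = (ad a ^^ (CHAR('k) ^ r)) ^^ CHAR('k)"
    by (simp add: funpow_mult mult.commute)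
  also have "\<dots> = ad ((a ^ (CHAR('k) ^ r)) ^ CHAR('k))" using Suc ad_power_p[OF assms] by simp
  finally show ?case by (simp add: power_mult mult.commute flip: power_mult)
qed simp

end

lemma normalize_monic_poly: "lead_coeff p = 1 \<Longrightarrow> normalize p = (p :: 'a::{field,euclidean_ring_gcd,semiring_gcd_mult_normalize} poly)"
  by (simp add: unit_factor_1_imp_normalized unit_factor_poly_def one_pCons)

context central_division_algebra
begin

section \<open>Evaluation of polynomials at an element, and minimal polynomials\<close>

definition peval :: "'a \<Rightarrow> 'k poly \<Rightarrow> 'a" where
  "peval a P = fold_coeffs (\<lambda>c v. scale c 1 + a * v) P 0"

lemma peval_0 [simp]: "peval a 0 = 0" by (simp add: peval_def)

lemma peval_pCons [simp]: "peval a (pCons c P) = scale c 1 + a * peval a P"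
  by (cases "P = 0 \<and> c = 0") (auto simp: peval_def)

lemma peval_1 [simp]: "peval a 1 = 1" by (simp add: one_pCons)

lemma peval_add [simp]: "peval a (P + Q) = peval a P + peval a Q"
  by (induction P Q rule: poly_induct2) (simp_all add: scale_left_distrib distrib_left algebra_simps)

lemma peval_smult [simp]: "peval a (smult c P) = scale c (peval a P)"
  by (induction P) (simp_all add: scale_right_distrib scale_mult_right)

lemma peval_uminus [simp]: "peval a (- P) = - peval a P"
  using peval_smult[of a "-1" P] by (simp del: peval_smult)

lemma peval_diff [simp]: "peval a (P - Q) = peval a P - peval a Q"
  using peval_add[of a P "- Q"] by (simp del: peval_add)

lemma peval_commute: "a * peval a P = peval a P * a"
proof (induction P)
  case (pCons c P)
  have "a * (a * peval a P) = a * peval a P * a" by (subst pCons.IH) (simp only: mult.assoc)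
  then show ?case by (simp add: distrib_left distrib_right scale_one_commute)
qed simp

lemma peval_mult [simp]: "peval a (P * Q) = peval a P * peval a Q"
proof (induction P)
  case (pCons c P)
  then show ?case by (simp add: distrib_right mult.assoc scale_mult_left)
qed simp

lemma peval_power [simp]: "peval a (P ^ m) = peval a P ^ m"
  by (induction m) simp_all

lemma peval_monom [simp]: "peval a (monom c m) = scale c (a ^ m)"
  by (induction m) (simp_all add: monom_0 monom_Suc scale_mult_right)

lemma peval_sum [simp]: "peval a (sum P I) = (\<Sum>i\<in>I. peval a (P i))"
  by (induction I rule: infinite_finite_induct) simp_all

lemma peval_altdef: "peval a P = (\<Sum>i\<le>degree P. scale (coeff P i) (a ^ i))"
proof -
  have "peval a P = peval a (\<Sum>i\<le>degree P. monom (coeff P i) i)"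
    by (simp add: poly_as_sum_of_monoms)
  then show ?thesis by simp
qed

lemma independent_powers:
  assumes "\<And>g. g \<noteq> 0 \<Longrightarrow> degree g < q \<Longrightarrow> peval a g \<noteq> 0"
  shows "inj_on (\<lambda>i. a ^ i) {..<q}" "independent ((\<lambda>i. a ^ i) ` {..<q})"
proof -
  show inj: "inj_on (\<lambda>i. a ^ i) {..<q}"
  proof (rule inj_onI, rule ccontr)
    fix i j assume ij: "i \<in> {..<q}" "j \<in> {..<q}" "a ^ i = a ^ j" "i \<noteq> j"
    have "monom 1 i - monom (1::'k) j \<noteq> 0" using ij(4) by (auto simp: poly_eq_iff)
    moreover have "degree (monom 1 i - monom (1::'k) j) < q"
      using ij by (intro degree_diff_less) (auto simp: degree_monom_eq)
    ultimately show False using assms[of "monom 1 i - monom 1 j"] ij(3) by simp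
  qed
  show "independent ((\<lambda>i. a ^ i) ` {..<q})"
  proof (rule independent_if_scalars_zero)
    fix f x assume s: "(\<Sum>x\<in>(\<lambda>i. a ^ i) ` {..<q}. scale (f x) x) = 0" and x: "x \<in> (\<lambda>i. a ^ i) ` {..<q}"
    define g where "g = (\<Sum>i<q. monom (f (a ^ i)) i)"
    have "peval a g = 0" using s by (simp add: g_def sum.reindex[OF inj])
    moreover have "degree g < q \<or> g = 0"
    proof (cases "q = 0")
      case False
      then have "degree g \<le> q - 1" unfolding g_def
        by (intro degree_sum_le) (auto intro: order.trans[OF degree_monom_le])
      then show ?thesis using False by linarith
    qed (simp add: g_def)
    ultimately have "g = 0" using assms by blast
    moreover have "coeff g i = f (a ^ i)" if "i < q" for i
      using that by (simp add: g_def coeff_sum)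
    ultimately show "f x = 0" using x by auto
  qed simp
qed

lemma minimal_polynomial:
  obtains f where "lead_coeff f = 1" "peval a f = 0" "\<And>g. peval a g = 0 \<Longrightarrow> f dvd g"
proof -
  have "\<exists>g. g \<noteq> 0 \<and> peval a g = 0"
  proof (rule ccontr)
    assume "\<nexists>g. g \<noteq> 0 \<and> peval a g = 0"
    then have *: "inj_on (\<lambda>i. a ^ i) {..<Suc (dim UNIV)}" "independent ((\<lambda>i. a ^ i) ` {..<Suc (dim UNIV)})"
      using independent_powers[of "Suc (dim UNIV)" a] by blast+
    then show False using independent_card_le_dim[OF subset_UNIV *(2)] card_image[OF *(1)] by simp
  qed
  then obtain g where g: "g \<noteq> 0 \<and> peval a g = 0"
    "\<And>h. h \<noteq> 0 \<and> peval a h = 0 \<Longrightarrow> degree g \<le> degree h"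
    using arg_min_nat_lemma[of "\<lambda>g. g \<noteq> 0 \<and> peval a g = 0" _ degree] by (metis (no_types, lifting))
  define f where "f = smult (inverse (lead_coeff g)) g"
  have f: "lead_coeff f = 1" "peval a f = 0" "degree f = degree g" using g by (auto simp: f_def)
  moreover have "f dvd h" if "peval a h = 0" for h
  proof -
    have "peval a (h mod f) = peval a h - peval a (f * (h div f))"
      by (simp only: minus_mult_div_eq_mod flip: peval_diff)
    then have "peval a (h mod f) = 0" using that f(2) by simp
    then have "h mod f = 0 \<or> degree f \<le> degree (h mod f)" using g(2) f(3) by auto
    then have "h mod f = 0" using degree_mod_less[of f h] f(1) by force
    then show ?thesis by (simp add: dvd_eq_mod_eq_0)
  qed
  ultimately show ?thesis using that by blast
qed

text \<open>An element whose $p^r$-th power is the first of its $p$-power powers to be central has degree $p^r$: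
  over the algebraic closure its minimal polynomial is a power of a linear form, and the coefficient of
  index $s-p^j$ of $(X-\alpha)^s$, $p^j$ the $p$-part of $s$, generates \<open>\<alpha>\<close> to the $p^j$.\<close>

lemma purely_inseparable_degree:
  fixes r :: nat
  defines "p \<equiv> CHAR('k)"
  assumes p: "prime p" and a: "a ^ (p ^ r) = scale c 1" and s: "\<And>j d. j < r \<Longrightarrow> a ^ (p ^ j) \<noteq> scale d 1"
    and g: "g \<noteq> 0" "degree g < p ^ r"
  shows "peval a g \<noteq> 0"
proof
  assume g0: "peval a g = 0"
  obtain f where f: "lead_coeff f = 1" "peval a f = 0" "\<And>g. peval a g = 0 \<Longrightarrow> f dvd g"
    using minimal_polynomial by metis
  define q where "q = p ^ r"
  have q0: "q > 0" using p prime_gt_0_nat by (simp add: q_def)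
  have prL: "prime CHAR('k alg_closure)" "prime CHAR('k alg_closure poly)" "prime CHAR('k poly)"
    using p by (simp_all add: p_def)
  obtain \<alpha> :: "'k alg_closure" where \<alpha>: "\<alpha> ^ q = to_ac c"
    using nth_root_exists[of q "to_ac c"] q0 by auto
  let ?F = "map_poly to_ac :: 'k poly \<Rightarrow> 'k alg_closure poly"
  interpret map_poly_inj_comm_ring_hom "to_ac :: 'k \<Rightarrow> 'k alg_closure"
    by unfold_locales auto
  have "f dvd monom 1 q - [:c:]" by (rule f(3)) (use a in \<open>simp add: q_def p_def\<close>)
  then have "?F f dvd ?F (monom 1 q - [:c:])" by (rule hom_dvd)
  also have "?F (monom 1 q - [:c:]) = monom 1 q - [:\<alpha> ^ q:]"
    by (simp add: hom_distribs \<alpha> map_poly_pCons)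
  also have "\<dots> = [:-\<alpha>, 1:] ^ q"
  proof -
    have "([:-\<alpha>, 1:] + [:\<alpha>:]) ^ q = [:-\<alpha>, 1:] ^ q + [:\<alpha>:] ^ q"
      by (rule freshmans_dream'[where n = r]) (use prL in \<open>auto simp: q_def p_def\<close>)
    moreover have "[:-\<alpha>, 1:] + [:\<alpha>:] = monom 1 1" by (simp add: monom_altdef)
    ultimately show ?thesis by (simp add: monom_power poly_const_pow algebra_simps)
  qed
  finally have dv: "?F f dvd [:-\<alpha>, 1:] ^ q" .
  have "prime_elem [:-\<alpha>, 1:]" by (simp add: prime_elem_linear_poly)
  moreover have "normalize [:-\<alpha>, 1:] = [:-\<alpha>, 1:]" by (simp add: normalize_monic_poly)
  ultimately have "prime [:-\<alpha>, 1:]" by (simp add: prime_def)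
  then obtain m where m: "normalize (?F f) = [:-\<alpha>, 1:] ^ m" using divides_primepow dv by blast
  have lcF: "lead_coeff (?F f) = 1" using f(1) by simp
  then have Ff: "?F f = [:-\<alpha>, 1:] ^ m" using m by (simp add: normalize_monic_poly)
  have degf: "degree f = m" using arg_cong[OF Ff, of degree] by (simp add: degree_linear_power)
  have "f \<noteq> 0" using f(1) by auto
  have "degree f \<le> degree g" by (rule dvd_imp_degree_le[OF f(3)[OF g0] g(1)])
  then have mq: "m < q" using g(2) degf q_def by simp
  have m0: "m > 0"
  proof (rule ccontr)
    assume "\<not> m > 0"
    then have "degree f = 0" using degf by simp
    then obtain z where "f = [:z:]" using degree_eq_zeroE by blast
    then have "f = 1" using f(1) by (simp add: one_pCons)
    then show False using f(2) by simp
  qed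
  obtain t where t: "m = p ^ multiplicity p m * t" "\<not> p dvd t"
    using multiplicity_decompose'[of m p] m0 p not_prime_unit by blast
  define j where "j = multiplicity p m"
  have tj: "m = p ^ j * t" "t > 0" using t m0 by (auto simp: j_def intro!: Nat.gr0I)
  have jr: "j < r"
  proof -
    have "p ^ j \<le> m" using tj by simp
    then have "p ^ j < p ^ r" using mq q_def by simp
    then show ?thesis using p prime_gt_1_nat power_less_imp_less_exp by blast
  qed
  have "\<not> p dvd (m choose p ^ j)"
  proof -
    have "multiplicity p (m choose p ^ j) = 0"
      using const_p_fac[OF tj(2) p, of j] t(2) tj(1) by (simp add: not_dvd_imp_multiplicity_0)
    moreover have "m choose p ^ j \<noteq> 0" using tj by (simp add: binomial_eq_0_iff)
    ultimately show ?thesis using p multiplicity_eq_zero_iff prime_nat_iff by (metis not_prime_unit)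
  qed
  then have ch: "(of_nat (m choose p ^ j) :: 'k) \<noteq> 0" by (simp add: of_nat_eq_0_iff_char_dvd p_def)
  have pjm: "p ^ j \<le> m" using tj by simp
  have "to_ac (coeff f (m - p ^ j)) = coeff (?F f) (m - p ^ j)" by simp
  also have "\<dots> = of_nat (m choose p ^ j) * (-\<alpha>) ^ (p ^ j)"
    unfolding Ff by (subst coeff_linear_poly_power) (use pjm binomial_symmetric[OF pjm] in simp_all)
  also have "(-\<alpha>) ^ (p ^ j) = (-1) ^ (p ^ j) * \<alpha> ^ (p ^ j)" by (simp flip: power_mult_distrib)
  finally have *: "to_ac (coeff f (m - p ^ j)) = to_ac (of_nat (m choose p ^ j) * (-1) ^ (p ^ j)) * \<alpha> ^ (p ^ j)"
    by simp
  define k where "k = coeff f (m - p ^ j) / (of_nat (m choose p ^ j) * (-1) ^ (p ^ j))"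
  have k: "\<alpha> ^ (p ^ j) = to_ac k"
    unfolding k_def to_ac_divide * using ch by (simp del: to_ac_mult)
  have "p ^ j * p ^ (r - j) = q" using jr by (simp add: q_def flip: power_add)
  then have "to_ac (k ^ (p ^ (r - j))) = to_ac c"
    using \<alpha> by (simp add: flip: k power_mult)
  then have kc: "k ^ (p ^ (r - j)) = c" by (simp only: to_ac_eq_iff)
  \<comment> \<open>In characteristic p, raising X^(p^j) - k to the power p^(r-j) gives X^q - c.
    Evaluated at \<open>a\<close> this is 0, and a division ring has no nilpotents, so a^(p^j) is
    already the scalar k although j < r.\<close>
  have "([:-k:] + monom 1 (p ^ j)) ^ (p ^ (r - j)) + [:k:] ^ (p ^ (r - j)) = ([:-k:] + monom 1 (p ^ j) + [:k:]) ^ (p ^ (r - j))"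
    by (rule sym, rule freshmans_dream'[where n = "r - j"]) (use prL in \<open>auto simp: p_def\<close>)
  also have "[:-k:] + monom 1 (p ^ j) + [:k:] = monom 1 (p ^ j)" by simp
  finally have e: "([:-k:] + monom 1 (p ^ j)) ^ (p ^ (r - j)) + [:c:] = monom 1 q"
    using jr kc by (simp add: poly_const_pow monom_power q_def flip: power_add)
  have "(scale (-k) 1 + a ^ (p ^ j)) ^ (p ^ (r - j)) + scale c 1 = a ^ q"
    using arg_cong[OF e, of "peval a"] by simp
  then have "scale (-k) 1 + a ^ (p ^ j) = 0" using a by (simp add: q_def)
  then have "a ^ (p ^ j) = scale k 1" by (simp add: add_eq_0_iff2 neg_eq_iff_add_eq_0)
  then show False using s[OF jr] by blast
qed

lemma linear_ad: "Vector_Spaces.linear scale scale (ad a)"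
  by (simp add: Vector_Spaces.linear_iff vector_space_axioms ad_def scale_mult_left scale_mult_right
      scale_right_diff_distrib algebra_simps)

lemma linear_ad_power: "Vector_Spaces.linear scale scale (ad a ^^ k)"
proof (induction k)
  case 0 show ?case by (simp add: Vector_Spaces.linear_iff vector_space_axioms)
next
  case (Suc k) then show ?case using linear_ad[of a] by (simp add: Vector_Spaces.linear_iff)
qed

lemma ad_power_centralizer:
  assumes "ad a c = 0" shows "(ad a ^^ k) (c * x) = c * (ad a ^^ k) x"
proof (induction k)
  case (Suc k)
  have "ad a (c * y) = c * ad a y" for y
    using assms by (simp add: ad_def right_diff_distrib flip: mult.assoc)
  then show ?case using Suc by simp
qed simp

text \<open>This does the work of the double centraliser theorem for K[a]. Put q = p^r and let C be
  the centraliser of \<open>a\<close>. Then \<open>ad a\<close> is C-linear, its q-th power is 0,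
  and its (q-1)-st power takes the value 1; so its iterated kernels grow by exactly dim C each time
  and dim A = q dim C. Moreover K[a] has dimension q and lies in C, so q divides dim C.\<close>

lemma purely_inseparable_dvd:
  fixes r :: nat
  defines "p \<equiv> CHAR('k)"
  assumes p: "prime p" and a: "a ^ (p ^ r) = scale c 1" and s: "\<And>j d. j < r \<Longrightarrow> a ^ (p ^ j) \<noteq> scale d 1"
  shows "(p ^ r)\<^sup>2 dvd dim (UNIV :: 'a set)"
proof -
  define q where "q = p ^ r"
  have q0: "q > 0" using p prime_gt_0_nat by (simp add: q_def)
  have nz: "peval a g \<noteq> 0" if "g \<noteq> 0" "degree g < q" for g
    using purely_inseparable_degree[where r = r and a = a and c = c and g = g] p a s that unfolding p_def q_def by blast
  note ind = independent_powers[OF nz, of q]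
  define C where "C = {x. ad a x = 0}"
  define D where "D = range (peval a)"
  have subC: "subspace C" unfolding C_def
    using module_hom.subspace_kernel linear_ad module_hom_iff_linear by blast
  have C: "is_subalg C"
  proof -
    have "1 \<in> C" by (simp add: C_def ad_def)
    moreover have "x * y \<in> C" if "x \<in> C" "y \<in> C" for x y
    proof -
      have "ad a (x * y) = x * ad a y" using that ad_power_centralizer[of a x 1 y] by (simp add: C_def)
      then show ?thesis using that by (simp add: C_def)
    qed
    ultimately show ?thesis using subC by (simp add: is_subalg_def)
  qed
  have evD: "peval a g \<in> D" for g by (simp add: D_def)
  have subD: "subspace D"
  proof (rule subspaceI)
    show "0 \<in> D" using evD[of 0] by simp
    show "x + y \<in> D" if xy: "x \<in> D" "y \<in> D" for x y
    proof -
      obtain g h where "x = peval a g" "y = peval a h" using xy by (auto simp: D_def)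
      then show ?thesis using evD[of "g + h"] by simp
    qed
    show "scale c x \<in> D" if x: "x \<in> D" for c x
    proof -
      obtain g where "x = peval a g" using x by (auto simp: D_def)
      then show ?thesis using evD[of "smult c g"] by simp
    qed
  qed
  have D: "is_subalg D"
  proof -
    have "1 \<in> D" using evD[of 1] by simp
    moreover have "x * y \<in> D" if xy: "x \<in> D" "y \<in> D" for x y
    proof -
      obtain g h where "x = peval a g" "y = peval a h" using xy by (auto simp: D_def)
      then show ?thesis using evD[of "g * h"] by simp
    qed
    ultimately show ?thesis using subD by (simp add: is_subalg_def)
  qed
  have "D = span ((\<lambda>i. a ^ i) ` {..<q})"
  proof (intro equalityI)
    have "a ^ i \<in> D" for i using evD[of "monom 1 i"] by simp
    then show "span ((\<lambda>i. a ^ i) ` {..<q}) \<subseteq> D" using subD by (intro span_minimal) auto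
    show "D \<subseteq> span ((\<lambda>i. a ^ i) ` {..<q})"
    proof
      fix x assume "x \<in> D"
      then obtain g where g: "x = peval a g" by (auto simp: D_def)
      define f where "f = monom 1 q - [:c:]"
      have f0: "f \<noteq> 0" "degree f = q"
      proof -
        have "degree (monom 1 q + [:-c:]) = degree (monom (1::'k) q)" using q0
          by (intro degree_add_eq_left) (simp add: degree_monom_eq)
        moreover have "f = monom 1 q + [:-c:]" by (simp add: f_def)
        ultimately show "degree f = q" by (simp add: degree_monom_eq)
        then show "f \<noteq> 0" using q0 by auto
      qed
      have "peval a f = 0" using a by (simp add: f_def q_def)
      then have "x = peval a (g mod f)"
        using g arg_cong[OF div_mult_mod_eq[of g f], of "peval a"] by (simp only: peval_add peval_mult) simp
      moreover have "degree (g mod f) < q" using degree_mod_less[of f g] f0 q0 by auto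
      ultimately show "x \<in> span ((\<lambda>i. a ^ i) ` {..<q})"
        unfolding peval_altdef by (auto intro!: span_sum span_scale intro: span_base)
    qed
  qed
  then have dimD: "dim D = q"
    using ind dim_span_eq_card_independent[of "(\<lambda>i. a ^ i) ` {..<q}"] card_image[of "\<lambda>i. a ^ i" "{..<q}"] by simp
  have DC: "d * v \<in> C" if "d \<in> D" "v \<in> C" for d v
  proof -
    have "d \<in> C" using that(1) peval_commute[of a] by (auto simp: D_def C_def ad_def)
    then show ?thesis using C that(2) by (simp add: is_subalg_def)
  qed
  have qC: "q dvd dim C" using dim_dvd[OF D subC DC] dimD by simp
  have dq: "(ad a ^^ q) x = 0" for x
    using ad_power_prime_power[where r = r and a = a] p a by (simp add: q_def p_def ad_def scale_mult_left scale_mult_right)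
  \<comment> \<open>Otherwise the binomial expansion would be a two-sided relation among the
    independent powers of \<open>a\<close>, yet its coefficient at i = q - 1 is 1 or -1.\<close>
  have "\<exists>x. (ad a ^^ (q - 1)) x \<noteq> 0"
  proof (rule ccontr)
    assume "\<not> ?thesis"
    moreover have "{..<q} = {..q - 1}" using q0 by auto
    ultimately have "(\<Sum>i\<in>{..<q}. (of_int ((-1)^i * of_nat ((q - 1) choose i)) * a ^ (q - 1 - i)) * x * a ^ i) = 0" for x
      using ad_power[where k = "q - 1" and a = a and x = x] by simp
    from independent_two_sided[OF _ ind this, of "q - 1"] q0 show False by simp
  qed
  then obtain u0 where u0: "(ad a ^^ (q - 1)) u0 \<noteq> 0" by blast
  define z where "z = (ad a ^^ (q - 1)) u0"
  have zC: "z \<in> C" using dq[of u0] q0 unfolding C_def z_def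
    by (cases q) (simp_all)
  then have "inverse z \<in> C" using C is_subalg_inverse u0 z_def by blast
  \<comment> \<open>\<open>z\<close> commutes with \<open>a\<close>, hence so does its inverse, and
    multiplying by that inverse normalises the top value of the chain to 1.\<close>
  define u where "u = inverse z * u0"
  have u: "(ad a ^^ (q - 1)) u = 1"
    using ad_power_centralizer[of a "inverse z" "q - 1" u0] \<open>inverse z \<in> C\<close> u0
    by (simp add: u_def C_def z_def)
  define N where "N k = {x. (ad a ^^ k) x = 0}" for k
  have subN: "subspace (N k)" for k unfolding N_def
    using module_hom.subspace_kernel linear_ad_power module_hom_iff_linear by blast
  have CN: "c * x \<in> N k" if "c \<in> C" "x \<in> N k" for c x k
    using that by (simp add: N_def C_def ad_power_centralizer)
  have add: "(ad a ^^ k) (x + y) = (ad a ^^ k) x + (ad a ^^ k) y" for k x y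
    using linear_ad_power[where a = a and k = k] by (simp add: Vector_Spaces.linear_iff)
  have "dim (N k) = k * dim C" if "k \<le> q" for k
    using that
  proof (induction k)
    case 0
    show ?case by (simp add: N_def)
  next
    case (Suc k)
    \<comment> \<open>A member of the chain below \<open>u\<close> that k applications of
      \<open>ad a\<close> take to 1. It contributes one free C-generator to the next kernel.\<close>
    define v where "v = (ad a ^^ (q - 1 - k)) u"
    have v: "(ad a ^^ k) v = 1"
    proof -
      have "k + (q - 1 - k) = q - 1" using Suc.prems by simp
      then show ?thesis using u by (simp add: v_def flip: comp_apply[of "ad a ^^ k"] funpow_add)
    qed
    then have "v \<notin> N k" by (simp add: N_def)
    note adj = adjoin[OF C subN CN this]
    have "N (Suc k) = {w + d |w d. w \<in> N k \<and> d \<in> (\<lambda>d. d * v) ` C}"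
    proof (intro equalityI subsetI)
      fix x assume x: "x \<in> N (Suc k)"
      define c where "c = (ad a ^^ k) x"
      have c: "c \<in> C" using x by (simp add: C_def c_def N_def)
      have "(ad a ^^ k) (x + (- c) * v) = 0"
        unfolding add using c v subspace_neg[OF subC c]
        by (subst ad_power_centralizer) (simp_all add: C_def flip: c_def)
      then have "x + (- c) * v \<in> N k" by (simp add: N_def)
      moreover have "x = (x + (- c) * v) + c * v" by simp
      ultimately show "x \<in> {w + d |w d. w \<in> N k \<and> d \<in> (\<lambda>d. d * v) ` C}" using c by blast
    next
      fix x assume "x \<in> {w + d |w d. w \<in> N k \<and> d \<in> (\<lambda>d. d * v) ` C}"
      then obtain w d where wd: "w \<in> N k" "d \<in> C" "x = w + d * v" by blast
      have "(ad a ^^ k) x = d" using wd v by (simp add: add N_def C_def ad_power_centralizer)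
      then show "x \<in> N (Suc k)" using wd(2) by (simp add: N_def C_def)
    qed
    then show ?case using adj(3) Suc by simp
  qed
  from this[of q] have "dim (UNIV :: 'a set) = q * dim C" using dq by (simp add: N_def)
  then show ?thesis using qC by (simp add: power2_eq_square q_def mult_dvd_mono)
qed

end

section \<open>Eigenvectors of conjugations\<close>

definition op_eval :: "('c::field \<Rightarrow> 'v::ab_group_add \<Rightarrow> 'v) \<Rightarrow> ('v \<Rightarrow> 'v) \<Rightarrow> 'c poly \<Rightarrow> 'v \<Rightarrow> 'v" where
  "op_eval scale E P w = fold_coeffs (\<lambda>c v. scale c w + E v) P 0"

lemma op_eval_0 [simp]: "op_eval scale E 0 w = 0" by (simp add: op_eval_def)

context vector_space
begin

context
  fixes E assumes E: "Vector_Spaces.linear scale scale E"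
begin

lemma E0: "E 0 = 0" and Eadd: "E (x + y) = E x + E y" and Escale: "E (scale c x) = scale c (E x)"
proof -
  show "E (x + y) = E x + E y" "E (scale c x) = scale c (E x)" for x y c
    using E by (auto simp: Vector_Spaces.linear_iff)
  from this(2)[of 0] show "E 0 = 0" by simp
qed

lemma op_eval_pCons: "op_eval scale E (pCons c P) w = scale c w + E (op_eval scale E P w)"
  by (cases "P = 0 \<and> c = 0") (auto simp: op_eval_def E0)

lemma op_eval_add: "op_eval scale E (P + Q) w = op_eval scale E P w + op_eval scale E Q w"
  by (induction P Q rule: poly_induct2) (simp_all add: op_eval_pCons Eadd scale_left_distrib algebra_simps)

lemma op_eval_smult: "op_eval scale E (smult c P) w = scale c (op_eval scale E P w)"
  by (induction P) (simp_all add: op_eval_pCons Escale scale_right_distrib)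

lemma op_eval_monom: "op_eval scale E (monom c i) w = scale c ((E ^^ i) w)"
  by (induction i) (simp_all add: monom_0 monom_Suc op_eval_pCons Escale E0)

lemma op_eval_linear: "op_eval scale E ([:- r, 1:] * Q) w = E (op_eval scale E Q w) - scale r (op_eval scale E Q w)"
proof -
  have "op_eval scale E ([:- r, 1:] * Q) w = op_eval scale E (smult (- r) Q + pCons 0 Q) w"
    by (simp add: mult_pCons_left)
  then show ?thesis by (simp only: op_eval_add op_eval_smult op_eval_pCons) simp
qed

lemma op_eval_mem:
  assumes "subspace W" "w \<in> W" "\<And>v. v \<in> W \<Longrightarrow> E v \<in> W"
  shows "op_eval scale E P w \<in> W"
  by (induction P) (auto simp: op_eval_pCons intro!: subspace_add subspace_scale subspace_0 assms)

text \<open>Apply the linear factors to \<open>w\<close> one after another: the last vector before 0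
  is reached is an eigenvector.\<close>

lemma eigenvector_of_split:
  assumes W: "subspace W" "w \<in> W" "w \<noteq> 0" "\<And>v. v \<in> W \<Longrightarrow> E v \<in> W"
    and R: "op_eval scale E (\<Prod>r\<in>#R. [:-r, 1:]) w = 0"
  shows "\<exists>x\<in>W. x \<noteq> 0 \<and> (\<exists>r. E x = scale r x)"
  using R
proof (induction R)
  case empty
  then show ?case using W(3) by (simp add: op_eval_monom flip: monom_eq_1)
next
  case (add r R)
  show ?case
  proof (cases "op_eval scale E (\<Prod>r\<in>#R. [:-r, 1:]) w = 0")
    case False
    have "E (op_eval scale E (\<Prod>r\<in>#R. [:-r, 1:]) w) = scale r (op_eval scale E (\<Prod>r\<in>#R. [:-r, 1:]) w)"
      using add.prems by (simp only: image_mset_add_mset prod_mset.add_mset op_eval_linear) simp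
    then show ?thesis using False op_eval_mem[OF W(1,2,4)] by blast
  qed (rule add.IH)
qed

end

end

context central_division_algebra
begin

lemma eigenvector_exists:
  assumes E: "Vector_Spaces.linear scale scale E"
    and W: "subspace W" "w \<in> W" "w \<noteq> 0" "\<And>v. v \<in> W \<Longrightarrow> E v \<in> W"
    and roots: "contains_all_roots_of_unity TYPE('k)" and m: "m > 0" "(E ^^ m) w = w"
  shows "\<exists>x\<in>W. x \<noteq> 0 \<and> (\<exists>r. E x = scale r x)"
proof -
  obtain R :: "'k multiset" where R: "monom 1 m - 1 = (\<Prod>r\<in>#R. [:-r, 1:])"
    using roots m(1) unfolding contains_all_roots_of_unity_def by blast
  have "(monom 1 m - 1 :: 'k poly) = monom 1 m + monom (-1) 0" by (simp add: monom_0 one_pCons)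
  then have "op_eval scale E (\<Prod>r\<in>#R. [:-r, 1:]) w = 0"
    using m(2) by (simp only: flip: R) (simp add: op_eval_add[OF E] op_eval_monom[OF E])
  then show ?thesis using eigenvector_of_split[OF E W] by blast
qed

text \<open>X^N - 1 splits over the base field, and its value at \<open>x\<close> is a product of
  factors x - r in a ring without zero divisors, so one of these factors is 0.\<close>

lemma root_of_unity_central:
  assumes "contains_all_roots_of_unity TYPE('k)" "N > 0" "x ^ N = 1"
  shows "\<exists>c. x = scale c 1"
proof -
  obtain R :: "'k multiset" where R: "monom 1 N - 1 = (\<Prod>r\<in>#R. [:-r, 1:])"
    using assms(1,2) unfolding contains_all_roots_of_unity_def by blast
  have "peval x (\<Prod>r\<in>#R. [:-r, 1:]) = 0" using assms(3) by (simp flip: R)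
  then show ?thesis
  proof (induction R)
    case (add r R)
    have "scale (- r) 1 + x = 0 \<or> peval x (\<Prod>r\<in>#R. [:-r, 1:]) = 0"
      using add.prems by (simp only: image_mset_add_mset prod_mset.add_mset peval_mult) simp
    moreover have "x = scale r 1" if "scale (- r) 1 + x = 0" using that by (simp add: add_eq_0_iff2)
    ultimately show ?case using add.IH by blast
  qed simp
qed

section \<open>Linear independence of elements that commute up to scalars\<close>

definition conj :: "'a \<Rightarrow> 'a \<Rightarrow> 'a" where "conj t x = t * x * inverse t"

lemma linear_conj: "Vector_Spaces.linear scale scale (conj t)"
  by (simp add: Vector_Spaces.linear_iff vector_space_axioms conj_def distrib_left distrib_right scale_mult_left scale_mult_right)

lemma conj_mult: "s \<noteq> 0 \<Longrightarrow> t \<noteq> 0 \<Longrightarrow> conj (s * t) x = conj s (conj t x)"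
  by (simp add: conj_def nonzero_inverse_mult_distrib mult.assoc)

lemma conj_scale: "c \<noteq> 0 \<Longrightarrow> t \<noteq> 0 \<Longrightarrow> conj (scale c t) x = conj t x"
proof -
  assume "c \<noteq> 0" "t \<noteq> 0"
  then have "inverse (scale c t) = scale (inverse c) (inverse t)"
    by (intro inverse_unique) (simp add: scale_mult_left scale_mult_right)
  then show ?thesis using \<open>c \<noteq> 0\<close> by (simp add: conj_def scale_mult_left scale_mult_right)
qed

lemma conj_power: "t \<noteq> 0 \<Longrightarrow> (conj t ^^ m) x = conj (t ^ m) x"
proof (induction m)
  case 0 show ?case by (simp add: conj_def)
next
  case (Suc m) then show ?case by (simp add: conj_mult)
qed

text \<open>\<open>Y\<close> will consist of the nonzero multiples of the lifts of the prime-to-p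
  part of the group. The conjugations by its elements commute and have order dividing
  \<open>m\<close>, so with the roots of unity at hand they have common eigenvectors.\<close>

context
  fixes Y :: "'a set" and m :: nat
  assumes roots: "contains_all_roots_of_unity TYPE('k)"
    and X0: "0 \<notin> Y"
    and X_mult: "\<And>x y. x \<in> Y \<Longrightarrow> y \<in> Y \<Longrightarrow> x * y \<in> Y"
    and X_inv: "\<And>x. x \<in> Y \<Longrightarrow> inverse x \<in> Y"
    and X_power: "\<And>x. x \<in> Y \<Longrightarrow> \<exists>c. x ^ m = scale c 1"
    and X_comm: "\<And>x y. x \<in> Y \<Longrightarrow> y \<in> Y \<Longrightarrow> \<exists>c. x * y = scale c (y * x)"
    and m: "m > 0" "coprime m CHAR('k)"
begin

lemma X_nz: "x \<in> Y \<Longrightarrow> x \<noteq> 0" using X0 by auto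

text \<open>\<open>x * y\<close> and \<open>y * x\<close> differ by a nonzero scalar, which
  conjugation does not see.\<close>

lemma conj_commute: assumes "x \<in> Y" "y \<in> Y" shows "conj x (conj y w) = conj y (conj x w)"
proof -
  obtain c where c: "x * y = scale c (y * x)" using X_comm assms by blast
  have "x \<noteq> 0" "y \<noteq> 0" using X_nz assms by auto
  then have "c \<noteq> 0" using c by auto
  then show ?thesis using c \<open>x \<noteq> 0\<close> \<open>y \<noteq> 0\<close> by (simp add: conj_scale flip: conj_mult)
qed

lemma conj_power_m: assumes "x \<in> Y" shows "(conj x ^^ m) w = w"
proof -
  obtain c where c: "x ^ m = scale c 1" using X_power assms by blast
  have "x \<noteq> 0" using X_nz assms by auto
  then have "c \<noteq> 0" using c by (metis power_not_zero scale_zero_left)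
  then show ?thesis using c \<open>x \<noteq> 0\<close> by (simp add: conj_power conj_scale) (simp add: conj_def)
qed

text \<open>Commuting operators preserve each other's eigenspaces, so the family is diagonalised one
  member at a time on a shrinking subspace.\<close>

lemma common_eigenvector:
  assumes "finite T" "T \<subseteq> Y" "subspace W" "w \<in> W" "w \<noteq> 0" "\<And>t v. t \<in> T \<Longrightarrow> v \<in> W \<Longrightarrow> conj t v \<in> W"
  shows "\<exists>x\<in>W. x \<noteq> 0 \<and> (\<forall>t\<in>T. \<exists>r. conj t x = scale r x)"
  using assms
proof (induction T arbitrary: W w rule: finite_induct)
  case empty then show ?case by auto
next
  case (insert t T)
  obtain x r where x: "x \<in> W" "x \<noteq> 0" "conj t x = scale r x"
    using eigenvector_exists[OF linear_conj insert.prems(2,3,4) _ roots m(1), of t] insert.prems(1,5)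
      conj_power_m[of t w] by blast
  have lin: "conj s (scale c v) = scale c (conj s v)" "conj s (u + v) = conj s u + conj s v" for s c u v
    using linear_conj by (auto simp: Vector_Spaces.linear_iff)
  define W' where "W' = {v\<in>W. conj t v = scale r v}"
  have "subspace W'" unfolding W'_def
    using insert.prems(2) lin by (intro subspaceI)
      (auto simp: subspace_0 subspace_add subspace_scale scale_right_distrib lin scale_left_commute conj_def[of _ 0])
  moreover have "x \<in> W'" using x by (simp add: W'_def)
  moreover have "conj s v \<in> W'" if "s \<in> T" "v \<in> W'" for s v
    using that insert.prems(1,5) conj_commute[of t s v] by (auto simp: W'_def lin subset_iff)
  ultimately show ?case using insert.IH[of W' x] x(2) insert.prems(1) unfolding W'_def by auto
qed

text \<open>The quotient b of s by t is not central. The powers of \<open>conj b\<close> with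
  exponent below \<open>m\<close> sum to m times the projection onto the vectors fixed by
  \<open>conj b\<close>, and \<open>W\<close> is the kernel of this sum. It is nonzero because it
  contains b y b^(-1) - y by telescoping, while a fixed vector x in it would satisfy m x = 0. So a
  common eigenvector in \<open>W\<close> is not fixed by \<open>conj b\<close>, which means that s
  and t act on it by different eigenvalues.\<close>

lemma separating_eigenvector:
  assumes T: "finite T" "T \<subseteq> Y" "s \<in> T" "t \<in> T" and st: "\<nexists>c. s = scale c t"
  shows "\<exists>x \<chi>. x \<noteq> 0 \<and> (\<forall>t\<in>T. conj t x = scale (\<chi> t) x) \<and> \<chi> s \<noteq> \<chi> t"
proof -
  define b where "b = s * inverse t"
  have s: "s \<in> Y" "s \<noteq> 0" and t: "t \<in> Y" "t \<noteq> 0" using T X_nz by auto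
  then have b: "b \<in> Y" "b \<noteq> 0" unfolding b_def using X_mult X_inv by auto
  have "\<nexists>c. b = scale c 1"
  proof
    assume "\<exists>c. b = scale c 1"
    then obtain c where "b * t = scale c 1 * t" by auto
    then show False using st t by (simp add: b_def mult.assoc scale_mult_left)
  qed
  then obtain y where y: "b * y \<noteq> y * b" using centralD[of b] by blast
  have lin: "conj s (scale c v) = scale c (conj s v)" "conj s (u + v) = conj s u + conj s v"
    "conj s (u - v) = conj s u - conj s v" "conj s (sum f I) = (\<Sum>i\<in>I. conj s (f i))" for s c u v f and I :: "nat set"
    by (auto simp: conj_def distrib_left distrib_right right_diff_distrib left_diff_distrib
        scale_mult_left scale_mult_right sum_distrib_left sum_distrib_right)
  have pow: "(conj b ^^ i) v = conj (b ^ i) v" for i v by (rule conj_power[OF b(2)])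
  define z where "z = conj b y - y"
  have z: "z \<noteq> 0"
  proof
    assume "z = 0"
    then have "b * y * inverse b * b = y * b" by (simp add: z_def conj_def)
    then show False using y b by (simp add: mult.assoc)
  qed
  define W where "W = {v. (\<Sum>i<m. (conj b ^^ i) v) = 0}"
  have subW: "subspace W" unfolding W_def
    by (intro subspaceI) (auto simp: pow lin sum.distrib conj_def[of _ 0] simp flip: scale_sum_right)
  have "(conj b ^^ i) z = (conj b ^^ Suc i) y - (conj b ^^ i) y" for i
    by (simp add: z_def pow lin funpow_swap1 del: power_Suc)
      (metis funpow.simps(2) funpow_swap1 o_apply pow)
  then have "(\<Sum>i<m. (conj b ^^ i) z) = (conj b ^^ m) y - (conj b ^^ 0) y"
    using sum_lessThan_telescope[of "\<lambda>i. (conj b ^^ i) y" m] by simp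
  then have zW: "z \<in> W" using conj_power_m[OF b(1), of y] by (simp add: W_def)
  have stab: "conj u v \<in> W" if "u \<in> insert b T" "v \<in> W" for u v
  proof -
    have u: "u \<in> Y" using that b T by auto
    have "(conj b ^^ i) (conj u v) = conj u ((conj b ^^ i) v)" for i
      by (induction i) (simp_all add: conj_commute[OF b(1) u])
    then show ?thesis using that(2) by (simp add: W_def conj_def[of _ 0] flip: lin(4))
  qed
  obtain x where x: "x \<in> W" "x \<noteq> 0" "\<forall>t\<in>insert b T. \<exists>r. conj t x = scale r x"
    using common_eigenvector[OF _ _ subW zW z stab, of "insert b T"] T b by auto
  then obtain \<chi> where \<chi>: "\<forall>t\<in>insert b T. conj t x = scale (\<chi> t) x" by metis
  have "\<chi> s \<noteq> \<chi> t"
  proof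
    assume eq: "\<chi> s = \<chi> t"
    have "conj t x = scale (\<chi> t) x" "conj s x = scale (\<chi> s) x" using \<chi> T by auto
    then have "conj s x = conj t x" using eq by simp
    have "conj b (conj t x) = conj s x" using s t
      by (simp add: b_def conj_def nonzero_inverse_mult_distrib mult.assoc) (simp flip: mult.assoc)
    then have "conj b (conj t x) = conj t x" using \<open>conj s x = conj t x\<close> by simp
    moreover have "\<chi> t \<noteq> 0"
    proof
      assume "\<chi> t = 0"
      then have "conj t x = 0" using \<open>conj t x = _\<close> by simp
      then show False using t x(2) by (simp add: conj_def)
    qed
    ultimately have fixb: "conj b x = x" using \<open>conj t x = scale _ x\<close> by (simp add: lin)
    have "(conj b ^^ i) x = x" for i by (induction i) (simp_all add: fixb)
    then have "scale (of_nat m) 1 * x = 0" using x(1) by (simp add: W_def scale_of_nat)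
    then have "(of_nat m :: 'k) = 0" using x(2) by (simp add: scale_mult_left)
    then have "CHAR('k) dvd m" by (simp add: of_nat_eq_0_iff_char_dvd)
    then have "CHAR('k) = 1" using m(2) by (meson coprime_absorb_right is_unit_gcd nat_dvd_1_iff_1)
    then show False using CHAR_not_1 by simp
  qed
  then show ?thesis using x(2) \<chi> by auto
qed

text \<open>Artin's shortening argument. Conjugation by a common eigenvector x multiplies each u of
  a relation by its eigenvalue \<open>\<chi> u\<close>; subtracting \<open>\<chi> t\<close> times
  the relation removes t and keeps s.\<close>

lemma independent_nonproportional:
  assumes "finite T" "T \<subseteq> Y" "\<And>s t. s \<in> T \<Longrightarrow> t \<in> T \<Longrightarrow> s \<noteq> t \<Longrightarrow> \<nexists>c. s = scale c t"
  shows "independent T"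
  using assms
proof (induction "card T" arbitrary: T rule: less_induct)
  case less
  show ?case
  proof (rule independent_if_scalars_zero)
    fix f s assume sum0: "(\<Sum>x\<in>T. scale (f x) x) = 0" and s: "s \<in> T"
    show "f s = 0"
    proof (cases "T = {s}")
      case True
      then show ?thesis using sum0 X_nz less.prems by auto
    next
      case False
      then obtain t where t: "t \<in> T" "t \<noteq> s" using s by blast
      obtain x \<chi> where x: "x \<noteq> 0" "\<forall>t\<in>T. conj t x = scale (\<chi> t) x" "\<chi> s \<noteq> \<chi> t"
        using separating_eigenvector[OF less.prems(1,2) s t(1)] less.prems(3)[OF s t(1)] t(2) by auto
      have c: "inverse x * u * x = scale (\<chi> u) u" if "u \<in> T" for u
      proof -
        have "u * x * inverse u * u = scale (\<chi> u) x * u" using x(2) that by (simp add: conj_def)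
        then have "u * x = scale (\<chi> u) (x * u)" using X_nz less.prems(2) that
          by (auto simp: mult.assoc scale_mult_left)
        then show ?thesis using x(1) by (simp add: mult.assoc scale_mult_right) (simp flip: mult.assoc)
      qed
      have "(\<Sum>u\<in>T. scale (f u * \<chi> u) u) = inverse x * (\<Sum>u\<in>T. scale (f u) u) * x"
        unfolding sum_distrib_left sum_distrib_right
        by (rule sum.cong) (simp_all add: scale_mult_left scale_mult_right c)
      then have "(\<Sum>u\<in>T. scale (f u * \<chi> u) u) - scale (\<chi> t) (\<Sum>u\<in>T. scale (f u) u) = 0" using sum0 by simp
      also have "(\<Sum>u\<in>T. scale (f u * \<chi> u) u) - scale (\<chi> t) (\<Sum>u\<in>T. scale (f u) u)
          = (\<Sum>u\<in>T. scale (f u * (\<chi> u - \<chi> t)) u)"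
        by (simp add: scale_sum_right scale_left_diff_distrib algebra_simps flip: sum_subtractf)
      also have "\<dots> = (\<Sum>u\<in>T - {t}. scale (f u * (\<chi> u - \<chi> t)) u)"
        using less.prems(1) t(1) by (simp add: sum.remove)
      finally have "(\<Sum>u\<in>T - {t}. scale (f u * (\<chi> u - \<chi> t)) u) = 0" .
      moreover have "independent (T - {t})"
        by (rule less.hyps[OF card_Diff1_less[OF less.prems(1) t(1)]]) (use less.prems in auto)
      ultimately have "f s * (\<chi> s - \<chi> t) = 0"
        using independentD[of "T - {t}" "T - {t}" "\<lambda>u. f u * (\<chi> u - \<chi> t)" s] less.prems(1) s t(2) by auto
      then show ?thesis using x(3) by simp
    qed
  qed (rule less.prems(1))
qed

end

end

section \<open>Finite projective groups of a division algebra\<close>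

lemma cauchy_theorem:
  assumes "group G" "finite (carrier G)" "prime l" "l dvd card (carrier G)"
  shows "\<exists>x\<in>carrier G. x \<noteq> \<one>\<^bsub>G\<^esub> \<and> x [^]\<^bsub>G\<^esub> l = \<one>\<^bsub>G\<^esub>"
proof -
  interpret group G by fact
  obtain m where "Coset.order G = l ^ 1 * m" using assms(4) by (auto simp: Coset.order_def)
  from sylow_thm[OF assms(3,1) this assms(2)] obtain H where H: "subgroup H G" "card H = l" by auto
  have "card H > 1" using H(2) assms(3) prime_gt_1_nat by simp
  then have "\<not> H \<subseteq> {\<one>\<^bsub>G\<^esub>}" using card_mono[of "{\<one>\<^bsub>G\<^esub>}" H] by auto
  then obtain x where x: "x \<in> H" "x \<noteq> \<one>\<^bsub>G\<^esub>" by blast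
  interpret HG: group "G\<lparr>carrier := H\<rparr>" using subgroup.subgroup_is_group H(1) assms(1) by blast
  have "x [^]\<^bsub>G\<lparr>carrier := H\<rparr>\<^esub> Coset.order (G\<lparr>carrier := H\<rparr>) = \<one>\<^bsub>G\<^esub>"
    using HG.pow_order_eq_1[of x] x by simp
  then have "x [^]\<^bsub>G\<^esub> l = \<one>\<^bsub>G\<^esub>" using H(2) by (simp add: Coset.order_def flip: nat_pow_consistent)
  then show ?thesis using x subgroup.mem_carrier[OF H(1)] by auto
qed

context comm_group
begin

definition torsion :: "nat \<Rightarrow> 'a set" where
  "torsion k = {x \<in> carrier G. x [^] k = \<one>}"

lemma subgroup_torsion: "subgroup (torsion k) G"
proof
  show "x \<otimes> y \<in> torsion k" if "x \<in> torsion k" "y \<in> torsion k" for x y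
    using that by (simp add: torsion_def nat_pow_distrib)
  show "inv x \<in> torsion k" if "x \<in> torsion k" for x
    using that by (simp add: torsion_def nat_pow_inv)
qed (auto simp: torsion_def)

text \<open>By Cauchy's theorem the k-torsion contains an element of order l, and its order also
  divides k.\<close>

lemma prime_dvd_card_torsion:
  assumes "finite (carrier G)" "prime l" "l dvd card (torsion k)" "k > 0"
  shows "l dvd k"
proof (rule ccontr)
  assume "\<not> l dvd k"
  then have "coprime l k" using assms(2) prime_imp_coprime by blast
  interpret T: group "G\<lparr>carrier := torsion k\<rparr>"
    using subgroup.subgroup_is_group[OF subgroup_torsion] is_group by blast
  obtain x where x: "x \<in> torsion k" "x \<noteq> \<one>" "x [^]\<^bsub>G\<lparr>carrier := torsion k\<rparr>\<^esub> l = \<one>"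
    using cauchy_theorem[OF T.is_group _ assms(2), of] assms(1,3) by (auto simp: torsion_def)
  then have "x [^] l = \<one>" "x [^] k = \<one>" "x \<in> carrier G" by (auto simp: torsion_def simp flip: nat_pow_consistent)
  then have "ord x dvd l" "ord x dvd k" by (auto simp: pow_eq_id)
  then have "ord x = 1" using \<open>coprime l k\<close> by (metis coprime_common_divisor_nat)
  then show False using x(2) \<open>x \<in> carrier G\<close> ord_eq_1 by blast
qed

lemma torsion_decomposition:
  assumes "finite (carrier G)" "Coset.order G = k * l" "coprime k l"
  shows "internal_semidirect_product G (torsion k) (torsion l)"
proof -
  have "torsion k \<lhd> G"
    by (rule normal_iff_subgroup[THEN iffD2]) (rule subgroup_torsion)
  moreover have "torsion k \<inter> torsion l = {\<one>}"
  proof -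
    have "x = \<one>" if "x \<in> torsion k" "x \<in> torsion l" for x
    proof -
      have "ord x dvd k" "ord x dvd l" "x \<in> carrier G" using that by (auto simp: torsion_def pow_eq_id)
      then show ?thesis using assms(3) ord_eq_1 by (metis coprime_common_divisor_nat)
    qed
    then show ?thesis by (auto simp: torsion_def)
  qed
  moreover have "torsion k <#> torsion l = carrier G"
  proof
    show "torsion k <#> torsion l \<subseteq> carrier G" by (auto simp: set_mult_def torsion_def)
    show "carrier G \<subseteq> torsion k <#> torsion l"
    proof
      fix x assume x: "x \<in> carrier G"
      have "k \<noteq> 0" using order_gt_0_iff_finite assms(1,2) by auto
      then obtain u v where uv: "k * u = l * v + 1"
        using bezout_nat[of k l] assms(3) by (auto simp: coprime_iff_gcd_eq_1)
      \<comment> \<open>Since k u = l v + 1, the element x is x^(-l v) times x^(k u); the order of x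
        divides k l, so these factors are killed by k and by l.\<close>
      define y z where "y = inv (x [^] (l * v))" and "z = x [^] (k * u)"
      have yz: "y \<in> carrier G" "z \<in> carrier G" using x by (auto simp: y_def z_def)
      have e: "x [^] (k * l) = \<one>" using pow_order_eq_1[OF x] assms(2) by simp
      have "y [^] k = inv ((x [^] (k * l)) [^] v)"
        using x by (simp add: y_def nat_pow_inv nat_pow_pow mult_ac)
      moreover have "z [^] l = (x [^] (k * l)) [^] u"
        using x by (simp add: z_def nat_pow_pow mult_ac)
      ultimately have "y [^] k = \<one>" "z [^] l = \<one>" using e by auto
      moreover have "x = y \<otimes> z"
        using x by (simp add: y_def z_def uv inv_solve_left)
      moreover note yz
      ultimately show "x \<in> torsion k <#> torsion l" by (auto simp: set_mult_def torsion_def)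
    qed
  qed
  ultimately show ?thesis using subgroup_torsion by (simp add: internal_semidirect_product_def)
qed

end

section \<open>Finite groups of units of a division algebra modulo scalars\<close>

context central_division_algebra
begin

text \<open>\<open>\<alpha>\<close> picks lifts for an embedding of G into the units of A modulo
  those of the field, so it is multiplicative and injective only up to scalars.\<close>

context
  fixes G :: "('g, 'b) monoid_scheme" (structure) and \<alpha> :: "'g \<Rightarrow> 'a"
  assumes roots: "contains_all_roots_of_unity TYPE('k)"
    and G: "Group.group G" and finG: "finite (carrier G)"
    and \<alpha>0: "\<And>g. g \<in> carrier G \<Longrightarrow> \<alpha> g \<noteq> 0"
    and \<alpha>_mult: "\<And>g h. g \<in> carrier G \<Longrightarrow> h \<in> carrier G \<Longrightarrow> \<exists>c. \<alpha> g * \<alpha> h = scale c (\<alpha> (g \<otimes> h))"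
    and \<alpha>_inj: "\<And>g c. g \<in> carrier G \<Longrightarrow> \<alpha> g = scale c 1 \<Longrightarrow> g = \<one>"
begin

interpretation G: Group.group G by (rule G)

lemma proportional_iff:
  assumes "g \<in> carrier G" "h \<in> carrier G" "\<alpha> g = scale c (\<alpha> h)"
  shows "g = h"
proof -
  have ih: "inv h \<in> carrier G" using assms by simp
  obtain d where d: "\<alpha> g * \<alpha> (inv h) = scale d (\<alpha> (g \<otimes> inv h))" using \<alpha>_mult assms(1) ih by blast
  obtain e where e: "\<alpha> h * \<alpha> (inv h) = scale e (\<alpha> \<one>)" using \<alpha>_mult[OF assms(2) ih] assms(2) by auto
  obtain f where f: "\<alpha> \<one> * \<alpha> \<one> = scale f (\<alpha> \<one>)" using \<alpha>_mult[of \<one> \<one>] by auto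
  then have "\<alpha> \<one> * \<alpha> \<one> = scale f 1 * \<alpha> \<one>" by (simp add: scale_mult_left)
  then have "\<alpha> \<one> = scale f 1" using \<alpha>0[of \<one>] by simp
  then have "scale d (\<alpha> (g \<otimes> inv h)) = scale (c * e * f) 1"
    using assms(3) by (simp add: scale_mult_left e flip: d)
  moreover have "d \<noteq> 0" using d \<alpha>0[OF assms(1)] \<alpha>0[OF ih] by auto
  ultimately have "\<alpha> (g \<otimes> inv h) = scale (inverse d * (c * e * f)) 1"
    using arg_cong[of _ _ "scale (inverse d)"] by (metis scale_one scale_scale left_inverse)
  then have "g \<otimes> inv h = \<one>" using \<alpha>_inj assms ih by blast
  then show ?thesis using assms G.inv_solve_right' by (metis G.inv_equality G.inv_inv ih)
qed

text \<open>The transfer: \<open>v\<close> is the determinant of the monomial matrix by which \<open>x\<close>, a multiple of \<open>\<alpha> s\<close>, permutes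
  the lines spanned by the \<open>\<alpha> g\<close>.\<close>

definition transfer :: "'a \<Rightarrow> 'g \<Rightarrow> 'k \<Rightarrow> bool" where
  "transfer x s v \<longleftrightarrow> s \<in> carrier G \<and>
     (\<exists>\<kappa>. (\<forall>g\<in>carrier G. x * \<alpha> g = scale (\<kappa> g) (\<alpha> (s \<otimes> g))) \<and> v = (\<Prod>g\<in>carrier G. \<kappa> g))"

text \<open>Determinants of monomial matrices multiply: in the product, the entries of the first
  factor are merely reindexed by the translation by \<open>t\<close>.\<close>

lemma transfer_mult:
  assumes "transfer x s v" "transfer y t w"
  shows "transfer (x * y) (s \<otimes> t) (v * w)"
proof -
  obtain \<kappa> where \<kappa>: "s \<in> carrier G" "\<forall>g\<in>carrier G. x * \<alpha> g = scale (\<kappa> g) (\<alpha> (s \<otimes> g))" "v = (\<Prod>g\<in>carrier G. \<kappa> g)"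
    using assms(1) by (auto simp: transfer_def)
  obtain \<mu> where \<mu>: "t \<in> carrier G" "\<forall>g\<in>carrier G. y * \<alpha> g = scale (\<mu> g) (\<alpha> (t \<otimes> g))" "w = (\<Prod>g\<in>carrier G. \<mu> g)"
    using assms(2) by (auto simp: transfer_def)
  have "x * y * \<alpha> g = scale (\<kappa> (t \<otimes> g) * \<mu> g) (\<alpha> (s \<otimes> t \<otimes> g))" if "g \<in> carrier G" for g
  proof -
    have "x * y * \<alpha> g = x * scale (\<mu> g) (\<alpha> (t \<otimes> g))" using \<mu>(2) that by (simp add: mult.assoc)
    also have "\<dots> = scale (\<mu> g) (scale (\<kappa> (t \<otimes> g)) (\<alpha> (s \<otimes> (t \<otimes> g))))"
      using \<kappa>(2) \<mu>(1) that by (simp add: scale_mult_right)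
    finally show ?thesis using \<kappa>(1) \<mu>(1) that by (simp add: G.m_assoc mult.commute)
  qed
  moreover have "bij_betw (\<lambda>g. t \<otimes> g) (carrier G) (carrier G)"
    using \<mu>(1) by (simp add: bij_betw_def G.inj_on_cmult G.surj_const_mult)
  then have "(\<Prod>g\<in>carrier G. \<kappa> (t \<otimes> g)) = v" unfolding \<kappa>(3) by (rule prod.reindex_bij_betw)
  then have "v * w = (\<Prod>g\<in>carrier G. \<kappa> (t \<otimes> g) * \<mu> g)" by (simp add: prod.distrib \<mu>(3))
  ultimately show ?thesis using \<kappa>(1) \<mu>(1) unfolding transfer_def
    by (intro conjI exI[of _ "\<lambda>g. \<kappa> (t \<otimes> g) * \<mu> g"]) auto
qed

lemma transfer_exists:
  assumes "s \<in> carrier G" shows "\<exists>v. v \<noteq> 0 \<and> transfer (\<alpha> s) s v"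
proof -
  obtain \<kappa> where \<kappa>: "\<forall>g\<in>carrier G. \<alpha> s * \<alpha> g = scale (\<kappa> g) (\<alpha> (s \<otimes> g))"
    using \<alpha>_mult[OF assms] by metis
  have "\<kappa> g \<noteq> 0" if "g \<in> carrier G" for g
    using \<kappa> \<alpha>0 that assms by (metis mult_eq_0_iff scale_zero_left)
  then show ?thesis using \<kappa> assms finG unfolding transfer_def by (intro exI[of _ "prod \<kappa> (carrier G)"]) auto
qed

lemma transfer_inverse:
  assumes "transfer x s v" "v \<noteq> 0"
  shows "transfer (inverse x) (inv s) (inverse v)"
proof -
  obtain \<kappa> where \<kappa>: "s \<in> carrier G" "\<forall>g\<in>carrier G. x * \<alpha> g = scale (\<kappa> g) (\<alpha> (s \<otimes> g))" "v = (\<Prod>g\<in>carrier G. \<kappa> g)"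
    using assms(1) by (auto simp: transfer_def)
  have \<kappa>0: "\<kappa> g \<noteq> 0" if "g \<in> carrier G" for g using assms(2) \<kappa>(3) that finG by auto
  have x0: "x \<noteq> 0"
  proof
    assume "x = 0"
    then have "scale (\<kappa> \<one>) (\<alpha> s) = 0" using \<kappa>(1,2) by force
    then show False using \<kappa>0 \<alpha>0 \<kappa>(1) by auto
  qed
  have "inverse x * \<alpha> g = scale (inverse (\<kappa> (inv s \<otimes> g))) (\<alpha> (inv s \<otimes> g))" if g: "g \<in> carrier G" for g
  proof -
    have "x * \<alpha> (inv s \<otimes> g) = scale (\<kappa> (inv s \<otimes> g)) (\<alpha> g)"
      using \<kappa>(1,2) g by (simp flip: G.m_assoc)
    then have "\<alpha> (inv s \<otimes> g) = inverse x * scale (\<kappa> (inv s \<otimes> g)) (\<alpha> g)"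
      using x0 by (metis mult.assoc left_inverse mult_1_left)
    then show ?thesis using \<kappa>0[of "inv s \<otimes> g"] \<kappa>(1) g by (simp add: scale_mult_right)
  qed
  moreover have "bij_betw (\<lambda>g. inv s \<otimes> g) (carrier G) (carrier G)"
    using \<kappa>(1) by (simp add: bij_betw_def G.inj_on_cmult G.surj_const_mult)
  then have "(\<Prod>g\<in>carrier G. (inverse \<circ> \<kappa>) (inv s \<otimes> g)) = (\<Prod>g\<in>carrier G. (inverse \<circ> \<kappa>) g)"
    by (rule prod.reindex_bij_betw)
  then have "(\<Prod>g\<in>carrier G. inverse (\<kappa> (inv s \<otimes> g))) = inverse v"
    unfolding \<kappa>(3) prod_inversef by simp
  ultimately show ?thesis using \<kappa>(1) unfolding transfer_def by (metis (no_types, lifting) G.inv_closed)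
qed

lemma transfer_power: "transfer x s v \<Longrightarrow> transfer (x ^ Suc k) (s [^] Suc k) (v ^ Suc k)"
proof (induction k)
  case 0
  then show ?case by (simp add: transfer_def)
next
  case (Suc k)
  then show ?case using transfer_mult[of "x ^ Suc k" "s [^] Suc k" "v ^ Suc k" x s v]
    by (simp add: mult.commute power_commutes del: G.nat_pow_Suc) (simp add: power_commutes mult.assoc mult.commute)
qed

text \<open>The commutator z of two lifts has transfer 1. For N the order of G, the power z^N is a
  scalar \<kappa> because it lifts the identity, and its transfer \<kappa>^N is 1. So z^(N N) = 1,
  and z is a scalar since the field contains the roots of unity; then the two products of the lifts
  are proportional.\<close>

lemma commutative: assumes s: "s \<in> carrier G" and t: "t \<in> carrier G" shows "s \<otimes> t = t \<otimes> s"
proof -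
  obtain v w where v: "v \<noteq> 0" "transfer (\<alpha> s) s v" and w: "w \<noteq> 0" "transfer (\<alpha> t) t w"
    using transfer_exists s t by metis
  define z where "z = \<alpha> s * \<alpha> t * inverse (\<alpha> s) * inverse (\<alpha> t)"
  define r where "r = s \<otimes> t \<otimes> inv s \<otimes> inv t"
  have "transfer z r (v * w * inverse v * inverse w)" unfolding z_def r_def
    by (intro transfer_mult transfer_inverse v w)
  moreover have "v * w * inverse v * inverse w = 1" using v(1) w(1) by (simp add: field_simps)
  ultimately have z: "transfer z r 1" by simp
  define N where "N = Coset.order G"
  obtain N' where N': "N = Suc N'" using G.order_gt_0_iff_finite finG N_def by (metis gr0_implies_Suc)
  have "r \<in> carrier G" using s t by (simp add: r_def)
  then have "r [^] Suc N' = \<one>" using G.pow_order_eq_1[of r] N' N_def by simp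
  then have "transfer (z ^ N) \<one> 1" using transfer_power[OF z, of N'] N' by simp
  then obtain \<kappa> where \<kappa>: "\<forall>g\<in>carrier G. z ^ N * \<alpha> g = scale (\<kappa> g) (\<alpha> g)" "1 = (\<Prod>g\<in>carrier G. \<kappa> g)"
    by (auto simp: transfer_def)
  have \<kappa>': "z ^ N = scale (\<kappa> g) 1" if "g \<in> carrier G" for g
  proof -
    have "z ^ N * \<alpha> g = scale (\<kappa> g) 1 * \<alpha> g" using \<kappa>(1) that by (simp add: scale_mult_left)
    then show ?thesis using \<alpha>0[OF that] by simp
  qed
  have "\<kappa> g = \<kappa> \<one>" if "g \<in> carrier G" for g
    using trans[OF \<kappa>'[OF that, symmetric] \<kappa>'[OF G.one_closed]] by (simp only: scale_eq_one_iff)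
  then have "(\<Prod>g\<in>carrier G. \<kappa> g) = (\<Prod>g\<in>carrier G. \<kappa> \<one>)" by (rule prod.cong[OF refl])
  then have "1 = \<kappa> \<one> ^ N" using \<kappa>(2) by (simp only: prod_constant N_def Coset.order_def)
  moreover have "scale c 1 ^ k = scale (c ^ k) 1" for c k
    by (induction k) (simp_all add: scale_mult_left)
  ultimately have "z ^ (N * N) = 1" using \<kappa>'[of \<one>] by (simp add: power_mult)
  then obtain c where c: "z = scale c 1" using root_of_unity_central[OF roots, of "N * N" z] N' by auto
  have "z * (\<alpha> t * \<alpha> s) = \<alpha> s * \<alpha> t * (inverse (\<alpha> s) * (inverse (\<alpha> t) * \<alpha> t) * \<alpha> s)"
    by (simp only: z_def mult.assoc)
  also have "inverse (\<alpha> s) * (inverse (\<alpha> t) * \<alpha> t) * \<alpha> s = 1" using \<alpha>0[OF s] \<alpha>0[OF t] by simp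
  finally have "\<alpha> s * \<alpha> t = z * (\<alpha> t * \<alpha> s)" by simp
  then have c': "\<alpha> s * \<alpha> t = scale c (\<alpha> t * \<alpha> s)" by (simp add: c scale_mult_left)
  obtain d e where d: "\<alpha> s * \<alpha> t = scale d (\<alpha> (s \<otimes> t))" and e: "\<alpha> t * \<alpha> s = scale e (\<alpha> (t \<otimes> s))"
    using \<alpha>_mult s t by metis
  have d0: "d \<noteq> 0" using d \<alpha>0[OF s] \<alpha>0[OF t] by auto
  have "scale d (\<alpha> (s \<otimes> t)) = scale (c * e) (\<alpha> (t \<otimes> s))" using c' d e by simp
  then have "\<alpha> (s \<otimes> t) = scale (inverse d * (c * e)) (\<alpha> (t \<otimes> s))"
    using d0 by (metis scale_one scale_scale left_inverse)
  then show ?thesis using proportional_iff[of "s \<otimes> t" "t \<otimes> s"] s t by blast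
qed

lemma power_proportional:
  assumes "g \<in> carrier G" shows "\<exists>c. c \<noteq> 0 \<and> \<alpha> g ^ k = scale c (\<alpha> (g [^] k))"
proof (induction k)
  case 0
  obtain f where f: "\<alpha> \<one> * \<alpha> \<one> = scale f (\<alpha> \<one>)" using \<alpha>_mult[of \<one> \<one>] by auto
  then have "\<alpha> \<one> * \<alpha> \<one> = scale f 1 * \<alpha> \<one>" by (simp add: scale_mult_left)
  then have f1: "\<alpha> \<one> = scale f 1" using \<alpha>0[of \<one>] by simp
  then have "f \<noteq> 0" using \<alpha>0[of \<one>] by auto
  then show ?case using f1 by (intro exI[of _ "inverse f"]) simp
next
  case (Suc k)
  then obtain c where c: "c \<noteq> 0" "\<alpha> g ^ k = scale c (\<alpha> (g [^] k))" by blast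
  have gk: "g [^] k \<in> carrier G" using assms by simp
  obtain d where d: "\<alpha> (g [^] k) * \<alpha> g = scale d (\<alpha> (g [^] Suc k))"
    using \<alpha>_mult[OF gk assms] by auto
  have "d \<noteq> 0" using d \<alpha>0[OF gk] \<alpha>0[OF assms] by auto
  moreover have "\<alpha> g ^ Suc k = scale c (\<alpha> (g [^] k) * \<alpha> g)"
    using c(2) by (simp only: power_Suc2 scale_mult_left)
  ultimately show ?case using c(1) d by (intro exI[of _ "c * d"]) simp
qed

lemma power_central_iff:
  assumes "g \<in> carrier G" shows "(\<exists>c. \<alpha> g ^ k = scale c 1) \<longleftrightarrow> g [^] k = \<one>"
proof -
  obtain c where c: "c \<noteq> 0" "\<alpha> g ^ k = scale c (\<alpha> (g [^] k))" using power_proportional assms by blast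
  obtain d where d: "1 = scale d (\<alpha> \<one>)" using power_proportional[OF G.one_closed, of 0] by auto
  have d0: "d \<noteq> 0" using d by auto
  show ?thesis
  proof
    assume "\<exists>e. \<alpha> g ^ k = scale e 1"
    then obtain e where "scale c (\<alpha> (g [^] k)) = scale e 1" using c by auto
    then have "\<alpha> (g [^] k) = scale (inverse c * e) 1"
      using c(1) by (metis scale_one scale_scale left_inverse)
    then show "g [^] k = \<one>" using \<alpha>_inj assms by blast
  next
    assume g: "g [^] k = \<one>"
    have "\<alpha> \<one> = scale (inverse d) 1" using d d0 by (metis scale_one scale_scale left_inverse)
    then show "\<exists>e. \<alpha> g ^ k = scale e 1" using c(2) g by simp
  qed
qed

interpretation G: Group.comm_group G
  by (rule G.group_comm_groupI) (rule commutative)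

lemma card_torsion_dvd:
  assumes k: "k > 0" "coprime k CHAR('k)"
  shows "card (G.torsion k) dvd dim (UNIV :: 'a set)"
proof -
  let ?H = "G.torsion k"
  have H: "subgroup ?H G" by (rule G.subgroup_torsion)
  have Hc: "h \<in> carrier G" if "h \<in> ?H" for h using that by (simp add: G.torsion_def)
  \<comment> \<open>All nonzero multiples are included because the lifts alone are closed under
    products and inverses only up to scalars.\<close>
  define Y where "Y = {scale c (\<alpha> h) |c h. c \<noteq> 0 \<and> h \<in> ?H}"
  have Y0: "0 \<notin> Y" using \<alpha>0 Hc by (auto simp: Y_def)
  have mul: "\<exists>c. c \<noteq> 0 \<and> \<alpha> g * \<alpha> h = scale c (\<alpha> (g \<otimes> h))" if "g \<in> carrier G" "h \<in> carrier G" for g h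
    using \<alpha>_mult[OF that] \<alpha>0[OF that(1)] \<alpha>0[OF that(2)] by (metis mult_eq_0_iff scale_zero_left)
  have Y_mult: "x * y \<in> Y" if "x \<in> Y" "y \<in> Y" for x y
  proof -
    obtain c g d h where x: "x = scale c (\<alpha> g)" "c \<noteq> 0" "g \<in> ?H" and y: "y = scale d (\<alpha> h)" "d \<noteq> 0" "h \<in> ?H"
      using \<open>x \<in> Y\<close> \<open>y \<in> Y\<close> by (auto simp: Y_def)
    obtain e where e: "e \<noteq> 0" "\<alpha> g * \<alpha> h = scale e (\<alpha> (g \<otimes> h))" using mul Hc x y by blast
    have "x * y = scale (c * d * e) (\<alpha> (g \<otimes> h))" using x y e by (simp add: scale_mult_left scale_mult_right)
    moreover have "g \<otimes> h \<in> ?H" using H x(3) y(3) by (rule subgroup.m_closed)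
    moreover have "c * d * e \<noteq> 0" using x y e by simp
    ultimately show ?thesis unfolding Y_def by blast
  qed
  obtain d where d: "1 = scale d (\<alpha> \<one>)" "d \<noteq> 0" using power_proportional[OF G.one_closed, of 0] by auto
  have Y_inv: "inverse x \<in> Y" if "x \<in> Y" for x
  proof -
    obtain c g where x: "x = scale c (\<alpha> g)" "c \<noteq> 0" "g \<in> ?H" using \<open>x \<in> Y\<close> by (auto simp: Y_def)
    have ig: "inv g \<in> ?H" using H x(3) by (rule subgroup.m_inv_closed)
    obtain e where e: "e \<noteq> 0" "\<alpha> g * \<alpha> (inv g) = scale e (\<alpha> \<one>)"
      using mul[of g "inv g"] Hc[OF x(3)] by auto
    define f where "f = inverse c * inverse e * d"
    have "c * f * e = d" using x(2) e(1) by (simp add: f_def field_simps)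
    moreover have "x * scale f (\<alpha> (inv g)) = scale (c * f * e) (\<alpha> \<one>)"
      by (simp add: x(1) scale_mult_left scale_mult_right e(2))
    ultimately have "x * scale f (\<alpha> (inv g)) = scale d (\<alpha> \<one>)" by simp
    then have "inverse x = scale f (\<alpha> (inv g))" using d(1) by (intro inverse_unique) simp
    moreover have "f \<noteq> 0" using x e d by (simp add: f_def)
    ultimately show ?thesis using ig unfolding Y_def by blast
  qed
  have spow: "(scale c x) ^ i = scale (c ^ i) (x ^ i)" for c x i
    by (induction i) (simp_all add: scale_mult_left scale_mult_right)
  have Y_power: "\<exists>c. x ^ k = scale c 1" if "x \<in> Y" for x
  proof -
    obtain c g where x: "x = scale c (\<alpha> g)" "c \<noteq> 0" "g \<in> ?H" using \<open>x \<in> Y\<close> by (auto simp: Y_def)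
    have "\<exists>e. \<alpha> g ^ k = scale e 1" using power_central_iff[OF Hc[OF x(3)]] x(3) by (simp add: G.torsion_def)
    then show ?thesis using x(1) by (auto simp: spow)
  qed
  have Y_comm: "\<exists>c. x * y = scale c (y * x)" if "x \<in> Y" "y \<in> Y" for x y
  proof -
    obtain c g e h where x: "x = scale c (\<alpha> g)" "g \<in> ?H" and y: "y = scale e (\<alpha> h)" "h \<in> ?H"
      using \<open>x \<in> Y\<close> \<open>y \<in> Y\<close> by (auto simp: Y_def)
    obtain u where u: "u \<noteq> 0" "\<alpha> g * \<alpha> h = scale u (\<alpha> (g \<otimes> h))" using mul Hc x y by blast
    obtain v where v: "v \<noteq> 0" "\<alpha> h * \<alpha> g = scale v (\<alpha> (g \<otimes> h))"
      using mul[of h g] Hc x y commutative[of g h] by auto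
    have "x * y = scale (u * inverse v) (y * x)"
      using x y u v by (simp add: scale_mult_left scale_mult_right mult_ac)
    then show ?thesis ..
  qed
  have "\<alpha> h \<in> Y" if "h \<in> ?H" for h
  proof -
    have "\<alpha> h = scale 1 (\<alpha> h) \<and> (1::'k) \<noteq> 0 \<and> h \<in> ?H" using \<open>h \<in> ?H\<close> by simp
    then show ?thesis unfolding Y_def by blast
  qed
  then have TY: "\<alpha> ` ?H \<subseteq> Y" by blast
  have finT: "finite (\<alpha> ` ?H)" using finG by (simp add: G.torsion_def)
  have ind: "independent (\<alpha> ` ?H)"
  proof (rule independent_nonproportional[OF roots Y0 Y_mult Y_inv Y_power Y_comm k finT TY])
    fix s t assume st: "s \<in> \<alpha> ` ?H" "t \<in> \<alpha> ` ?H" "s \<noteq> t"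
    obtain g h where gh: "g \<in> ?H" "h \<in> ?H" "s = \<alpha> g" "t = \<alpha> h" using st(1,2) by blast
    show "\<nexists>c. s = scale c t"
    proof
      assume "\<exists>c. s = scale c t"
      then obtain c where "s = scale c t" by blast
      then have "\<alpha> g = scale c (\<alpha> h)" by (simp only: gh(3,4))
      then have "g = h" using proportional_iff Hc gh(1,2) by blast
      then show False using st(3) gh(3,4) by blast
    qed
  qed
  have inj: "inj_on \<alpha> ?H"
  proof (rule inj_onI)
    fix g h assume "g \<in> ?H" "h \<in> ?H" "\<alpha> g = \<alpha> h"
    then show "g = h" using proportional_iff[of g h 1] Hc by simp
  qed
  define D where "D = span (\<alpha> ` ?H)"
  have dimD: "dim D = card ?H"
    using dim_span_eq_card_independent[OF ind] card_image[OF inj] by (simp add: D_def)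
  have YD: "x \<in> D" if "x \<in> Y" for x using that by (auto simp: Y_def D_def intro: span_scale span_base)
  have "1 \<in> Y" using d subgroup.one_closed[OF H] by (auto simp: Y_def)
  moreover have mD: "x * y \<in> D" if "x \<in> D" "y \<in> D" for x y
  proof -
    have *: "s * y \<in> D" if s: "s \<in> \<alpha> ` ?H" for s
      using \<open>y \<in> D\<close> unfolding D_def
    proof (induction rule: span_induct)
      case base
      show ?case by (rule subspaceI) (auto simp: distrib_left scale_mult_right span_zero span_add span_scale)
    next
      case (step t)
      then show ?case using YD Y_mult TY s unfolding D_def by blast
    qed
    show ?thesis using \<open>x \<in> D\<close> unfolding D_def
    proof (induction rule: span_induct)
      case base
      show ?case by (rule subspaceI) (auto simp: distrib_right scale_mult_left span_zero span_add span_scale)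
    next
      case (step t)
      then show ?case using * unfolding D_def by blast
    qed
  qed
  ultimately have "is_subalg D" using YD by (simp add: is_subalg_def D_def)
  from dim_dvd[OF this subspace_UNIV] show ?thesis using dimD by simp
qed

theorem projective_group_structure:
  fixes n n' m :: nat
  defines "p \<equiv> CHAR('k)"
  assumes p: "p > 0" and dim: "dim (UNIV :: 'a set) = n\<^sup>2" and n: "n = n' * p ^ m" "coprime n' p"
  shows "\<exists>H S. internal_semidirect_product G H S \<and> coprime (card H) p \<and> card H \<le> n' ^ (2 * (n - 1)) \<and>
     Group.comm_group (G\<lparr>carrier := S\<rparr>) \<and> (\<exists>k. card S = p ^ k) \<and> group_exp (G\<lparr>carrier := S\<rparr>) \<le> p ^ m"
proof -
  have pp: "prime p" using p prime_CHAR_semidom[where 'a = 'k] by (simp add: p_def)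
  have n0: "n > 0"
  proof -
    have "dim (UNIV :: 'a set) \<noteq> 0" using dim_eq_0[of UNIV] by (metis UNIV_I singletonD subsetD zero_neq_one)
    then show ?thesis using dim by (simp add: power2_eq_square)
  qed
  then have n'0: "n' > 0" using n by auto
  define N where "N = Coset.order G"
  have N0: "N \<noteq> 0" using G.order_gt_0_iff_finite finG by (simp add: N_def)
  obtain e l where N: "N = p ^ e * l" "\<not> p dvd l"
    using multiplicity_decompose'[of N p] N0 pp not_prime_unit by metis
  have cop: "coprime l p" using N(2) pp prime_imp_coprime coprime_commute by blast
  have l0: "l > 0" using N N0 by (auto intro!: Nat.gr0I)
  define H S where "H = G.torsion l" and "S = G.torsion (p ^ e)"
  have "internal_semidirect_product G H S" unfolding H_def S_def
    by (rule G.torsion_decomposition[OF finG]) (use N cop N_def in \<open>auto simp: mult.commute\<close>)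
  moreover have copH: "coprime (card H) p"
  proof -
    have "\<not> p dvd card H" using G.prime_dvd_card_torsion[OF finG pp, of l] N(2) l0 by (auto simp: H_def)
    then show ?thesis using pp prime_imp_coprime coprime_commute by blast
  qed
  moreover have "card H \<le> n' ^ (2 * (n - 1))"
  proof -
    have "card H dvd n'\<^sup>2 * p ^ (2 * m)"
      using card_torsion_dvd[OF l0] cop dim n(1) by (simp add: p_def H_def power_mult_distrib mult.commute flip: power_mult)
    then have dv: "card H dvd n'\<^sup>2" using copH by (meson coprime_dvd_mult_left_iff coprime_power_right_iff)
    show ?thesis
    \<comment> \<open>For n = 1 the exponent 2 (n - 1) is 0, but then n' = 1 as well. For larger n
      the exponent is at least 2, so the bound by the square of n' is enough.\<close>
    proof (cases "n = 1")
      case True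
      then have "n' = 1" using n(1) by auto
      then show ?thesis using dv by simp
    next
      case False
      then have "2 \<le> 2 * (n - 1)" using n0 by simp
      then have "n'\<^sup>2 \<le> n' ^ (2 * (n - 1))" using n'0 by (intro power_increasing) auto
      then show ?thesis using dvd_imp_le[OF dv] n'0 by simp
    qed
  qed
  moreover have "Group.comm_group (G\<lparr>carrier := S\<rparr>)"
    
  proof (rule group.group_comm_groupI)
    show "group (G\<lparr>carrier := S\<rparr>)"
      unfolding S_def by (rule subgroup.subgroup_is_group[OF G.subgroup_torsion G.is_group])
  qed (auto simp: S_def G.torsion_def G.m_comm)
  moreover have "\<exists>k. card S = p ^ k"
  proof -
    have "card S \<noteq> 0" using finG subgroup.one_closed[OF G.subgroup_torsion] by (auto simp: S_def G.torsion_def)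
    then obtain k t where t: "card S = p ^ k * t" "\<not> p dvd t"
      using multiplicity_decompose'[of "card S" p] pp not_prime_unit by metis
    have "t = 1"
    proof (rule ccontr)
      assume "t \<noteq> 1"
      then obtain q where q: "prime q" "q dvd t" using prime_factor_nat by blast
      then have "q dvd card S" using t(1) by simp
      then have "q dvd p ^ e" using G.prime_dvd_card_torsion[OF finG q(1), of "p ^ e"] p by (simp add: S_def)
      then have "q dvd p" using q(1) prime_dvd_power by blast
      then have "q = p" using q(1) pp primes_dvd_imp_eq by blast
      then show False using q t by simp
    qed
    then show ?thesis using t(1) by auto
  qed
  moreover have "group_exp (G\<lparr>carrier := S\<rparr>) \<le> p ^ m"
  proof -
    have "x [^] (p ^ m) = \<one>" if x: "x \<in> S" for x
    proof -
      have xc: "x \<in> carrier G" "x [^] (p ^ e) = \<one>" using x by (auto simp: S_def G.torsion_def)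
      \<comment> \<open>By minimality of r, the p^r-th power of the lift is its first p-power power
        that is a scalar, as the result on purely inseparable elements requires.\<close>
      define r where "r = (LEAST r. x [^] (p ^ r) = \<one>)"
      have r: "x [^] (p ^ r) = \<one>" unfolding r_def by (rule LeastI) (rule xc(2))
      have less: "x [^] (p ^ j) \<noteq> \<one>" if "j < r" for j using not_less_Least that unfolding r_def by blast
      obtain c where c: "\<alpha> x ^ (p ^ r) = scale c 1" using power_central_iff[OF xc(1)] r by blast
      have "(p ^ r)\<^sup>2 dvd n\<^sup>2"
        unfolding p_def dim[symmetric]
        by (rule purely_inseparable_dvd) (use pp c less power_central_iff[OF xc(1)] in \<open>auto simp: p_def\<close>)
      then have "p ^ r dvd n" by (simp add: pow_divides_pow_iff)
      then have "p ^ r dvd p ^ m" using n by (metis coprime_commute coprime_dvd_mult_right_iff coprime_power_left_iff)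
      then have "r \<le> m" using pp by (meson power_dvd_imp_le prime_gt_1_nat)
      then have "p ^ m = p ^ r * p ^ (m - r)" by (simp flip: power_add)
      then have "x [^] (p ^ m) = (x [^] (p ^ r)) [^] (p ^ (m - r))" using xc(1) by (simp add: G.nat_pow_pow)
      then show ?thesis using r by simp
    qed
    then show ?thesis unfolding group_exp_def using p
      by (intro Least_le) (simp flip: G.nat_pow_consistent)
  qed
  ultimately show ?thesis by blast
qed

end

end

section \<open>Automorphisms of projective space\<close>

text \<open>In a finite field the product of all X - a, increased by 1, would be a polynomial of
  positive degree without roots.\<close>

lemma infinite_alg_closed: "infinite (UNIV :: 'l::alg_closed_field set)"
proof
  assume fin: "finite (UNIV :: 'l set)"
  define p :: "'l poly" where "p = (\<Prod>a\<in>UNIV. [:-a, 1:]) + 1"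
  have "degree (\<Prod>a\<in>(UNIV::'l set). [:-a, 1:]) = card (UNIV :: 'l set)"
    by (subst degree_prod_eq_sum_degree) auto
  moreover have "card (UNIV :: 'l set) > 0" using fin by (simp add: card_gt_0_iff)
  ultimately have "degree p > 0" unfolding p_def by (subst degree_add_eq_left) auto
  then obtain x where "poly p x = 0" using alg_closed_imp_poly_has_root by blast
  moreover have "poly p x = 1" using fin by (simp add: p_def poly_prod)
  ultimately show False by simp
qed

lemma poly_eq_0_infinite:
  fixes p :: "'r::idom poly"
  assumes "infinite S" "\<And>x. x \<in> S \<Longrightarrow> poly p x = 0"
  shows "p = 0"
  using assms poly_roots_finite[of p] by (metis (mono_tags, lifting) finite_subset mem_Collect_eq subsetI)

lemma poly_eq_nonzero:
  fixes p q :: "'l::alg_closed_field poly"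
  assumes "\<And>x. x \<noteq> 0 \<Longrightarrow> poly p x = poly q x"
  shows "p = q"
proof -
  have "infinite (UNIV - {0 :: 'l})" using infinite_alg_closed by simp
  then have "p - q = 0" by (rule poly_eq_0_infinite) (use assms in auto)
  then show ?thesis by simp
qed

lemma poly_no_root_const:
  fixes p :: "'l::alg_closed_field poly"
  assumes "\<And>x. poly p x \<noteq> 0"
  obtains c where "c \<noteq> 0" "p = [:c:]"
proof -
  have "degree p = 0" using alg_closed_imp_poly_has_root assms by blast
  then obtain c where "p = [:c:]" using degree_eq_zeroE by blast
  then show ?thesis using assms[of 0] that by auto
qed

text \<open>After splitting off the power of X at 0 the cofactor has no roots at all, so it is
  constant, and the value at 1 makes it 1.\<close>

lemma poly_only_root_0:
  fixes p :: "'l::alg_closed_field poly"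
  assumes "\<And>x. x \<noteq> 0 \<Longrightarrow> poly p x \<noteq> 0" "poly p 1 = 1"
  obtains d where "p = monom 1 d"
proof -
  have "p \<noteq> 0" using assms(2) by auto
  then obtain q where q: "p = [:-0, 1:] ^ Polynomial.order 0 p * q" "\<not> [:-0, 1:] dvd q"
    using order_decomp by blast
  have "poly q x \<noteq> 0" for x
  proof (cases "x = 0")
    case True then show ?thesis using q(2) by (simp add: poly_eq_0_iff_dvd)
  next
    case False
    then have "poly ([:-0, 1:] ^ Polynomial.order 0 p) x * poly q x \<noteq> 0"
      using assms(1)[of x] q(1) by (metis poly_mult)
    then show ?thesis by simp
  qed
  then obtain c where c: "q = [:c:]" using poly_no_root_const by metis
  have "c = 1" using assms(2) by (subst (asm) q(1)) (simp add: c)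
  then show ?thesis using q(1) c that by (simp add: monom_altdef)
qed

section \<open>Polynomials in three variables\<close>

type_synonym 'l poly3 = "'l poly poly poly"

text \<open>\<open>r\<close> is put for the outermost variable \<open>X1\<close> and
  \<open>t\<close> for the innermost variable \<open>X3\<close>. As iterated univariate polynomials
  these inherit gcds and unique factorisation through type classes, on which the coprime
  representations below rest.\<close>

definition ev :: "'l::comm_ring_1 \<Rightarrow> 'l \<Rightarrow> 'l \<Rightarrow> 'l poly3 \<Rightarrow> 'l" where
  "ev r s t P = poly (poly (poly P [:[:r:]:]) [:s:]) t"

definition const3 :: "'l::comm_ring_1 \<Rightarrow> 'l poly3" where "const3 c = [:[:[:c:]:]:]"

definition X1 :: "'l::comm_ring_1 poly3" where "X1 = [:0, 1:]"
definition X2 :: "'l::comm_ring_1 poly3" where "X2 = [:[:0, 1:]:]"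
definition X3 :: "'l::comm_ring_1 poly3" where "X3 = [:[:[:0, 1:]:]:]"

lemma ev_simps [simp]:
  "ev r s t (P + Q) = ev r s t P + ev r s t Q" "ev r s t (P * Q) = ev r s t P * ev r s t Q"
  "ev r s t (P - Q) = ev r s t P - ev r s t Q" "ev r s t 0 = 0" "ev r s t 1 = 1"
  "ev r s t (const3 c) = c" "ev r s t X1 = r" "ev r s t X2 = s" "ev r s t X3 = t"
  by (simp_all add: ev_def const3_def X1_def X2_def X3_def)

lemma poly3_induct [case_names const X1 X2 X3 add mult]:
  fixes P :: "'l::comm_ring_1 poly3"
  assumes c: "\<And>c. Q (const3 c)" and X: "Q X1" "Q X2" "Q X3"
    and a: "\<And>p q. Q p \<Longrightarrow> Q q \<Longrightarrow> Q (p + q)" and m: "\<And>p q. Q p \<Longrightarrow> Q q \<Longrightarrow> Q (p * q)"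
  shows "Q P"
proof -
  have z: "Q 0" using c[of 0] by (simp add: const3_def)
  have 1: "Q [:[:b:]:]" for b
  proof (induction b)
    case 0 then show ?case using z by simp
  next
    case (pCons x p)
    have "[:[:pCons x p:]:] = const3 x + X3 * [:[:p:]:]" by (simp add: const3_def X3_def)
    then show ?case using c X(3) a m pCons by metis
  qed
  have 2: "Q [:b:]" for b
  proof (induction b)
    case 0 then show ?case using z by simp
  next
    case (pCons x p)
    have "[:pCons x p:] = [:[:x:]:] + X2 * [:p:]" by (simp add: X2_def)
    then show ?case using 1 X(2) a m pCons by metis
  qed
  show ?thesis
  proof (induction P)
    case 0 then show ?case by (rule z)
  next
    case (pCons x p)
    have "pCons x p = [:x:] + X1 * p" by (simp add: X1_def)
    then show ?case using 2 X(1) a m pCons by metis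
  qed
qed

text \<open>Substitution is used only through values, so it is stated as existence of a polynomial
  with the right values and proved on the generators.\<close>

lemma subst3: "\<exists>P'. \<forall>r s t. ev r s t P' = ev (ev r s t A) (ev r s t B) (ev r s t C) P"
proof (induction P rule: poly3_induct)
  case (const c) show ?case by (rule exI[of _ "const3 c"]) simp
next
  case X1 show ?case by (rule exI[of _ A]) simp
next
  case X2 show ?case by (rule exI[of _ B]) simp
next
  case X3 show ?case by (rule exI[of _ C]) simp
next
  case (add p q) then show ?case by (metis ev_simps(1))
next
  case (mult p q) then show ?case by (metis ev_simps(2))
qed

lemma subst1: "\<exists>q. \<forall>x. poly q x = ev (poly a x) (poly b x) (poly c x) P"
proof (induction P rule: poly3_induct)
  case (const z) show ?case by (rule exI[of _ "[:z:]"]) simp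
next
  case X1 show ?case by (rule exI[of _ a]) simp
next
  case X2 show ?case by (rule exI[of _ b]) simp
next
  case X3 show ?case by (rule exI[of _ c]) simp
next
  case (add p q) then show ?case by (metis ev_simps(1) poly_add)
next
  case (mult p q) then show ?case by (metis ev_simps(2) poly_mult)
qed

text \<open>Expansion to second order along the ray through a point. The remainder may depend on the
  point, but the first-order coefficients do not.\<close>

lemma ev_linear_part:
  "\<exists>c0 a b c. \<forall>r s t. \<exists>q. \<forall>l. ev (l * r) (l * s) (l * t) P = c0 + l * (a * r + b * s + c * t) + l\<^sup>2 * poly q l"
  (is "\<exists>c0 a b c. ?Q P c0 a b c")
proof (induction P rule: poly3_induct)
  case (const z)
  have "?Q (const3 z) z 0 0 0" by (intro allI exI[of _ 0]) simp
  then show ?case by blast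
next
  case X1
  have "?Q X1 0 1 0 0" by (intro allI exI[of _ 0]) simp
  then show ?case by blast
next
  case X2
  have "?Q X2 0 0 1 0" by (intro allI exI[of _ 0]) simp
  then show ?case by blast
next
  case X3
  have "?Q X3 0 0 0 1" by (intro allI exI[of _ 0]) simp
  then show ?case by blast
next
  case (add p q)
  obtain c0 a b c where p: "?Q p c0 a b c" using add by blast
  obtain c0' a' b' c' where q: "?Q q c0' a' b' c'" using add by blast
  have "?Q (p + q) (c0 + c0') (a + a') (b + b') (c + c')"
  proof (intro allI)
    fix r s t
    obtain f where f: "\<forall>l. ev (l * r) (l * s) (l * t) p = c0 + l * (a * r + b * s + c * t) + l\<^sup>2 * poly f l" using p by blast
    obtain g where g: "\<forall>l. ev (l * r) (l * s) (l * t) q = c0' + l * (a' * r + b' * s + c' * t) + l\<^sup>2 * poly g l" using q by blast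
    show "\<exists>h. \<forall>l. ev (l * r) (l * s) (l * t) (p + q)
      = c0 + c0' + l * ((a + a') * r + (b + b') * s + (c + c') * t) + l\<^sup>2 * poly h l"
      by (rule exI[of _ "f + g"]) (simp add: f g algebra_simps)
  qed
  then show ?case by blast
next
  case (mult p q)
  obtain c0 a b c where p: "?Q p c0 a b c" using mult by blast
  obtain c0' a' b' c' where q: "?Q q c0' a' b' c'" using mult by blast
  have "?Q (p * q) (c0 * c0') (c0 * a' + c0' * a) (c0 * b' + c0' * b) (c0 * c' + c0' * c)"
  proof (intro allI)
    fix r s t
    obtain f where f: "\<forall>l. ev (l * r) (l * s) (l * t) p = c0 + l * (a * r + b * s + c * t) + l\<^sup>2 * poly f l" using p by blast
    obtain g where g: "\<forall>l. ev (l * r) (l * s) (l * t) q = c0' + l * (a' * r + b' * s + c' * t) + l\<^sup>2 * poly g l" using q by blast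
    define u v where "u = a * r + b * s + c * t" and "v = a' * r + b' * s + c' * t"
    show "\<exists>h. \<forall>l. ev (l * r) (l * s) (l * t) (p * q) = c0 * c0'
       + l * ((c0 * a' + c0' * a) * r + (c0 * b' + c0' * b) * s + (c0 * c' + c0' * c) * t) + l\<^sup>2 * poly h l"
      by (rule exI[of _ "[:u * v:] + smult c0 g + smult c0' f + [:0,1:] * (smult u g + smult v f) + [:0,0,1:] * f * g"])
        (simp add: f g flip: u_def v_def, simp add: u_def v_def algebra_simps power2_eq_square)
  qed
  then show ?case by blast
qed

text \<open>Compare the coefficients of l along the ray. Homogeneity is required inside, point by
  point, so that a, b, c depend on \<open>P\<close> alone.\<close>

lemma ev_homogeneous_linear:
  fixes P :: "'l::alg_closed_field poly3"
  shows "\<exists>a b c. \<forall>r s t. (\<forall>l. l \<noteq> 0 \<longrightarrow> ev (l * r) (l * s) (l * t) P = l * ev r s t P)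
    \<longrightarrow> ev r s t P = a * r + b * s + c * t"
proof -
  obtain c0 a b c where *: "\<And>r s t. \<exists>q. \<forall>l. ev (l * r) (l * s) (l * t) P = c0 + l * (a * r + b * s + c * t) + l\<^sup>2 * poly q l"
    using ev_linear_part[of P] by blast
  have "ev r s t P = a * r + b * s + c * t" if h: "\<And>l. l \<noteq> 0 \<Longrightarrow> ev (l * r) (l * s) (l * t) P = l * ev r s t P" for r s t
  proof -
    obtain q where q: "\<And>l. ev (l * r) (l * s) (l * t) P = c0 + l * (a * r + b * s + c * t) + l\<^sup>2 * poly q l" using * by blast
    have "[:0, ev r s t P:] = [:c0, a * r + b * s + c * t:] + [:0,0,1:] * q"
      by (rule poly_eq_nonzero) (use h q in \<open>simp add: power2_eq_square algebra_simps\<close>)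
    then have "coeff [:0, ev r s t P:] 1 = coeff ([:c0, a * r + b * s + c * t:] + [:0,0,1:] * q) 1" by simp
    then show ?thesis by simp
  qed
  then show ?thesis by blast
qed

text \<open>Points with nonzero \<open>s\<close> and \<open>t\<close> form a product of infinite
  sets, which is enough to force a polynomial to vanish. Every parameter domain \<open>E\<close>
  used below contains these points.\<close>

lemma ev_eq_0:
  fixes P :: "'l::alg_closed_field poly3"
  assumes "\<And>r s t. s \<noteq> 0 \<Longrightarrow> t \<noteq> 0 \<Longrightarrow> ev r s t P = 0"
  shows "P = 0"
proof -
  have 1: "infinite (UNIV - {0 :: 'l})" using infinite_alg_closed by simp
  have 2: "infinite ((\<lambda>s. [:s:]) ` (UNIV - {0 :: 'l}))"
    using 1 by (subst finite_image_iff) (auto simp: inj_on_def)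
  have 3: "infinite ((\<lambda>r. [:[:r:]:]) ` (UNIV :: 'l set))"
    using infinite_alg_closed by (subst finite_image_iff) (auto simp: inj_on_def)
  show ?thesis
  proof (rule poly_eq_0_infinite[OF 3])
    fix x :: "'l poly poly" assume "x \<in> range (\<lambda>r. [:[:r:]:])"
    then obtain r where x: "x = [:[:r:]:]" by blast
    show "poly P x = 0"
    proof (rule poly_eq_0_infinite[OF 2])
      fix y assume "y \<in> (\<lambda>s. [:s:]) ` (UNIV - {0 :: 'l})"
      then obtain s where y: "y = [:s:]" "s \<noteq> 0" by blast
      show "poly (poly P x) y = 0"
        by (rule poly_eq_0_infinite[OF 1]) (use assms[of s _ r] x y in \<open>simp add: ev_def\<close>)
    qed
  qed
qed

lemma is_unit_poly3:
  fixes P :: "'l::field poly3"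
  assumes "P dvd 1" obtains c where "P = const3 c"
proof -
  obtain a where a: "P = [:a:]" "a dvd 1" using assms by (auto simp: is_unit_poly_iff)
  obtain b where b: "a = [:b:]" "b dvd 1" using a(2) by (auto simp: is_unit_poly_iff)
  have "b \<noteq> 0" using b(2) by auto
  then have "degree b = 0" using b(2) is_unit_iff_degree by blast
  then obtain c where c: "b = [:c:]" by (rule degree_eq_zeroE)
  show ?thesis using that a b c by (simp add: const3_def)
qed

section \<open>Representing maps into projective space by coprime polynomials\<close>

definition par :: "('i \<Rightarrow> 'l::field) \<Rightarrow> ('i \<Rightarrow> 'l) \<Rightarrow> bool" where
  "par u v \<longleftrightarrow> (\<exists>c. u = (\<lambda>i. c * v i))"

lemma par_cross: assumes "par u w" "par v w" shows "u i * v j = u j * v i"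
  using assms by (auto simp: par_def)

lemma par_trans: assumes "par u v" "par v w" shows "par u w"
  using assms by (fastforce simp: par_def mult.assoc[symmetric])

text \<open>The relation admits the factor 0, hence the condition on \<open>u\<close>. The asymmetry
  is wanted: a local formula counts as parallel to the map also at the points where it
  vanishes.\<close>

lemma par_sym: assumes "par u v" "u i \<noteq> 0" shows "par v u"
proof -
  obtain c where c: "u = (\<lambda>i. c * v i)" using assms(1) by (auto simp: par_def)
  then have "v = (\<lambda>i. inverse c * u i)" using assms(2) by auto
  then show ?thesis unfolding par_def by blast
qed

lemma par_sym': assumes "par u v" "u \<noteq> (\<lambda>_. 0)" shows "par v u"
  using assms par_sym by (metis (mono_tags) ext)

text \<open>One local formula is divided by the gcd of its coordinates. Cross-multiplication
  together with gcd 1 forces every other formula for the same map to be a polynomial multiple of the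
  result. Since each point of \<open>E\<close> has a formula that is nonzero there, the result
  vanishes nowhere on \<open>E\<close>.\<close>

lemma projective_map_representation:
  fixes \<kappa> :: "'l::{alg_closed_field, factorial_ring_gcd, semiring_gcd_mult_normalize} \<Rightarrow> 'l \<Rightarrow> 'l \<Rightarrow> 'i \<Rightarrow> 'l"
  assumes fin: "finite B" and supp: "\<And>r s t i. i \<notin> B \<Longrightarrow> \<kappa> r s t i = 0"
    and E: "\<And>r s t. s \<noteq> 0 \<Longrightarrow> t \<noteq> 0 \<Longrightarrow> E r s t"
    and loc: "\<And>r0 s0 t0. E r0 s0 t0 \<Longrightarrow> \<exists>Q::'i \<Rightarrow> 'l poly3. (\<exists>i. ev r0 s0 t0 (Q i) \<noteq> 0) \<and>
       (\<forall>r s t. E r s t \<longrightarrow> par (\<lambda>i. ev r s t (Q i)) (\<kappa> r s t))"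
  obtains G :: "'i \<Rightarrow> 'l poly3" where
    "\<And>r s t. E r s t \<Longrightarrow> (\<exists>i. ev r s t (G i) \<noteq> 0) \<and> par (\<lambda>i. ev r s t (G i)) (\<kappa> r s t)"
    "\<And>Q. (\<And>r s t. E r s t \<Longrightarrow> par (\<lambda>i. ev r s t (Q i)) (\<kappa> r s t)) \<Longrightarrow> \<exists>H. \<forall>i. Q i = H * G i"
proof -
  have cross: "Q i * Q' j = Q j * Q' i"
    if "\<And>r s t. E r s t \<Longrightarrow> par (\<lambda>i. ev r s t (Q i)) (\<kappa> r s t)"
      "\<And>r s t. E r s t \<Longrightarrow> par (\<lambda>i. ev r s t (Q' i)) (\<kappa> r s t)" for Q Q' :: "'i \<Rightarrow> 'l poly3" and i j
  proof -
    have "Q i * Q' j - Q j * Q' i = 0"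
      by (rule ev_eq_0) (use par_cross[OF that] E in auto)
    then show ?thesis by simp
  qed
  have supp0: "Q i = 0" if "\<And>r s t. E r s t \<Longrightarrow> par (\<lambda>i. ev r s t (Q i)) (\<kappa> r s t)" "i \<notin> B" for Q :: "'i \<Rightarrow> 'l poly3" and i
  proof (rule ev_eq_0)
    fix r s t :: 'l assume "s \<noteq> 0" "t \<noteq> 0"
    then have "par (\<lambda>i. ev r s t (Q i)) (\<kappa> r s t)" using that(1) E by blast
    then obtain c where "(\<lambda>i. ev r s t (Q i)) = (\<lambda>i. c * \<kappa> r s t i)" unfolding par_def by blast
    then show "ev r s t (Q i) = 0" using supp[OF that(2)] by (metis mult_zero_right)
  qed
  obtain Q0 :: "'i \<Rightarrow> 'l poly3" where Q0: "\<exists>i. ev 1 1 1 (Q0 i) \<noteq> 0"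
    "\<And>r s t. E r s t \<Longrightarrow> par (\<lambda>i. ev r s t (Q0 i)) (\<kappa> r s t)"
    using loc[of 1 1 1] E[of 1 1 1] by auto
  obtain i0 where i0: "Q0 i0 \<noteq> 0" using Q0(1) by (metis ev_simps(4))
  have i0B: "i0 \<in> B" using supp0[OF Q0(2)] i0 by blast
  define D where "D = Gcd (Q0 ` B)"
  have D0: "D \<noteq> 0" using i0 i0B by (auto simp: D_def)
  define G where "G i = Q0 i div D" for i
  have QG: "Q0 i = D * G i" for i
  proof (cases "i \<in> B")
    case True then show ?thesis by (simp add: G_def D_def Gcd_dvd)
  next
    case False then show ?thesis using supp0[OF Q0(2) False] by (simp add: G_def)
  qed
  have gcdG: "Gcd (G ` B) = 1"
  proof -
    have "Q0 ` B = (\<lambda>x. D * x) ` G ` B" unfolding image_image by (rule image_cong[OF refl QG])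
    then have "Gcd (Q0 ` B) = normalize (D * Gcd (G ` B))" by (simp only: Gcd_mult)
    then have "normalize D * 1 = normalize D * normalize (Gcd (G ` B))"
      by (simp add: D_def normalize_mult)
    then show ?thesis using D0 by (simp only: mult_cancel_left) simp
  qed
  have G0: "G i0 \<noteq> 0" using i0 QG[of i0] by auto
  have uniq: "\<exists>H. \<forall>i. Q i = H * G i" if Q: "\<And>r s t. E r s t \<Longrightarrow> par (\<lambda>i. ev r s t (Q i)) (\<kappa> r s t)" for Q
  proof -
    have crossG: "Q i * G j = Q j * G i" for i j
      using cross[OF Q Q0(2), of i j] D0 by (simp add: QG mult.left_commute)
    have "G i0 dvd Gcd ((\<lambda>x. Q i0 * x) ` G ` B)"
    proof (rule Gcd_greatest)
      fix x assume "x \<in> (\<lambda>x. Q i0 * x) ` G ` B"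
      then obtain i where "x = Q i0 * G i" by blast
      then show "G i0 dvd x" using crossG[of i0 i] by simp
    qed
    then have "G i0 dvd Q i0" by (simp only: Gcd_mult gcdG) simp
    then obtain H where H: "Q i0 = G i0 * H" by blast
    have "Q i = H * G i" for i
    proof -
      have "G i0 * Q i = G i0 * (H * G i)" using crossG[of i i0] H by (simp add: mult_ac)
      then show ?thesis using G0 by simp
    qed
    then show ?thesis by blast
  qed
  have "(\<exists>i. ev r s t (G i) \<noteq> 0) \<and> par (\<lambda>i. ev r s t (G i)) (\<kappa> r s t)" if rst: "E r s t" for r s t
  proof -
    obtain Q :: "'i \<Rightarrow> 'l poly3" where Q: "\<exists>i. ev r s t (Q i) \<noteq> 0"
      "\<And>r s t. E r s t \<Longrightarrow> par (\<lambda>i. ev r s t (Q i)) (\<kappa> r s t)"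
      using loc[OF rst] by blast
    obtain H where H: "\<And>i. Q i = H * G i" using uniq[OF Q(2)] by blast
    obtain i where i: "ev r s t (Q i) \<noteq> 0" using Q(1) by blast
    then have H0: "ev r s t H \<noteq> 0" and Gi: "ev r s t (G i) \<noteq> 0" by (auto simp: H)
    have "(\<lambda>i. ev r s t (G i)) = (\<lambda>i. inverse (ev r s t H) * ev r s t (Q i))" using H0 by (simp add: H flip: mult.assoc)
    then have "par (\<lambda>i. ev r s t (G i)) (\<lambda>i. ev r s t (Q i))" unfolding par_def by blast
    then show ?thesis using par_trans Q(2)[OF rst] Gi by blast
  qed
  then show ?thesis using uniq that by blast
qed

text \<open>By uniqueness of the coprime representation, a representation of a map that is invariant under a weighted
  action of the multiplicative group changes by a unit, i.e. by a constant, under this action.\<close>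

lemma weighted_homogeneous:
  fixes G :: "'i \<Rightarrow> 'l::{alg_closed_field, factorial_ring_gcd, semiring_gcd_mult_normalize} poly3"
  assumes G: "\<And>r s t. E r s t \<Longrightarrow> (\<exists>i. ev r s t (G i) \<noteq> 0) \<and> par (\<lambda>i. ev r s t (G i)) (\<kappa> r s t)"
    "\<And>Q. (\<And>r s t. E r s t \<Longrightarrow> par (\<lambda>i. ev r s t (Q i)) (\<kappa> r s t)) \<Longrightarrow> \<exists>H. \<forall>i. Q i = H * G i"
    and E: "\<And>l r s t. l \<noteq> 0 \<Longrightarrow> E r s t \<Longrightarrow> E (l ^ d * r) (l * s) (l * t)" "E 0 0 1"
    and \<kappa>: "\<And>l r s t. l \<noteq> 0 \<Longrightarrow> E r s t \<Longrightarrow> par (\<kappa> (l ^ d * r) (l * s) (l * t)) (\<kappa> r s t)"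
  shows "\<exists>M. \<forall>l r s t i. l \<noteq> 0 \<longrightarrow> ev (l ^ d * r) (l * s) (l * t) (G i) = l ^ M * ev r s t (G i)"
proof -
  have "\<exists>H. \<forall>r s t i. ev (l ^ d * r) (l * s) (l * t) (G i) = ev r s t H * ev r s t (G i)" if l: "l \<noteq> 0" for l
  proof -
    have "\<forall>i. \<exists>Q. \<forall>r s t. ev r s t Q = ev (l ^ d * r) (l * s) (l * t) (G i)"
      using subst3[of "const3 (l ^ d) * X1" "const3 l * X2" "const3 l * X3"] by simp
    then obtain Q where Q: "\<And>i r s t. ev r s t (Q i) = ev (l ^ d * r) (l * s) (l * t) (G i)" by metis
    have "par (\<lambda>i. ev r s t (Q i)) (\<kappa> r s t)" if "E r s t" for r s t
      unfolding Q using G(1)[OF E(1)[OF l that]] \<kappa>[OF l that] par_trans by blast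
    then obtain H where "\<forall>i. Q i = H * G i" using G(2)[of Q] by blast
    then show ?thesis using Q by (metis ev_simps(2))
  qed
  then obtain H where H: "\<And>l r s t i. l \<noteq> 0 \<Longrightarrow> ev (l ^ d * r) (l * s) (l * t) (G i) = ev r s t (H l) * ev r s t (G i)"
    by metis
  obtain i0 where i0: "ev 0 0 1 (G i0) \<noteq> 0" using G(1)[OF E(2)] by blast
  \<comment> \<open>Scaling by l and then by 1/l is the identity, so the factor \<open>H l\<close>
    has a polynomial inverse.\<close>
  have const: "\<exists>c. H l = const3 c" if l: "l \<noteq> 0" for l
  proof -
    obtain H' where H': "\<And>r s t. ev r s t H' = ev (l ^ d * r) (l * s) (l * t) (H (inverse l))"
      using subst3[of "const3 (l ^ d) * X1" "const3 l * X2" "const3 l * X3" "H (inverse l)"] by auto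
    have "(H' * H l - 1) * G i0 = 0"
    proof (rule ev_eq_0)
      fix r s t :: 'l
      have "ev r s t (G i0) = ev (inverse l ^ d * (l ^ d * r)) (inverse l * (l * s)) (inverse l * (l * t)) (G i0)"
        using l by (simp add: power_inverse flip: mult.assoc)
      also have "\<dots> = ev (l ^ d * r) (l * s) (l * t) (H (inverse l)) * ev (l ^ d * r) (l * s) (l * t) (G i0)"
        by (rule H) (use l in simp)
      also have "\<dots> = ev r s t H' * ev r s t (H l) * ev r s t (G i0)" using H[OF l] H' by simp
      finally show "ev r s t ((H' * H l - 1) * G i0) = 0" by (simp add: algebra_simps)
    qed
    moreover have "G i0 \<noteq> 0" using i0 by auto
    ultimately have "1 = H l * H'" by (simp add: mult.commute)
    then have "H l dvd 1" by (rule dvdI)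
    then show ?thesis using is_unit_poly3 by blast
  qed
  define \<mu> where "\<mu> l = ev 0 0 1 (H l)" for l
  have Hmu: "ev (l ^ d * r) (l * s) (l * t) (G i) = \<mu> l * ev r s t (G i)" if "l \<noteq> 0" for l r s t i
  proof -
    have "\<exists>c. H l = const3 c" by (rule const[OF that])
    then show ?thesis using H[OF that, of r s t i] by (auto simp: \<mu>_def)
  qed
  obtain q where q: "\<And>x. poly q x = ev 0 0 x (G i0)"
    using subst1[of 0 0 "[:0,1:]" "G i0"] by auto
  \<comment> \<open>Along the points (0, 0, x) the constant \<open>\<mu> x\<close> becomes a
    polynomial in x that is nonzero for x \<noteq> 0 and equals 1 at x = 1, so it is a power of
    x.\<close>
  define q' where "q' = smult (inverse (ev 0 0 1 (G i0))) q"
  have q': "poly q' x = \<mu> x" if "x \<noteq> 0" for x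
    using Hmu[OF that, of 0 0 1 i0] i0 by (simp add: q'_def q)
  have "\<mu> l \<noteq> 0" if "l \<noteq> 0" for l
  proof -
    have "\<exists>i. ev 0 0 l (G i) \<noteq> 0" using G(1)[OF E(1)[OF that E(2)]] by simp
    then show ?thesis using Hmu[OF that, of 0 0 1] by auto
  qed
  then have "poly q' x \<noteq> 0" if "x \<noteq> 0" for x using q' that by simp
  moreover have "poly q' 1 = 1" using i0 by (simp add: q'_def q)
  ultimately obtain M where M: "q' = monom 1 M" using poly_only_root_0 by blast
  have "\<mu> l = l ^ M" if "l \<noteq> 0" for l using q'[OF that] by (simp add: M poly_monom)
  then show ?thesis using Hmu by (metis (no_types, lifting))
qed

text \<open>Here \<open>G\<close> represents the identity of the line through x and y. By Cramer's
  rule \<open>W1\<close> and \<open>W2\<close> are, up to a common factor, its coordinates on that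
  line. \<open>W1\<close> at (1, z) and \<open>W2\<close> at (z, 1) have no zeros, hence are
  constants c1 and c2, and the ratio of coordinates at (s, 1) yields s^M c1 = s c2.\<close>

lemma degree_one:
  fixes G :: "'i \<Rightarrow> 'l::alg_closed_field poly3"
  assumes G: "\<And>s t. s \<noteq> 0 \<or> t \<noteq> 0 \<Longrightarrow> (\<exists>i. ev 0 s t (G i) \<noteq> 0) \<and> par (\<lambda>i. ev 0 s t (G i)) (\<lambda>i. s * x i + t * y i)"
    and h: "\<And>l s t i. l \<noteq> 0 \<Longrightarrow> ev 0 (l * s) (l * t) (G i) = l ^ M * ev 0 s t (G i)"
    and ij: "x i * y j \<noteq> x j * y i"
  shows "M = 1"
proof -
  define W1 where "W1 = G i * const3 (y j) - G j * const3 (y i)"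
  define W2 where "W2 = G j * const3 (x i) - G i * const3 (x j)"
  define \<delta> where "\<delta> = x i * y j - x j * y i"
  have \<delta>: "\<delta> \<noteq> 0" using ij by (simp add: \<delta>_def)
  have W: "\<exists>c. c \<noteq> 0 \<and> ev 0 s t W1 = c * s \<and> ev 0 s t W2 = c * t" if st: "s \<noteq> 0 \<or> t \<noteq> 0" for s t
  proof -
    obtain c where c: "\<And>i. ev 0 s t (G i) = c * (s * x i + t * y i)" using G[OF st] by (auto simp: par_def fun_eq_iff)
    then have "c \<noteq> 0" using G[OF st] by auto
    then show ?thesis by (intro exI[of _ "c * \<delta>"]) (use \<delta> in \<open>simp add: W1_def W2_def c, simp add: \<delta>_def algebra_simps\<close>)
  qed
  have hW: "ev 0 (l * s) (l * t) W1 = l ^ M * ev 0 s t W1" "ev 0 (l * s) (l * t) W2 = l ^ M * ev 0 s t W2" if "l \<noteq> 0" for l s t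
    by (simp_all add: W1_def W2_def h[OF that] algebra_simps)
  obtain q1 where q1: "\<And>z. poly q1 z = ev 0 1 z W1" using subst1[of 0 1 "[:0,1:]" W1] by auto
  obtain q2 where q2: "\<And>z. poly q2 z = ev 0 z 1 W2" using subst1[of 0 "[:0,1:]" 1 W2] by auto
  have "poly q1 z \<noteq> 0" for z using W[of 1 z] q1 by auto
  then obtain c1 where c1: "c1 \<noteq> 0" "q1 = [:c1:]" using poly_no_root_const by metis
  have "poly q2 z \<noteq> 0" for z using W[of z 1] q2 by auto
  then obtain c2 where c2: "c2 \<noteq> 0" "q2 = [:c2:]" using poly_no_root_const by metis
  have "s ^ M * c1 = s * c2" if s: "s \<noteq> 0" for s
  proof -
    have 1: "ev 0 s 1 W1 = s ^ M * c1" using hW(1)[OF s, of 1 "inverse s"] q1[of "inverse s"] c1 s by simp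
    have 2: "ev 0 s 1 W2 = c2" using q2[of s] c2 by simp
    obtain c where "ev 0 s 1 W1 = c * s" "ev 0 s 1 W2 = c" using W[of s 1] by auto
    then show ?thesis using 1 2 by simp
  qed
  then have "monom c1 M = monom c2 1" by (intro poly_eq_nonzero) (simp add: poly_monom mult.commute)
  then have "degree (monom c1 M) = degree (monom c2 1)" by simp
  then show ?thesis using c1(1) c2(1) by (simp add: degree_monom_eq)
qed

inductive polyfun :: "(('i \<Rightarrow> 'l::comm_ring_1) \<Rightarrow> 'l) \<Rightarrow> bool" where
  const: "polyfun (\<lambda>_. c)"
| coord: "polyfun (\<lambda>v. v i)"
| add: "polyfun F \<Longrightarrow> polyfun F' \<Longrightarrow> polyfun (\<lambda>v. F v + F' v)"
| mult: "polyfun F \<Longrightarrow> polyfun F' \<Longrightarrow> polyfun (\<lambda>v. F v * F' v)"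

lemma polyfun_ev: "polyfun N \<Longrightarrow> \<exists>P. \<forall>r s t. ev r s t P = N (\<lambda>i. ev r s t (c i))"
proof (induction rule: polyfun.induct)
  case (const z) show ?case by (rule exI[of _ "const3 z"]) simp
next
  case (coord i) show ?case by (rule exI[of _ "c i"]) simp
next
  case (add F F') then show ?case by (metis ev_simps(1))
next
  case (mult F F') then show ?case by (metis ev_simps(2))
qed

text \<open>A map of the projective space of \<open>V\<close> to itself that is Zariski locally given by polynomials, represented by
  a map on the nonzero vectors.\<close>

definition regular_map :: "('i \<Rightarrow> 'l::field) set \<Rightarrow> (('i \<Rightarrow> 'l) \<Rightarrow> 'i \<Rightarrow> 'l) \<Rightarrow> bool" where
  "regular_map V h \<longleftrightarrow> (\<forall>x\<in>V - {0}. h x \<in> V - {0}) \<and> (\<forall>x\<in>V - {0}. \<forall>c. c \<noteq> 0 \<longrightarrow> par (h (\<lambda>i. c * x i)) (h x)) \<and>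
     (\<forall>x0\<in>V - {0}. \<exists>N. (\<forall>i. polyfun (N i)) \<and> (\<exists>i. N i x0 \<noteq> 0) \<and> (\<forall>x\<in>V - {0}. par (\<lambda>i. N i x) (h x)))"

lemma regular_map_representation:
  fixes h :: "('i \<Rightarrow> 'l::{alg_closed_field, factorial_ring_gcd, semiring_gcd_mult_normalize}) \<Rightarrow> 'i \<Rightarrow> 'l"
    and c :: "'i \<Rightarrow> 'l poly3"
  assumes fin: "finite B" and V: "\<And>x i. x \<in> V \<Longrightarrow> i \<notin> B \<Longrightarrow> x i = 0"
    and h: "regular_map V h"
    and E: "\<And>r s t. s \<noteq> 0 \<Longrightarrow> t \<noteq> 0 \<Longrightarrow> E r s t" "\<And>l r s t. l \<noteq> 0 \<Longrightarrow> E r s t \<Longrightarrow> E (l ^ d * r) (l * s) (l * t)" "E 0 0 1"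
    and c: "\<And>r s t. E r s t \<Longrightarrow> (\<lambda>i. ev r s t (c i)) \<in> V - {0}"
    and chom: "\<And>l r s t i. l \<noteq> 0 \<Longrightarrow> ev (l ^ d * r) (l * s) (l * t) (c i) = l ^ e * ev r s t (c i)"
  obtains G M where
    "\<And>r s t. E r s t \<Longrightarrow> (\<exists>i. ev r s t (G i) \<noteq> 0) \<and> par (\<lambda>i. ev r s t (G i)) (h (\<lambda>i. ev r s t (c i)))"
    "\<And>l r s t i. l \<noteq> 0 \<Longrightarrow> ev (l ^ d * r) (l * s) (l * t) (G i) = l ^ M * ev r s t (G i)"
proof -
  \<comment> \<open>Extended by 0 outside \<open>E\<close>, where the vector of coordinates may
    leave the domain of \<open>h\<close>, so that the support condition holds at all
    parameters.\<close>
  define \<kappa> where "\<kappa> r s t = (if E r s t then h (\<lambda>i. ev r s t (c i)) else 0)" for r s t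
  have supp: "\<kappa> r s t i = 0" if "i \<notin> B" for r s t i
    using V[OF _ that] c h unfolding \<kappa>_def regular_map_def by auto
  have loc: "\<exists>Q. (\<exists>i. ev r0 s0 t0 (Q i) \<noteq> 0) \<and> (\<forall>r s t. E r s t \<longrightarrow> par (\<lambda>i. ev r s t (Q i)) (\<kappa> r s t))"
    if pt: "E r0 s0 t0" for r0 s0 t0
  proof -
    obtain N where N: "\<forall>i. polyfun (N i)" "\<exists>i. N i (\<lambda>i. ev r0 s0 t0 (c i)) \<noteq> 0"
      "\<forall>x\<in>V - {0}. par (\<lambda>i. N i x) (h x)"
      using h c[OF pt] unfolding regular_map_def by blast
    have "\<forall>i. \<exists>P. \<forall>r s t. ev r s t P = N i (\<lambda>i. ev r s t (c i))" using polyfun_ev N(1) by blast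
    then obtain Q where Q: "\<And>i r s t. ev r s t (Q i) = N i (\<lambda>i. ev r s t (c i))" by metis
    have "par (\<lambda>i. ev r s t (Q i)) (\<kappa> r s t)" if "E r s t" for r s t
      using N(3) c[OF that] that by (simp add: Q \<kappa>_def)
    then show ?thesis using N(2) Q by metis
  qed
  obtain G :: "'i \<Rightarrow> 'l poly3" where G: "\<And>r s t. E r s t \<Longrightarrow> (\<exists>i. ev r s t (G i) \<noteq> 0) \<and> par (\<lambda>i. ev r s t (G i)) (\<kappa> r s t)"
    "\<And>Q. (\<And>r s t. E r s t \<Longrightarrow> par (\<lambda>i. ev r s t (Q i)) (\<kappa> r s t)) \<Longrightarrow> \<exists>H. \<forall>i. Q i = H * G i"
    using projective_map_representation[where B = B and \<kappa> = \<kappa> and E = E, OF fin supp E(1) loc] by metis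
  have inv: "par (\<kappa> (l ^ d * r) (l * s) (l * t)) (\<kappa> r s t)" if "l \<noteq> 0" "E r s t" for l r s t
    using h c[OF that(2)] that E(2)[OF that] unfolding regular_map_def by (simp add: \<kappa>_def chom)
  obtain M where M: "\<And>l r s t i. l \<noteq> 0 \<Longrightarrow> ev (l ^ d * r) (l * s) (l * t) (G i) = l ^ M * ev r s t (G i)"
    using weighted_homogeneous[where E = E and \<kappa> = \<kappa> and d = d, OF G E(2,3) inv] by blast
  have "(\<exists>i. ev r s t (G i) \<noteq> 0) \<and> par (\<lambda>i. ev r s t (G i)) (h (\<lambda>i. ev r s t (c i)))" if "E r s t" for r s t
    using G(1)[OF that] that by (simp add: \<kappa>_def)
  then show ?thesis using M that by blast
qed

text \<open>The convention 0^0 = 1 keeps the case d = 0, in which the polynomial is constant along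
  the ray up to and including the origin.\<close>

lemma ev_homogeneous_zero:
  fixes P :: "'l::alg_closed_field poly3"
  assumes "\<And>l. l \<noteq> 0 \<Longrightarrow> ev (l * r) (l * s) (l * t) P = l ^ d * ev r s t P"
  shows "ev 0 0 0 P = 0 ^ d * ev r s t P"
proof -
  obtain q where q: "\<And>l. poly q l = ev (l * r) (l * s) (l * t) P"
    using subst1[of "[:0, r:]" "[:0, s:]" "[:0, t:]" P] by auto
  have "q = monom (ev r s t P) d"
    by (rule poly_eq_nonzero) (simp add: q assms poly_monom mult.commute)
  then show ?thesis using q[of 0] by (simp add: poly_monom mult.commute)
qed

lemma not_par_minor:
  assumes "\<not> par y x" "x \<noteq> 0"
  obtains i j where "x i * y j \<noteq> x j * y i"
proof -
  obtain i where i: "x i \<noteq> 0" using assms(2) by (auto simp: fun_eq_iff)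
  have "\<exists>j. x i * y j \<noteq> x j * y i"
  proof (rule ccontr)
    assume "\<nexists>j. x i * y j \<noteq> x j * y i"
    then have "y j = (y i / x i) * x j" for j using i by (simp add: field_simps)
    then have "par y x" unfolding par_def by (intro exI[of _ "y i / x i"]) blast
    then show False using assms(1) by blast
  qed
  then show ?thesis using that by blast
qed

section \<open>The linear lift of an automorphism of projective space\<close>

locale projective_automorphism =
  fixes V :: "('i \<Rightarrow> 'l::{alg_closed_field, factorial_ring_gcd, semiring_gcd_mult_normalize}) set"
    and B :: "'i set" and h k :: "('i \<Rightarrow> 'l) \<Rightarrow> 'i \<Rightarrow> 'l"
  assumes fin: "finite B" and supp: "\<And>x i. x \<in> V \<Longrightarrow> i \<notin> B \<Longrightarrow> x i = 0"
    and V0: "0 \<in> V" and V_add: "\<And>x y. x \<in> V \<Longrightarrow> y \<in> V \<Longrightarrow> (\<lambda>i. x i + y i) \<in> V"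
    and V_scale: "\<And>c x. x \<in> V \<Longrightarrow> (\<lambda>i. c * x i) \<in> V"
    and h: "regular_map V h" and k: "regular_map V k"
    and kh: "\<And>x. x \<in> V \<Longrightarrow> x \<noteq> 0 \<Longrightarrow> par (k (h x)) x"
    and hk: "\<And>x. x \<in> V \<Longrightarrow> x \<noteq> 0 \<Longrightarrow> par (h (k x)) x"
begin

definition lin2 :: "'l \<Rightarrow> 'l \<Rightarrow> ('i \<Rightarrow> 'l) \<Rightarrow> ('i \<Rightarrow> 'l) \<Rightarrow> 'i \<Rightarrow> 'l" where
  "lin2 s t x y = (\<lambda>i. s * x i + t * y i)"

definition lin3 :: "'l \<Rightarrow> 'l \<Rightarrow> 'l \<Rightarrow> ('i \<Rightarrow> 'l) \<Rightarrow> ('i \<Rightarrow> 'l) \<Rightarrow> ('i \<Rightarrow> 'l) \<Rightarrow> 'i \<Rightarrow> 'l" where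
  "lin3 r s t z x y = (\<lambda>i. r * z i + s * x i + t * y i)"

lemma lin2_V: "x \<in> V \<Longrightarrow> y \<in> V \<Longrightarrow> lin2 s t x y \<in> V"
  unfolding lin2_def by (rule V_add[OF V_scale V_scale])

lemma lin3_V: "z \<in> V \<Longrightarrow> x \<in> V \<Longrightarrow> y \<in> V \<Longrightarrow> lin3 r s t z x y \<in> V"
  unfolding lin3_def by (rule V_add[OF V_add[OF V_scale V_scale] V_scale])

lemma lin2_nonzero:
  assumes "\<not> par y x" "x \<noteq> 0" "s \<noteq> 0 \<or> t \<noteq> 0" shows "lin2 s t x y \<noteq> 0"
proof
  assume z: "lin2 s t x y = 0"
  obtain i j where ij: "x i * y j \<noteq> x j * y i" using not_par_minor assms(1,2) by blast
  have "s * x i + t * y i = 0" "s * x j + t * y j = 0" using z by (auto simp: lin2_def fun_eq_iff)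
  then have "(s * x i + t * y i) * y j - (s * x j + t * y j) * y i = 0"
    "x i * (s * x j + t * y j) - x j * (s * x i + t * y i) = 0" by simp_all
  then have "s * (x i * y j - x j * y i) = 0" "t * (x i * y j - x j * y i) = 0"
    by (simp_all add: algebra_simps)
  then show False using ij assms(3) by auto
qed

lemma representation_exists:
  assumes "regular_map V g"
    and "\<And>r s t. s \<noteq> 0 \<Longrightarrow> t \<noteq> 0 \<Longrightarrow> E r s t" "\<And>l r s t. l \<noteq> 0 \<Longrightarrow> E r s t \<Longrightarrow> E (l ^ d * r) (l * s) (l * t)" "E 0 0 1"
    and "\<And>r s t. E r s t \<Longrightarrow> (\<lambda>i. ev r s t (c i)) \<in> V - {0}"
    and "\<And>l r s t i. l \<noteq> 0 \<Longrightarrow> ev (l ^ d * r) (l * s) (l * t) (c i) = l ^ e * ev r s t (c i)"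
  shows "\<exists>G M. (\<forall>r s t. E r s t \<longrightarrow> (\<exists>i. ev r s t (G i) \<noteq> 0) \<and> par (\<lambda>i. ev r s t (G i)) (g (\<lambda>i. ev r s t (c i)))) \<and>
    (\<forall>l r s t i. l \<noteq> 0 \<longrightarrow> ev (l ^ d * r) (l * s) (l * t) (G i) = l ^ M * ev r s t (G i))"
proof (rule regular_map_representation[where B = B and V = V and h = g and c = c and E = E and d = d and e = e])
  fix G :: "'i \<Rightarrow> 'l poly3" and M
  assume "\<And>r s t. E r s t \<Longrightarrow> (\<exists>i. ev r s t (G i) \<noteq> 0) \<and> par (\<lambda>i. ev r s t (G i)) (g (\<lambda>i. ev r s t (c i)))"
    "\<And>l r s t i. l \<noteq> 0 \<Longrightarrow> ev (l ^ d * r) (l * s) (l * t) (G i) = l ^ M * ev r s t (G i)"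
  then show ?thesis by blast
qed (fact fin supp assms)+

lemma h_V: "x \<in> V \<Longrightarrow> x \<noteq> 0 \<Longrightarrow> h x \<in> V" "x \<in> V \<Longrightarrow> x \<noteq> 0 \<Longrightarrow> h x \<noteq> 0"
  using h by (auto simp: regular_map_def)

lemma k_par: assumes "x \<in> V" "x \<noteq> 0" "y \<noteq> 0" "par y x" shows "par (k y) (k x)"
proof -
  obtain c where c: "y = (\<lambda>i. c * x i)" using assms(4) by (auto simp: par_def)
  then have "c \<noteq> 0" using assms(3) by auto
  then show ?thesis using k assms(1,2) c by (auto simp: regular_map_def)
qed

lemma h_inj: assumes "x \<in> V" "y \<in> V" "x \<noteq> 0" "y \<noteq> 0" "par (h x) (h y)" shows "par x y"
proof -
  have "par (k (h x)) (k (h y))" by (rule k_par) (use assms h_V in auto)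
  moreover have "k (h x) \<noteq> 0" using k h_V assms by (auto simp: regular_map_def)
  moreover have "par x (k (h x))" 
    using par_sym'[OF kh[OF assms(1,3)]] \<open>k (h x) \<noteq> 0\<close> by (simp add: zero_fun_def)
  ultimately show ?thesis using par_trans kh[OF assms(2,4)] by blast
qed

text \<open>The degree d of the formula \<open>F\<close> for h is found with the help of the inverse
  k. Form the cone with vertex h z over the image of the line through x and y: its points r h(z) +
  F(0, s, t) are homogeneous if r has weight d. Pulled back along this cone, k has a formula of some
  weighted degree M. On the base line k undoes h, which gives M = 1; on the ray through the vertex
  only r varies, with weight d, which makes d a divisor of M.\<close>

lemma map_on_plane:
  assumes x: "x \<in> V" "x \<noteq> 0" and y: "y \<in> V" "\<not> par y x" and z: "z \<in> V" "\<And>s t. z \<noteq> lin2 s t x y"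
  shows "\<exists>a b c. \<forall>r s t. r \<noteq> 0 \<or> s \<noteq> 0 \<or> t \<noteq> 0 \<longrightarrow>
     par (lin3 r s t a b c) (h (lin3 r s t z x y)) \<and> lin3 r s t a b c \<noteq> 0"
proof -
  define E where "E r s t \<longleftrightarrow> r \<noteq> 0 \<or> s \<noteq> 0 \<or> t \<noteq> 0" for r s t :: 'l
  define c where "c i = const3 (z i) * X1 + const3 (x i) * X2 + const3 (y i) * X3" for i
  have evc: "(\<lambda>i. ev r s t (c i)) = lin3 r s t z x y" for r s t
    by (simp add: c_def lin3_def mult.commute)
  have lin3_0: "lin3 0 s t z x y = lin2 s t x y" for s t by (simp add: lin3_def lin2_def)
  have nz: "lin3 r s t z x y \<noteq> 0" if "E r s t" for r s t
  proof (cases "r = 0")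
    case True
    then show ?thesis using lin2_nonzero[OF y(2) x(2), of s t] that lin3_0 by (simp add: E_def)
  next
    case False
    show ?thesis
    proof
      assume "lin3 r s t z x y = 0"
      then have "r * z i + s * x i + t * y i = 0" for i
        by (simp only: lin3_def fun_eq_iff zero_fun_def)
      then have "r * z i = - (s * x i + t * y i)" for i
        by (simp only: eq_neg_iff_add_eq_0 add.assoc)
      then have "z i = (- s / r) * x i + (- t / r) * y i" for i
        using False by (simp add: field_simps)
      then have "z = lin2 (- s / r) (- t / r) x y" by (auto simp: lin2_def)
      then show False using z(2) by blast
    qed
  qed
  have E1: "E r s t" if "s \<noteq> 0" "t \<noteq> 0" for r s t using that by (simp add: E_def)
  have E2: "E (l ^ d * r) (l * s) (l * t)" if "l \<noteq> 0" "E r s t" for l r s t d using that by (auto simp: E_def)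
  have E3: "E 0 0 1" by (simp add: E_def)
  have cV: "(\<lambda>i. ev r s t (c i)) \<in> V - {0}" if "E r s t" for r s t
    using nz[OF that] lin3_V z(1) x(1) y(1) by (simp add: evc)
  have ch: "ev (l ^ 1 * r) (l * s) (l * t) (c i) = l ^ 1 * ev r s t (c i)" if "l \<noteq> 0" for l r s t i
    by (simp add: c_def algebra_simps)
  obtain F d where F0: "\<forall>r s t. E r s t \<longrightarrow> (\<exists>i. ev r s t (F i) \<noteq> 0) \<and> par (\<lambda>i. ev r s t (F i)) (h (\<lambda>i. ev r s t (c i)))"
    "\<forall>l r s t i. l \<noteq> 0 \<longrightarrow> ev (l ^ 1 * r) (l * s) (l * t) (F i) = l ^ d * ev r s t (F i)"
  proof -
    have "\<exists>F d. (\<forall>r s t. E r s t \<longrightarrow> (\<exists>i. ev r s t (F i) \<noteq> 0) \<and> par (\<lambda>i. ev r s t (F i)) (h (\<lambda>i. ev r s t (c i)))) \<and>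
      (\<forall>l r s t i. l \<noteq> 0 \<longrightarrow> ev (l ^ 1 * r) (l * s) (l * t) (F i) = l ^ d * ev r s t (F i))"
      by (rule representation_exists[where g = h and c = c and E = E and d = 1 and e = 1]) (fact h E1 E2 E3 cV ch)+
    then show thesis using that by blast
  qed
  have F: "\<And>r s t. E r s t \<Longrightarrow> (\<exists>i. ev r s t (F i) \<noteq> 0) \<and> par (\<lambda>i. ev r s t (F i)) (h (lin3 r s t z x y))"
    "\<And>l r s t i. l \<noteq> 0 \<Longrightarrow> ev (l ^ 1 * r) (l * s) (l * t) (F i) = l ^ d * ev r s t (F i)"
    using F0 unfolding evc by blast+
  have F0: "ev 0 0 0 (F i) = 0 ^ d * ev r s t (F i)" for r s t i
    by (rule ev_homogeneous_zero) (use F(2) in simp)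
  \<comment> \<open>If d were 0, \<open>F\<close> would take the same value at (0, 1, 0) and (0, 0,
    1), and h would identify the points x and y.\<close>
  have Fzero: "ev 0 0 0 (F i) = 0" for i
  proof (cases "d = 0")
    case False then show ?thesis using F0[of i 0 0 0] by (cases d) simp_all
  next
    case True
    then have "ev 0 1 0 (F i) = ev 0 0 1 (F i)" for i using F0[of i 0 1 0] F0[of i 0 0 1] by simp
    then have *: "par (\<lambda>i. ev 0 0 1 (F i)) (h x)" "par (\<lambda>i. ev 0 0 1 (F i)) (h y)"
      using F(1)[of 0 1 0] F(1)[of 0 0 1] by (simp_all add: E_def lin3_def)
    obtain i where "ev 0 0 1 (F i) \<noteq> 0" using F(1)[OF E3] by blast
    then have "par (h y) (h x)" using par_trans par_sym * by (metis (mono_tags, lifting))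
    moreover have "y \<noteq> 0" using y(2) unfolding par_def by (metis mult_zero_left zero_fun_def)
    ultimately show ?thesis using h_inj[OF y(1) x(1)] x y by blast
  qed
  have FV: "(\<lambda>i. ev r s t (F i)) \<in> V" if "E r s t" for r s t
    using F(1)[OF that] V_scale h_V(1)[of "lin3 r s t z x y"] nz[OF that] lin3_V z(1) x(1) y(1)
    by (auto simp: par_def)
  have "\<forall>i. \<exists>P. \<forall>r s t. ev r s t P = ev 0 s t (F i)"
  proof
    fix i show "\<exists>P. \<forall>r s t. ev r s t P = ev 0 s t (F i)" using subst3[of 0 X2 X3 "F i"] by simp
  qed
  then obtain F' where F': "\<And>i r s t. ev r s t (F' i) = ev 0 s t (F i)" by metis
  have z0: "z \<noteq> 0" using z(2)[of 0 0] by (auto simp: lin2_def fun_eq_iff)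
  \<comment> \<open>The cone with vertex \<open>h z\<close>. It avoids the zero vector because h is
    injective on projective points and z lies outside the span of x and y.\<close>
  define c' where "c' i = const3 (h z i) * X1 + F' i" for i
  have c'V: "(\<lambda>i. ev r s t (c' i)) \<in> V - {0}" if e: "E r s t" for r s t
  proof -
    have hz: "(\<lambda>i. r * h z i) \<in> V" using V_scale h_V z(1) z0 by blast
    have ev': "(\<lambda>i. ev r s t (c' i)) = (\<lambda>i. r * h z i + ev 0 s t (F i))" by (simp add: c'_def F' mult.commute)
    show ?thesis
    proof (cases "s = 0 \<and> t = 0")
      case True
      have "h z \<noteq> 0" using h_V z(1) z0 by blast
      then show ?thesis using hz e True unfolding ev' by (auto simp: Fzero E_def fun_eq_iff)
    next
      case False
      then have e0: "E 0 s t" by (simp add: E_def)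
      have "(\<lambda>i. ev r s t (c' i)) \<in> V" unfolding ev' using V_add[OF hz FV[OF e0]] by simp
      moreover have "(\<lambda>i. r * h z i + ev 0 s t (F i)) \<noteq> (\<lambda>_. 0)"
      proof
        assume "(\<lambda>i. r * h z i + ev 0 s t (F i)) = (\<lambda>_. 0)"
        then have eq: "r * h z i + ev 0 s t (F i) = 0" for i by (simp add: fun_eq_iff)
        obtain i where i: "ev 0 s t (F i) \<noteq> 0" using F(1)[OF e0] by blast
        have r: "r \<noteq> 0" using eq[of i] i by auto
        have "h z = (\<lambda>i. (- 1 / r) * ev 0 s t (F i))"
        proof
          fix i
          have "r * h z i = - ev 0 s t (F i)" using eq[of i] by (simp add: eq_neg_iff_add_eq_0)
          then show "h z i = (- 1 / r) * ev 0 s t (F i)" using r by (simp add: field_simps)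
        qed
        then have "par (h z) (\<lambda>i. ev 0 s t (F i))" unfolding par_def by blast
        then have "par (h z) (h (lin2 s t x y))" using F(1)[OF e0] par_trans lin3_0 by metis
        then have "par z (lin2 s t x y)"
          using h_inj[OF z(1) lin2_V[OF x(1) y(1)] z0 lin2_nonzero[OF y(2) x(2)]] False by blast
        then obtain e where "z = (\<lambda>i. e * lin2 s t x y i)" by (auto simp: par_def)
        then have "z = lin2 (e * s) (e * t) x y" by (simp add: lin2_def algebra_simps)
        then show False using z(2) by blast
      qed
      ultimately show ?thesis by (simp add: ev' zero_fun_def)
    qed
  qed
  have c'h: "ev (l ^ d * r) (l * s) (l * t) (c' i) = l ^ d * ev r s t (c' i)" if "l \<noteq> 0" for l r s t i
    using F(2)[OF that, of 0 s t i] by (simp add: c'_def F' algebra_simps)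
  have "\<exists>G M. (\<forall>r s t. E r s t \<longrightarrow> (\<exists>i. ev r s t (G i) \<noteq> 0) \<and> par (\<lambda>i. ev r s t (G i)) (k (\<lambda>i. ev r s t (c' i)))) \<and>
    (\<forall>l r s t i. l \<noteq> 0 \<longrightarrow> ev (l ^ d * r) (l * s) (l * t) (G i) = l ^ M * ev r s t (G i))"
    by (rule representation_exists[where g = k and c = c' and E = E and d = d and e = d]) (fact k E1 E2 E3 c'V c'h)+
  then obtain G M where G: "\<And>r s t. E r s t \<Longrightarrow> (\<exists>i. ev r s t (G i) \<noteq> 0) \<and> par (\<lambda>i. ev r s t (G i)) (k (\<lambda>i. ev r s t (c' i)))"
    "\<And>l r s t i. l \<noteq> 0 \<Longrightarrow> ev (l ^ d * r) (l * s) (l * t) (G i) = l ^ M * ev r s t (G i)" by blast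
  obtain i j where ij: "x i * y j \<noteq> x j * y i" using not_par_minor y(2) x(2) by blast
  have "M = 1"
  proof (rule degree_one[of G x y, OF _ _ ij])
    fix s t :: 'l assume st: "s \<noteq> 0 \<or> t \<noteq> 0"
    then have e0: "E 0 s t" by (simp add: E_def)
    have V': "lin2 s t x y \<in> V" "lin2 s t x y \<noteq> 0" using lin2_V x y lin2_nonzero st by auto
    have "(\<lambda>i. ev 0 s t (c' i)) = (\<lambda>i. ev 0 s t (F i))" by (simp add: c'_def F')
    then have "par (\<lambda>i. ev 0 s t (c' i)) (h (lin2 s t x y))" using F(1)[OF e0] lin3_0 by simp
    then have "par (k (\<lambda>i. ev 0 s t (c' i))) (k (h (lin2 s t x y)))"
      using k_par[of "h (lin2 s t x y)" "\<lambda>i. ev 0 s t (c' i)"] h_V V' c'V[OF e0] by blast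
    then have "par (k (\<lambda>i. ev 0 s t (c' i))) (lin2 s t x y)" using kh[OF V'] par_trans by blast
    then show "(\<exists>i. ev 0 s t (G i) \<noteq> 0) \<and> par (\<lambda>i. ev 0 s t (G i)) (\<lambda>i. s * x i + t * y i)"
      using G(1)[OF e0] par_trans unfolding lin2_def by blast
  next
    fix l s t :: 'l and i assume "l \<noteq> 0"
    then show "ev 0 (l * s) (l * t) (G i) = l ^ M * ev 0 s t (G i)" using G(2)[of l 0 s t i] by simp
  qed
  have "d = 1"
  proof -
    have "E 1 0 0" by (simp add: E_def)
    then obtain i where i: "ev 1 0 0 (G i) \<noteq> 0" using G(1) by blast
    obtain q where q: "\<And>l. poly q l = ev l 0 0 (G i)" using subst1[of "[:0,1:]" 0 0 "G i"] by auto
    \<comment> \<open>On the ray through the vertex weighted homogeneity reads q(l^d) = l q(1), so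
      the degree of q times d is 1.\<close>
    have "pcompose q (monom 1 d) = [:0, ev 1 0 0 (G i):]"
      by (rule poly_eq_nonzero)
        (use G(2)[of _ 1 0 0 i] in \<open>simp add: poly_pcompose poly_monom q \<open>M = 1\<close> mult.commute\<close>)
    then have "degree (pcompose q (monom 1 d)) = 1" using i by simp
    then have "degree q * d = 1" by (simp add: degree_pcompose degree_monom_eq)
    then show ?thesis by simp
  qed
  then have "ev (l * r) (l * s) (l * t) (F i) = l * ev r s t (F i)" if "l \<noteq> 0" for l r s t i
    using F(2)[OF that, of r s t i] by simp
  then have "\<forall>i. \<exists>a b c. \<forall>r s t. ev r s t (F i) = a * r + b * s + c * t"
    using ev_homogeneous_linear by metis
  then obtain a b c where abc: "\<And>i r s t. ev r s t (F i) = a i * r + b i * s + c i * t" by metis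
  have "(\<lambda>i. ev r s t (F i)) = lin3 r s t a b c" for r s t
    by (simp add: abc lin3_def mult.commute)
  moreover have "(\<lambda>i. ev r s t (F i)) \<noteq> 0" if "E r s t" for r s t
    using F(1)[OF that] by (auto simp: fun_eq_iff)
  ultimately have "par (lin3 r s t a b c) (h (lin3 r s t z x y)) \<and> lin3 r s t a b c \<noteq> 0" if "E r s t" for r s t
    using F(1)[OF that] that by metis
  then show ?thesis unfolding E_def by blast
qed

text \<open>The case in which no third vector is left for a cone. Here h maps the projective line of
  V to itself, so its formula can be written in coordinates \<open>F1\<close>, \<open>F2\<close> and
  inserted into the formula of k. The composite represents the identity and has degree d e, hence
  both degrees are 1.\<close>

lemma map_on_line_spanning:
  assumes x: "x \<in> V" "x \<noteq> 0" and y: "y \<in> V" "\<not> par y x" and span: "\<And>z. z \<in> V \<Longrightarrow> \<exists>s t. z = lin2 s t x y"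
  shows "\<exists>a b. \<forall>s t. s \<noteq> 0 \<or> t \<noteq> 0 \<longrightarrow> par (lin2 s t a b) (h (lin2 s t x y)) \<and> lin2 s t a b \<noteq> 0"
proof -
  define E where "E r s t \<longleftrightarrow> s \<noteq> 0 \<or> t \<noteq> 0" for r s t :: 'l
  define c where "c i = const3 (x i) * X2 + const3 (y i) * X3" for i
  have evc: "(\<lambda>i. ev r s t (c i)) = lin2 s t x y" for r s t
    by (simp add: c_def lin2_def mult.commute)
  have E1: "E r s t" if "s \<noteq> 0" "t \<noteq> 0" for r s t using that by (simp add: E_def)
  have E2: "E (l ^ d * r) (l * s) (l * t)" if "l \<noteq> 0" "E r s t" for l r s t d using that by (auto simp: E_def)
  have E3: "E 0 0 1" by (simp add: E_def)
  have cV: "(\<lambda>i. ev r s t (c i)) \<in> V - {0}" if "E r s t" for r s t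
    using lin2_nonzero[OF y(2) x(2)] that lin2_V x(1) y(1) by (simp add: evc E_def)
  have ch: "ev (l ^ 1 * r) (l * s) (l * t) (c i) = l ^ 1 * ev r s t (c i)" if "l \<noteq> 0" for l r s t i
    by (simp add: c_def algebra_simps)
  have rep: "\<exists>F d. (\<forall>r s t. E r s t \<longrightarrow> (\<exists>i. ev r s t (F i) \<noteq> 0) \<and> par (\<lambda>i. ev r s t (F i)) (g (lin2 s t x y))) \<and>
      (\<forall>l r s t i. l \<noteq> 0 \<longrightarrow> ev (l ^ 1 * r) (l * s) (l * t) (F i) = l ^ d * ev r s t (F i))"
    if g: "regular_map V g" for g
  proof -
    have "\<exists>F d. (\<forall>r s t. E r s t \<longrightarrow> (\<exists>i. ev r s t (F i) \<noteq> 0) \<and> par (\<lambda>i. ev r s t (F i)) (g (\<lambda>i. ev r s t (c i)))) \<and>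
      (\<forall>l r s t i. l \<noteq> 0 \<longrightarrow> ev (l ^ 1 * r) (l * s) (l * t) (F i) = l ^ d * ev r s t (F i))"
      by (rule representation_exists[where g = g and c = c and E = E and d = 1 and e = 1]) (fact g E1 E2 E3 cV ch)+
    then show ?thesis unfolding evc .
  qed
  obtain F d where F: "\<And>r s t. E r s t \<Longrightarrow> (\<exists>i. ev r s t (F i) \<noteq> 0) \<and> par (\<lambda>i. ev r s t (F i)) (h (lin2 s t x y))"
    "\<And>l r s t i. l \<noteq> 0 \<Longrightarrow> ev (l ^ 1 * r) (l * s) (l * t) (F i) = l ^ d * ev r s t (F i)"
    using rep[OF h] by blast
  obtain G e where G: "\<And>r s t. E r s t \<Longrightarrow> (\<exists>i. ev r s t (G i) \<noteq> 0) \<and> par (\<lambda>i. ev r s t (G i)) (k (lin2 s t x y))"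
    "\<And>l r s t i. l \<noteq> 0 \<Longrightarrow> ev (l ^ 1 * r) (l * s) (l * t) (G i) = l ^ e * ev r s t (G i)"
    using rep[OF k] by blast
  obtain i j where ij: "x i * y j \<noteq> x j * y i" using not_par_minor y(2) x(2) by blast
  define \<delta> where "\<delta> = x i * y j - x j * y i"
  have \<delta>: "\<delta> \<noteq> 0" using ij by (simp add: \<delta>_def)
  define F1 F2 where "F1 = const3 (inverse \<delta>) * (F i * const3 (y j) - F j * const3 (y i))"
    and "F2 = const3 (inverse \<delta>) * (F j * const3 (x i) - F i * const3 (x j))"
  obtain F1' where F1': "\<And>r s t. ev r s t F1' = ev 0 s t F1" using subst3[of 0 X2 X3 F1] by auto
  obtain F2' where F2': "\<And>r s t. ev r s t F2' = ev 0 s t F2" using subst3[of 0 X2 X3 F2] by auto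
  have "\<forall>i. \<exists>P. \<forall>r s t. ev r s t P = ev 0 (ev r s t F1') (ev r s t F2') (G i)"
  proof
    fix i show "\<exists>P. \<forall>r s t. ev r s t P = ev 0 (ev r s t F1') (ev r s t F2') (G i)"
      using subst3[of 0 F1' F2' "G i"] by simp
  qed
  then obtain \<Gamma> where \<Gamma>: "\<And>i r s t. ev r s t (\<Gamma> i) = ev 0 (ev 0 s t F1) (ev 0 s t F2) (G i)"
    unfolding F1' F2' by metis
  have F12: "(\<lambda>i. ev 0 s t (F i)) = lin2 (ev 0 s t F1) (ev 0 s t F2) x y \<and> (ev 0 s t F1 \<noteq> 0 \<or> ev 0 s t F2 \<noteq> 0)"
    if st: "E 0 s t" for s t
  proof -
    have "(\<lambda>i. ev 0 s t (F i)) \<in> V"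
      using F(1)[OF st] V_scale h_V(1)[of "lin2 s t x y"] lin2_nonzero[OF y(2) x(2)] st lin2_V x(1) y(1)
      by (auto simp: par_def E_def)
    then obtain p q where pq: "(\<lambda>i. ev 0 s t (F i)) = lin2 p q x y" using span by blast
    then have Fi: "ev 0 s t (F i) = p * x i + q * y i" for i by (simp add: lin2_def fun_eq_iff)
    have "ev 0 s t F1 = inverse \<delta> * (p * \<delta>)" "ev 0 s t F2 = inverse \<delta> * (q * \<delta>)"
      by (simp_all add: F1_def F2_def Fi) (simp_all add: \<delta>_def algebra_simps)
    then have "ev 0 s t F1 = p" "ev 0 s t F2 = q" using \<delta> by simp_all
    moreover have "p \<noteq> 0 \<or> q \<noteq> 0" using F(1)[OF st] by (auto simp: Fi)
    ultimately show ?thesis using pq by simp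
  qed
  have "d * e = 1"
  proof (rule degree_one[of \<Gamma> x y, OF _ _ ij])
    fix s t :: 'l assume st: "s \<noteq> 0 \<or> t \<noteq> 0"
    then have e0: "E 0 s t" by (simp add: E_def)
    have V': "lin2 s t x y \<in> V" "lin2 s t x y \<noteq> 0" using lin2_V x y lin2_nonzero st by auto
    define w where "w = lin2 (ev 0 s t F1) (ev 0 s t F2) x y"
    have w: "w \<in> V" "w \<noteq> 0" using lin2_V x y lin2_nonzero F12[OF e0] by (auto simp: w_def)
    have "par w (h (lin2 s t x y))" using F(1)[OF e0] F12[OF e0] by (simp add: w_def)
    then have "par (k w) (k (h (lin2 s t x y)))"
      using k_par[of "h (lin2 s t x y)" w] h_V V' w by blast
    then have "par (k w) (lin2 s t x y)" using kh[OF V'] par_trans by blast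
    moreover have "E 0 (ev 0 s t F1) (ev 0 s t F2)" using F12[OF e0] by (simp add: E_def)
    note G(1)[OF this]
    ultimately show "(\<exists>i. ev 0 s t (\<Gamma> i) \<noteq> 0) \<and> par (\<lambda>i. ev 0 s t (\<Gamma> i)) (\<lambda>i. s * x i + t * y i)"
      using par_trans unfolding lin2_def \<Gamma> w_def by blast
  next
    fix l s t :: 'l and i assume l: "l \<noteq> 0"
    have "ev 0 (l * s) (l * t) (F i) = l ^ d * ev 0 s t (F i)" for i using F(2)[OF l, of 0 s t i] by simp
    then have "ev 0 (l * s) (l * t) F1 = l ^ d * ev 0 s t F1" "ev 0 (l * s) (l * t) F2 = l ^ d * ev 0 s t F2"
      by (simp_all add: F1_def F2_def algebra_simps)
    then have "ev 0 (l * s) (l * t) (\<Gamma> i) = ev 0 (l ^ d * ev 0 s t F1) (l ^ d * ev 0 s t F2) (G i)" by (simp add: \<Gamma>)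
    also have "\<dots> = (l ^ d) ^ e * ev 0 (ev 0 s t F1) (ev 0 s t F2) (G i)"
      using G(2)[of "l ^ d" 0 "ev 0 s t F1" "ev 0 s t F2" i] l by simp
    finally show "ev 0 (l * s) (l * t) (\<Gamma> i) = l ^ (d * e) * ev 0 s t (\<Gamma> i)" by (simp add: \<Gamma> power_mult)
  qed
  then have "ev (l * r) (l * s) (l * t) (F i) = l * ev r s t (F i)" if "l \<noteq> 0" for l r s t i
    using F(2)[OF that, of r s t i] by simp
  then have "\<forall>i. \<exists>a b c. \<forall>r s t. ev r s t (F i) = a * r + b * s + c * t"
    using ev_homogeneous_linear by metis
  then obtain a b c where abc: "\<And>i r s t. ev r s t (F i) = a i * r + b i * s + c i * t" by metis
  have "(\<lambda>i. ev 0 s t (F i)) = lin2 s t b c" for s t by (simp add: abc lin2_def mult.commute)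
  then have "par (lin2 s t b c) (h (lin2 s t x y)) \<and> lin2 s t b c \<noteq> 0" if "s \<noteq> 0 \<or> t \<noteq> 0" for s t
    using F(1)[of 0 s t] that by (auto simp: E_def fun_eq_iff)
  then show ?thesis by blast
qed

lemma map_on_line:
  assumes x: "x \<in> V" "x \<noteq> 0" and y: "y \<in> V" "\<not> par y x"
  shows "\<exists>a b. \<forall>s t. s \<noteq> 0 \<or> t \<noteq> 0 \<longrightarrow> par (lin2 s t a b) (h (lin2 s t x y)) \<and> lin2 s t a b \<noteq> 0"
proof (cases "\<exists>z\<in>V. \<forall>s t. z \<noteq> lin2 s t x y")
  case True
  then obtain z where z: "z \<in> V" "\<And>s t. z \<noteq> lin2 s t x y" by blast
  obtain a b c where abc: "\<And>r s t. r \<noteq> 0 \<or> s \<noteq> 0 \<or> t \<noteq> 0 \<Longrightarrow>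
     par (lin3 r s t a b c) (h (lin3 r s t z x y)) \<and> lin3 r s t a b c \<noteq> 0"
    using map_on_plane[OF x y z] by blast
  have "lin3 0 s t p q r = lin2 s t q r" for p q r s t by (simp add: lin3_def lin2_def)
  then have "par (lin2 s t b c) (h (lin2 s t x y)) \<and> lin2 s t b c \<noteq> 0" if "s \<noteq> 0 \<or> t \<noteq> 0" for s t
    using abc[of 0 s t] that by auto
  then show ?thesis by blast
next
  case False
  then show ?thesis using map_on_line_spanning[OF x y] by blast
qed

context
  fixes e0 assumes e0: "e0 \<in> V" "e0 \<noteq> 0"
begin

text \<open>\<open>b\<close> is meant to be the value at \<open>y\<close> of the linear lift that
  sends \<open>e0\<close> to \<open>h e0\<close>; prescribing this value removes the scalar
  ambiguity. The guard admits \<open>y\<close> proportional to \<open>e0\<close>, a case in which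
  nonvanishing pins down the factor of \<open>b\<close>.\<close>

definition lifts :: "('i \<Rightarrow> 'l) \<Rightarrow> ('i \<Rightarrow> 'l) \<Rightarrow> bool" where
  "lifts y b \<longleftrightarrow> (\<forall>s t. lin2 s t e0 y \<noteq> 0 \<longrightarrow> par (lin2 s t (h e0) b) (h (lin2 s t e0 y)) \<and> lin2 s t (h e0) b \<noteq> 0)"

lemma lifts_lin: assumes "lifts y b" shows "lifts (lin2 \<beta> \<alpha> e0 y) (lin2 \<beta> \<alpha> (h e0) b)"
proof -
  have "lin2 s t u (lin2 \<beta> \<alpha> u v) = lin2 (s + t * \<beta>) (t * \<alpha>) u v" for s t u v
    by (simp add: lin2_def algebra_simps)
  then show ?thesis using assms by (simp add: lifts_def)
qed

lemma lifts_scaled: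
  assumes "\<gamma> \<noteq> 0" "\<And>s t. lin2 s t e0 y \<noteq> 0 \<Longrightarrow> par (\<lambda>i. \<gamma> * lin2 s t (h e0) b i) (h (lin2 s t e0 y)) \<and> (\<lambda>i. \<gamma> * lin2 s t (h e0) b i) \<noteq> 0"
  shows "lifts y b"
proof -
  have "par v (\<lambda>i. \<gamma> * v i)" for v :: "'i \<Rightarrow> 'l"
    unfolding par_def using assms(1) by (intro exI[of _ "inverse \<gamma>"]) (simp flip: mult.assoc)
  then have p: "par v w" if "par (\<lambda>i. \<gamma> * v i) w" for v w :: "'i \<Rightarrow> 'l" using par_trans that by blast
  have n: "v \<noteq> 0" if "(\<lambda>i. \<gamma> * v i) \<noteq> 0" for v :: "'i \<Rightarrow> 'l"
  proof
    assume "v = 0"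
    then have "(\<lambda>i. \<gamma> * v i) = 0" by (simp add: fun_eq_iff)
    then show False using that by blast
  qed
  show ?thesis unfolding lifts_def
  proof (intro allI impI conjI)
    fix s t assume "lin2 s t e0 y \<noteq> 0"
    note a = assms(2)[OF this]
    show "par (lin2 s t (h e0) b) (h (lin2 s t e0 y))" by (rule p[OF conjunct1[OF a]])
    show "lin2 s t (h e0) b \<noteq> 0" by (rule n[OF conjunct2[OF a]])
  qed
qed

lemma lifts_0: "lifts 0 0"
  unfolding lifts_def
proof (intro allI impI)
  fix s t assume nz: "lin2 s t e0 0 \<noteq> 0"
  then have s: "s \<noteq> 0" by (auto simp: lin2_def fun_eq_iff)
  have eq: "lin2 s t u 0 = (\<lambda>i. s * u i)" for u by (simp add: lin2_def)
  have p: "par (h (\<lambda>i. s * e0 i)) (h e0)" using h e0 s by (auto simp: regular_map_def)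
  have "(\<lambda>i. s * e0 i) \<in> V" by (rule V_scale[OF e0(1)])
  moreover have "(\<lambda>i. s * e0 i) \<noteq> 0" using nz unfolding eq .
  ultimately have "h (\<lambda>i. s * e0 i) \<noteq> 0" by (rule h_V(2))
  then have "par (h e0) (h (\<lambda>i. s * e0 i))" using par_sym'[OF p] unfolding zero_fun_def by blast
  moreover have "par (\<lambda>i. s * h e0 i) (h e0)" by (auto simp: par_def)
  ultimately have "par (\<lambda>i. s * h e0 i) (h (\<lambda>i. s * e0 i))" using par_trans by blast
  moreover have "(\<lambda>i. s * h e0 i) \<noteq> 0" using s h_V(2)[OF e0] by (auto simp: fun_eq_iff)
  ultimately show "par (lin2 s t (h e0) 0) (h (lin2 s t e0 0)) \<and> lin2 s t (h e0) 0 \<noteq> 0" by (simp add: eq)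
qed

lemma par_scale_nonzero: assumes "par a v" "a \<noteq> 0" shows "\<exists>c. c \<noteq> 0 \<and> a = (\<lambda>i. c * v i)"
  using assms by (force simp: par_def fun_eq_iff)

lemma lifts_exists: assumes y: "y \<in> V" shows "\<exists>b. lifts y b"
proof (cases "par y e0")
  case True
  then obtain \<beta> where "y = (\<lambda>i. \<beta> * e0 i)" by (auto simp: par_def)
  then have "y = lin2 \<beta> 1 e0 0" by (simp add: lin2_def)
  then show ?thesis using lifts_lin[OF lifts_0, of \<beta> 1] by auto
next
  case False
  obtain a b where ab: "\<And>s t. s \<noteq> 0 \<or> t \<noteq> 0 \<Longrightarrow> par (lin2 s t a b) (h (lin2 s t e0 y)) \<and> lin2 s t a b \<noteq> 0"
    using map_on_line[OF e0 y False] by blast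
  have "lin2 1 0 u v = u" for u v by (simp add: lin2_def)
  then have "par a (h e0)" "a \<noteq> 0" using ab[of 1 0] by auto
  then obtain \<gamma> where \<gamma>: "\<gamma> \<noteq> 0" "a = (\<lambda>i. \<gamma> * h e0 i)" using par_scale_nonzero by blast
  have eq: "(\<lambda>i. \<gamma> * lin2 s t (h e0) (\<lambda>i. inverse \<gamma> * b i) i) = lin2 s t a b" for s t
  proof
    fix i
    have "\<gamma> * (s * h e0 i + t * (inverse \<gamma> * b i)) = s * (\<gamma> * h e0 i) + t * ((\<gamma> * inverse \<gamma>) * b i)"
      by (simp only: distrib_left mult_ac)
    then show "\<gamma> * lin2 s t (h e0) (\<lambda>i. inverse \<gamma> * b i) i = lin2 s t a b i" using \<gamma> by (simp add: lin2_def)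
  qed
  have "lifts y (\<lambda>i. inverse \<gamma> * b i)"
  proof (rule lifts_scaled[OF \<gamma>(1)], unfold eq)
    fix s t assume "lin2 s t e0 y \<noteq> 0"
    then have "s \<noteq> 0 \<or> t \<noteq> 0" by (auto simp: lin2_def fun_eq_iff)
    then show "par (lin2 s t a b) (h (lin2 s t e0 y)) \<and> lin2 s t a b \<noteq> 0" by (rule ab)
  qed
  then show ?thesis by blast
qed

text \<open>In general the point y fixes b up to a factor, and the point e0 + y fixes the factor, as
  h e0 and h y are not proportional. If y = \<beta> e0, then b is some \<beta>' times h e0, and
  \<beta>' \<noteq> \<beta> would make the combination with coefficients -\<beta>' and 1 vanish on
  the image side only.\<close>

lemma lifts_unique: assumes y: "y \<in> V" and b: "lifts y b" "lifts y b'" shows "b = b'"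
proof (cases "par y e0")
  case True
  then obtain \<beta> where y: "y = (\<lambda>i. \<beta> * e0 i)" by (auto simp: par_def)
  have eq: "lin2 s t e0 y = (\<lambda>i. (s + t * \<beta>) * e0 i)" for s t by (simp add: y lin2_def algebra_simps)
  have *: "c = (\<lambda>i. \<beta> * h e0 i)" if c: "lifts y c" for c
  proof -
    have nz: "lin2 s t e0 y \<noteq> 0" if "s + t * \<beta> \<noteq> 0" for s t
      using e0(2) that by (auto simp: eq fun_eq_iff)
    have "lin2 (1 - \<beta>) 1 e0 y = e0" by (simp add: eq)
    then have "par (lin2 (1 - \<beta>) 1 (h e0) c) (h e0)" using c nz[of "1 - \<beta>" 1] unfolding lifts_def by fastforce
    then obtain z where "lin2 (1 - \<beta>) 1 (h e0) c = (\<lambda>i. z * h e0 i)" by (auto simp: par_def)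
    then have "(1 - \<beta>) * h e0 i + c i = z * h e0 i" for i by (simp add: lin2_def fun_eq_iff)
    then have "c i = (z - (1 - \<beta>)) * h e0 i" for i by (metis add_diff_cancel_left' left_diff_distrib)
    then obtain \<beta>' where c': "c = (\<lambda>i. \<beta>' * h e0 i)" by blast
    have "\<beta>' = \<beta>"
    proof (rule ccontr)
      assume "\<beta>' \<noteq> \<beta>"
      then have "lin2 (- \<beta>') 1 e0 y \<noteq> 0" by (intro nz) auto
      then have "lin2 (- \<beta>') 1 (h e0) c \<noteq> 0" using c unfolding lifts_def by blast
      then show False by (auto simp: lin2_def c' fun_eq_iff)
    qed
    then show ?thesis using c' by simp
  qed
  show ?thesis using *[OF b(1)] *[OF b(2)] by simp
next
  case False
  have y0: "y \<noteq> 0" using False unfolding par_def by (metis mult_zero_left zero_fun_def)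
  have l01: "lin2 0 1 u v = v" for u v by (simp add: lin2_def)
  have "lin2 0 1 e0 y \<noteq> 0" using y0 by (simp add: l01)
  then have "par b (h y)" "par b' (h y)" using b unfolding lifts_def by (metis l01)+
  then obtain \<beta> \<beta>' where \<beta>: "b = (\<lambda>i. \<beta> * h y i)" "b' = (\<lambda>i. \<beta>' * h y i)" by (auto simp: par_def)
  have nz: "lin2 1 1 e0 y \<noteq> 0" using lin2_nonzero[OF False e0(2)] by simp
  then have "par (lin2 1 1 (h e0) b) (h (lin2 1 1 e0 y))" "lin2 1 1 (h e0) b \<noteq> 0"
    "par (lin2 1 1 (h e0) b') (h (lin2 1 1 e0 y))" using b unfolding lifts_def by blast+
  note q = this
  have "par (h (lin2 1 1 e0 y)) (lin2 1 1 (h e0) b)"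
    by (rule par_sym'[OF q(1)]) (use q(2) in \<open>simp add: zero_fun_def\<close>)
  then have "par (lin2 1 1 (h e0) b') (lin2 1 1 (h e0) b)" by (rule par_trans[OF q(3)])
  then obtain c where c: "lin2 1 1 (h e0) b' = (\<lambda>i. c * lin2 1 1 (h e0) b i)" by (auto simp: par_def)
  have eq: "(1 - c) * h e0 i = (c * \<beta> - \<beta>') * h y i" for i
    using fun_cong[OF c, of i] by (simp add: lin2_def \<beta> algebra_simps)
  have "c = 1"
  proof (rule ccontr)
    assume "c \<noteq> 1"
    then have "h e0 i = ((c * \<beta> - \<beta>') / (1 - c)) * h y i" for i using eq[of i] by (simp add: field_simps)
    then have "par (h e0) (h y)" unfolding par_def by blast
    then have "par e0 y" using h_inj e0 y y0 by blast
    then have "par y e0" by (rule par_sym') (use e0(2) in \<open>simp add: zero_fun_def\<close>)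
    then show False using False by blast
  qed
  then have "(\<beta> - \<beta>') * h y i = 0" for i using eq[of i] by simp
  moreover obtain i where "h y i \<noteq> 0" using h_V(2)[OF y y0] by (auto simp: fun_eq_iff)
  ultimately have "\<beta> = \<beta>'" by (metis mult_eq_0_iff right_minus_eq)
  then show ?thesis using \<beta> by simp
qed

text \<open>If e0, y, z are independent, the linear formula on their span, rescaled to send e0 to h
  e0, lifts every combination of y and z, and by uniqueness its values at y and z are b and c.
  Otherwise one of y, z is a combination of e0 and the other one.\<close>

lemma lifts_add: assumes y: "y \<in> V" "lifts y b" and z: "z \<in> V" "lifts z c" shows "lifts (lin2 1 1 y z) (lin2 1 1 b c)"
proof -
  have dep: "lifts (lin2 1 1 y z) (lin2 1 1 b c)" if yz: "y \<in> V" "lifts y b" "z \<in> V" "lifts z c" "z = lin2 \<beta> \<alpha> e0 y"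
    for y z b c \<alpha> \<beta>
  proof -
    have "c = lin2 \<beta> \<alpha> (h e0) b" using lifts_unique[OF yz(3,4)] lifts_lin[OF yz(2)] yz(5) by simp
    then have "lin2 1 1 y z = lin2 \<beta> (1 + \<alpha>) e0 y" "lin2 1 1 b c = lin2 \<beta> (1 + \<alpha>) (h e0) b"
      by (simp_all add: yz(5) lin2_def algebra_simps)
    then show ?thesis using lifts_lin[OF yz(2)] by simp
  qed
  have comm: "lin2 1 1 u v = lin2 1 1 v u" for u v by (simp add: lin2_def add.commute)
  consider (1) \<alpha> \<beta> where "z = lin2 \<beta> \<alpha> e0 y" | (2) \<alpha> \<beta> where "y = lin2 \<beta> \<alpha> e0 z"
    | (3) "\<And>s t. z \<noteq> lin2 s t e0 y" "\<not> par y e0"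
  proof -
    have "y = lin2 \<beta> 0 e0 z" if "y = (\<lambda>i. \<beta> * e0 i)" for \<beta> using that by (simp add: lin2_def)
    then show ?thesis using that unfolding par_def by metis
  qed
  then show ?thesis
  proof cases
    case 1 then show ?thesis using dep y z by blast
  next
    case 2 then show ?thesis using dep[OF z y] comm by metis
  next
    case 3
    obtain a b' c' where abc: "\<And>r s t. r \<noteq> 0 \<or> s \<noteq> 0 \<or> t \<noteq> 0 \<Longrightarrow>
      par (lin3 r s t a b' c') (h (lin3 r s t z e0 y)) \<and> lin3 r s t a b' c' \<noteq> 0"
      using map_on_plane[OF e0 y(1) 3(2) z(1) 3(1)] by blast
    have "lin3 0 1 0 u v w = v" for u v w by (simp add: lin3_def)
    then have "par b' (h e0)" "b' \<noteq> 0" using abc[of 0 1 0] by auto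
    then obtain \<gamma> where \<gamma>: "\<gamma> \<noteq> 0" "b' = (\<lambda>i. \<gamma> * h e0 i)" using par_scale_nonzero by blast
    define v where "v p q = (\<lambda>i. inverse \<gamma> * (p * c' i + q * a i))" for p q
    have L: "lifts (lin2 p q y z) (v p q)" for p q
    proof (rule lifts_scaled[OF \<gamma>(1)])
      fix s t assume nz: "lin2 s t e0 (lin2 p q y z) \<noteq> 0"
      have "\<gamma> * (s * h e0 i + t * v p q i) = s * (\<gamma> * h e0 i) + t * ((\<gamma> * inverse \<gamma>) * (p * c' i + q * a i))" for i
        by (simp only: v_def distrib_left mult_ac)
      then have 1: "(\<lambda>i. \<gamma> * lin2 s t (h e0) (v p q) i) = lin3 (t * q) s (t * p) a b' c'"
        using \<gamma> by (simp add: lin2_def lin3_def fun_eq_iff) (simp add: algebra_simps)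
      have 2: "lin2 s t e0 (lin2 p q y z) = lin3 (t * q) s (t * p) z e0 y"
        by (simp add: lin2_def lin3_def algebra_simps)
      have "t * q \<noteq> 0 \<or> s \<noteq> 0 \<or> t * p \<noteq> 0"
        using nz by (auto simp: 2 lin3_def fun_eq_iff)
      then show "par (\<lambda>i. \<gamma> * lin2 s t (h e0) (v p q) i) (h (lin2 s t e0 (lin2 p q y z))) \<and>
          (\<lambda>i. \<gamma> * lin2 s t (h e0) (v p q) i) \<noteq> 0"
        unfolding 1 2 by (rule abc)
    qed
    have "lin2 1 0 y z = y" "lin2 0 1 y z = z" by (simp_all add: lin2_def)
    then have "b = v 1 0" "c = v 0 1" using lifts_unique y z L by metis+
    then have "lin2 1 1 b c = v 1 1" by (simp add: v_def lin2_def algebra_simps)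
    then show ?thesis using L[of 1 1] by simp
  qed
qed

end

text \<open>Since normalised lifts are unique, their closure under sums and multiples says that
  choosing them is linear.\<close>

theorem linear_lift:
  "\<exists>u. (\<forall>x\<in>V. \<forall>y\<in>V. u (\<lambda>i. x i + y i) = (\<lambda>i. u x i + u y i)) \<and> (\<forall>x\<in>V. \<forall>c. u (\<lambda>i. c * x i) = (\<lambda>i. c * u x i)) \<and>
     (\<forall>x\<in>V - {0}. u x \<noteq> 0 \<and> par (u x) (h x))"
proof (cases "V = {0}")
  case True
  then show ?thesis by (intro exI[of _ "\<lambda>x. x"]) auto
next
  case False
  then obtain e0 where e0: "e0 \<in> V" "e0 \<noteq> 0" using V0 by blast
  define u where "u y = (SOME b. lifts e0 y b)" for y
  have u: "lifts e0 y (u y)" if "y \<in> V" for y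
    unfolding u_def using lifts_exists[OF e0 that] by (rule someI_ex)
  have uI: "u y = b" if "y \<in> V" "lifts e0 y b" for y b
    using lifts_unique[OF e0 that(1) u[OF that(1)] that(2)] .
  have "u (\<lambda>i. x i + y i) = (\<lambda>i. u x i + u y i)" if "x \<in> V" "y \<in> V" for x y
    using uI[OF V_add[OF that]] lifts_add[OF e0 that(1) u[OF that(1)] that(2) u[OF that(2)]]
    by (simp add: lin2_def)
  moreover have "u (\<lambda>i. c * x i) = (\<lambda>i. c * u x i)" if "x \<in> V" for x c
    using uI[OF V_scale[OF that]] lifts_lin[OF e0 u[OF that], of 0 c] by (simp add: lin2_def)
  moreover have "u x \<noteq> 0 \<and> par (u x) (h x)" if "x \<in> V - {0}" for x
  proof -
    have l: "lin2 0 1 a b = b" for a b :: "'i \<Rightarrow> 'l" by (simp add: lin2_def)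
    have "lin2 0 1 e0 x \<noteq> 0" using that by (simp add: l)
    then have "par (lin2 0 1 (h e0) (u x)) (h (lin2 0 1 e0 x)) \<and> lin2 0 1 (h e0) (u x) \<noteq> 0"
      using u[of x] that unfolding lifts_def[OF e0] by blast
    then show ?thesis by (simp add: l)
  qed
  ultimately show ?thesis by blast
qed

end

section \<open>The scalar extension to the algebraic closure\<close>

lemma sum_fun_apply: "(\<Sum>i\<in>I. f i) x = (\<Sum>i\<in>I. f i x :: 'b::comm_monoid_add)"
  by (induction I rule: infinite_finite_induct) auto

interpretation FS: vector_space "fun_scale :: 'l::field \<Rightarrow> ('i \<Rightarrow> 'l) \<Rightarrow> 'i \<Rightarrow> 'l"
  by (rule vector_space_fun_scale)

context vector_space
begin

text \<open>The space of all functions need not be finite-dimensional, so the facts on dimension are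
  stated relative to a finite set \<open>F\<close> whose span contains the subspaces at
  hand.\<close>

lemma dim_le_of_subset:
  assumes "S \<subseteq> T" "T \<subseteq> span F" "finite F"
  shows "dim S \<le> dim T"
proof -
  obtain b where b: "b \<subseteq> S" "independent b" "S \<subseteq> span b" "card b = dim S" using basis_exists by blast
  obtain c where c: "b \<subseteq> c" "c \<subseteq> T" "independent c" "T \<subseteq> span c"
    using maximal_independent_subset_extend[of b T] b assms(1) by blast
  have "finite c" using independent_span_bound[OF assms(3) c(3)] c(2) assms(2) by blast
  then have "card b \<le> card c" using card_mono c(1) by blast
  then show ?thesis using basis_card_eq_dim[OF c(2,4,3)] b(4) by simp
qed

lemma subspace_eq_of_dim:
  assumes "S \<subseteq> T" "T \<subseteq> span F" "finite F" "subspace S" "dim T \<le> dim S"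
  shows "S = T"
proof -
  obtain b where b: "b \<subseteq> S" "independent b" "S \<subseteq> span b" "card b = dim S" using basis_exists by blast
  obtain c where c: "b \<subseteq> c" "c \<subseteq> T" "independent c" "T \<subseteq> span c"
    using maximal_independent_subset_extend[of b T] b assms(1) by blast
  have f: "finite c" using independent_span_bound[OF assms(3) c(3)] c(2) assms(2) by blast
  have "card c \<le> card b" using basis_card_eq_dim[OF c(2,4,3)] b(4) assms(5) by simp
  then have "b = c" using card_seteq[OF f c(1)] by blast
  then have "T \<subseteq> span S" using c(4) b(1) span_mono by blast
  then show ?thesis using assms(1,4) span_eq_iff by blast
qed

lemma card_le_dim_of_independent:
  assumes "independent b" "b \<subseteq> T" "T \<subseteq> span F" "finite F"
  shows "finite b \<and> card b \<le> dim T"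
proof -
  have "finite b" using independent_span_bound[OF assms(4,1)] assms(2,3) by blast
  then show ?thesis using dim_le_of_subset[OF assms(2-4)] dim_eq_card_independent[OF assms(1)] by simp
qed

end

locale severi_brauer = central_division_algebra scale
  for scale :: "'k::field \<Rightarrow> 'a::division_ring \<Rightarrow> 'a" +
  fixes B :: "'a set" and n :: nat
  assumes basis: "is_basis scale B" and dim_A: "dim (UNIV :: 'a set) = n\<^sup>2"
begin

lemma B: "independent B" "span B = UNIV" using basis by (auto simp: is_basis_def)

lemma finite_B: "finite B" by (rule finiteI_independent[OF B(1)])

lemma card_B: "card B = n\<^sup>2"
  using dim_span_eq_card_independent[OF B(1)] B(2) dim_A by simp

definition mul :: "('a \<Rightarrow> 'k alg_closure) \<Rightarrow> ('a \<Rightarrow> 'k alg_closure) \<Rightarrow> 'a \<Rightarrow> 'k alg_closure" (infixl \<open>\<star>\<close> 70)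
  where "x \<star> y = ext_mult scale B x y"

text \<open>The embedding a \<mapsto> a \<otimes> 1 of A into its scalar extension.\<close>

definition \<iota> :: "'a \<Rightarrow> 'a \<Rightarrow> 'k alg_closure" where "\<iota> a = (\<lambda>b. to_ac (representation B a b))"

abbreviation C :: "('a \<Rightarrow> 'k alg_closure) set" where "C \<equiv> ext_carrier B"

lemma mul_alt: "x \<star> y = (\<Sum>a\<in>B. \<Sum>b\<in>B. fun_scale (x a * y b) (\<iota> (a * b)))"
  by (rule ext) (simp add: mul_def ext_mult_def \<iota>_def sum_fun_apply)

lemma \<iota>_C: "\<iota> a \<in> C"
  using representation_ne_zero[of B a] by (auto simp: ext_carrier_def \<iota>_def)

lemma subspace_C: "FS.subspace C"
  by (rule FS.subspaceI) (auto simp: ext_carrier_def)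

lemma mul_C: "x \<star> y \<in> C"
  unfolding mul_alt by (intro FS.subspace_sum FS.subspace_scale subspace_C \<iota>_C)

lemma mul_add_left: "(x + y) \<star> z = x \<star> z + y \<star> z"
  by (rule ext) (simp add: mul_def ext_mult_def distrib_right sum.distrib)

lemma mul_add_right: "x \<star> (y + z) = x \<star> y + x \<star> z"
  by (rule ext) (simp add: mul_def ext_mult_def distrib_left distrib_right sum.distrib)

lemma mul_scale_left: "fun_scale c x \<star> y = fun_scale c (x \<star> y)"
  by (rule ext) (simp add: mul_def ext_mult_def sum_distrib_left mult.assoc)

lemma mul_scale_right: "x \<star> fun_scale c y = fun_scale c (x \<star> y)"
  by (rule ext) (simp add: mul_def ext_mult_def sum_distrib_left mult_ac)

lemma linear_mul_left: "Vector_Spaces.linear fun_scale fun_scale (\<lambda>y. x \<star> y)"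
  using FS.vector_space_axioms by (simp add: Vector_Spaces.linear_iff mul_add_right mul_scale_right)

lemma linear_mul_right: "Vector_Spaces.linear fun_scale fun_scale (\<lambda>x. x \<star> y)"
  using FS.vector_space_axioms by (simp add: Vector_Spaces.linear_iff mul_add_left mul_scale_left)

lemma mul_0 [simp]: "x \<star> 0 = 0" "0 \<star> x = 0"
  by (rule ext, simp add: mul_def ext_mult_def)+

lemma mul_sum_left: "(\<Sum>i\<in>I. f i) \<star> z = (\<Sum>i\<in>I. f i \<star> z)"
  using module_hom.sum[OF linear_mul_right[unfolded module_hom_iff_linear[symmetric]]] .

lemma mul_sum_right: "x \<star> (\<Sum>i\<in>I. f i) = (\<Sum>i\<in>I. x \<star> f i)"
  using module_hom.sum[OF linear_mul_left[unfolded module_hom_iff_linear[symmetric]]] .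

lemma \<iota>_add: "\<iota> (a + b) = \<iota> a + \<iota> b"
  by (rule ext) (simp add: \<iota>_def representation_add[OF B(1)] B(2))

lemma \<iota>_scale: "\<iota> (scale c a) = fun_scale (to_ac c) (\<iota> a)"
  by (rule ext) (simp add: \<iota>_def representation_scale[OF B(1)] B(2))

lemma \<iota>_0 [simp]: "\<iota> 0 = 0"
  by (rule ext) (simp add: \<iota>_def representation_zero)

lemma \<iota>_sum: "\<iota> (\<Sum>i\<in>I. f i) = (\<Sum>i\<in>I. \<iota> (f i))"
  by (induction I rule: infinite_finite_induct) (simp_all add: \<iota>_add)

lemma \<iota>_basis: "b \<in> B \<Longrightarrow> \<iota> b = (\<lambda>c. if c = b then 1 else 0)"
  by (rule ext) (simp add: \<iota>_def representation_basis[OF B(1)])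

lemma C_expand: assumes "x \<in> C" shows "x = (\<Sum>b\<in>B. fun_scale (x b) (\<iota> b))"
proof
  fix c
  have "(\<Sum>b\<in>B. x b * \<iota> b c) = (\<Sum>b\<in>B. if b = c then x c else 0)"
    by (rule sum.cong) (auto simp: \<iota>_basis)
  also have "\<dots> = x c" using assms finite_B by (auto simp: ext_carrier_def)
  finally show "x c = (\<Sum>b\<in>B. fun_scale (x b) (\<iota> b)) c" by (simp add: sum_fun_apply)
qed

lemma A_expand: "a = (\<Sum>b\<in>B. scale (representation B a b) b)"
  using sum_representation_eq[OF B(1), of a B] finite_B B(2) by simp

lemma mul_\<iota>_left: "\<iota> w \<star> z = (\<Sum>d\<in>B. fun_scale (z d) (\<iota> (w * d)))"
proof -
  have "\<iota> w \<star> z = (\<Sum>a\<in>B. \<Sum>d\<in>B. fun_scale (z d) (fun_scale (\<iota> w a) (\<iota> (a * d))))"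
    unfolding mul_alt by (intro sum.cong refl) (simp only: mult_ac)
  also have "\<dots> = (\<Sum>d\<in>B. \<Sum>a\<in>B. fun_scale (z d) (fun_scale (\<iota> w a) (\<iota> (a * d))))" by (rule sum.swap)
  also have "\<dots> = (\<Sum>d\<in>B. fun_scale (z d) (\<iota> (w * d)))"
  proof (rule sum.cong[OF refl])
    fix d
    have "w * d = (\<Sum>a\<in>B. scale (representation B w a) (a * d))"
      by (subst A_expand[of w]) (simp add: sum_distrib_right scale_mult_left)
    then have "\<iota> (w * d) = (\<Sum>a\<in>B. fun_scale (\<iota> w a) (\<iota> (a * d)))"
      by (simp only: \<iota>_sum \<iota>_scale) (simp only: \<iota>_def[of w])
    then show "(\<Sum>a\<in>B. fun_scale (z d) (fun_scale (\<iota> w a) (\<iota> (a * d)))) = fun_scale (z d) (\<iota> (w * d))"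
      by (simp only: FS.scale_sum_right)
  qed
  finally show ?thesis .
qed

lemma mul_\<iota>_right: "z \<star> \<iota> w = (\<Sum>d\<in>B. fun_scale (z d) (\<iota> (d * w)))"
proof -
  have "z \<star> \<iota> w = (\<Sum>d\<in>B. \<Sum>a\<in>B. fun_scale (z d) (fun_scale (\<iota> w a) (\<iota> (d * a))))"
    unfolding mul_alt by (intro sum.cong refl) (simp only: mult_ac)
  also have "\<dots> = (\<Sum>d\<in>B. fun_scale (z d) (\<iota> (d * w)))"
  proof (rule sum.cong[OF refl])
    fix d
    have "d * w = (\<Sum>a\<in>B. scale (representation B w a) (d * a))"
      by (subst A_expand[of w]) (simp add: sum_distrib_left scale_mult_right)
    then have "\<iota> (d * w) = (\<Sum>a\<in>B. fun_scale (\<iota> w a) (\<iota> (d * a)))"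
      by (simp only: \<iota>_sum \<iota>_scale) (simp only: \<iota>_def[of w])
    then show "(\<Sum>a\<in>B. fun_scale (z d) (fun_scale (\<iota> w a) (\<iota> (d * a)))) = fun_scale (z d) (\<iota> (d * w))"
      by (simp only: FS.scale_sum_right)
  qed
  finally show ?thesis .
qed

lemma \<iota>_mult: "\<iota> (a * b) = \<iota> a \<star> \<iota> b"
proof -
  have "a * b = (\<Sum>d\<in>B. scale (representation B b d) (a * d))"
    by (subst A_expand[of b]) (simp add: sum_distrib_left scale_mult_right)
  then have "\<iota> (a * b) = (\<Sum>d\<in>B. fun_scale (to_ac (representation B b d)) (\<iota> (a * d)))"
    by (simp only: \<iota>_sum \<iota>_scale)
  then show ?thesis unfolding mul_\<iota>_left by (simp only: \<iota>_def[of b])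
qed

lemma mul_assoc: "(x \<star> y) \<star> z = x \<star> (y \<star> z)"
proof -
  have "(x \<star> y) \<star> z = (\<Sum>a\<in>B. \<Sum>b\<in>B. \<Sum>d\<in>B. fun_scale (x a * y b * z d) (\<iota> (a * b * d)))"
    unfolding mul_alt[of x y] mul_sum_left mul_scale_left mul_\<iota>_left FS.scale_sum_right FS.scale_scale ..
  also have "\<dots> = (\<Sum>a\<in>B. \<Sum>b\<in>B. \<Sum>d\<in>B. fun_scale (y b * z d * x a) (\<iota> (a * (b * d))))"
    by (intro sum.cong refl) (simp only: mult_ac)
  also have "\<dots> = (\<Sum>b\<in>B. \<Sum>a\<in>B. \<Sum>d\<in>B. fun_scale (y b * z d * x a) (\<iota> (a * (b * d))))"
    by (rule sum.swap)
  also have "\<dots> = (\<Sum>b\<in>B. \<Sum>d\<in>B. \<Sum>a\<in>B. fun_scale (y b * z d * x a) (\<iota> (a * (b * d))))"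
    by (rule sum.cong[OF refl sum.swap])
  also have "\<dots> = x \<star> (y \<star> z)"
    unfolding mul_alt[of y z] mul_sum_right mul_scale_right mul_\<iota>_right FS.scale_sum_right FS.scale_scale ..
  finally show ?thesis .
qed

abbreviation one :: "'a \<Rightarrow> 'k alg_closure" (\<open>\<e>\<close>) where "\<e> \<equiv> \<iota> 1"

lemma mul_one: "x \<in> C \<Longrightarrow> \<e> \<star> x = x" "x \<in> C \<Longrightarrow> x \<star> \<e> = x"
  unfolding mul_\<iota>_left mul_\<iota>_right mult_1_left mult_1_right by (rule C_expand[symmetric], assumption)+

lemma C_span: "C \<subseteq> FS.span (\<iota> ` B)"
proof
  fix x assume "x \<in> C"
  have "(\<Sum>b\<in>B. fun_scale (x b) (\<iota> b)) \<in> FS.span (\<iota> ` B)"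
    by (intro FS.span_sum FS.span_scale FS.span_base imageI)
  then show "x \<in> FS.span (\<iota> ` B)" using C_expand[OF \<open>x \<in> C\<close>] by (simp only:)
qed

lemma finite_\<iota>B: "finite (\<iota> ` B)" using finite_B by simp

lemma \<iota>_inj: "\<iota> a = \<iota> b \<Longrightarrow> a = b"
proof -
  assume "\<iota> a = \<iota> b"
  then have "representation B a c = representation B b c" for c by (simp add: \<iota>_def fun_eq_iff)
  then show "a = b" using A_expand[of a] A_expand[of b] by simp
qed

lemma one_nonzero: "\<e> \<noteq> 0" using \<iota>_inj[of 1 0] by auto

lemma dim_C: "FS.dim C = n\<^sup>2"
proof -
  have inj: "inj_on \<iota> B" using \<iota>_inj by (auto simp: inj_on_def)
  have "FS.independent (\<iota> ` B)"
  proof (rule FS.independent_if_scalars_zero[OF finite_\<iota>B])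
    fix f x assume s: "(\<Sum>x\<in>\<iota> ` B. fun_scale (f x) x) = 0" and "x \<in> \<iota> ` B"
    then obtain b where b: "b \<in> B" "x = \<iota> b" by blast
    have "(\<Sum>c\<in>B. f (\<iota> c) * \<iota> c b) = 0"
      using fun_cong[OF s, of b] by (simp add: sum.reindex[OF inj] sum_fun_apply)
    moreover have "(\<Sum>c\<in>B. f (\<iota> c) * \<iota> c b) = (\<Sum>c\<in>B. if c = b then f (\<iota> b) else 0)"
      by (rule sum.cong) (auto simp: \<iota>_basis)
    ultimately show "f x = 0" using b finite_B by simp
  qed
  then have "FS.dim (\<iota> ` B) = card (\<iota> ` B)" by (rule FS.dim_eq_card_independent)
  then have "FS.dim (\<iota> ` B) = n\<^sup>2" using card_image[OF inj] card_B by simp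
  moreover have "FS.span (\<iota> ` B) = C"
    using C_span FS.span_minimal[OF _ subspace_C, of "\<iota> ` B"] \<iota>_C by blast
  ultimately show ?thesis by (metis FS.dim_span)
qed

end

text \<open>There are more iterates of \<open>w\<close> than the dimension of \<open>W\<close>, so
  they are dependent and some nonzero polynomial in \<open>E\<close> kills \<open>w\<close>; over an
  algebraically closed field it splits.\<close>

lemma eigenvector_alg_closed:
  fixes E :: "('i \<Rightarrow> 'l::alg_closed_field) \<Rightarrow> 'i \<Rightarrow> 'l"
  assumes E: "Vector_Spaces.linear fun_scale fun_scale E"
    and W: "FS.subspace W" "w \<in> W" "w \<noteq> 0" "\<And>v. v \<in> W \<Longrightarrow> E v \<in> W" "W \<subseteq> FS.span F" "finite F"
  shows "\<exists>x\<in>W. x \<noteq> 0 \<and> (\<exists>r. E x = fun_scale r x)"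
proof -
  have EW: "(E ^^ i) w \<in> W" for i by (induction i) (use W in auto)
  note op = FS.op_eval_add[OF E] FS.op_eval_monom[OF E] FS.op_eval_smult[OF E]
  have "\<exists>P. P \<noteq> 0 \<and> op_eval fun_scale E P w = 0"
  proof (rule ccontr)
    assume "\<nexists>P. P \<noteq> 0 \<and> op_eval fun_scale E P w = 0"
    then have nz: "P = 0" if "op_eval fun_scale E P w = 0" for P using that by blast
    define N where "N = FS.dim W"
    have opsum: "op_eval fun_scale E (sum P I) w = (\<Sum>i\<in>I. op_eval fun_scale E (P i) w)" for P and I :: "nat set"
      by (induction I rule: infinite_finite_induct) (simp_all add: op)
    have inj: "inj_on (\<lambda>i. (E ^^ i) w) {..N}"
    proof (rule inj_onI, rule ccontr)
      fix i j assume "(E ^^ i) w = (E ^^ j) w" "i \<noteq> j"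
      then have "op_eval fun_scale E (monom 1 i + monom (-1) j) w = 0" by (simp add: op fun_eq_iff)
      then have "monom 1 i + monom (-1 :: 'l) j = 0" by (rule nz)
      then have "coeff (monom 1 i + monom (-1 :: 'l) j) i = 0" by simp
      then show False using \<open>i \<noteq> j\<close> by simp
    qed
    have "FS.independent ((\<lambda>i. (E ^^ i) w) ` {..N})"
    proof (rule FS.independent_if_scalars_zero)
      fix f x assume s: "(\<Sum>x\<in>(\<lambda>i. (E ^^ i) w) ` {..N}. fun_scale (f x) x) = 0" and x: "x \<in> (\<lambda>i. (E ^^ i) w) ` {..N}"
      define P where "P = (\<Sum>i\<in>{..N}. monom (f ((E ^^ i) w)) i)"
      have "op_eval fun_scale E P w = (\<Sum>x\<in>(\<lambda>i. (E ^^ i) w) ` {..N}. fun_scale (f x) x)"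
        by (simp only: P_def opsum op sum.reindex[OF inj] o_def)
      then have "P = 0" using nz s by simp
      moreover have "coeff P i = f ((E ^^ i) w)" if "i \<le> N" for i using that by (simp add: P_def coeff_sum)
      ultimately show "f x = 0" using x by auto
    qed simp
    then have "card ((\<lambda>i. (E ^^ i) w) ` {..N}) \<le> N"
      using FS.card_le_dim_of_independent[OF _ _ W(5,6)] EW N_def by blast
    then show False using card_image[OF inj] by simp
  qed
  then obtain P where P: "P \<noteq> 0" "op_eval fun_scale E P w = 0" by blast
  obtain R where R: "P = smult (lead_coeff P) (\<Prod>x\<in>#R. [:-x, 1:])"
    using alg_closed_imp_factorization[OF P(1)] by metis
  have "fun_scale (lead_coeff P) (op_eval fun_scale E (\<Prod>x\<in>#R. [:-x, 1:]) w) = 0"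
    using P(2) by (subst (asm) R) (simp only: op)
  then have "lead_coeff P = 0 \<or> op_eval fun_scale E (\<Prod>x\<in>#R. [:-x, 1:]) w = 0"
    by (simp only: FS.scale_eq_0_iff)
  then have "op_eval fun_scale E (\<Prod>x\<in>#R. [:-x, 1:]) w = 0"
    using P(1) by (simp only: leading_coeff_0_iff) blast
  then show ?thesis using FS.eigenvector_of_split[OF E W(1-4)] by blast
qed

section \<open>Simplicity of the scalar extension, and a primitive idempotent\<close>

context severi_brauer
begin

text \<open>Multiplication operators of A extend to the scalar extension and preserve two-sided
  ideals. One that sends \<open>b0\<close> to 1 and the other basis elements to 0 turns
  \<open>z\<close> into the nonzero multiple \<open>z b0\<close> of the unit.\<close>

lemma two_sided_ideal_one:
  assumes J: "FS.subspace J" "\<And>x c. x \<in> J \<Longrightarrow> c \<in> C \<Longrightarrow> c \<star> x \<in> J" "\<And>x c. x \<in> J \<Longrightarrow> c \<in> C \<Longrightarrow> x \<star> c \<in> J"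
    and z: "z \<in> J" "z \<in> C" "z \<noteq> 0"
  shows "\<e> \<in> J"
proof -
  obtain b0 where b0: "z b0 \<noteq> 0" using z(3) by (auto simp: fun_eq_iff)
  then have b0B: "b0 \<in> B" using z(2) by (auto simp: ext_carrier_def)
  then have "b0 \<notin> span (B - {b0})" using B(1) dependent_def by blast
  then obtain T where T: "mult_operator T" "T b0 = 1" "\<forall>x\<in>B - {b0}. T x = 0"
    using density[of "B - {b0}" b0] finite_B by blast
  have "(\<Sum>b\<in>B. fun_scale (z b) (\<iota> (U b))) \<in> J" if "mult_operator U" for U
    using that
  proof (induction rule: mult_operator.induct)
    case ident
    show ?case using z(1) C_expand[OF z(2)] by (simp only:)
  next
    case (left T c)
    have "(\<Sum>b\<in>B. fun_scale (z b) (\<iota> (c * T b))) = \<iota> c \<star> (\<Sum>b\<in>B. fun_scale (z b) (\<iota> (T b)))"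
      by (simp only: mul_sum_right mul_scale_right \<iota>_mult)
    then show ?case using J(2)[OF left.IH \<iota>_C] by (simp only:)
  next
    case (right T c)
    have "(\<Sum>b\<in>B. fun_scale (z b) (\<iota> (T b * c))) = (\<Sum>b\<in>B. fun_scale (z b) (\<iota> (T b))) \<star> \<iota> c"
      by (simp only: mul_sum_left mul_scale_left \<iota>_mult)
    then show ?case using J(3)[OF right.IH \<iota>_C] by (simp only:)
  next
    case (add T U)
    have "(\<Sum>b\<in>B. fun_scale (z b) (\<iota> (T b + U b)))
      = (\<Sum>b\<in>B. fun_scale (z b) (\<iota> (T b))) + (\<Sum>b\<in>B. fun_scale (z b) (\<iota> (U b)))"
      by (simp only: \<iota>_add FS.scale_right_distrib sum.distrib)
    then show ?case using FS.subspace_add[OF J(1) add.IH] by (simp only:)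
  qed
  from this[OF T(1)] have "(\<Sum>b\<in>B. fun_scale (z b) (\<iota> (T b))) \<in> J" .
  also have "(\<Sum>b\<in>B. fun_scale (z b) (\<iota> (T b))) = fun_scale (z b0) \<e>"
  proof (rule ext)
    fix c
    have "(\<Sum>b\<in>B. z b * \<iota> (T b) c) = (\<Sum>b\<in>B. if b = b0 then z b0 * \<e> c else 0)"
      by (rule sum.cong) (use T in auto)
    then show "(\<Sum>b\<in>B. fun_scale (z b) (\<iota> (T b))) c = z b0 * \<e> c"
      using finite_B b0B by (simp add: sum_fun_apply)
  qed
  finally have "fun_scale (inverse (z b0)) (fun_scale (z b0) \<e>) \<in> J" by (rule FS.subspace_scale[OF J(1)])
  then show ?thesis using b0 by (simp flip: mult.assoc)
qed

definition right_ideal :: "('a \<Rightarrow> 'k alg_closure) set \<Rightarrow> bool" where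
  "right_ideal I \<longleftrightarrow> I \<subseteq> C \<and> FS.subspace I \<and> (\<forall>x\<in>I. \<forall>y\<in>C. x \<star> y \<in> I)"

lemma right_ideal_C: "right_ideal C"
  by (simp add: right_ideal_def subspace_C mul_C)

lemma right_ideal_span: "right_ideal I \<Longrightarrow> I \<subseteq> FS.span (\<iota> ` B)"
  using C_span by (auto simp: right_ideal_def)

lemma right_ideal_principal: assumes "x \<in> C" shows "right_ideal ((\<lambda>c. x \<star> c) ` C)"
proof -
  have "FS.subspace ((\<lambda>c. x \<star> c) ` C)"
    using module_hom.subspace_image linear_mul_left subspace_C module_hom_iff_linear by blast
  then show ?thesis using mul_C by (auto simp: right_ideal_def mul_assoc)
qed

text \<open>Schur's lemma on a minimal right ideal \<open>I\<close>: an element that stabilises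
  \<open>I\<close> from the left acts on it as a scalar, since its eigenspaces are right ideals.
  Simplicity provides x and y in \<open>I\<close> with nonzero product, so x acts on
  \<open>I\<close> by some r \<noteq> 0, and x divided by r is a left unit of
  \<open>I\<close>.\<close>

lemma primitive_idempotent:
  obtains e where "e \<in> C" "e \<noteq> 0" "e \<star> e = e" "\<And>c. c \<in> C \<Longrightarrow> \<exists>r. e \<star> c \<star> e = fun_scale r e"
proof -
  define P where "P I \<longleftrightarrow> right_ideal I \<and> I \<noteq> {0}" for I
  have "P C" using right_ideal_C one_nonzero \<iota>_C[of 1] by (auto simp: P_def)
  then obtain I where I: "P I" and min: "\<And>I'. P I' \<Longrightarrow> FS.dim I \<le> FS.dim I'"
    using ex_has_least_nat[of P C FS.dim] by blast
  have rI: "I \<subseteq> C" "FS.subspace I" "\<And>x y. x \<in> I \<Longrightarrow> y \<in> C \<Longrightarrow> x \<star> y \<in> I" using I by (auto simp: P_def right_ideal_def)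
  obtain w0 where w0: "w0 \<in> I" "w0 \<noteq> 0" using I FS.subspace_0[OF rI(2)] by (auto simp: P_def)
  have schur: "\<exists>r. \<forall>w\<in>I. x \<star> w = fun_scale r w" if x: "x \<in> C" "\<And>w. w \<in> I \<Longrightarrow> x \<star> w \<in> I" for x
  proof -
    obtain v r where v: "v \<in> I" "v \<noteq> 0" "x \<star> v = fun_scale r v"
      using eigenvector_alg_closed[OF linear_mul_left rI(2) w0 x(2) right_ideal_span finite_\<iota>B] I
      unfolding P_def by blast
    define I' where "I' = {w\<in>I. x \<star> w = fun_scale r w}"
    have "right_ideal I'" unfolding right_ideal_def I'_def
    proof (intro conjI ballI)
      show "FS.subspace {w \<in> I. x \<star> w = fun_scale r w}"
      proof (rule FS.subspaceI)
        show "0 \<in> {w \<in> I. x \<star> w = fun_scale r w}" using FS.subspace_0[OF rI(2)] by (simp add: fun_eq_iff)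
        show "u + v \<in> {w \<in> I. x \<star> w = fun_scale r w}"
          if "u \<in> {w \<in> I. x \<star> w = fun_scale r w}" "v \<in> {w \<in> I. x \<star> w = fun_scale r w}" for u v
          using that FS.subspace_add[OF rI(2)] by (simp add: mul_add_right fun_eq_iff distrib_left)
        show "fun_scale c u \<in> {w \<in> I. x \<star> w = fun_scale r w}" if "u \<in> {w \<in> I. x \<star> w = fun_scale r w}" for c u
          using that FS.subspace_scale[OF rI(2)] by (simp add: mul_scale_right fun_eq_iff mult.left_commute)
      qed
    next
      fix u y assume "u \<in> {w \<in> I. x \<star> w = fun_scale r w}" "y \<in> C"
      then show "u \<star> y \<in> {w \<in> I. x \<star> w = fun_scale r w}"
        using rI(3) by (auto simp: mul_scale_left simp flip: mul_assoc)
    qed (use rI(1) in auto)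
    then have "P I'" using v by (auto simp: P_def I'_def)
    have sub: "I' \<subseteq> I" by (auto simp: I'_def)
    have "I' = I"
      by (rule FS.subspace_eq_of_dim[OF sub _ finite_\<iota>B _ min[OF \<open>P I'\<close>]])
        (use I right_ideal_span \<open>right_ideal I'\<close> in \<open>auto simp: P_def right_ideal_def\<close>)
    then show ?thesis by (auto simp: I'_def)
  qed
  have "\<exists>x\<in>I. \<exists>y\<in>I. x \<star> y \<noteq> 0"
  proof (rule ccontr)
    assume "\<not> ?thesis"
    then have z: "x \<star> y = 0" if "x \<in> I" "y \<in> I" for x y using that by blast
    \<comment> \<open>The right annihilator of the right ideal \<open>I\<close> is a two-sided
      ideal. If all products in \<open>I\<close> were 0, it would contain \<open>I\<close>, hence
      the unit.\<close>
    define J where "J = {z\<in>C. \<forall>x\<in>I. x \<star> z = 0}"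
    have "\<e> \<in> J"
    proof (rule two_sided_ideal_one)
      show "FS.subspace J" unfolding J_def
        by (rule FS.subspaceI) (auto simp: mul_add_right mul_scale_right FS.subspace_0[OF subspace_C]
            FS.subspace_add[OF subspace_C] FS.subspace_scale[OF subspace_C] fun_eq_iff)
      show "c \<star> x \<in> J" if "x \<in> J" "c \<in> C" for x c
        using that rI(3) mul_C by (auto simp: J_def simp flip: mul_assoc)
      show "x \<star> c \<in> J" if "x \<in> J" "c \<in> C" for x c
        using that mul_C by (auto simp: J_def simp flip: mul_assoc)
      show "w0 \<in> J" "w0 \<in> C" "w0 \<noteq> 0" using w0 rI(1) z by (auto simp: J_def)
    qed
    then have "w0 \<star> \<e> = 0" using w0 by (auto simp: J_def)
    then show False using w0 mul_one(2)[of w0] rI(1) by auto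
  qed
  then obtain x y where xy: "x \<in> I" "y \<in> I" "x \<star> y \<noteq> 0" by blast
  have "x \<in> C" using rI(1) xy(1) by blast
  moreover have "x \<star> w \<in> I" if "w \<in> I" for w using rI(1,3) xy(1) that by blast
  ultimately obtain r where r: "\<forall>w\<in>I. x \<star> w = fun_scale r w" using schur[of x] by blast
  have r0: "r \<noteq> 0" using r xy by auto
  define e where "e = fun_scale (inverse r) x"
  have eI: "e \<in> I" unfolding e_def by (rule FS.subspace_scale[OF rI(2) xy(1)])
  have ew: "e \<star> w = w" if "w \<in> I" for w
    using r that r0 by (simp add: e_def mul_scale_left flip: mult.assoc)
  have "e \<noteq> 0" using ew[OF w0(1)] w0(2) by auto
  moreover have "\<exists>s. e \<star> c \<star> e = fun_scale s e" if c: "c \<in> C" for c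
  proof -
    have "(e \<star> c) \<star> w \<in> I" if "w \<in> I" for w
      using rI(3)[OF eI] mul_C by (simp add: mul_assoc)
    then obtain s where "\<forall>w\<in>I. (e \<star> c) \<star> w = fun_scale s w" using schur[OF mul_C] by blast
    then show ?thesis using eI by blast
  qed
  ultimately show ?thesis using that[of e] eI rI(1) ew[OF eI] by blast
qed

end

section \<open>The simple module V, and the points of the variety as its lines\<close>

locale severi_brauer_split = severi_brauer scale B n
  for scale :: "'k::field \<Rightarrow> 'a::division_ring \<Rightarrow> 'a" and B n +
  fixes e :: "'a \<Rightarrow> 'k alg_closure"
  assumes e: "e \<in> C" "e \<noteq> 0" "e \<star> e = e" and eCe: "\<And>c. c \<in> C \<Longrightarrow> \<exists>r. e \<star> c \<star> e = fun_scale r e"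
begin

text \<open>\<open>V\<close> is C e, the simple left module, and \<open>W\<close> is e C, its dual
  under multiplication w x: such a product lies in e C e, which consists of the multiples of the
  primitive idempotent.\<close>

definition V :: "('a \<Rightarrow> 'k alg_closure) set" where "V = {x \<in> C. x \<star> e = x}"
definition W :: "('a \<Rightarrow> 'k alg_closure) set" where "W = {x \<in> C. e \<star> x = x}"

lemma VC: "x \<in> V \<Longrightarrow> x \<in> C" and WC: "x \<in> W \<Longrightarrow> x \<in> C" by (auto simp: V_def W_def)

lemma subspace_V: "FS.subspace V"
proof (rule FS.subspaceI)
  show "0 \<in> V" using FS.subspace_0[OF subspace_C] by (simp add: V_def)
  show "x + y \<in> V" if "x \<in> V" "y \<in> V" for x y
    using that FS.subspace_add[OF subspace_C] by (simp add: V_def mul_add_left)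
  show "fun_scale c x \<in> V" if "x \<in> V" for c x
    using that FS.subspace_scale[OF subspace_C] by (simp add: V_def mul_scale_left)
qed

lemma mul_V: "y \<in> V \<Longrightarrow> x \<star> y \<in> V"
  using mul_C by (simp add: V_def mul_assoc)

lemma mul_W: "x \<in> W \<Longrightarrow> x \<star> y \<in> W"
  using mul_C by (simp add: W_def flip: mul_assoc)

lemma mul_e_W: "e \<star> c \<in> W"
  using mul_C by (simp add: W_def e(3) flip: mul_assoc)

lemma pairing: assumes "w \<in> W" "x \<in> V" shows "\<exists>r. w \<star> x = fun_scale r e"
proof -
  have "w \<star> x = e \<star> (w \<star> x) \<star> e" using assms by (simp add: V_def W_def mul_assoc flip: mul_assoc[of e])
  then show ?thesis using eCe[OF mul_C] by metis
qed

lemma scale_e_cancel: "fun_scale r e = fun_scale s e \<Longrightarrow> r = s"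
  using e(2) FS.scale_cancel_right by blast

lemma W_span: "W \<subseteq> FS.span (\<iota> ` B)" and V_span: "V \<subseteq> FS.span (\<iota> ` B)"
  using C_span by (auto simp: V_def W_def)

text \<open>The products of V and W span the two-sided ideal C e C, which contains the unit. Writing
  the unit along a basis w of W defines the v i, and multiplying it by w i from the left shows that
  they are dual to w.\<close>

lemma dual_basis_aux:
  obtains N :: nat and v w where "\<And>i. i < N \<Longrightarrow> v i \<in> V \<and> w i \<in> W"
    "\<And>i j. i < N \<Longrightarrow> j < N \<Longrightarrow> w i \<star> v j = (if i = j then e else 0)"
    "\<e> = (\<Sum>i<N. v i \<star> w i)"
proof -
  obtain b where b: "b \<subseteq> W" "FS.independent b" "W \<subseteq> FS.span b" by (rule FS.maximal_independent_subset[of W])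
  have finb: "finite b" using FS.card_le_dim_of_independent[OF b(2,1) W_span finite_\<iota>B] by simp
  obtain w where w: "bij_betw w {..<card b} b"
    using ex_bij_betw_nat_finite[OF finb] by (auto simp: atLeast0LessThan)
  define N where "N = card b"
  have w': "inj_on w {..<N}" "w ` {..<N} = b" using w by (auto simp: bij_betw_def N_def)
  have wW: "w i \<in> W" if "i < N" for i using w'(2) b(1) that by blast
  have ind: "f i = g i" if "(\<Sum>i<N. fun_scale (f i) (w i)) = (\<Sum>i<N. fun_scale (g i) (w i))" "i < N" for f g i
  proof -
    have "(\<Sum>i<N. fun_scale (f i - g i) (w i)) = (\<Sum>i<N. fun_scale (f i) (w i)) - (\<Sum>i<N. fun_scale (g i) (w i))"
      by (rule ext) (simp add: sum_fun_apply left_diff_distrib sum_subtractf)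
    then have z: "(\<Sum>i<N. fun_scale (f i - g i) (w i)) = 0" using that(1) by simp
    define h where "h x = f (the_inv_into {..<N} w x) - g (the_inv_into {..<N} w x)" for x
    have "(\<Sum>x\<in>b. fun_scale (h x) x) = (\<Sum>i<N. fun_scale (h (w i)) (w i))"
      by (simp only: sum.reindex[OF w'(1)] o_def flip: w'(2))
    also have "\<dots> = (\<Sum>i<N. fun_scale (f i - g i) (w i))"
      by (rule sum.cong[OF refl]) (simp add: h_def the_inv_into_f_f[OF w'(1)])
    finally have "(\<Sum>x\<in>b. fun_scale (h x) x) = 0" using z by simp
    then have "h (w i) = 0" using FS.independentD[OF b(2) finb subset_refl, of h "w i"] w'(2) that(2) by blast
    then show ?thesis using that(2) by (simp add: h_def the_inv_into_f_f[OF w'(1)])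
  qed
  have span: "\<exists>f. x = (\<Sum>i<N. fun_scale (f i) (w i))" if "x \<in> W" for x
  proof -
    have "x \<in> FS.span b" using b(3) that by blast
    then obtain u where "x = (\<Sum>y\<in>b. fun_scale (u y) y)" using FS.span_finite[OF finb] by auto
    then have "x = (\<Sum>i<N. fun_scale (u (w i)) (w i))"
      by (simp only: sum.reindex[OF w'(1)] o_def flip: w'(2))
    then show ?thesis by (rule exI[of _ "\<lambda>i. u (w i)"])
  qed
  define J where "J = {(\<Sum>i<N. v i \<star> w i) |v. \<forall>i<N. v i \<in> V}"
  have JI: "(\<Sum>i<N. v i \<star> w i) \<in> J" if "\<forall>i<N. v i \<in> V" for v using that unfolding J_def by blast
  have VW: "x \<star> u \<in> J" if "x \<in> V" "u \<in> W" for x u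
  proof -
    obtain f where "u = (\<Sum>i<N. fun_scale (f i) (w i))" using span \<open>u \<in> W\<close> by blast
    then have "x \<star> u = (\<Sum>i<N. fun_scale (f i) x \<star> w i)"
      by (simp only: mul_sum_right mul_scale_right mul_scale_left)
    moreover have "\<forall>i<N. fun_scale (f i) x \<in> V" using FS.subspace_scale[OF subspace_V that(1)] by blast
    ultimately show ?thesis using JI[of "\<lambda>i. fun_scale (f i) x"] by simp
  qed
  have subJ: "FS.subspace J"
  proof (rule FS.subspaceI)
    show "0 \<in> J" using JI[of "\<lambda>_. 0"] FS.subspace_0[OF subspace_V] by simp
    show "x + y \<in> J" if "x \<in> J" "y \<in> J" for x y
    proof -
      obtain u v where uv: "\<forall>i<N. u i \<in> V" "\<forall>i<N. v i \<in> V" "x = (\<Sum>i<N. u i \<star> w i)" "y = (\<Sum>i<N. v i \<star> w i)"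
        using \<open>x \<in> J\<close> \<open>y \<in> J\<close> unfolding J_def by blast
      have "x + y = (\<Sum>i<N. (u i + v i) \<star> w i)" unfolding uv by (simp only: mul_add_left sum.distrib)
      then show ?thesis using JI[of "\<lambda>i. u i + v i"] uv FS.subspace_add[OF subspace_V] by simp
    qed
    show "fun_scale c x \<in> J" if "x \<in> J" for c x
    proof -
      obtain u where u: "\<forall>i<N. u i \<in> V" "x = (\<Sum>i<N. u i \<star> w i)" using \<open>x \<in> J\<close> unfolding J_def by blast
      have "fun_scale c x = (\<Sum>i<N. (fun_scale c (u i)) \<star> w i)"
        unfolding u by (simp only: FS.scale_sum_right mul_scale_left)
      then show ?thesis using JI[of "\<lambda>i. fun_scale c (u i)"] u FS.subspace_scale[OF subspace_V] by simp
    qed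
  qed
  have "\<e> \<in> J"
  proof (rule two_sided_ideal_one[OF subJ])
    show "c \<star> x \<in> J" if "x \<in> J" "c \<in> C" for x c
    proof -
      obtain u where u: "\<forall>i<N. u i \<in> V" "x = (\<Sum>i<N. u i \<star> w i)" using \<open>x \<in> J\<close> unfolding J_def by blast
      have "c \<star> x = (\<Sum>i<N. (c \<star> u i) \<star> w i)" unfolding u by (simp only: mul_sum_right mul_assoc)
      then show ?thesis using JI[of "\<lambda>i. c \<star> u i"] u mul_V by simp
    qed
    show "x \<star> c \<in> J" if "x \<in> J" "c \<in> C" for x c
    proof -
      obtain u where u: "\<forall>i<N. u i \<in> V" "x = (\<Sum>i<N. u i \<star> w i)" using \<open>x \<in> J\<close> unfolding J_def by blast
      have "x \<star> c = (\<Sum>i<N. u i \<star> (w i \<star> c))" unfolding u by (simp only: mul_sum_left mul_assoc)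
      also have "\<dots> \<in> J" by (rule FS.subspace_sum[OF subJ]) (use u VW wW mul_W in auto)
      finally show ?thesis .
    qed
    have "e \<in> V" "e \<in> W" using e by (auto simp: V_def W_def)
    then show "e \<in> J" using VW[of e e] e(3) by simp
  qed (use e in auto)
  then obtain v where v: "\<forall>i<N. v i \<in> V" "\<e> = (\<Sum>i<N. v i \<star> w i)" unfolding J_def by blast
  have "w i \<star> v j = (if i = j then e else 0)" if ij: "i < N" "j < N" for i j
  proof -
    have "\<forall>j. \<exists>r. j < N \<longrightarrow> w i \<star> v j = fun_scale r e" using pairing wW ij(1) v(1) by blast
    then obtain r where r: "\<And>j. j < N \<Longrightarrow> w i \<star> v j = fun_scale (r j) e" by metis
    have ew: "e \<star> w j = w j" if "j < N" for j using wW[OF that] by (simp add: W_def)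
    have "w i = w i \<star> \<e>" using mul_one(2)[OF WC[OF wW[OF ij(1)]]] by simp
    also have "\<dots> = (\<Sum>j<N. (w i \<star> v j) \<star> w j)" unfolding v(2) by (simp only: mul_sum_right mul_assoc)
    also have "\<dots> = (\<Sum>j<N. fun_scale (r j) (w j))"
      by (rule sum.cong[OF refl]) (simp add: r mul_scale_left ew)
    finally have 1: "w i = (\<Sum>j<N. fun_scale (r j) (w j))" .
    have "(\<Sum>j<N. fun_scale (if i = j then 1 else 0) (w j)) = (\<Sum>j<N. if i = j then w i else 0)"
      by (rule sum.cong[OF refl]) (auto simp: fun_eq_iff)
    also have "\<dots> = w i" using ij(1) by (subst sum.delta') auto
    finally have "r j = (if i = j then 1 else 0)" using ind[of r "\<lambda>j. if i = j then 1 else 0" j] 1 ij(2) by metis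
    then show ?thesis using r[OF ij(2)] by (auto simp: fun_eq_iff)
  qed
  then show ?thesis using that[of N v w] v wW by blast
qed

text \<open>The products v i w j behave as matrix units, so they form a basis of C; counting them
  gives N = n.\<close>

lemma dual_basis:
  obtains v w where "\<And>i. i < n \<Longrightarrow> v i \<in> V \<and> w i \<in> W"
    "\<And>i j. i < n \<Longrightarrow> j < n \<Longrightarrow> w i \<star> v j = (if i = j then e else 0)"
    "\<e> = (\<Sum>i<n. v i \<star> w i)"
proof -
  obtain N :: nat and v w where vw: "\<And>i. i < N \<Longrightarrow> v i \<in> V \<and> w i \<in> W"
    "\<And>i j. i < N \<Longrightarrow> j < N \<Longrightarrow> w i \<star> v j = (if i = j then e else 0)"
    "\<e> = (\<Sum>i<N. v i \<star> w i)"
    by (rule dual_basis_aux) (rule that)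
  define E where "E p = v (fst p) \<star> w (snd p)" for p
  define S where "S = {..<N} \<times> {..<N}"
  have ve: "v i \<star> e = v i" "e \<star> w i = w i" if "i < N" for i using vw(1)[OF that] by (auto simp: V_def W_def)
  have key: "w k \<star> (E p \<star> v l) = (if p = (k, l) then e else 0)" if kl: "p \<in> S" "k < N" "l < N" for p k l
  proof -
    obtain i j where p: "p = (i, j)" "i < N" "j < N" using kl(1) by (auto simp: S_def)
    have "w k \<star> (E p \<star> v l) = (w k \<star> v i) \<star> (w j \<star> v l)" by (simp add: E_def p mul_assoc)
    also have "\<dots> = (if k = i \<and> j = l then e else 0)" using vw(2) p kl by (auto simp: e(3))
    finally show ?thesis using p(1) by auto
  qed
  have inj: "inj_on E S"
  proof (rule inj_onI)
    fix p q assume pq: "p \<in> S" "q \<in> S" "E p = E q"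
    obtain k l where kl: "p = (k, l)" "k < N" "l < N" using pq(1) by (auto simp: S_def)
    have "w k \<star> (E q \<star> v l) = e" using key[OF pq(1) kl(2,3)] kl(1) pq(3) by simp
    then show "p = q" using key[OF pq(2) kl(2,3)] e(2) kl(1) by (cases "q = (k, l)") auto
  qed
  have finS: "finite S" by (simp add: S_def)
  have "FS.independent (E ` S)"
  proof (rule FS.independent_if_scalars_zero)
    fix f x assume s: "(\<Sum>x\<in>E ` S. fun_scale (f x) x) = 0" and "x \<in> E ` S"
    then obtain p where p: "p \<in> S" "x = E p" by blast
    obtain k l where kl: "p = (k, l)" "k < N" "l < N" using p(1) by (auto simp: S_def)
    have "(\<Sum>q\<in>S. fun_scale (f (E q)) (E q)) = 0" using s by (simp only: sum.reindex[OF inj] o_def)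
    then have "w k \<star> ((\<Sum>q\<in>S. fun_scale (f (E q)) (E q)) \<star> v l) = 0" by simp
    then have "(\<Sum>q\<in>S. fun_scale (f (E q)) (w k \<star> (E q \<star> v l))) = 0"
      by (simp only: mul_sum_left mul_sum_right mul_scale_left mul_scale_right)
    also have "(\<Sum>q\<in>S. fun_scale (f (E q)) (w k \<star> (E q \<star> v l))) = (\<Sum>q\<in>S. if q = p then fun_scale (f (E p)) e else 0)"
      by (rule sum.cong[OF refl]) (use key kl in \<open>auto simp: fun_eq_iff\<close>)
    also have "\<dots> = fun_scale (f (E p)) e" using p(1) finS by (subst sum.delta) auto
    finally show "f x = 0" using e(2) p(2) FS.scale_eq_0_iff by blast
  qed (use finS in simp)
  moreover have "C \<subseteq> FS.span (E ` S)"
  proof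
    fix x assume x: "x \<in> C"
    have "\<forall>p. \<exists>r. p \<in> S \<longrightarrow> w (fst p) \<star> (x \<star> v (snd p)) = fun_scale r e"
    proof
      fix p show "\<exists>r. p \<in> S \<longrightarrow> w (fst p) \<star> (x \<star> v (snd p)) = fun_scale r e"
        using pairing[of "w (fst p)" "x \<star> v (snd p)"] vw(1) mul_V by (auto simp: S_def)
    qed
    then obtain r where r: "\<And>p. p \<in> S \<Longrightarrow> w (fst p) \<star> (x \<star> v (snd p)) = fun_scale (r p) e" by metis
    have "x = \<e> \<star> (x \<star> \<e>)" using mul_one x by simp
    also have "\<dots> = (\<Sum>i<N. \<Sum>j<N. v i \<star> ((w i \<star> (x \<star> v j)) \<star> w j))"
      unfolding vw(3) by (simp only: mul_sum_left mul_sum_right mul_assoc) (rule sum.swap)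
    also have "\<dots> = (\<Sum>p\<in>S. v (fst p) \<star> ((w (fst p) \<star> (x \<star> v (snd p))) \<star> w (snd p)))"
      unfolding S_def by (simp only: sum.cartesian_product split_def)
    also have "\<dots> = (\<Sum>p\<in>S. fun_scale (r p) (E p))"
      by (rule sum.cong[OF refl]) (use r ve in \<open>auto simp: E_def S_def mul_scale_left mul_scale_right\<close>)
    also have "\<dots> \<in> FS.span (E ` S)" by (intro FS.span_sum FS.span_scale FS.span_base imageI)
    finally show "x \<in> FS.span (E ` S)" .
  qed
  moreover have "E ` S \<subseteq> C" using mul_C by (auto simp: E_def)
  ultimately have "card (E ` S) = FS.dim C" using FS.basis_card_eq_dim by blast
  then have "N * N = n\<^sup>2" using card_image[OF inj] dim_C by (simp add: S_def)
  then have "N = n" by (simp flip: power2_eq_square)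
  show ?thesis by (rule that[of v w]) (fact vw[unfolded \<open>N = n\<close>])+
qed

definition pt :: "('a \<Rightarrow> 'k alg_closure) \<Rightarrow> ('a \<Rightarrow> 'k alg_closure) set" where
  "pt x = (\<lambda>c. x \<star> c) ` C"

definition dual_pair :: "(nat \<Rightarrow> 'a \<Rightarrow> 'k alg_closure) \<times> (nat \<Rightarrow> 'a \<Rightarrow> 'k alg_closure)" where
  "dual_pair = (SOME p. (\<forall>i<n. fst p i \<in> V \<and> snd p i \<in> W) \<and>
     (\<forall>i<n. \<forall>j<n. snd p i \<star> fst p j = (if i = j then e else 0)) \<and> \<e> = (\<Sum>i<n. fst p i \<star> snd p i))"

definition v :: "nat \<Rightarrow> 'a \<Rightarrow> 'k alg_closure" where "v = fst dual_pair"
definition w :: "nat \<Rightarrow> 'a \<Rightarrow> 'k alg_closure" where "w = snd dual_pair"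

lemma vw: "i < n \<Longrightarrow> v i \<in> V" "i < n \<Longrightarrow> w i \<in> W"
  "i < n \<Longrightarrow> j < n \<Longrightarrow> w i \<star> v j = (if i = j then e else 0)" "\<e> = (\<Sum>i<n. v i \<star> w i)"
proof -
  have "\<exists>p. (\<forall>i<n. fst p i \<in> V \<and> snd p i \<in> W) \<and>
     (\<forall>i<n. \<forall>j<n. snd p i \<star> fst p j = (if i = j then e else 0)) \<and> \<e> = (\<Sum>i<n. fst p i \<star> snd p i)"
  proof (rule dual_basis)
    fix v w assume *: "\<And>i. i < n \<Longrightarrow> v i \<in> V \<and> w i \<in> W"
      "\<And>i j. i < n \<Longrightarrow> j < n \<Longrightarrow> w i \<star> v j = (if i = j then e else 0)" "\<e> = (\<Sum>i<n. v i \<star> w i)"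
    show ?thesis by (rule exI[of _ "(v, w)"]) (use * in simp)
  qed
  from someI_ex[OF this, folded dual_pair_def v_def w_def]
  show "i < n \<Longrightarrow> v i \<in> V" "i < n \<Longrightarrow> w i \<in> W"
    "i < n \<Longrightarrow> j < n \<Longrightarrow> w i \<star> v j = (if i = j then e else 0)" "\<e> = (\<Sum>i<n. v i \<star> w i)"
    by blast+
qed

lemma expand_left: "x \<in> C \<Longrightarrow> x = (\<Sum>i<n. v i \<star> (w i \<star> x))"
  using mul_one(1)[of x] vw(4) by (simp only: mul_sum_left mul_assoc)

lemma expand_right: "x \<in> C \<Longrightarrow> x = (\<Sum>i<n. (x \<star> v i) \<star> w i)"
  using mul_one(2)[of x] vw(4) by (simp only: mul_sum_right mul_assoc)

lemma left_inverse_V: assumes "x \<in> V" "x \<noteq> 0" shows "\<exists>c\<in>W. c \<star> x = e"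
proof -
  have "\<exists>i<n. w i \<star> x \<noteq> 0"
  proof (rule ccontr)
    assume "\<not> ?thesis"
    then have "x = (\<Sum>i<n. v i \<star> 0)" using expand_left[OF VC[OF assms(1)]] by simp
    then show False using assms(2) by simp
  qed
  then obtain i where i: "i < n" "w i \<star> x \<noteq> 0" by blast
  obtain r where r: "w i \<star> x = fun_scale r e" using pairing vw(2) i(1) assms(1) by blast
  have "r \<noteq> 0" using i r by (auto simp: fun_eq_iff)
  then have "fun_scale (inverse r) (w i) \<star> x = e" by (simp add: mul_scale_left r flip: mult.assoc)
  moreover have "fun_scale (inverse r) (w i) \<in> W"
    using vw(2)[OF i(1)] FS.subspace_scale[OF subspace_C] by (simp add: W_def mul_scale_right)
  ultimately show ?thesis by blast
qed

lemma W_expand: assumes "x \<in> W" shows "\<exists>f. x = (\<Sum>i<n. fun_scale (f i) (w i))"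
proof -
  have "\<forall>i. \<exists>r. i < n \<longrightarrow> x \<star> v i = fun_scale r e" using pairing assms vw(1) by blast
  then obtain f where f: "\<And>i. i < n \<Longrightarrow> x \<star> v i = fun_scale (f i) e" by metis
  have "x = (\<Sum>i<n. (x \<star> v i) \<star> w i)" by (rule expand_right[OF WC[OF assms]])
  also have "\<dots> = (\<Sum>i<n. fun_scale (f i) (w i))"
    by (rule sum.cong[OF refl]) (use f vw(2) in \<open>auto simp: mul_scale_left W_def\<close>)
  finally show ?thesis by blast
qed

text \<open>A left inverse of \<open>x\<close> in W carries the vectors x w i back to the dual basis
  w i, which gives independence. They span because x c = x (e c) and e c lies in W.\<close>

lemma pt_basis:
  assumes x: "x \<in> V" "x \<noteq> 0"
  shows "inj_on (\<lambda>i. x \<star> w i) {..<n}" "FS.independent ((\<lambda>i. x \<star> w i) ` {..<n})"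
    "FS.span ((\<lambda>i. x \<star> w i) ` {..<n}) = pt x"
proof -
  obtain c where c: "c \<in> W" "c \<star> x = e" using left_inverse_V x by blast
  have key: "(c \<star> (x \<star> w i)) \<star> v j = (if i = j then e else 0)" if "i < n" "j < n" for i j
  proof -
    have "(c \<star> (x \<star> w i)) \<star> v j = e \<star> w i \<star> v j" by (simp only: c(2) flip: mul_assoc)
    also have "e \<star> w i = w i" using vw(2) that by (simp add: W_def)
    finally show ?thesis using vw(3) that by simp
  qed
  show inj: "inj_on (\<lambda>i. x \<star> w i) {..<n}"
  proof (rule inj_onI)
    fix i j assume ij: "i \<in> {..<n}" "j \<in> {..<n}" "x \<star> w i = x \<star> w j"
    then have "(if i = j then e else 0) = e" using key[of i j] key[of j j] by simp
    then show "i = j" using e(2) by (auto split: if_splits)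
  qed
  show "FS.independent ((\<lambda>i. x \<star> w i) ` {..<n})"
  proof (rule FS.independent_if_scalars_zero)
    fix f y assume s: "(\<Sum>y\<in>(\<lambda>i. x \<star> w i) ` {..<n}. fun_scale (f y) y) = 0" and "y \<in> (\<lambda>i. x \<star> w i) ` {..<n}"
    then obtain j where j: "j < n" "y = x \<star> w j" by blast
    have "(\<Sum>i<n. fun_scale (f (x \<star> w i)) (x \<star> w i)) = 0" using s by (simp only: sum.reindex[OF inj] o_def)
    then have "(c \<star> (\<Sum>i<n. fun_scale (f (x \<star> w i)) (x \<star> w i))) \<star> v j = 0" by simp
    then have "(\<Sum>i<n. fun_scale (f (x \<star> w i)) ((c \<star> (x \<star> w i)) \<star> v j)) = 0"
      by (simp only: mul_sum_right mul_sum_left mul_scale_right mul_scale_left)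
    also have "(\<Sum>i<n. fun_scale (f (x \<star> w i)) ((c \<star> (x \<star> w i)) \<star> v j)) = (\<Sum>i<n. if i = j then fun_scale (f y) e else 0)"
    proof (rule sum.cong[OF refl])
      fix i assume "i \<in> {..<n}"
      then show "fun_scale (f (x \<star> w i)) ((c \<star> (x \<star> w i)) \<star> v j) = (if i = j then fun_scale (f y) e else 0)"
        using key[of i j] j by (cases "i = j") (simp_all add: zero_fun_def)
    qed
    also have "\<dots> = fun_scale (f y) e" using j(1) by (subst sum.delta) auto
    finally show "f y = 0" using e(2) FS.scale_eq_0_iff by blast
  qed simp
  show "FS.span ((\<lambda>i. x \<star> w i) ` {..<n}) = pt x"
  proof
    have "(\<lambda>i. x \<star> w i) ` {..<n} \<subseteq> pt x" using vw(2) WC by (auto simp: pt_def)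
    moreover have "FS.subspace (pt x)"
      using right_ideal_principal[OF VC[OF x(1)]] unfolding right_ideal_def pt_def by blast
    ultimately show "FS.span ((\<lambda>i. x \<star> w i) ` {..<n}) \<subseteq> pt x" by (rule FS.span_minimal)
    show "pt x \<subseteq> FS.span ((\<lambda>i. x \<star> w i) ` {..<n})"
    proof
      fix y assume "y \<in> pt x"
      then obtain d where d: "y = x \<star> d" by (auto simp: pt_def)
      have "y = x \<star> (e \<star> d)" using x(1) d by (simp add: V_def flip: mul_assoc)
      moreover obtain f where "e \<star> d = (\<Sum>i<n. fun_scale (f i) (w i))" using W_expand[OF mul_e_W] by blast
      ultimately have "y = (\<Sum>i<n. fun_scale (f i) (x \<star> w i))" by (simp only: mul_sum_right mul_scale_right)
      then show "y \<in> FS.span ((\<lambda>i. x \<star> w i) ` {..<n})"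
        by (simp only:) (intro FS.span_sum FS.span_scale FS.span_base imageI)
    qed
  qed
qed

lemma dim_pt: assumes "x \<in> V" "x \<noteq> 0" shows "FS.dim (pt x) = n"
  using FS.dim_span_eq_card_independent[OF pt_basis(2)[OF assms]] card_image[OF pt_basis(1)[OF assms]]
    pt_basis(3)[OF assms] by simp

lemma SB_points_alt: "SB_points scale B n = {I. right_ideal I \<and> FS.dim I = n}"
  by (auto simp: SB_points_def right_ideal_def mul_def)

lemma pt_SB: assumes "x \<in> V" "x \<noteq> 0" shows "pt x \<in> SB_points scale B n"
  using right_ideal_principal[OF VC[OF assms(1)]] dim_pt[OF assms] by (simp add: SB_points_alt pt_def)

lemma pt_mem: "x \<in> V \<Longrightarrow> x \<in> pt x"
  using e(1) by (auto simp: pt_def V_def intro!: rev_image_eqI[of e])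

lemma n_pos: "n > 0"
proof (rule Nat.gr0I)
  assume "n = 0"
  then have "\<e> = 0" using vw(4) by simp
  then show False using one_nonzero by simp
qed

text \<open>A nonzero y in \<open>I\<close> has a nonzero product y v i, which lies in both
  \<open>I\<close> and V; the ideal it generates already has dimension \<open>n\<close>.\<close>

lemma SB_point_exists:
  assumes I: "I \<in> SB_points scale B n" obtains x where "x \<in> V" "x \<noteq> 0" "I = pt x"
proof -
  have rI: "right_ideal I" "FS.dim I = n" using I by (auto simp: SB_points_alt)
  have "\<not> I \<subseteq> {0}"
  proof
    assume "I \<subseteq> {0}"
    then have "FS.dim I \<le> card ({} :: ('a \<Rightarrow> 'k alg_closure) set)" by (intro FS.dim_le_card) auto
    then show False using rI(2) n_pos by simp
  qed
  then obtain y where y: "y \<in> I" "y \<noteq> 0" by blast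
  have yC: "y \<in> C" using y rI by (auto simp: right_ideal_def)
  have "\<exists>i<n. y \<star> v i \<noteq> 0"
  proof (rule ccontr)
    assume "\<not> ?thesis"
    then have "y = (\<Sum>i<n. 0 \<star> w i)" using expand_right[OF yC] by simp
    then show False using y(2) by simp
  qed
  then obtain i where i: "i < n" "y \<star> v i \<noteq> 0" by blast
  define x where "x = y \<star> v i"
  have x: "x \<in> V" "x \<noteq> 0" "x \<in> I"
    using i mul_V vw(1) rI(1) y(1) VC by (auto simp: x_def right_ideal_def)
  have sub: "pt x \<subseteq> I" using x(3) rI(1) by (auto simp: pt_def right_ideal_def)
  have "pt x = I"
    by (rule FS.subspace_eq_of_dim[OF sub right_ideal_span[OF rI(1)] finite_\<iota>B])
      (use right_ideal_principal[OF VC[OF x(1)]] dim_pt[OF x(1,2)] rI(2) in \<open>auto simp: right_ideal_def pt_def\<close>)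
  then show ?thesis using that x by blast
qed

text \<open>The ideal of x meets V only in the line of x, since e c e is a multiple of e.\<close>

lemma mem_pt_V: assumes "x \<in> V" "y \<in> pt x" "y \<in> V" shows "par y x"
proof -
  obtain c where c: "y = x \<star> c" "c \<in> C" using assms(2) by (auto simp: pt_def)
  have "y = x \<star> (e \<star> c \<star> e)" using assms(1,3) c(1) by (simp add: V_def flip: mul_assoc)
  moreover obtain r where "e \<star> c \<star> e = fun_scale r e" using eCe c(2) by blast
  ultimately have "y = fun_scale r x" using assms(1) by (simp add: mul_scale_right V_def)
  then show ?thesis by (auto simp: par_def)
qed

lemma pt_eqD: "x \<in> V \<Longrightarrow> y \<in> V \<Longrightarrow> pt x = pt y \<Longrightarrow> par x y"
  using mem_pt_V pt_mem by blast

lemma pt_eqI: assumes "par x y" "x \<noteq> 0" shows "pt x = pt y"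
proof -
  obtain r where r: "x = fun_scale r y" using assms(1) by (auto simp: par_def)
  then have r0: "r \<noteq> 0" using assms(2) by (auto simp: fun_eq_iff)
  have "y \<star> c \<in> pt x" if "c \<in> C" for c
  proof -
    have "y \<star> c = x \<star> fun_scale (inverse r) c" using r r0 by (simp add: mul_scale_left mul_scale_right flip: mult.assoc)
    then show ?thesis using that FS.subspace_scale[OF subspace_C] by (auto simp: pt_def)
  qed
  moreover have "x \<star> c \<in> pt y" if "c \<in> C" for c
  proof -
    have "x \<star> c = y \<star> fun_scale r c" using r by (simp add: mul_scale_left mul_scale_right)
    then show ?thesis using that FS.subspace_scale[OF subspace_C] by (auto simp: pt_def)
  qed
  ultimately show ?thesis by (auto simp: pt_def)
qed

end

section \<open>Pluecker coordinates and morphisms\<close>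

lemma form_one: "form T 0 (\<lambda>_. 1)"
  using form.const[of T 1] by simp

lemma form_prod:
  assumes "finite S" "\<And>i. i \<in> S \<Longrightarrow> form T (d i) (P i)"
  shows "form T (\<Sum>i\<in>S. d i) (\<lambda>v. \<Prod>i\<in>S. P i v)"
  using assms by (induction S rule: finite_induct) (simp_all add: form_one form.mult)

lemma form_homogeneous: "form T d P \<Longrightarrow> P (\<lambda>i. c * v i) = c ^ d * P v"
  by (induction rule: form.induct) (simp_all add: algebra_simps power_add)

text \<open>Clearing denominators in the pullback of the ratios of two coordinates.\<close>

lemma endomorphism_forms:
  assumes f: "endomorphism T \<phi> Y f" and fin: "finite T" and x0: "x0 \<in> Y" and J0: "J0 \<in> T" "\<phi> (f x0) J0 \<noteq> 0"
  shows "\<exists>D R. (\<forall>J\<in>T. form T D (R J)) \<and> (\<exists>J\<in>T. R J (\<phi> x0) \<noteq> 0) \<and> (\<forall>x\<in>Y. \<exists>\<kappa>. \<forall>J\<in>T. R J (\<phi> x) = \<kappa> * \<phi> (f x) J)"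
proof -
  define U where "U = Y - {y\<in>Y. \<forall>F\<in>{\<lambda>v. v J0}. F (\<phi> y) = 0}"
  have U: "y \<in> U \<longleftrightarrow> y \<in> Y \<and> \<phi> y J0 \<noteq> 0" for y by (auto simp: U_def)
  have oU: "zariski_open T \<phi> Y U"
    unfolding zariski_open_def U_def by (rule exI[of _ "{\<lambda>v. v J0}"]) (use form.coord[OF J0(1)] in auto)
  have "regular_on T \<phi> Y U (\<lambda>y. \<phi> y J / \<phi> y J0)" if "J \<in> T" for J
    unfolding regular_on_def
  proof
    fix y assume "y \<in> U"
    then show "\<exists>V d P Q. zariski_open T \<phi> Y V \<and> y \<in> V \<and> V \<subseteq> U \<and> form T d P \<and> form T d Q \<and>
        (\<forall>y\<in>V. Q (\<phi> y) \<noteq> 0 \<and> \<phi> y J / \<phi> y J0 = P (\<phi> y) / Q (\<phi> y))"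
      by (intro exI[of _ U] exI[of _ "1::nat"] exI[of _ "\<lambda>v. v J"] exI[of _ "\<lambda>v. v J0"])
        (use oU U form.coord J0(1) that in auto)
  qed
  then have reg: "regular_on T \<phi> Y {x\<in>Y. f x \<in> U} (\<lambda>x. \<phi> (f x) J / \<phi> (f x) J0)" if "J \<in> T" for J
    using f oU that unfolding endomorphism_def by blast
  have fY: "f x \<in> Y" if "x \<in> Y" for x using f that unfolding endomorphism_def by blast
  have x0U: "x0 \<in> {x\<in>Y. f x \<in> U}" using x0 J0(2) fY by (simp add: U)
  define Pr where "Pr J F e d P Q \<longleftrightarrow> form T e F \<and> F (\<phi> x0) \<noteq> 0 \<and> form T d P \<and> form T d Q \<and>
      (\<forall>x\<in>Y. F (\<phi> x) \<noteq> 0 \<longrightarrow> f x \<in> U \<and> Q (\<phi> x) \<noteq> 0 \<and> \<phi> (f x) J / \<phi> (f x) J0 = P (\<phi> x) / Q (\<phi> x))"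
    for J F e d P Q
  have "\<exists>F e d P Q. Pr J F e d P Q"
    if J: "J \<in> T" for J
  proof -
    obtain V d P Q where V: "zariski_open T \<phi> Y V" "x0 \<in> V" "V \<subseteq> {x\<in>Y. f x \<in> U}" "form T d P" "form T d Q"
      "\<forall>x\<in>V. Q (\<phi> x) \<noteq> 0 \<and> \<phi> (f x) J / \<phi> (f x) J0 = P (\<phi> x) / Q (\<phi> x)"
      using reg[OF J] x0U unfolding regular_on_def by meson
    obtain Fs where Fs: "\<forall>F\<in>Fs. \<exists>d. form T d F" "V = Y - {x\<in>Y. \<forall>F\<in>Fs. F (\<phi> x) = 0}"
      using V(1) unfolding zariski_open_def by blast
    obtain F where F: "F \<in> Fs" "F (\<phi> x0) \<noteq> 0" using V(2) Fs(2) x0 by blast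
    obtain e where e: "form T e F" using Fs(1) F(1) by blast
    have "x \<in> V" if "x \<in> Y" "F (\<phi> x) \<noteq> 0" for x using that F(1) Fs(2) by blast
    then have "Pr J F e d P Q" unfolding Pr_def using V F(2) e by blast
    then show ?thesis by blast
  qed
  then have "\<forall>J. \<exists>F e d P Q. J \<in> T \<longrightarrow> Pr J F e d P Q" by blast
  then obtain F e d P Q where pr: "\<And>J. J \<in> T \<Longrightarrow> Pr J (F J) (e J) (d J) (P J) (Q J)" by metis
  have *: "\<And>J. J \<in> T \<Longrightarrow> form T (e J) (F J)" "\<And>J. J \<in> T \<Longrightarrow> F J (\<phi> x0) \<noteq> 0"
    "\<And>J. J \<in> T \<Longrightarrow> form T (d J) (P J)" "\<And>J. J \<in> T \<Longrightarrow> form T (d J) (Q J)"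
    "\<And>J x. J \<in> T \<Longrightarrow> x \<in> Y \<Longrightarrow> F J (\<phi> x) \<noteq> 0 \<Longrightarrow> f x \<in> U"
    "\<And>J x. J \<in> T \<Longrightarrow> x \<in> Y \<Longrightarrow> F J (\<phi> x) \<noteq> 0 \<Longrightarrow> Q J (\<phi> x) \<noteq> 0"
    "\<And>J x. J \<in> T \<Longrightarrow> x \<in> Y \<Longrightarrow> F J (\<phi> x) \<noteq> 0 \<Longrightarrow> \<phi> (f x) J / \<phi> (f x) J0 = P J (\<phi> x) / Q J (\<phi> x)"
    using pr unfolding Pr_def by blast+
  \<comment> \<open>The remaining factors clear the denominators \<open>Q\<close>. The product of
    all \<open>F\<close> makes every \<open>R J\<close> vanish where some local fraction is not
    known to be valid, so that the relation holds there with factor 0.\<close>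
  define R where "R J = (\<lambda>v. (\<Prod>J\<in>T. F J v) * (P J v * (\<Prod>J'\<in>T - {J}. Q J' v)))" for J
  define D where "D = (\<Sum>J\<in>T. e J) + (\<Sum>J\<in>T. d J)"
  have "form T D (R J)" if J: "J \<in> T" for J
  proof -
    have "form T ((\<Sum>J\<in>T. e J) + (d J + (\<Sum>J'\<in>T - {J}. d J'))) (R J)"
      unfolding R_def by (intro form.mult form_prod) (use * fin J in auto)
    then show ?thesis using sum.remove[OF fin J, of d] by (simp add: D_def)
  qed
  moreover have "R J0 (\<phi> x0) \<noteq> 0"
  proof -
    have "P J0 (\<phi> x0) \<noteq> 0" using *(7)[OF J0(1) x0 *(2)[OF J0(1)]] J0(2) by auto
    moreover have "Q J (\<phi> x0) \<noteq> 0" if "J \<in> T" for J using *(6)[OF that x0 *(2)[OF that]] .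
    ultimately show ?thesis using *(2) fin by (simp add: R_def)
  qed
  moreover have "\<exists>\<kappa>. \<forall>J\<in>T. R J (\<phi> x) = \<kappa> * \<phi> (f x) J" if x: "x \<in> Y" for x
  proof (cases "(\<Prod>J\<in>T. F J (\<phi> x)) = 0")
    case True
    then show ?thesis by (intro exI[of _ 0]) (simp add: R_def)
  next
    case False
    then have F0: "F J (\<phi> x) \<noteq> 0" if "J \<in> T" for J using that fin by auto
    have n0: "\<phi> (f x) J0 \<noteq> 0" using *(5)[OF J0(1) x F0[OF J0(1)]] by (simp add: U)
    have "R J (\<phi> x) = ((\<Prod>J\<in>T. F J (\<phi> x)) * (\<Prod>J\<in>T. Q J (\<phi> x)) / \<phi> (f x) J0) * \<phi> (f x) J" if J: "J \<in> T" for J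
    proof -
      have "P J (\<phi> x) = \<phi> (f x) J / \<phi> (f x) J0 * Q J (\<phi> x)"
        using *(7)[OF J x F0[OF J]] *(6)[OF J x F0[OF J]] by simp
      then show ?thesis using prod.remove[OF fin J, of "\<lambda>J. Q J (\<phi> x)"] by (simp add: R_def mult_ac)
    qed
    then show ?thesis by blast
  qed
  ultimately show ?thesis using J0(1) by blast
qed

section \<open>Minors of families and Pluecker coordinates\<close>

definition minor :: "nat \<Rightarrow> (nat \<Rightarrow> 'a \<Rightarrow> 'l::comm_ring_1) \<Rightarrow> (nat \<Rightarrow> 'a) \<Rightarrow> 'l" where
  "minor n b J = det (mat n n (\<lambda>(i, j). b i (J j)))"

text \<open>Laplace expansion along the last column. It is the only column that involves x, so the
  cofactors do not.\<close>

lemma minor_last: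
  "\<exists>c. (\<forall>x. minor (Suc k) b (J(k := x)) = (\<Sum>i<Suc k. c i * b i x)) \<and> c k = minor k b J"
proof -
  define M where "M x = mat (Suc k) (Suc k) (\<lambda>(i, j). b i ((J(k := x)) j))" for x
  define c where "c i = cofactor (M undefined) i k" for i
  have cof: "cofactor (M x) i k = c i" if "i < Suc k" for x i
  proof -
    have "mat_delete (M x) i k = mat_delete (M undefined) i k"
      using that by (intro eq_matI) (auto simp: M_def mat_delete_def)
    then show ?thesis by (simp add: c_def cofactor_def)
  qed
  have "minor (Suc k) b (J(k := x)) = (\<Sum>i<Suc k. c i * b i x)" for x
  proof -
    have "det (M x) = (\<Sum>i<Suc k. M x $$ (i, k) * cofactor (M x) i k)"
      by (rule laplace_expansion_column) (auto simp: M_def)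
    also have "\<dots> = (\<Sum>i<Suc k. c i * b i x)"
      by (rule sum.cong[OF refl]) (use cof in \<open>auto simp: M_def mult.commute\<close>)
    finally show ?thesis by (simp add: minor_def M_def)
  qed
  moreover have "c k = minor k b J"
  proof -
    have "mat_delete (M undefined) k k = mat k k (\<lambda>(i, j). b i (J j))"
      by (intro eq_matI) (auto simp: M_def mat_delete_def)
    then show ?thesis by (simp add: c_def cofactor_def minor_def)
  qed
  ultimately show ?thesis by blast
qed

text \<open>A nonzero minor of the first k rows is the coefficient of the new row in the expansion
  along a new last column. Independence makes this combination of rows nonzero at some index, and
  the support condition puts that index into \<open>B\<close>.\<close>

lemma minor_nonzero:
  assumes ind: "\<And>c. (\<And>x. (\<Sum>i<n. c i * b i x) = 0) \<Longrightarrow> \<forall>i<n. c i = 0" and supp: "\<And>i x. i < n \<Longrightarrow> x \<notin> B \<Longrightarrow> b i x = (0 :: 'l::field)"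
  shows "\<exists>J\<in>{..<n} \<rightarrow>\<^sub>E B. minor n b J \<noteq> 0"
  using assms
proof (induction n)
  case 0
  then show ?case by (auto simp: minor_def)
next
  case (Suc k)
  have "\<forall>i<k. c i = 0" if "\<And>x. (\<Sum>i<k. c i * b i x) = 0" for c
  proof -
    have "(\<Sum>i<Suc k. (if i < k then c i else 0) * b i x) = 0" for x using that[of x] by simp
    then have "\<forall>i<Suc k. (if i < k then c i else 0) = 0" by (rule Suc.prems(1))
    then show ?thesis by (metis less_SucI)
  qed
  then obtain J where J: "J \<in> {..<k} \<rightarrow>\<^sub>E B" "minor k b J \<noteq> 0" using Suc.IH Suc.prems(2) by fastforce
  obtain c where c: "\<And>x. minor (Suc k) b (J(k := x)) = (\<Sum>i<Suc k. c i * b i x)" "c k = minor k b J"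
    using minor_last[of k b J] by blast
  have "\<exists>x. (\<Sum>i<Suc k. c i * b i x) \<noteq> 0"
  proof (rule ccontr)
    assume "\<not> ?thesis"
    then have "\<forall>i<Suc k. c i = 0" by (intro Suc.prems(1)) blast
    then show False using c(2) J(2) by simp
  qed
  then obtain x where x: "(\<Sum>i<Suc k. c i * b i x) \<noteq> 0" by blast
  have "x \<in> B"
  proof (rule ccontr)
    assume "x \<notin> B"
    then have "(\<Sum>i<Suc k. c i * b i x) = 0" using Suc.prems(2) by (intro sum.neutral) auto
    then show False using x by blast
  qed
  then have "J(k := x) \<in> {..<Suc k} \<rightarrow>\<^sub>E B" using J(1) by (auto simp: PiE_iff extensional_def less_Suc_eq)
  then show ?case using c(1) x by metis
qed

lemma minor_change_basis:
  assumes "\<And>i x. i < n \<Longrightarrow> b i x = (\<Sum>k<n. m i k * b' k x)"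
  shows "minor n b J = det (mat n n (\<lambda>(i, k). m i k)) * minor n b' J"
proof -
  have "mat n n (\<lambda>(i, j). b i (J j)) = mat n n (\<lambda>(i, k). m i k) * mat n n (\<lambda>(i, j). b' i (J j))"
    by (intro eq_matI) (auto simp: assms scalar_prod_def atLeast0LessThan)
  then show ?thesis unfolding minor_def by (simp add: det_mult[of _ n])
qed

definition family_basis :: "nat \<Rightarrow> (nat \<Rightarrow> 'a \<Rightarrow> 'l::field) \<Rightarrow> ('a \<Rightarrow> 'l) set \<Rightarrow> bool" where
  "family_basis n b I \<longleftrightarrow> inj_on b {..<n} \<and> FS.independent (b ` {..<n}) \<and> FS.span (b ` {..<n}) = I"

lemma family_basis_independent:
  assumes "family_basis n b I" "\<And>x. (\<Sum>i<n. c i * b i x) = 0"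
  shows "\<forall>i<n. c i = 0"
proof -
  have inj: "inj_on b {..<n}" using assms(1) by (simp add: family_basis_def)
  define h where "h y = c (the_inv_into {..<n} b y)" for y
  have "(\<Sum>y\<in>b ` {..<n}. fun_scale (h y) y) = (\<Sum>i<n. fun_scale (h (b i)) (b i))"
    by (simp only: sum.reindex[OF inj] o_def)
  also have "\<dots> = 0"
    by (rule ext) (use assms(2) in \<open>simp add: sum_fun_apply h_def the_inv_into_f_f[OF inj]\<close>)
  finally have "\<forall>y\<in>b ` {..<n}. h y = 0"
    using FS.independentD[of "b ` {..<n}" "b ` {..<n}" h] assms(1) by (auto simp: family_basis_def)
  then show ?thesis by (simp add: h_def the_inv_into_f_f[OF inj])
qed

lemma family_basis_span:
  assumes "family_basis n b I" "y \<in> I"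
  shows "\<exists>c. y = (\<lambda>x. \<Sum>i<n. c i * b i x)"
proof -
  have inj: "inj_on b {..<n}" using assms(1) by (simp add: family_basis_def)
  have "y \<in> FS.span (b ` {..<n})" using assms by (simp add: family_basis_def)
  then obtain u where "y = (\<Sum>z\<in>b ` {..<n}. fun_scale (u z) z)" using FS.span_finite[of "b ` {..<n}"] by auto
  then have "y = (\<Sum>i<n. fun_scale (u (b i)) (b i))" by (simp only: sum.reindex[OF inj] o_def)
  then have "y = (\<lambda>x. \<Sum>i<n. u (b i) * b i x)" by (simp add: sum_fun_apply fun_eq_iff)
  then show ?thesis by (rule exI[of _ "\<lambda>i. u (b i)"])
qed

lemma family_basis_mem: "family_basis n b I \<Longrightarrow> i < n \<Longrightarrow> b i \<in> I"
  unfolding family_basis_def using subsetD[OF FS.span_superset[of "b ` {..<n}"], of "b i"] by auto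

text \<open>The last claim recovers vectors of the subspace from its coordinates: when the last
  index runs through all positions, Laplace expansion gives a combination of the basis
  vectors.\<close>

lemma plucker_minor:
  assumes b: "family_basis n b I" and supp: "\<forall>y\<in>I. \<forall>x. x \<notin> B \<longrightarrow> y x = 0"
  shows "\<exists>\<kappa>. \<kappa> \<noteq> 0 \<and> (\<forall>J. plucker n I J = \<kappa> * minor n b J)" "\<exists>J\<in>{..<n} \<rightarrow>\<^sub>E B. plucker n I J \<noteq> 0"
    "n = Suc k \<Longrightarrow> (\<lambda>x. plucker n I (J(k := x))) \<in> I"
proof -
  define ob where "ob = ordered_basis n I"
  have "\<exists>w. family_basis n w I" using b by blast
  then have ob: "family_basis n ob I"
    unfolding ob_def ordered_basis_def family_basis_def by (rule someI_ex)
  have pl: "plucker n I J = minor n ob J" for J by (simp add: plucker_def minor_def ob_def)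
  have ne: "\<exists>J\<in>{..<n} \<rightarrow>\<^sub>E B. minor n ob J \<noteq> 0"
  proof (rule minor_nonzero)
    fix c assume "\<And>x. (\<Sum>i<n. c i * ob i x) = 0"
    then show "\<forall>i<n. c i = 0" by (rule family_basis_independent[OF ob])
  qed (use supp family_basis_mem[OF ob] in blast)
  then show "\<exists>J\<in>{..<n} \<rightarrow>\<^sub>E B. plucker n I J \<noteq> 0" by (simp add: pl)
  have "\<forall>i. \<exists>c. i < n \<longrightarrow> ob i = (\<lambda>x. \<Sum>k<n. c k * b k x)"
    using family_basis_span[OF b] family_basis_mem[OF ob] by blast
  then obtain m where "\<And>i. i < n \<Longrightarrow> ob i = (\<lambda>x. \<Sum>k<n. m i k * b k x)" by metis
  then have "plucker n I J = det (mat n n (\<lambda>(i, k). m i k)) * minor n b J" for J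
    unfolding pl by (intro minor_change_basis) (simp add: fun_eq_iff)
  moreover from this have "det (mat n n (\<lambda>(i, k). m i k)) \<noteq> 0" using ne pl by auto
  ultimately show "\<exists>\<kappa>. \<kappa> \<noteq> 0 \<and> (\<forall>J. plucker n I J = \<kappa> * minor n b J)" by blast
  assume n: "n = Suc k"
  obtain c where "\<And>x. minor n ob (J(k := x)) = (\<Sum>i<n. c i * ob i x)" using minor_last[of k ob J] n by blast
  then have "(\<lambda>x. plucker n I (J(k := x))) = (\<Sum>i<n. fun_scale (c i) (ob i))"
    by (simp add: pl sum_fun_apply fun_eq_iff)
  also have "\<dots> \<in> FS.span (ob ` {..<n})" by (intro FS.span_sum FS.span_scale FS.span_base imageI)
  also have "FS.span (ob ` {..<n}) = I" using ob by (simp add: family_basis_def)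
  finally show "(\<lambda>x. plucker n I (J(k := x))) \<in> I" .
qed

lemma polyfun_sum: "(\<And>i. i \<in> S \<Longrightarrow> polyfun (F i)) \<Longrightarrow> polyfun (\<lambda>x. \<Sum>i\<in>S. F i x)"
  by (induction S rule: infinite_finite_induct) (simp_all add: polyfun.const polyfun.add)

lemma polyfun_prod: "(\<And>i. i \<in> S \<Longrightarrow> polyfun (F i)) \<Longrightarrow> polyfun (\<lambda>x. \<Prod>i\<in>S. F i x)"
  by (induction S rule: infinite_finite_induct) (simp_all add: polyfun.const polyfun.mult)

lemma polyfun_minor:
  assumes "\<And>i b. polyfun (\<lambda>x. F x i b)"
  shows "polyfun (\<lambda>x. minor n (F x) J)"
proof -
  have "minor n (F x) J = (\<Sum>p | p permutes {0..<n}. signof p * (\<Prod>i\<in>{0..<n}. F x i (J (p i))))" for x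
    unfolding minor_def det_def by (auto intro!: sum.cong prod.cong dest: permutes_in_image)
  then show ?thesis by (simp only:) (intro polyfun_sum polyfun.mult polyfun_prod polyfun.const assms)
qed

lemma polyfun_form: "form T d R \<Longrightarrow> (\<And>J. polyfun (\<lambda>x. P x J)) \<Longrightarrow> polyfun (\<lambda>x. R (P x))"
  by (induction rule: form.induct) (auto intro: polyfun.intros)

section \<open>Automorphisms of the variety as left multiplications\<close>

context severi_brauer_split
begin

abbreviation Y where "Y \<equiv> SB_points scale B n"
abbreviation T where "T \<equiv> {..<n} \<rightarrow>\<^sub>E B"

lemma finite_T: "finite T" by (intro finite_PiE finite_B) simp

lemma polyfun_mul: "(\<And>a. polyfun (\<lambda>x. F x a)) \<Longrightarrow> polyfun (\<lambda>x. (F x \<star> c) b)"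
  unfolding mul_def ext_mult_def by (intro polyfun_sum polyfun.mult polyfun.const) auto

lemma family_basis_pt: "x \<in> V \<Longrightarrow> x \<noteq> 0 \<Longrightarrow> family_basis n (\<lambda>i. x \<star> w i) (pt x)"
  using pt_basis by (simp add: family_basis_def)

lemma pt_supp: "\<forall>y\<in>pt x. \<forall>b. b \<notin> B \<longrightarrow> y b = 0"
  using mul_C by (auto simp: pt_def ext_carrier_def)

lemma subspace_pt: "x \<in> V \<Longrightarrow> FS.subspace (pt x)"
  using right_ideal_principal[OF VC, of x] unfolding right_ideal_def pt_def by blast

text \<open>The forms \<open>R\<close> give multiples of the Pluecker coordinates of f I. Varying
  the last index of one fixed tuple \<open>J1\<close> converts them into a vector of f I, which is
  nonzero at \<open>pt x0\<close> because \<open>J1\<close> itself occurs among the tuples.\<close>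

lemma endomorphism_plucker:
  assumes f: "endomorphism T (plucker n) Y f" and x0: "x0 \<in> V" "x0 \<noteq> 0"
  shows "\<exists>D R J1. (\<forall>J\<in>T. form T D (R J)) \<and> J1 \<in> T \<and> R J1 (plucker n (pt x0)) \<noteq> 0 \<and>
    (\<forall>I\<in>Y. (\<lambda>b. if b \<in> B then R (J1(n - 1 := b)) (plucker n I) else 0) \<in> f I)"
proof -
  have fY: "f I \<in> Y" if "I \<in> Y" for I using f that unfolding endomorphism_def by blast
  obtain y0 where y0: "y0 \<in> V" "y0 \<noteq> 0" "f (pt x0) = pt y0" using SB_point_exists[OF fY[OF pt_SB[OF x0]]] by metis
  obtain J0 where J0: "J0 \<in> T" "plucker n (f (pt x0)) J0 \<noteq> 0"
    unfolding y0(3) using plucker_minor(2)[OF family_basis_pt[OF y0(1,2)] pt_supp] by blast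
  obtain D R where R: "\<forall>J\<in>T. form T D (R J)" "\<exists>J\<in>T. R J (plucker n (pt x0)) \<noteq> 0"
    "\<forall>I\<in>Y. \<exists>\<kappa>. \<forall>J\<in>T. R J (plucker n I) = \<kappa> * plucker n (f I) J"
    using endomorphism_forms[OF f finite_T pt_SB[OF x0], of J0, OF J0] by metis
  obtain J1 where J1: "J1 \<in> T" "R J1 (plucker n (pt x0)) \<noteq> 0" using R(2) by blast
  have J1b: "J1(n - 1 := b) \<in> T" if "b \<in> B" for b
    using J1(1) that n_pos by (auto simp: PiE_iff extensional_def)
  have "(\<lambda>b. if b \<in> B then R (J1(n - 1 := b)) (plucker n I) else 0) \<in> f I" if I: "I \<in> Y" for I
  proof -
    obtain y where y: "y \<in> V" "y \<noteq> 0" "f I = pt y" using SB_point_exists[OF fY[OF I]] by metis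
    obtain \<kappa> where \<kappa>: "\<forall>J\<in>T. R J (plucker n I) = \<kappa> * plucker n (f I) J" using R(3) I by blast
    define z where "z = (\<lambda>b. plucker n (pt y) (J1(n - 1 := b)))"
    have z: "z \<in> pt y" unfolding z_def
      by (rule plucker_minor(3)[OF family_basis_pt[OF y(1,2)] pt_supp]) (use n_pos in auto)
    have "(\<lambda>b. if b \<in> B then R (J1(n - 1 := b)) (plucker n I) else 0) = fun_scale \<kappa> z"
    proof
      fix b
      show "(if b \<in> B then R (J1(n - 1 := b)) (plucker n I) else 0) = \<kappa> * z b"
      proof (cases "b \<in> B")
        case True then show ?thesis using \<kappa> J1b[OF True] y(3) by (simp add: z_def)
      next
        case False
        then have "z b = 0" using pt_supp z by blast
        then show ?thesis using False by simp
      qed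
    qed
    then show ?thesis using FS.subspace_scale[OF subspace_pt[OF y(1)] z] y(3) by simp
  qed
  then show ?thesis using R(1) J1 by blast
qed

text \<open>A vector of the ideal of h x with coordinates polynomial in x is multiplied on the right
  by some v i; this lands in V, on the line of h x. The index i is chosen so that the product is
  nonzero at the given point.\<close>

lemma regular_map_lift:
  assumes f: "endomorphism T (plucker n) Y f"
  obtains h where "regular_map V h" "\<And>x. x \<in> V \<Longrightarrow> x \<noteq> 0 \<Longrightarrow> f (pt x) = pt (h x)"
proof -
  have fY: "f I \<in> Y" if "I \<in> Y" for I using f that unfolding endomorphism_def by blast
  have "\<exists>y. y \<in> V \<and> y \<noteq> 0 \<and> f (pt x) = pt y" if "x \<in> V" "x \<noteq> 0" for x
    using SB_point_exists[OF fY[OF pt_SB[OF that]]] by metis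
  then obtain h where h: "\<And>x. x \<in> V \<Longrightarrow> x \<noteq> 0 \<Longrightarrow> h x \<in> V \<and> h x \<noteq> 0 \<and> f (pt x) = pt (h x)" by metis
  have "regular_map V h"
    unfolding regular_map_def
  proof (intro conjI ballI allI impI)
    show "h x \<in> V - {0}" if "x \<in> V - {0}" for x using h that by blast
    show "par (h (fun_scale c x)) (h x)" if x: "x \<in> V - {0}" and c: "c \<noteq> 0" for x c
    proof -
      have cx: "fun_scale c x \<in> V" "fun_scale c x \<noteq> 0"
        using x c FS.subspace_scale[OF subspace_V] FS.scale_eq_0_iff[of c x] by auto
      have "pt (fun_scale c x) = pt x" by (rule pt_eqI) (use cx in \<open>auto simp: par_def\<close>)
      then have "pt (h (fun_scale c x)) = pt (h x)" using h cx x by (metis DiffD1 DiffD2 singletonI)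
      then show ?thesis using pt_eqD h cx x by blast
    qed
    fix x0 assume "x0 \<in> V - {0}"
    then have x0: "x0 \<in> V" "x0 \<noteq> 0" by auto
    obtain D R J1 where R: "\<And>J. J \<in> T \<Longrightarrow> form T D (R J)" "J1 \<in> T" "R J1 (plucker n (pt x0)) \<noteq> 0"
      "\<And>I. I \<in> Y \<Longrightarrow> (\<lambda>b. if b \<in> B then R (J1(n - 1 := b)) (plucker n I) else 0) \<in> f I"
      using endomorphism_plucker[OF f x0] by blast
    have J1b: "J1(n - 1 := b) \<in> T" if "b \<in> B" for b
      using R(2) that n_pos by (auto simp: PiE_iff extensional_def)
    define P where "P x J = minor n (\<lambda>i. x \<star> w i) J" for x J
    define q where "q x b = (if b \<in> B then R (J1(n - 1 := b)) (P x) else 0)" for x b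
    have pl: "\<exists>\<kappa>. \<kappa> \<noteq> 0 \<and> plucker n (pt x) = (\<lambda>J. \<kappa> * P x J)" if "x \<in> V" "x \<noteq> 0" for x
      using plucker_minor(1)[OF family_basis_pt[OF that] pt_supp] by (auto simp: P_def fun_eq_iff)
    have q: "q x \<in> pt (h x)" if x: "x \<in> V" "x \<noteq> 0" for x
    proof -
      obtain \<kappa> where \<kappa>: "\<kappa> \<noteq> 0" "plucker n (pt x) = (\<lambda>J. \<kappa> * P x J)" using pl x by blast
      have "(\<lambda>b. if b \<in> B then R (J1(n - 1 := b)) (plucker n (pt x)) else 0) = fun_scale (\<kappa> ^ D) (q x)"
        using form_homogeneous[OF R(1)[OF J1b]] by (auto simp: q_def \<kappa>(2) fun_eq_iff)
      then have *: "fun_scale (\<kappa> ^ D) (q x) \<in> pt (h x)" using R(4)[OF pt_SB[OF x]] h[OF x] by simp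
      have "fun_scale (inverse (\<kappa> ^ D)) (fun_scale (\<kappa> ^ D) (q x)) \<in> pt (h x)"
        by (rule FS.subspace_scale[OF subspace_pt *]) (use h x in blast)
      then show ?thesis using \<kappa>(1) by (simp flip: mult.assoc)
    qed
    have nz: "q x0 (J1 (n - 1)) \<noteq> 0"
    proof -
      obtain \<kappa> where \<kappa>: "\<kappa> \<noteq> 0" "plucker n (pt x0) = (\<lambda>J. \<kappa> * P x0 J)" using pl x0 by blast
      have "\<kappa> ^ D * R J1 (P x0) \<noteq> 0"
        using R(3) unfolding \<kappa>(2) form_homogeneous[OF R(1)[OF R(2)]] .
      then have "R J1 (P x0) \<noteq> 0" by simp
      moreover have "J1 (n - 1) \<in> B" using PiE_mem[OF R(2), of "n - 1"] n_pos by simp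
      ultimately show ?thesis unfolding q_def fun_upd_triv by simp
    qed
    have qC: "q x0 \<in> C" by (auto simp: q_def ext_carrier_def)
    have "\<exists>i<n. q x0 \<star> v i \<noteq> 0"
    proof (rule ccontr)
      assume "\<not> ?thesis"
      then have "(\<Sum>i<n. (q x0 \<star> v i) \<star> w i) = (\<Sum>i<n. 0 \<star> w i)" by (intro sum.cong) auto
      then have "q x0 = 0" using expand_right[OF qC] by simp
      then show False using nz by simp
    qed
    then obtain i where i: "i < n" "q x0 \<star> v i \<noteq> 0" by blast
    show "\<exists>N. (\<forall>b. polyfun (N b)) \<and> (\<exists>b. N b x0 \<noteq> 0) \<and> (\<forall>x\<in>V - {0}. par (\<lambda>b. N b x) (h x))"
    proof (intro exI[of _ "\<lambda>b x. (q x \<star> v i) b"] conjI allI ballI)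
      fix b
      have pP: "polyfun (\<lambda>x. P x J)" for J unfolding P_def
        by (intro polyfun_minor polyfun_mul polyfun.coord)
      have "polyfun (\<lambda>x. q x a)" for a
        using polyfun_form[OF R(1)[OF J1b] pP] by (cases "a \<in> B") (auto simp: q_def polyfun.const)
      then show "polyfun (\<lambda>x. (q x \<star> v i) b)" by (rule polyfun_mul)
    next
      show "\<exists>b. (q x0 \<star> v i) b \<noteq> 0" using i(2) by (auto simp: fun_eq_iff)
    next
      fix x assume "x \<in> V - {0}"
      then have x: "x \<in> V" "x \<noteq> 0" by auto
      obtain c where "q x = h x \<star> c" using q[OF x] by (auto simp: pt_def)
      then have "q x \<star> v i \<in> pt (h x)" using mul_C VC vw(1)[OF i(1)] by (auto simp: pt_def mul_assoc)
      then have "par (q x \<star> v i) (h x)" by (rule mem_pt_V[rotated]) (use h x mul_V vw(1)[OF i(1)] in auto)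
      then show "par (\<lambda>b. (q x \<star> v i) b) (h x)" by simp
    qed
  qed
  then show ?thesis using h that by blast
qed

text \<open>C is the full endomorphism algebra of V, so the linear lift u is a left multiplication;
  explicitly, by the sum of the products u(v i) w i.\<close>

lemma automorphism_left_mult:
  assumes f: "f \<in> carrier (SB_Aut scale B n)"
  shows "\<exists>u\<in>C. \<forall>x\<in>V - {0}. u \<star> x \<noteq> 0 \<and> f (pt x) = pt (u \<star> x)"
proof -
  have bij: "bij_betw f Y Y" and f1: "endomorphism T (plucker n) Y f" and f2: "endomorphism T (plucker n) Y (inv_into Y f)"
    using f by (auto simp: SB_Aut_def Aut_variety_def Bij_def)
  obtain h where h: "regular_map V h" "\<And>x. x \<in> V \<Longrightarrow> x \<noteq> 0 \<Longrightarrow> f (pt x) = pt (h x)" using regular_map_lift[OF f1] by blast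
  obtain k where k: "regular_map V k" "\<And>x. x \<in> V \<Longrightarrow> x \<noteq> 0 \<Longrightarrow> inv_into Y f (pt x) = pt (k x)"
    using regular_map_lift[OF f2] by blast
  have hV: "h x \<in> V" "h x \<noteq> 0" if "x \<in> V" "x \<noteq> 0" for x using h(1) that by (auto simp: regular_map_def)
  have kV: "k x \<in> V" "k x \<noteq> 0" if "x \<in> V" "x \<noteq> 0" for x using k(1) that by (auto simp: regular_map_def)
  interpret P: projective_automorphism V B h k
  proof
    show "x b = 0" if "x \<in> V" "b \<notin> B" for x b using VC[OF that(1)] that(2) by (simp add: ext_carrier_def)
    show "(\<lambda>b. x b + y b) \<in> V" if "x \<in> V" "y \<in> V" for x y
      using FS.subspace_add[OF subspace_V that] by (simp add: plus_fun_def)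
    show "fun_scale c x \<in> V" if "x \<in> V" for c x using FS.subspace_scale[OF subspace_V that] .
    show "par (k (h x)) x" if x: "x \<in> V" "x \<noteq> 0" for x
    proof (rule pt_eqD[OF kV(1)[OF hV[OF x]] x(1)])
      show "pt (k (h x)) = pt x"
        using k(2)[OF hV[OF x]] h(2)[OF x] bij_betw_inv_into_left[OF bij pt_SB[OF x]] by simp
    qed
    show "par (h (k x)) x" if x: "x \<in> V" "x \<noteq> 0" for x
    proof (rule pt_eqD[OF hV(1)[OF kV[OF x]] x(1)])
      show "pt (h (k x)) = pt x"
        using h(2)[OF kV[OF x]] k(2)[OF x] bij_betw_inv_into_right[OF bij pt_SB[OF x]] by simp
    qed
  qed (use finite_B FS.subspace_0[OF subspace_V] h(1) k(1) in auto)
  obtain u where u: "\<And>x y. x \<in> V \<Longrightarrow> y \<in> V \<Longrightarrow> u (x + y) = u x + u y"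
    "\<And>c x. x \<in> V \<Longrightarrow> u (fun_scale c x) = fun_scale c (u x)" "\<And>x. x \<in> V - {0} \<Longrightarrow> u x \<noteq> 0 \<and> par (u x) (h x)"
    using P.linear_lift unfolding plus_fun_def by blast
  have u0: "u 0 = 0" using u(2)[of 0 0] FS.subspace_0[OF subspace_V] by (simp add: zero_fun_def)
  have uV: "u x \<in> V" if "x \<in> V" for x
  proof (cases "x = 0")
    case True then show ?thesis using u0 FS.subspace_0[OF subspace_V] by simp
  next
    case False
    then show ?thesis using u(3)[of x] hV(1)[of x] that FS.subspace_scale[OF subspace_V] by (auto simp: par_def)
  qed
  have usum: "u (\<Sum>i\<in>S. g i) = (\<Sum>i\<in>S. u (g i))" if "finite S" "\<And>i. i \<in> S \<Longrightarrow> g i \<in> V" for S :: "nat set" and g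
    using that
  proof (induction S rule: finite_induct)
    case empty then show ?case using u0 by (simp add: zero_fun_def)
  next
    case (insert i S)
    have "(\<Sum>i\<in>S. g i) \<in> V" by (rule FS.subspace_sum[OF subspace_V]) (rule insert.prems, blast)
    then have "u (g i + (\<Sum>i\<in>S. g i)) = u (g i) + u (\<Sum>i\<in>S. g i)"
      using insert.prems by (intro u(1)) auto
    also have "u (\<Sum>i\<in>S. g i) = (\<Sum>i\<in>S. u (g i))" by (rule insert.IH) (rule insert.prems, blast)
    finally show ?case by (simp only: sum.insert[OF insert.hyps])
  qed
  define U where "U = (\<Sum>i<n. u (v i) \<star> w i)"
  have Ux: "U \<star> x = u x" if x: "x \<in> V" for x
  proof -
    have "\<forall>i. \<exists>r. i < n \<longrightarrow> w i \<star> x = fun_scale r e" using pairing vw(2) x by blast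
    then obtain r where r: "\<And>i. i < n \<Longrightarrow> w i \<star> x = fun_scale (r i) e" by metis
    have "x = (\<Sum>i<n. v i \<star> (w i \<star> x))" by (rule expand_left[OF VC[OF x]])
    also have "\<dots> = (\<Sum>i<n. fun_scale (r i) (v i))"
      by (rule sum.cong[OF refl]) (use r vw(1) in \<open>auto simp: mul_scale_right V_def\<close>)
    finally have "u x = u (\<Sum>i<n. fun_scale (r i) (v i))" by simp
    also have "\<dots> = (\<Sum>i<n. u (fun_scale (r i) (v i)))"
      by (rule usum) (use vw(1) FS.subspace_scale[OF subspace_V] in auto)
    also have "\<dots> = (\<Sum>i<n. fun_scale (r i) (u (v i)))"
      by (rule sum.cong[OF refl]) (use u(2) vw(1) in auto)
    also have "\<dots> = (\<Sum>i<n. u (v i) \<star> (w i \<star> x))"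
      by (rule sum.cong[OF refl]) (use r uV[OF vw(1)] in \<open>auto simp: mul_scale_right V_def\<close>)
    also have "\<dots> = U \<star> x" by (simp only: U_def mul_sum_left mul_assoc)
    finally show ?thesis by simp
  qed
  have "U \<in> C" unfolding U_def by (rule FS.subspace_sum[OF subspace_C]) (rule mul_C)
  moreover have "U \<star> x \<noteq> 0 \<and> f (pt x) = pt (U \<star> x)" if x: "x \<in> V - {0}" for x
  proof -
    have "u x \<noteq> 0" "par (u x) (h x)" using u(3)[OF x] by auto
    then have "pt (u x) = pt (h x)" using pt_eqI by blast
    then show ?thesis using h(2) x Ux[of x] \<open>u x \<noteq> 0\<close> by simp
  qed
  ultimately show ?thesis by blast
qed

end

section \<open>Separable elements of maximal degree\<close>

lemma polyfun_update: "polyfun F \<Longrightarrow> \<exists>q. \<forall>t. poly q t = F (x(b := t))"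
proof (induction rule: polyfun.induct)
  case (const c) show ?case by (rule exI[of _ "[:c:]"]) simp
next
  case (coord i) show ?case by (rule exI[of _ "if i = b then [:0,1:] else [:x i:]"]) simp
next
  case (add F F') then show ?case by (metis poly_add)
next
  case (mult F F') then show ?case by (metis poly_mult)
qed

lemma card_roots_simple:
  fixes f :: "'l::field poly"
  assumes R: "f = (\<Prod>r\<in>#R. [:-r, 1:])" and simple: "\<And>r. poly f r = 0 \<Longrightarrow> poly (pderiv f) r \<noteq> 0"
  shows "card {r. poly f r = 0} = degree f"
proof -
  have root: "poly f r = 0 \<longleftrightarrow> r \<in># R" for r
  proof -
    have "poly (\<Prod>r\<in>#R. [:-r, 1:]) r = 0 \<longleftrightarrow> r \<in># R" for R :: "'l multiset"
    proof (induction R)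
      case (add s R)
      have "poly (\<Prod>r\<in>#add_mset s R. [:-r, 1:]) r = (r - s) * poly (\<Prod>r\<in>#R. [:-r, 1:]) r"
        by (simp only: image_mset_add_mset prod_mset.add_mset poly_mult) simp
      then show ?case using add by auto
    qed simp
    then show ?thesis using R by simp
  qed
  have c1: "count R r \<le> 1" for r
  proof (rule ccontr)
    assume "\<not> count R r \<le> 1"
    then have c2: "count R r \<ge> 2" by simp
    then have "r \<in># R" by (simp flip: count_greater_zero_iff)
    then obtain R1 where R1: "R = add_mset r R1" by (rule mset_add)
    then have "r \<in># R1" using c2 by (simp flip: count_greater_zero_iff)
    then obtain R' where R': "R1 = add_mset r R'" by (rule mset_add)
    define g where "g = [:-r, 1:] * (\<Prod>r\<in>#R'. [:-r, 1:])"
    have fg: "f = [:-r, 1:] * g" using R R1 R' by (simp only: image_mset_add_mset prod_mset.add_mset g_def)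
    have g0: "poly g r = 0" by (simp only: g_def poly_mult) simp
    have "poly f r = 0" by (simp only: fg poly_mult g0) simp
    moreover have "poly (pderiv f) r = 0" by (simp only: fg pderiv_mult poly_add poly_mult g0) simp
    ultimately show False using simple by blast
  qed
  have "degree (\<Prod>r\<in>#R. [:-r, 1:]) = size R" for R :: "'l multiset"
  proof (induction R)
    case (add r R)
    have "(\<Prod>r\<in>#R. [:-r, 1:]) \<noteq> 0" by (auto simp: prod_mset_zero_iff)
    then show ?case using add by (simp add: degree_mult_eq del: mult_pCons_left)
  qed simp
  then have "degree f = size R" using R by simp
  also have "size R = (\<Sum>r\<in>set_mset R. count R r)" by (rule size_multiset_overloaded_eq)
  also have "\<dots> = (\<Sum>r\<in>set_mset R. 1)"
    by (rule sum.cong[OF refl]) (use c1 in \<open>metis count_greater_eq_one_iff le_antisym\<close>)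
  also have "\<dots> = card {r. poly f r = 0}" by (simp add: root)
  finally show ?thesis by simp
qed

text \<open>If K were finite, choose N larger than its size and congruent to 1 modulo p. Then X^N -
  1 is separable and splits, so it has N roots in K.\<close>

lemma infinite_of_roots_of_unity:
  assumes roots: "contains_all_roots_of_unity TYPE('k::field)" and p: "CHAR('k) > 0"
  shows "infinite (UNIV :: 'k set)"
proof
  assume fin: "finite (UNIV :: 'k set)"
  have pp: "prime CHAR('k)" using p prime_CHAR_semidom by blast
  define N where "N = CHAR('k) * card (UNIV :: 'k set) + 1"
  have N0: "N > 0" by (simp add: N_def)
  define f :: "'k poly" where "f = monom 1 N - 1"
  obtain R where R: "f = (\<Prod>r\<in>#R. [:-r, 1:])" using roots N0 unfolding contains_all_roots_of_unity_def f_def by blast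
  have oN: "(of_nat N :: 'k) = 1" by (simp add: N_def)
  have "card {r. poly f r = 0} = degree f"
  proof (rule card_roots_simple[OF R])
    fix r assume "poly f r = 0"
    then have rN: "r ^ N = 1" by (simp add: f_def poly_monom)
    have "poly (pderiv f) r = r ^ (N - 1)" using oN by (simp add: f_def pderiv_diff pderiv_monom poly_monom)
    then show "poly (pderiv f) r \<noteq> 0" using rN N0 by (auto simp: power_0_left)
  qed
  moreover have "degree f = N"
  proof -
    have "f = monom 1 N + (-1)" by (simp add: f_def)
    then show ?thesis using N0 by (simp only:) (subst degree_add_eq_left; simp add: degree_monom_eq)
  qed
  moreover have "card {r. poly f r = 0} \<le> card (UNIV :: 'k set)" using fin by (intro card_mono) auto
  moreover have "card (UNIV :: 'k set) < N" 
  proof -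
    have "1 * card (UNIV :: 'k set) \<le> CHAR('k) * card (UNIV :: 'k set)" by (rule mult_le_mono1) (use p in simp)
    then show ?thesis unfolding N_def by linarith
  qed
  ultimately show False by linarith
qed

context severi_brauer_split
begin

text \<open>The coordinates are moved into K one at a time: as a function of a single coordinate,
  \<open>F\<close> has finitely many zeros, and K is infinite.\<close>

lemma polyfun_nonzero_rational:
  assumes inf: "infinite (UNIV :: 'k set)" and F: "polyfun F" and x: "x \<in> C" "F x \<noteq> 0"
  obtains a where "F (\<iota> a) \<noteq> 0"
proof -
  have "\<exists>y\<in>C. F y \<noteq> 0 \<and> (\<forall>b\<in>S. y b \<in> range to_ac)" if "finite S" "S \<subseteq> B" for S
    using that
  proof (induction S rule: finite_induct)
    case empty
    then show ?case using x by blast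
  next
    case (insert b S)
    then obtain y where y: "y \<in> C" "F y \<noteq> 0" "\<forall>b\<in>S. y b \<in> range to_ac" by auto
    obtain q where q: "\<And>t. poly q t = F (y(b := t))" using polyfun_update[OF F] by blast
    have "q \<noteq> 0" using q[of "y b"] y(2) by auto
    then have "finite {t. poly q t = 0}" by (rule poly_roots_finite)
    moreover have "infinite (range (to_ac :: 'k \<Rightarrow> _))" using inf inj_to_ac finite_imageD by blast
    ultimately obtain t where t: "t \<in> range to_ac" "poly q t \<noteq> 0"
      by (metis (mono_tags, lifting) finite_subset mem_Collect_eq subsetI)
    have "y(b := t) \<in> C" using y(1) insert.prems by (auto simp: ext_carrier_def)
    moreover have "F (y(b := t)) \<noteq> 0" using q t(2) by simp
    moreover have "\<forall>c\<in>insert b S. (y(b := t)) c \<in> range to_ac" using y(3) t(1) by simp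
    ultimately show ?case by blast
  qed
  from this[OF finite_B subset_refl] obtain y where y: "y \<in> C" "F y \<noteq> 0" "\<forall>b\<in>B. y b \<in> range to_ac" by blast
  define a where "a = (\<Sum>b\<in>B. scale (of_ac (y b)) b)"
  have "\<iota> a = (\<Sum>b\<in>B. fun_scale (to_ac (of_ac (y b))) (\<iota> b))" by (simp only: a_def \<iota>_sum \<iota>_scale)
  also have "\<dots> = (\<Sum>b\<in>B. fun_scale (y b) (\<iota> b))"
    by (rule sum.cong[OF refl]) (use y(3) in \<open>simp add: to_ac_of_ac\<close>)
  also have "\<dots> = y" using C_expand[OF y(1)] by (simp only:)
  finally have "F (\<iota> a) \<noteq> 0" using y(2) by simp
  then show ?thesis by (rule that)
qed

section \<open>Matrices of elements on V, and the discriminant\<close>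

definition be where "be = (SOME b. e b \<noteq> 0)"

lemma be: "e be \<noteq> 0"
proof -
  have "\<exists>b. e b \<noteq> 0" using e(2) by (auto simp: fun_eq_iff)
  then show ?thesis unfolding be_def by (rule someI_ex)
qed

definition entry :: "('a \<Rightarrow> 'k alg_closure) \<Rightarrow> nat \<Rightarrow> nat \<Rightarrow> 'k alg_closure" where
  "entry x i j = (w i \<star> x \<star> v j) be / e be"

lemma entry: assumes "i < n" "j < n" shows "w i \<star> x \<star> v j = fun_scale (entry x i j) e"
proof -
  obtain r where r: "w i \<star> (x \<star> v j) = fun_scale r e" using pairing[OF vw(2) mul_V[OF vw(1)]] assms by blast
  then show ?thesis using be by (simp add: entry_def mul_assoc)
qed

lemma entry_eqI: "i < n \<Longrightarrow> j < n \<Longrightarrow> w i \<star> x \<star> v j = fun_scale r e \<Longrightarrow> entry x i j = r"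
  using entry scale_e_cancel by metis

lemma polyfun_entry: "polyfun (\<lambda>x. entry x i j)"
proof -
  have "polyfun (\<lambda>x. (w i \<star> x) b)" for b
    unfolding mul_def ext_mult_def by (intro polyfun_sum polyfun.mult polyfun.const polyfun.coord)
  then have "polyfun (\<lambda>x. (w i \<star> x \<star> v j) be * inverse (e be))"
    by (intro polyfun.mult polyfun_mul polyfun.const)
  then show ?thesis by (simp add: entry_def divide_inverse)
qed

definition Mat :: "('a \<Rightarrow> 'k alg_closure) \<Rightarrow> 'k alg_closure mat" where
  "Mat x = mat n n (\<lambda>(i, j). entry x i j)"

lemma Mat_carrier [simp]: "Mat x \<in> carrier_mat n n" by (simp add: Mat_def)

definition vec_of :: "'k alg_closure vec \<Rightarrow> 'a \<Rightarrow> 'k alg_closure" where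
  "vec_of y = (\<Sum>j<n. fun_scale (y $ j) (v j))"

lemma vec_of_V: "vec_of y \<in> V"
  unfolding vec_of_def by (intro FS.subspace_sum FS.subspace_scale subspace_V vw(1)) simp

lemma w_vec_of: assumes "i < n" shows "w i \<star> vec_of y = fun_scale (y $ i) e"
proof -
  have "w i \<star> vec_of y = (\<Sum>j<n. if j = i then fun_scale (y $ i) e else 0)"
    unfolding vec_of_def mul_sum_right mul_scale_right
    by (rule sum.cong[OF refl]) (use vw(3)[OF assms] in \<open>auto simp: fun_eq_iff\<close>)
  also have "\<dots> = fun_scale (y $ i) e" using assms by (subst sum.delta) auto
  finally show ?thesis .
qed

lemma Mat_vec: assumes y: "y \<in> carrier_vec n" shows "x \<star> vec_of y = vec_of (Mat x *\<^sub>v y)"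
proof -
  have "w i \<star> (x \<star> vec_of y) = w i \<star> vec_of (Mat x *\<^sub>v y)" if i: "i < n" for i
  proof -
    have "w i \<star> (x \<star> vec_of y) = (\<Sum>j<n. fun_scale (y $ j) (w i \<star> x \<star> v j))"
      unfolding vec_of_def by (simp only: mul_sum_right mul_scale_right mul_assoc)
    also have "\<dots> = (\<Sum>j<n. fun_scale (y $ j) (fun_scale (entry x i j) e))"
      by (rule sum.cong[OF refl]) (use entry i in simp)
    also have "\<dots> = fun_scale ((Mat x *\<^sub>v y) $ i) e"
    proof
      fix b
      have "(Mat x *\<^sub>v y) $ i = (\<Sum>j<n. entry x i j * y $ j)"
        using i y by (simp add: Mat_def scalar_prod_def atLeast0LessThan)
      then show "(\<Sum>j<n. fun_scale (y $ j) (fun_scale (entry x i j) e)) b = (Mat x *\<^sub>v y) $ i * e b"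
        unfolding sum_fun_apply by (simp only: sum_distrib_right) (intro sum.cong refl, simp only: mult_ac)
    qed
    finally show ?thesis using w_vec_of[OF i] by simp
  qed
  then have "(\<Sum>i<n. v i \<star> (w i \<star> (x \<star> vec_of y))) = (\<Sum>i<n. v i \<star> (w i \<star> vec_of (Mat x *\<^sub>v y)))"
    by (intro sum.cong) auto
  then show ?thesis using expand_left[OF mul_C, of x "vec_of y"] expand_left[OF VC[OF vec_of_V], of "Mat x *\<^sub>v y"] by simp
qed

lemma vec_of_nonzero: assumes "y \<in> carrier_vec n" "y \<noteq> 0\<^sub>v n" shows "vec_of y \<noteq> 0"
proof
  assume z: "vec_of y = 0"
  have "y $ i = 0" if "i < n" for i using w_vec_of[OF that, of y] z e(2) FS.scale_eq_0_iff[of "y $ i" e] by simp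
  then show False using assms by (auto simp: vec_eq_iff)
qed

text \<open>The derivative \<chi>' of the characteristic polynomial, evaluated at the matrix itself.
  Its degree is below n, which bounds the sum.\<close>

definition cp_deriv_mat :: "('a \<Rightarrow> 'k alg_closure) \<Rightarrow> 'k alg_closure mat" where
  "cp_deriv_mat x = mat n n (\<lambda>(i, j). \<Sum>k<n. coeff (pderiv (char_poly (Mat x))) k * (Mat x ^\<^sub>m k) $$ (i, j))"

text \<open>This is the product of the values of \<chi>' at the eigenvalues, so up to sign the
  discriminant of the characteristic polynomial. In this form it is visibly polynomial in the
  coordinates of \<open>x\<close>.\<close>

definition disc :: "('a \<Rightarrow> 'k alg_closure) \<Rightarrow> 'k alg_closure" where
  "disc x = det (cp_deriv_mat x)"

lemma polyfun_det:
  assumes "\<And>i j. polyfun (\<lambda>x. F x i j)" shows "polyfun (\<lambda>x. det (mat n n (\<lambda>(i, j). F x i j)))"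
proof -
  have "det (mat n n (\<lambda>(i, j). F x i j)) = (\<Sum>p | p permutes {0..<n}. signof p * (\<Prod>i\<in>{0..<n}. F x i (p i)))" for x
    unfolding det_def by (auto intro!: sum.cong prod.cong dest: permutes_in_image)
  then show ?thesis by (simp only:) (intro polyfun_sum polyfun.mult polyfun_prod polyfun.const assms)
qed

definition polycoeff :: "(('a \<Rightarrow> 'k alg_closure) \<Rightarrow> 'k alg_closure poly) \<Rightarrow> bool" where
  "polycoeff P \<longleftrightarrow> (\<forall>k. polyfun (\<lambda>x. coeff (P x) k))"

lemma polycoeff_sum: "(\<And>i. i \<in> S \<Longrightarrow> polycoeff (P i)) \<Longrightarrow> polycoeff (\<lambda>x. \<Sum>i\<in>S. P i x)"
  unfolding polycoeff_def coeff_sum by (auto intro: polyfun_sum)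

lemma polycoeff_mult: "polycoeff P \<Longrightarrow> polycoeff Q \<Longrightarrow> polycoeff (\<lambda>x. P x * Q x)"
  unfolding polycoeff_def coeff_mult by (auto intro!: polyfun_sum polyfun.mult)

lemma polycoeff_const: "polycoeff (\<lambda>x. c)" by (simp add: polycoeff_def polyfun.const)

lemma polycoeff_prod: "(\<And>i. i \<in> S \<Longrightarrow> polycoeff (P i)) \<Longrightarrow> polycoeff (\<lambda>x. \<Prod>i\<in>S. P i x)"
  by (induction S rule: infinite_finite_induct) (auto simp: polycoeff_const polycoeff_mult)

lemma polycoeff_char_poly: "polycoeff (\<lambda>x. char_poly (Mat x))"
proof -
  have c: "char_poly_matrix (Mat x) = mat n n (\<lambda>(i, j). (if i = j then [:0, 1:] else 0) + [:- entry x i j:])" for x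
    by (intro eq_matI) (auto simp: char_poly_matrix_def Mat_def)
  have "char_poly (Mat x) = (\<Sum>p | p permutes {0..<n}. signof p *
      (\<Prod>i\<in>{0..<n}. (if i = p i then [:0, 1:] else 0) + [:- entry x i (p i):]))" for x
    unfolding char_poly_def c det_def by (auto intro!: sum.cong prod.cong dest: permutes_in_image)
  moreover have "polycoeff (\<lambda>x. (if i = j then [:0, 1:] else 0) + [:- entry x i j:])" for i j
    unfolding polycoeff_def
  proof
    fix k
    have "polyfun (\<lambda>x. coeff (if i = j then [:0, 1:] else 0) k + (if k = 0 then - 1 else 0) * entry x i j)"
      by (intro polyfun.add polyfun.mult polyfun.const polyfun_entry)
    moreover have "coeff ((if i = j then [:0, 1:] else 0) + [:- entry x i j:]) k
        = coeff (if i = j then [:0, 1:] else 0) k + (if k = 0 then - 1 else 0) * entry x i j" for x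
      by (simp add: coeff_pCons split: nat.split)
    ultimately show "polyfun (\<lambda>x. coeff ((if i = j then [:0, 1:] else 0) + [:- entry x i j:]) k)" by simp
  qed
  ultimately show ?thesis by (simp only:) (intro polycoeff_sum polycoeff_mult polycoeff_prod polycoeff_const)
qed

lemma polyfun_Mat_pow: "i < n \<Longrightarrow> j < n \<Longrightarrow> polyfun (\<lambda>x. (Mat x ^\<^sub>m k) $$ (i, j))"
proof (induction k arbitrary: i j)
  case 0
  then show ?case by (simp add: polyfun.const Mat_def)
next
  case (Suc k)
  have "(Mat x ^\<^sub>m Suc k) $$ (i, j) = (\<Sum>l<n. (Mat x ^\<^sub>m k) $$ (i, l) * entry x l j)" for x
    using Suc.prems pow_carrier_mat[OF Mat_carrier, of x k]
    by (simp add: times_mat_def scalar_prod_def Mat_def atLeast0LessThan)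
  then show ?case using Suc by (simp only:) (auto intro!: polyfun_sum polyfun.mult polyfun_entry)
qed

lemma polyfun_disc: "polyfun disc"
proof -
  have "polyfun (\<lambda>x. det (mat n n (\<lambda>(i, j). if i < n \<and> j < n then \<Sum>k<n. coeff (pderiv (char_poly (Mat x))) k * (Mat x ^\<^sub>m k) $$ (i, j) else 0)))"
  proof (rule polyfun_det)
    fix i j
    have "polyfun (\<lambda>x. coeff (pderiv (char_poly (Mat x))) k)" for k
      using polycoeff_char_poly unfolding polycoeff_def coeff_pderiv by (auto intro!: polyfun.mult polyfun.const)
    then show "polyfun (\<lambda>x. if i < n \<and> j < n then \<Sum>k<n. coeff (pderiv (char_poly (Mat x))) k * (Mat x ^\<^sub>m k) $$ (i, j) else 0)"
      by (cases "i < n \<and> j < n") (auto intro!: polyfun_sum polyfun.mult polyfun_Mat_pow polyfun.const)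
  qed
  moreover have "disc x = det (mat n n (\<lambda>(i, j). if i < n \<and> j < n then \<Sum>k<n. coeff (pderiv (char_poly (Mat x))) k * (Mat x ^\<^sub>m k) $$ (i, j) else 0))" for x
    unfolding disc_def cp_deriv_mat_def by (intro arg_cong[where f = det] eq_matI) auto
  ultimately show ?thesis by (metis (no_types, lifting) ext)
qed

text \<open>Independence over K persists over the closure: a multiplication operator dual to
  \<open>c j\<close> can be applied under the sum and isolates \<open>r j\<close>.\<close>

lemma \<iota>_independent:
  assumes "finite I" "inj_on c I" "independent (c ` I)" "(\<Sum>i\<in>I. fun_scale (r i) (\<iota> (c i))) = 0" "j \<in> I"
  shows "r j = 0"
proof -
  have "c j \<notin> span (c ` I - {c j})" using assms(3,5) dependent_def by blast
  then obtain T where T: "mult_operator T" "T (c j) = 1" "\<forall>x\<in>c ` I - {c j}. T x = 0"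
    using density[of "c ` I - {c j}"] assms(1) by blast
  have "(\<Sum>i\<in>I. fun_scale (r i) (\<iota> (U (c i)))) = 0" if "mult_operator U" for U
    using that
  proof (induction rule: mult_operator.induct)
    case ident show ?case by (rule assms(4))
  next
    case (left T d)
    have "(\<Sum>i\<in>I. fun_scale (r i) (\<iota> (d * T (c i)))) = \<iota> d \<star> (\<Sum>i\<in>I. fun_scale (r i) (\<iota> (T (c i))))"
      by (simp only: mul_sum_right mul_scale_right \<iota>_mult)
    then show ?case using left.IH by (simp only: mul_0)
  next
    case (right T d)
    have "(\<Sum>i\<in>I. fun_scale (r i) (\<iota> (T (c i) * d))) = (\<Sum>i\<in>I. fun_scale (r i) (\<iota> (T (c i)))) \<star> \<iota> d"
      by (simp only: mul_sum_left mul_scale_left \<iota>_mult)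
    then show ?case using right.IH by (simp only: mul_0)
  next
    case (add T U)
    have "(\<Sum>i\<in>I. fun_scale (r i) (\<iota> (T (c i) + U (c i))))
      = (\<Sum>i\<in>I. fun_scale (r i) (\<iota> (T (c i)))) + (\<Sum>i\<in>I. fun_scale (r i) (\<iota> (U (c i))))"
      by (simp only: \<iota>_add FS.scale_right_distrib sum.distrib)
    then show ?case using add.IH by (simp only: add_0)
  qed
  from this[OF T(1)] have "(\<Sum>i\<in>I. fun_scale (r i) (\<iota> (T (c i)))) = 0" .
  also have "(\<Sum>i\<in>I. fun_scale (r i) (\<iota> (T (c i)))) = (\<Sum>i\<in>I. if i = j then fun_scale (r j) \<e> else 0)"
  proof (rule sum.cong[OF refl])
    fix i assume i: "i \<in> I"
    show "fun_scale (r i) (\<iota> (T (c i))) = (if i = j then fun_scale (r j) \<e> else 0)"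
    proof (cases "i = j")
      case False
      then have "c i \<in> c ` I - {c j}" using i assms(2,5) by (auto simp: inj_on_def)
      then have "T (c i) = 0" using T(3) by blast
      then show ?thesis using False by (simp add: zero_fun_def)
    qed (use T(2) in simp)
  qed
  also have "\<dots> = fun_scale (r j) \<e>" using assms(1,5) by (simp only: sum.delta) simp
  finally show ?thesis using one_nonzero FS.scale_eq_0_iff[of "r j" \<e>] by blast
qed

lemma Mat_pow_vec:
  assumes y: "y \<in> carrier_vec n" "Mat x *\<^sub>v y = z \<cdot>\<^sub>v y"
  shows "(Mat x ^\<^sub>m k) *\<^sub>v y = z ^ k \<cdot>\<^sub>v y"
proof (induction k)
  case 0
  then show ?case using y by (simp add: Mat_def)
next
  case (Suc k)
  have "(Mat x ^\<^sub>m Suc k) *\<^sub>v y = (Mat x ^\<^sub>m k) *\<^sub>v (Mat x *\<^sub>v y)"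
    using y(1) by (simp add: assoc_mult_mat_vec[OF pow_carrier_mat[OF Mat_carrier] Mat_carrier])
  also have "\<dots> = z \<cdot>\<^sub>v ((Mat x ^\<^sub>m k) *\<^sub>v y)"
    using mult_mat_vec[OF pow_carrier_mat[OF Mat_carrier] y(1)] by (simp add: y(2))
  finally show ?case using Suc by (simp add: smult_smult_assoc)
qed

lemma degree_char_poly_Mat: "degree (char_poly (Mat x)) = n" "lead_coeff (char_poly (Mat x)) = 1"
  using degree_monic_char_poly[OF Mat_carrier[of x]] by auto

lemma poly_pderiv_char_poly: "poly (pderiv (char_poly (Mat x))) z = (\<Sum>k<n. coeff (pderiv (char_poly (Mat x))) k * z ^ k)"
proof -
  have "degree (pderiv (char_poly (Mat x))) < n"
    using degree_pderiv_le[of "char_poly (Mat x)"] n_pos by (simp add: degree_char_poly_Mat)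
  then show ?thesis unfolding poly_altdef
    by (intro sum.mono_neutral_left) (auto simp: coeff_eq_0)
qed

text \<open>An eigenvector for a double root would lie in the kernel of \<chi>' evaluated at the
  matrix.\<close>

lemma disc_simple_roots:
  assumes d: "disc x \<noteq> 0" and z: "poly (char_poly (Mat x)) z = 0"
  shows "poly (pderiv (char_poly (Mat x))) z \<noteq> 0"
proof
  assume p0: "poly (pderiv (char_poly (Mat x))) z = 0"
  have "eigenvalue (Mat x) z" using eigenvalue_root_char_poly[OF Mat_carrier] z by blast
  then obtain y where y: "y \<in> carrier_vec n" "y \<noteq> 0\<^sub>v n" "Mat x *\<^sub>v y = z \<cdot>\<^sub>v y"
    unfolding eigenvalue_def eigenvector_def using Mat_carrier[of x] by auto
  let ?c = "\<lambda>k. coeff (pderiv (char_poly (Mat x))) k"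
  have "(cp_deriv_mat x *\<^sub>v y) $ i = 0" if i: "i < n" for i
  proof -
    have "(cp_deriv_mat x *\<^sub>v y) $ i = (\<Sum>j<n. (\<Sum>k<n. ?c k * (Mat x ^\<^sub>m k) $$ (i, j)) * y $ j)"
      using i y(1) by (simp add: cp_deriv_mat_def scalar_prod_def atLeast0LessThan)
    also have "\<dots> = (\<Sum>k<n. \<Sum>j<n. ?c k * ((Mat x ^\<^sub>m k) $$ (i, j) * y $ j))"
      by (subst sum.swap) (simp add: sum_distrib_right mult.assoc)
    also have "\<dots> = (\<Sum>k<n. ?c k * ((Mat x ^\<^sub>m k) *\<^sub>v y) $ i)"
    proof (rule sum.cong[OF refl])
      fix k
      have "((Mat x ^\<^sub>m k) *\<^sub>v y) $ i = (\<Sum>j<n. (Mat x ^\<^sub>m k) $$ (i, j) * y $ j)"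
        using i y(1) carrier_matD[OF pow_carrier_mat[OF Mat_carrier[of x], of k]]
        by (simp add: scalar_prod_def atLeast0LessThan )
      then show "(\<Sum>j<n. ?c k * ((Mat x ^\<^sub>m k) $$ (i, j) * y $ j)) = ?c k * ((Mat x ^\<^sub>m k) *\<^sub>v y) $ i"
        by (simp only: sum_distrib_left)
    qed
    also have "\<dots> = (\<Sum>k<n. ?c k * (z ^ k * y $ i))"
      by (intro sum.cong refl) (use i y(1) in \<open>simp add: Mat_pow_vec[OF y(1,3)]\<close>)
    also have "\<dots> = poly (pderiv (char_poly (Mat x))) z * y $ i"
      unfolding poly_pderiv_char_poly sum_distrib_right by (simp only: mult.assoc)
    finally show ?thesis using p0 by simp
  qed
  then have "cp_deriv_mat x *\<^sub>v y = 0\<^sub>v n" by (intro eq_vecI) (auto simp: cp_deriv_mat_def)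
  then have "det (cp_deriv_mat x) = 0"
    using det_0_iff_vec_prod_zero[of "cp_deriv_mat x" n] y(1,2) by (auto simp: cp_deriv_mat_def)
  then show False using d by (simp add: disc_def)
qed

text \<open>A diagonal matrix with distinct entries shows that the discriminant does not vanish
  identically, which is what passing to a rational element needs.\<close>

lemma disc_diagonal:
  assumes c: "inj_on c {..<n}"
  defines "x \<equiv> (\<Sum>i<n. fun_scale (c i) (v i \<star> w i))"
  shows "x \<in> C" "disc x \<noteq> 0"
proof -
  show "x \<in> C" unfolding x_def by (intro FS.subspace_sum FS.subspace_scale subspace_C mul_C)
  have ent: "entry x i j = (if i = j then c i else 0)" if "i < n" "j < n" for i j
  proof (rule entry_eqI[OF that])
    have "w i \<star> x \<star> v j = (\<Sum>k<n. fun_scale (c k) ((w i \<star> v k) \<star> (w k \<star> v j)))"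
      unfolding x_def by (simp only: mul_sum_left mul_sum_right mul_scale_left mul_scale_right mul_assoc)
    also have "\<dots> = (\<Sum>k<n. if k = i then fun_scale (if i = j then c i else 0) e else 0)"
    proof (rule sum.cong[OF refl])
      fix k assume "k \<in> {..<n}"
      then have "w i \<star> v k = (if i = k then e else 0)" "w k \<star> v j = (if k = j then e else 0)" using vw(3) that by auto
      then show "fun_scale (c k) ((w i \<star> v k) \<star> (w k \<star> v j)) = (if k = i then fun_scale (if i = j then c i else 0) e else 0)"
        by (cases "k = i"; cases "k = j") (simp_all add: e(3), simp_all add: zero_fun_def)
    qed
    also have "\<dots> = fun_scale (if i = j then c i else 0) e" using that(1) by (subst sum.delta) auto
    finally show "w i \<star> x \<star> v j = fun_scale (if i = j then c i else 0) e" .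
  qed
  have pow: "(Mat x ^\<^sub>m k) $$ (i, j) = (if i = j then c i ^ k else 0)" if "i < n" "j < n" for i j k
    using that
  proof (induction k arbitrary: i j)
    case 0 then show ?case by (simp add: Mat_def)
  next
    case (Suc k)
    have "(Mat x ^\<^sub>m Suc k) $$ (i, j) = (\<Sum>l<n. (Mat x ^\<^sub>m k) $$ (i, l) * entry x l j)"
      using Suc.prems pow_carrier_mat[OF Mat_carrier, of x k]
      by (simp add: times_mat_def scalar_prod_def Mat_def atLeast0LessThan)
    also have "\<dots> = (\<Sum>l<n. if l = i then (if i = j then c i ^ Suc k else 0) else 0)"
      by (rule sum.cong[OF refl]) (use Suc ent in auto)
    also have "\<dots> = (if i = j then c i ^ Suc k else 0)" using Suc.prems by (subst sum.delta) auto
    finally show ?case .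
  qed
  have "upper_triangular (Mat x)" by (auto simp: Mat_def ent upper_triangular_def)
  then have "char_poly (Mat x) = (\<Prod>a\<leftarrow>diag_mat (Mat x). [:- a, 1:])"
    by (rule char_poly_upper_triangular[OF Mat_carrier])
  also have "diag_mat (Mat x) = map c [0..<n]" by (auto simp: diag_mat_def Mat_def ent)
  also have "(\<Prod>a\<leftarrow>map c [0..<n]. [:- a, 1:]) = (\<Prod>i<n. [:- c i, 1:])"
    by (simp add: prod.distinct_set_conv_list[symmetric] atLeast0LessThan comp_def flip: prod.list_conv_set_nth)
  finally have cp: "char_poly (Mat x) = (\<Prod>i<n. [:- c i, 1:])" .
  have simple: "poly (pderiv (char_poly (Mat x))) (c i) \<noteq> 0" if i: "i < n" for i
  proof -
    define g where "g = (\<Prod>j\<in>{..<n} - {i}. [:- c j, 1:])"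
    have fg: "char_poly (Mat x) = [:- c i, 1:] * g" unfolding cp g_def using i by (intro prod.remove) auto
    have "poly g (c i) \<noteq> 0" unfolding g_def poly_prod using c i by (auto simp: inj_on_def)
    moreover have "poly (pderiv (char_poly (Mat x))) (c i) = poly g (c i)"
      by (simp only: fg pderiv_mult poly_add poly_mult) (simp add: pderiv_pCons)
    ultimately show ?thesis by simp
  qed
  have cpm: "cp_deriv_mat x = mat n n (\<lambda>(i, j). if i = j then poly (pderiv (char_poly (Mat x))) (c i) else 0)"
    unfolding cp_deriv_mat_def poly_pderiv_char_poly by (intro eq_matI) (auto simp: pow intro!: sum.neutral)
  have "det (cp_deriv_mat x) = prod_list (diag_mat (cp_deriv_mat x))"
    by (rule det_upper_triangular[of _ n]) (auto simp: cpm upper_triangular_def)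
  also have "\<dots> \<noteq> 0" using simple by (auto simp: prod_list_zero_iff diag_mat_def cpm)
  finally show "disc x \<noteq> 0" by (simp add: disc_def)
qed

text \<open>A rational \<open>a\<close> with nonzero discriminant has n distinct eigenvalues on V.
  They are roots of its minimal polynomial over K, whose degree is thus at least n. It is at most n:
  the product of the X - z i kills an eigenbasis of V, so it is a relation over the closure among
  the powers of \<open>a\<close>, which could not exist if these were independent over K.\<close>

lemma separable_element:
  assumes inf: "infinite (UNIV :: 'k set)"
  obtains a f z y where "lead_coeff f = 1" "degree f = n" "peval a f = 0" "inj_on z {..<n}"
    "\<And>i. i < n \<Longrightarrow> poly (map_poly to_ac f) (z i) = 0"
    "\<And>i. i < n \<Longrightarrow> y i \<in> V \<and> y i \<noteq> 0 \<and> \<iota> a \<star> y i = fun_scale (z i) (y i)"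
    "V \<subseteq> FS.span (y ` {..<n})"
proof -
  obtain c :: "nat \<Rightarrow> 'k alg_closure" where c: "inj c" using infinite_countable_subset[OF infinite_alg_closed] by auto
  obtain a where a: "disc (\<iota> a) \<noteq> 0"
    using polyfun_nonzero_rational[OF inf polyfun_disc disc_diagonal[OF inj_on_subset[OF c subset_UNIV]]] by metis
  let ?\<chi> = "char_poly (Mat (\<iota> a))"
  have "?\<chi> \<noteq> 0" using degree_char_poly_Mat(2)[of "\<iota> a"] by auto
  then obtain R where R: "?\<chi> = (\<Prod>x\<in>#R. [:-x, 1:])"
    using alg_closed_imp_factorization[of ?\<chi>] degree_char_poly_Mat(2)[of "\<iota> a"] by auto
  have cardZ: "card {r. poly ?\<chi> r = 0} = n"
    using card_roots_simple[OF R disc_simple_roots[OF a]] degree_char_poly_Mat(1) by simp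
  then have "finite {r. poly ?\<chi> r = 0}" using n_pos card_ge_0_finite by metis
  then obtain z where z: "bij_betw z {..<n} {r. poly ?\<chi> r = 0}"
    using ex_bij_betw_nat_finite cardZ by (metis atLeast0LessThan)
  have zi: "inj_on z {..<n}" using z by (simp add: bij_betw_def)
  have "\<exists>y. y \<in> V \<and> y \<noteq> 0 \<and> \<iota> a \<star> y = fun_scale (z i) y" if i: "i < n" for i
  proof -
    have "poly ?\<chi> (z i) = 0" using z i by (auto simp: bij_betw_def)
    then have "eigenvalue (Mat (\<iota> a)) (z i)" using eigenvalue_root_char_poly[OF Mat_carrier] by blast
    then obtain y where y: "y \<in> carrier_vec n" "y \<noteq> 0\<^sub>v n" "Mat (\<iota> a) *\<^sub>v y = z i \<cdot>\<^sub>v y"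
      unfolding eigenvalue_def eigenvector_def using Mat_carrier[of "\<iota> a"] by auto
    have "\<iota> a \<star> vec_of y = vec_of (z i \<cdot>\<^sub>v y)" using Mat_vec[OF y(1)] y(3) by simp
    also have "\<dots> = fun_scale (z i) (vec_of y)"
      unfolding vec_of_def FS.scale_sum_right
    proof (rule sum.cong[OF refl])
      fix j assume "j \<in> {..<n}"
      then have "(z i \<cdot>\<^sub>v y) $ j = z i * y $ j" using y(1) by simp
      then show "fun_scale ((z i \<cdot>\<^sub>v y) $ j) (v j) = fun_scale (z i) (fun_scale (y $ j) (v j))" by (simp only: FS.scale_scale)
    qed
    finally have eig: "\<iota> a \<star> vec_of y = fun_scale (z i) (vec_of y)" .
    show ?thesis by (rule exI[where x = "vec_of y"]) (rule conjI[OF vec_of_V conjI[OF vec_of_nonzero[OF y(1,2)] eig]])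
  qed
  then have ex: "\<exists>y. y \<in> V \<and> y \<noteq> 0 \<and> \<iota> a \<star> y = fun_scale (z i) y" if "i < n" for i using that .
  define y where "y i = (SOME y. y \<in> V \<and> y \<noteq> 0 \<and> \<iota> a \<star> y = fun_scale (z i) y)" for i
  have y: "y i \<in> V \<and> y i \<noteq> 0 \<and> \<iota> a \<star> y i = fun_scale (z i) (y i)" if "i < n" for i
    unfolding y_def by (rule someI_ex[OF ex[OF that]])
  have ypow: "\<iota> (a ^ k) \<star> y i = fun_scale (z i ^ k) (y i)" if "i < n" for i k
  proof (induction k)
    case 0 then show ?case using y[OF that] mul_one(1)[OF VC] by simp
  next
    case (Suc k)
    have "\<iota> (a ^ Suc k) \<star> y i = \<iota> a \<star> (\<iota> (a ^ k) \<star> y i)" by (simp only: power_Suc \<iota>_mult mul_assoc)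
    also have "\<dots> = fun_scale (z i ^ k) (fun_scale (z i) (y i))"
      by (simp only: Suc mul_scale_right) (use y[OF that] in simp)
    also have "\<dots> = fun_scale (z i ^ Suc k) (y i)" by (simp only: power_Suc mult_ac)
    finally show ?case .
  qed
  define PL where "PL P = (\<Sum>k\<le>degree P. fun_scale (coeff P k) (\<iota> (a ^ k)))" for P
  have PLy: "PL P \<star> y i = fun_scale (poly P (z i)) (y i)" if i: "i < n" for P i
  proof -
    have "PL P \<star> y i = (\<Sum>k\<le>degree P. fun_scale (coeff P k) (fun_scale (z i ^ k) (y i)))"
      unfolding PL_def by (simp only: mul_sum_left mul_scale_left ypow[OF i])
    also have "\<dots> = fun_scale (poly P (z i)) (y i)"
      unfolding poly_altdef by (rule ext) (simp only: sum_fun_apply sum_distrib_right mult.assoc)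
    finally show ?thesis .
  qed
  have ind: "\<forall>i<n. r i = 0" if s: "(\<Sum>i<n. fun_scale (r i) (y i)) = 0" for r
  proof (intro allI impI)
    fix k assume k: "k < n"
    \<comment> \<open>A Lagrange polynomial: it vanishes at every eigenvalue except
      \<open>z k\<close>, so its value at \<open>a\<close> isolates the k-th term.\<close>
    define P where "P = (\<Prod>j\<in>{..<n} - {k}. [:- z j, 1:])"
    have Pj: "poly P (z j) = 0" if "j < n" "j \<noteq> k" for j
      using that unfolding P_def poly_prod by (intro prod_zero) auto
    have P0: "poly P (z k) \<noteq> 0" using zi k by (auto simp: P_def poly_prod inj_on_def)
    have "(\<Sum>i<n. fun_scale (r i) (PL P \<star> y i)) = (\<Sum>i<n. if i = k then fun_scale (r k * poly P (z k)) (y k) else 0)"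
    proof (rule sum.cong[OF refl])
      fix i assume "i \<in> {..<n}"
      then have i: "i < n" by simp
      show "fun_scale (r i) (PL P \<star> y i) = (if i = k then fun_scale (r k * poly P (z k)) (y k) else 0)"
      proof (cases "i = k")
        case True then show ?thesis by (simp only: True PLy[OF k] FS.scale_scale if_True simp_thms)
      next
        case False
        then show ?thesis by (simp only: PLy[OF i] Pj[OF i False] if_False mult_zero_left mult_zero_right zero_fun_def)
      qed
    qed
    also have "\<dots> = fun_scale (r k * poly P (z k)) (y k)" using k by (subst sum.delta) auto
    also have "(\<Sum>i<n. fun_scale (r i) (PL P \<star> y i)) = PL P \<star> (\<Sum>i<n. fun_scale (r i) (y i))"
      by (simp only: mul_sum_right mul_scale_right)
    finally have "fun_scale (r k * poly P (z k)) (y k) = 0" by (simp only: s mul_0)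
    then show "r k = 0" using FS.scale_eq_0_iff[of "r k * poly P (z k)" "y k"] y[OF k] P0 by simp
  qed
  have inj: "inj_on y {..<n}"
  proof (rule inj_onI)
    fix i j assume ij: "i \<in> {..<n}" "j \<in> {..<n}" "y i = y j"
    then have "fun_scale (z i) (y i) = fun_scale (z j) (y i)" using y[of i] y[of j] by simp
    then have "z i = z j" using FS.scale_cancel_right[of "z i" "y i" "z j"] y[of i] ij(1) by simp
    then show "i = j" using zi ij by (auto simp: inj_on_def)
  qed
  have indy: "FS.independent (y ` {..<n})"
  proof (rule FS.independent_if_scalars_zero)
    fix r x assume "(\<Sum>x\<in>y ` {..<n}. fun_scale (r x) x) = 0" and x: "x \<in> y ` {..<n}"
    then have "(\<Sum>i<n. fun_scale (r (y i)) (y i)) = 0" by (simp only: sum.reindex[OF inj] o_def)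
    from ind[OF this] show "r x = 0" using x by auto
  qed simp
  have spanV: "FS.span (y ` {..<n}) = V"
  proof (rule FS.subspace_eq_of_dim[OF _ V_span finite_\<iota>B])
    show "FS.span (y ` {..<n}) \<subseteq> V" using y by (intro FS.span_minimal subspace_V) auto
    have "V \<subseteq> FS.span (v ` {..<n})"
    proof
      fix x assume x: "x \<in> V"
      have "\<forall>i. \<exists>r. i < n \<longrightarrow> w i \<star> x = fun_scale r e" using pairing vw(2) x by blast
      then obtain r where r: "\<And>i. i < n \<Longrightarrow> w i \<star> x = fun_scale (r i) e" by metis
      have "x = (\<Sum>i<n. v i \<star> (w i \<star> x))" by (rule expand_left[OF VC[OF x]])
      also have "\<dots> = (\<Sum>i<n. fun_scale (r i) (v i))"
        by (rule sum.cong[OF refl]) (use r vw(1) in \<open>auto simp: mul_scale_right V_def\<close>)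
      also have "\<dots> \<in> FS.span (v ` {..<n})" by (intro FS.span_sum FS.span_scale FS.span_base imageI)
      finally show "x \<in> FS.span (v ` {..<n})" .
    qed
    then have "FS.dim V \<le> card (v ` {..<n})" by (intro FS.dim_le_card) auto
    also have "\<dots> \<le> n" using card_image_le[of "{..<n}" v] by simp
    also have "n = FS.dim (FS.span (y ` {..<n}))"
      using FS.dim_span_eq_card_independent[OF indy] card_image[OF inj] by simp
    finally show "FS.dim V \<le> FS.dim (FS.span (y ` {..<n}))" .
  qed simp
  have kill: "q = 0" if q: "q \<in> C" "\<And>i. i < n \<Longrightarrow> q \<star> y i = 0" for q
  proof -
    have "q \<star> x = 0" if "x \<in> V" for x
    proof -
      have "x \<in> FS.span (y ` {..<n})" using spanV that by simp
      then show ?thesis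
        using module_hom.eq_0_on_span[OF linear_mul_left[unfolded module_hom_iff_linear[symmetric]], of "y ` {..<n}" q x] q(2)
        by auto
    qed
    then have "(\<Sum>i<n. (q \<star> v i) \<star> w i) = (\<Sum>i<n. 0 \<star> w i)" by (intro sum.cong) (auto simp: vw(1))
    then show ?thesis using expand_right[OF q(1)] by simp
  qed
  obtain f where f: "lead_coeff f = 1" "peval a f = 0" "\<And>g. peval a g = 0 \<Longrightarrow> f dvd g"
    using minimal_polynomial by metis
  have PLf: "PL (map_poly to_ac f) = \<iota> (peval a f)"
    unfolding PL_def peval_altdef \<iota>_sum \<iota>_scale by (simp add: degree_map_poly coeff_map_poly)
  have root: "poly (map_poly to_ac f) (z i) = 0" if i: "i < n" for i
  proof -
    have "fun_scale (poly (map_poly to_ac f) (z i)) (y i) = 0" using PLy[OF i, of "map_poly to_ac f"] PLf f(2) by simp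
    then show ?thesis using FS.scale_eq_0_iff[of _ "y i"] y[OF i] by blast
  qed
  have f0: "f \<noteq> 0" using f(1) by auto
  have "n \<le> degree f"
  proof -
    have "map_poly to_ac f \<noteq> 0" using f0 by (simp add: map_poly_eq_0_iff)
    moreover have "z ` {..<n} \<subseteq> {r. poly (map_poly to_ac f) r = 0}" using root by auto
    ultimately have "card (z ` {..<n}) \<le> degree (map_poly to_ac f)"
      using card_mono[OF poly_roots_finite] card_poly_roots_bound[of "map_poly to_ac f"] le_trans by blast
    then show ?thesis using card_image[OF zi] by (simp add: degree_map_poly)
  qed
  moreover have "degree f \<le> n"
  proof (rule ccontr)
    assume less: "\<not> degree f \<le> n"
    have "peval a g \<noteq> 0" if "g \<noteq> 0" "degree g < Suc n" for g
      using f(3)[of g] dvd_imp_degree_le[of f g] that less by auto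
    note ip = independent_powers[OF this, of "Suc n"]
    define P where "P = (\<Prod>i<n. [:- z i, 1:])"
    have degP: "degree P = n" unfolding P_def by (subst degree_prod_eq_sum_degree) auto
    have "poly P (z i) = 0" if "i < n" for i using that unfolding P_def poly_prod by (intro prod_zero) auto
    then have PL0: "PL P \<star> y i = 0" if "i < n" for i
      by (simp only: PLy[OF that] that mult_zero_left zero_fun_def)
    have "PL P \<in> C" unfolding PL_def by (intro FS.subspace_sum FS.subspace_scale subspace_C \<iota>_C)
    from kill[OF this PL0] have "PL P = 0" .
    then have "(\<Sum>k<Suc n. fun_scale (coeff P k) (\<iota> (a ^ k))) = 0" by (simp only: PL_def degP lessThan_Suc_atMost)
    then have "coeff P n = 0" by (intro \<iota>_independent[OF _ ip]) auto
    then have "lead_coeff P = 0" using degP by simp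
    then have "P = 0" by (simp only: leading_coeff_0_iff)
    then show False unfolding P_def by simp
  qed
  ultimately have degf: "degree f = n" by simp
  show ?thesis
    by (rule that[of f a z y, OF f(1) degf f(2) zi root y equalityD2[OF spanV]])
qed

end

section \<open>Descent to the algebra\<close>

lemma poly_to_ac_pCons: "poly (map_poly to_ac (pCons c t)) x = to_ac c + x * poly (map_poly to_ac t) x"
proof -
  have "map_poly to_ac (pCons c t) = pCons (to_ac c) (map_poly to_ac t)"
    by (rule poly_eqI) (simp add: coeff_map_poly coeff_pCons split: nat.split)
  then show ?thesis by simp
qed

lemma poly_to_ac_add: "poly (map_poly to_ac (s + t)) x = poly (map_poly to_ac s) x + poly (map_poly to_ac t) x"
proof -
  have "map_poly to_ac (s + t) = map_poly to_ac s + map_poly to_ac t"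
    by (rule poly_eqI) (simp add: coeff_map_poly)
  then show ?thesis by simp
qed

lemma poly_to_ac_smult: "poly (map_poly to_ac (smult c t)) x = to_ac c * poly (map_poly to_ac t) x"
proof -
  have "map_poly to_ac (smult c t) = smult (to_ac c) (map_poly to_ac t)"
    by (rule poly_eqI) (simp add: coeff_map_poly)
  then show ?thesis by simp
qed

lemma poly_to_ac_mult: "poly (map_poly to_ac (s * t)) x = poly (map_poly to_ac s) x * poly (map_poly to_ac t) x"
proof (induction s)
  case (pCons c s)
  have "pCons c s * t = smult c t + pCons 0 (s * t)" by simp
  then show ?case
    by (simp only: poly_to_ac_add poly_to_ac_smult poly_to_ac_pCons pCons.IH to_ac_0) (simp add: algebra_simps)
qed simp

definition kpoly :: "('k::field alg_closure \<Rightarrow> 'k alg_closure) \<Rightarrow> bool" where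
  "kpoly F \<longleftrightarrow> (\<exists>t. \<forall>x. F x = poly (map_poly to_ac t) x)"

lemma kpoly_const: "kpoly (\<lambda>_. to_ac c)"
  unfolding kpoly_def by (rule exI[of _ "[:c:]"]) (simp only: poly_to_ac_pCons, simp)

lemma kpoly_id: "kpoly (\<lambda>x. x)"
  unfolding kpoly_def by (rule exI[of _ "[:0, 1:]"]) (simp only: poly_to_ac_pCons, simp)

lemma kpoly_add: "kpoly F \<Longrightarrow> kpoly G \<Longrightarrow> kpoly (\<lambda>x. F x + G x)"
  unfolding kpoly_def by (metis poly_to_ac_add)

lemma kpoly_mult: "kpoly F \<Longrightarrow> kpoly G \<Longrightarrow> kpoly (\<lambda>x. F x * G x)"
  unfolding kpoly_def by (metis poly_to_ac_mult)

lemma kpoly_0: "kpoly (\<lambda>_. 0)" and kpoly_1: "kpoly (\<lambda>_. 1)"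
  using kpoly_const[of 0] kpoly_const[of 1] by simp_all

lemma kpoly_diff: "kpoly F \<Longrightarrow> kpoly G \<Longrightarrow> kpoly (\<lambda>x. F x - G x)"
  using kpoly_add[of F "\<lambda>x. to_ac (- 1) * G x"] kpoly_mult[OF kpoly_const[of "- 1"], of G] by simp

lemma kpoly_sum: "(\<And>i. i \<in> S \<Longrightarrow> kpoly (F i)) \<Longrightarrow> kpoly (\<lambda>x. \<Sum>i\<in>S. F i x)"
  by (induction S rule: infinite_finite_induct) (simp_all add: kpoly_0 kpoly_add)

lemma kpoly_prod: "(\<And>i. i \<in> S \<Longrightarrow> kpoly (F i)) \<Longrightarrow> kpoly (\<lambda>x. \<Prod>i\<in>S. F i x)"
  by (induction S rule: infinite_finite_induct) (simp_all add: kpoly_1 kpoly_mult)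

lemma kpoly_power: "kpoly F \<Longrightarrow> kpoly (\<lambda>x. F x ^ m)"
  by (induction m) (simp_all add: kpoly_1 kpoly_mult)

lemma kpoly_minor:
  assumes "\<And>i b. kpoly (\<lambda>x. F x i b)"
  shows "kpoly (\<lambda>x. minor n (F x) J)"
proof -
  have "minor n (F x) J = (\<Sum>p | p permutes {0..<n}. signof p * (\<Prod>i\<in>{0..<n}. F x i (J (p i))))" for x
    unfolding minor_def det_def by (auto intro!: sum.cong prod.cong dest: permutes_in_image)
  moreover have "kpoly (\<lambda>x. signof p)" for p
    using kpoly_const[of 1] kpoly_const[of "-1"] by (cases "sign p = 1") (auto simp: sign_def)
  ultimately show ?thesis by (simp only:) (intro kpoly_sum kpoly_mult kpoly_prod assms)
qed

text \<open>Forms have coefficients in K, so this is the point through which the automorphism being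
  defined over K enters the descent.\<close>

lemma kpoly_form: "form T d R \<Longrightarrow> (\<And>J. kpoly (\<lambda>x. P x J)) \<Longrightarrow> kpoly (\<lambda>x. R (P x))"
  by (induction rule: form.induct) (auto intro: kpoly_const kpoly_add kpoly_mult)

lemma poly_eq_0_of_roots:
  fixes q :: "'l::idom poly"
  assumes "inj_on z {..<n}" "\<And>i. i < n \<Longrightarrow> poly q (z i) = 0" "\<And>k. n \<le> k \<Longrightarrow> coeff q k = 0"
  shows "q = 0"
proof (rule ccontr)
  assume q0: "q \<noteq> 0"
  have "z ` {..<n} \<subseteq> {x. poly q x = 0}" using assms(2) by auto
  then have "card (z ` {..<n}) \<le> card {x. poly q x = 0}" by (intro card_mono poly_roots_finite q0)
  also have "\<dots> \<le> degree q" by (rule card_poly_roots_bound[OF q0])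
  finally have "n \<le> degree q" using card_image[OF assms(1)] by simp
  then have "lead_coeff q = 0" by (rule assms(3))
  then show False using q0 by simp
qed

lemma monic_roots_pderiv:
  fixes q :: "'l::field poly"
  assumes q: "lead_coeff q = 1" "degree q = n" and z: "inj_on z {..<n}" "\<And>i. i < n \<Longrightarrow> poly q (z i) = 0"
    and i: "i < n"
  shows "poly (pderiv q) (z i) \<noteq> 0"
proof -
  define P where "P = (\<Prod>i<n. [:- z i, 1:])"
  have P: "lead_coeff P = 1" "degree P = n"
    unfolding P_def by (subst lead_coeff_prod, simp) (subst degree_prod_eq_sum_degree, auto)
  have "q - P = 0"
  proof (rule poly_eq_0_of_roots[OF z(1)])
    show "poly (q - P) (z j) = 0" if "j < n" for j
      using z(2)[OF that] that by (auto simp: P_def poly_prod)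
    show "coeff (q - P) k = 0" if "n \<le> k" for k
      using q P that by (cases "k = n") (simp_all add: coeff_eq_0)
  qed
  then have qP: "q = P" by simp
  define g where "g = (\<Prod>j\<in>{..<n} - {i}. [:- z j, 1:])"
  have fg: "q = [:- z i, 1:] * g" unfolding qP P_def g_def using i by (intro prod.remove) auto
  have "poly g (z i) \<noteq> 0" unfolding g_def poly_prod using z(1) i by (auto simp: inj_on_def)
  moreover have "poly (pderiv q) (z i) = poly g (z i)"
    by (simp only: fg pderiv_mult poly_add poly_mult) (simp add: pderiv_pCons)
  ultimately show ?thesis by simp
qed

text \<open>The coordinate at \<open>u0\<close> with respect to a K-basis of the closure that
  contains \<open>u0\<close>.\<close>

lemma linear_functional_to_ac:
  fixes u0 :: "'k::field alg_closure"
  assumes "u0 \<noteq> 0"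
  obtains \<pi> :: "'k alg_closure \<Rightarrow> 'k" where "\<And>x y. \<pi> (x + y) = \<pi> x + \<pi> y" "\<And>c x. \<pi> (to_ac c * x) = c * \<pi> x" "\<pi> u0 = 1"
proof -
  interpret M: vector_space "\<lambda>(c::'k) x. to_ac c * x"
    by unfold_locales (auto simp: algebra_simps)
  have ind: "M.independent {u0}" using assms by simp
  define E where "E = M.extend_basis {u0}"
  have E: "M.independent E" "M.span E = UNIV" "u0 \<in> E"
    using M.independent_extend_basis[OF ind] M.span_extend_basis[OF ind] M.extend_basis_superset[OF ind]
    by (auto simp: E_def)
  show ?thesis
  proof (rule that[of "\<lambda>x. M.representation E x u0"])
    show "M.representation E (x + y) u0 = M.representation E x u0 + M.representation E y u0" for x y
      by (simp add: M.representation_add[OF E(1)] E(2))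
    show "M.representation E (to_ac c * x) u0 = c * M.representation E x u0" for c x
      by (simp add: M.representation_scale[OF E(1)] E(2))
    show "M.representation E u0 u0 = 1" using M.representation_basis[OF E(1,3)] by simp
  qed
qed

text \<open>Reduced modulo \<open>h\<close>, the functions \<open>t c\<close> have degree below n,
  so a combination over the closure that vanishes at n distinct roots vanishes as a polynomial. Its
  coefficients are linear equations over K for the \<open>u c\<close>, and these are preserved by
  \<open>\<pi>\<close>.\<close>

lemma kpoly_descent:
  fixes \<pi> :: "'k::field alg_closure \<Rightarrow> 'k" and h :: "'k poly"
  assumes \<pi>: "\<And>x y. \<pi> (x + y) = \<pi> x + \<pi> y" "\<And>c x. \<pi> (to_ac c * x) = c * \<pi> x"
    and h: "degree h = n" "h \<noteq> 0" and z: "inj_on z {..<n}" "\<And>i. i < n \<Longrightarrow> poly (map_poly to_ac h) (z i) = 0"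
    and t: "\<And>c. c \<in> B \<Longrightarrow> kpoly (t c)" and s: "\<And>i. i < n \<Longrightarrow> (\<Sum>c\<in>B. u c * t c (z i)) = 0" and i: "i < n"
  shows "(\<Sum>c\<in>B. to_ac (\<pi> (u c)) * t c (z i)) = 0"
proof -
  have \<pi>0: "\<pi> 0 = 0" using \<pi>(2)[of 0 0] by simp
  have \<pi>s: "\<pi> (sum g S) = (\<Sum>c\<in>S. \<pi> (g c))" for g :: "'b \<Rightarrow> 'k alg_closure" and S
    by (induction S rule: infinite_finite_induct) (simp_all add: \<pi> \<pi>0)
  have "\<forall>c. \<exists>P. c \<in> B \<longrightarrow> (\<forall>x. t c x = poly (map_poly to_ac P) x)" using t unfolding kpoly_def by blast
  then obtain P where P: "\<And>c x. c \<in> B \<Longrightarrow> t c x = poly (map_poly to_ac (P c)) x" by metis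
  define r where "r c = P c mod h" for c
  have r: "t c (z j) = poly (map_poly to_ac (r c)) (z j)" if "c \<in> B" "j < n" for c j
  proof -
    have "t c (z j) = poly (map_poly to_ac (h * (P c div h) + r c)) (z j)" using P[OF that(1)] by (simp add: r_def)
    then show ?thesis by (simp only: poly_to_ac_add poly_to_ac_mult z(2)[OF that(2)]) simp
  qed
  have rd: "coeff (r c) k = 0" if "n \<le> k" for c k
  proof -
    have "r c = 0 \<or> degree (r c) < n" using degree_mod_less[OF h(2), of "P c"] h(1) by (auto simp: r_def)
    then show ?thesis using that by (auto simp: coeff_eq_0)
  qed
  define S where "S = (\<Sum>c\<in>B. smult (u c) (map_poly to_ac (r c)))"
  have "S = 0"
  proof (rule poly_eq_0_of_roots[OF z(1)])
    show "poly S (z j) = 0" if "j < n" for j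
    proof -
      have "poly S (z j) = (\<Sum>c\<in>B. u c * t c (z j))"
        unfolding S_def poly_sum by (rule sum.cong[OF refl]) (simp add: r[OF _ that])
      then show ?thesis using s[OF that] by simp
    qed
    show "coeff S k = 0" if "n \<le> k" for k
      using rd[OF that] by (simp add: S_def coeff_sum coeff_map_poly)
  qed
  have c0: "(\<Sum>c\<in>B. \<pi> (u c) * coeff (r c) k) = 0" for k
  proof -
    have "(\<Sum>c\<in>B. to_ac (coeff (r c) k) * u c) = coeff S k"
      by (simp add: S_def coeff_sum coeff_map_poly mult.commute)
    then have "(\<Sum>c\<in>B. to_ac (coeff (r c) k) * u c) = 0" using \<open>S = 0\<close> by simp
    then have "(\<Sum>c\<in>B. \<pi> (to_ac (coeff (r c) k) * u c)) = 0" using \<pi>s[of "\<lambda>c. to_ac (coeff (r c) k) * u c" B] \<pi>0 by simp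
    then have "(\<Sum>c\<in>B. coeff (r c) k * \<pi> (u c)) = 0" by (simp only: \<pi>(2))
    then show ?thesis by (simp add: mult.commute)
  qed
  have "(\<Sum>c\<in>B. smult (to_ac (\<pi> (u c))) (map_poly to_ac (r c))) = 0"
  proof (rule poly_eqI)
    fix k
    have "coeff (\<Sum>c\<in>B. smult (to_ac (\<pi> (u c))) (map_poly to_ac (r c))) k = to_ac (\<Sum>c\<in>B. \<pi> (u c) * coeff (r c) k)"
      by (simp add: coeff_sum coeff_map_poly to_ac_sum)
    then show "coeff (\<Sum>c\<in>B. smult (to_ac (\<pi> (u c))) (map_poly to_ac (r c))) k = coeff 0 k" by (simp add: c0)
  qed
  then have "poly (\<Sum>c\<in>B. smult (to_ac (\<pi> (u c))) (map_poly to_ac (r c))) (z i) = 0" by simp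
  moreover have "(\<Sum>c\<in>B. to_ac (\<pi> (u c)) * t c (z i)) = poly (\<Sum>c\<in>B. smult (to_ac (\<pi> (u c))) (map_poly to_ac (r c))) (z i)"
    unfolding poly_sum by (rule sum.cong[OF refl]) (simp add: r[OF _ i])
  ultimately show ?thesis by simp
qed

text \<open>The divided difference (h(x) - h(t)) / (x - t), written out as a polynomial in t and x
  so that x = t is allowed.\<close>

definition diffquot :: "'k::field poly \<Rightarrow> 'k alg_closure \<Rightarrow> 'k alg_closure \<Rightarrow> 'k alg_closure" where
  "diffquot h t x = (\<Sum>k\<le>degree h. to_ac (coeff h k) * (\<Sum>j<k. t ^ (k - Suc j) * x ^ j))"

lemma diffquot: "(x - t) * diffquot h t x = poly (map_poly to_ac h) x - poly (map_poly to_ac h) t"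
proof -
  have "(x - t) * diffquot h t x = (\<Sum>k\<le>degree h. to_ac (coeff h k) * (x ^ k - t ^ k))"
    unfolding diffquot_def sum_distrib_left
    by (rule sum.cong[OF refl]) (simp only: power_diff_sumr2 sum_distrib_left mult_ac)
  then show ?thesis
    by (simp add: poly_altdef degree_map_poly coeff_map_poly right_diff_distrib sum_subtractf)
qed

lemma diffquot_diag: "diffquot h t t = poly (pderiv (map_poly to_ac h)) t"
proof -
  have "t ^ (k - Suc j) * t ^ j = t ^ (k - 1)" if "j < k" for j k using that by (simp flip: power_add)
  then have "diffquot h t t = (\<Sum>k\<le>degree h. to_ac (coeff h k) * (of_nat k * t ^ (k - 1)))"
    unfolding diffquot_def by (intro sum.cong refl arg_cong2[where f = "(*)"]) simp
  also have "\<dots> = poly (\<Sum>k\<le>degree h. pderiv (monom (to_ac (coeff h k)) k)) t"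
    by (simp add: poly_sum pderiv_monom poly_monom mult_ac)
  also have "(\<Sum>k\<le>degree h. pderiv (monom (to_ac (coeff h k)) k)) = pderiv (map_poly to_ac h)"
    using poly_as_sum_of_monoms[of "map_poly to_ac h"]
    by (simp add: coeff_map_poly degree_map_poly flip: pderiv_sum)
  finally show ?thesis .
qed

section \<open>Lagrange idempotents over K, and rationality of the lift\<close>

context severi_brauer_split
begin

lemma kpoly_mul:
  assumes "\<And>b. kpoly (\<lambda>t. F t b)" "\<And>b. kpoly (\<lambda>t. G t b)" shows "kpoly (\<lambda>t. (F t \<star> G t) c)"
  unfolding mul_def ext_mult_def by (intro kpoly_sum kpoly_mult kpoly_const assms)

lemma kpoly_\<iota>: "kpoly (\<lambda>_. \<iota> c b)" unfolding \<iota>_def by (rule kpoly_const)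

lemma \<iota>_nonzero_left: assumes "s \<noteq> 0" "x \<in> C" "x \<noteq> 0" shows "\<iota> s \<star> x \<noteq> 0"
proof
  assume "\<iota> s \<star> x = 0"
  then have "\<iota> (inverse s) \<star> (\<iota> s \<star> x) = 0" by simp
  moreover have "\<iota> (inverse s) \<star> (\<iota> s \<star> x) = x"
    using assms mul_one(1) by (simp flip: mul_assoc \<iota>_mult)
  ultimately show False using assms(3) by simp
qed

text \<open>Up to the factor \<open>h'(t)\<close>, the Lagrange idempotent of the separable element \<open>a\<close> at the root
  \<open>t\<close> of its minimal polynomial \<open>h\<close>; its coordinates are polynomials in \<open>t\<close> over \<open>\<bbbK>\<close>.\<close>

definition eps :: "'a \<Rightarrow> 'k poly \<Rightarrow> 'k alg_closure \<Rightarrow> 'a \<Rightarrow> 'k alg_closure" where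
  "eps a h t = (\<Sum>k\<le>degree h. \<Sum>j<k. fun_scale (to_ac (coeff h k) * t ^ (k - Suc j)) (\<iota> (a ^ j)))"

lemma eps_C: "eps a h t \<in> C"
  unfolding eps_def by (intro FS.subspace_sum FS.subspace_scale subspace_C \<iota>_C)

lemma kpoly_eps: "kpoly (\<lambda>t. eps a h t b)"
  unfolding eps_def sum_fun_apply by (intro kpoly_sum kpoly_mult kpoly_const kpoly_power kpoly_id kpoly_\<iota>)

lemma \<iota>_power_eigen:
  assumes "x \<in> C" "\<iota> a \<star> x = fun_scale t x" shows "\<iota> (a ^ k) \<star> x = fun_scale (t ^ k) x"
proof (induction k)
  case 0 then show ?case using mul_one(1)[OF assms(1)] by simp
next
  case (Suc k)
  have "\<iota> (a ^ Suc k) \<star> x = \<iota> a \<star> (\<iota> (a ^ k) \<star> x)" by (simp only: power_Suc \<iota>_mult mul_assoc)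
  also have "\<dots> = fun_scale (t ^ k) (fun_scale t x)" by (simp only: Suc mul_scale_right assms(2))
  also have "\<dots> = fun_scale (t ^ Suc k) x" by (simp only: power_Suc mult_ac)
  finally show ?case .
qed

lemma eps_eigen:
  assumes "x \<in> C" "\<iota> a \<star> x = fun_scale r x" shows "eps a h t \<star> x = fun_scale (diffquot h t r) x"
proof -
  have "eps a h t \<star> x = (\<Sum>k\<le>degree h. \<Sum>j<k. fun_scale (to_ac (coeff h k) * t ^ (k - Suc j)) (fun_scale (r ^ j) x))"
    unfolding eps_def mul_sum_left mul_scale_left \<iota>_power_eigen[OF assms] ..
  also have "\<dots> = fun_scale (diffquot h t r) x"
    unfolding diffquot_def by (rule ext) (simp only: sum_fun_apply sum_distrib_right sum_distrib_left mult.assoc)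
  finally show ?thesis .
qed

text \<open>Comparing the factors at x0, x and x0 + x shows that they agree unless x is a multiple
  of x0, where they agree anyway. Closure under addition alone is asked of \<open>S\<close>, because
  it will be the orbit of a vector under A, which is not a space over the closure.\<close>

lemma common_eigenvalue:
  assumes S: "S \<subseteq> V" "\<And>x y. x \<in> S \<Longrightarrow> y \<in> S \<Longrightarrow> x + y \<in> S"
    and U: "\<And>x. x \<in> V \<Longrightarrow> x \<noteq> 0 \<Longrightarrow> U \<star> x \<noteq> 0"
    and ev: "\<And>x. x \<in> S \<Longrightarrow> \<exists>r. P \<star> x = fun_scale r (U \<star> x)"
  shows "\<exists>r. \<forall>x\<in>S. P \<star> x = fun_scale r (U \<star> x)"
proof (cases "S \<subseteq> {0}")
  case True
  then show ?thesis by (intro exI[of _ 0]) (auto simp: zero_fun_def[symmetric])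
next
  case False
  then obtain x0 where x0: "x0 \<in> S" "x0 \<noteq> 0" by blast
  obtain r0 where r0: "P \<star> x0 = fun_scale r0 (U \<star> x0)" using ev x0 by blast
  have "P \<star> x = fun_scale r0 (U \<star> x)" if x: "x \<in> S" for x
  proof -
    obtain r where r: "P \<star> x = fun_scale r (U \<star> x)" using ev x by blast
    obtain r2 where r2: "P \<star> (x0 + x) = fun_scale r2 (U \<star> (x0 + x))" using ev S(2) x x0 by blast
    have xV: "x \<in> V" "x0 \<in> V" using S(1) x x0 by auto
    have "U \<star> (fun_scale (r2 - r0) x0 + fun_scale (r2 - r) x)
        = fun_scale r2 (U \<star> (x0 + x)) - (fun_scale r0 (U \<star> x0) + fun_scale r (U \<star> x))"
      unfolding mul_add_right mul_scale_right by (rule ext) (simp add: algebra_simps)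
    also have "\<dots> = P \<star> (x0 + x) - (P \<star> x0 + P \<star> x)" by (simp only: r r0 r2)
    also have "\<dots> = 0" by (simp only: mul_add_right) simp
    finally have z: "fun_scale (r2 - r0) x0 + fun_scale (r2 - r) x = 0"
      using U[of "fun_scale (r2 - r0) x0 + fun_scale (r2 - r) x"] xV FS.subspace_add[OF subspace_V]
        FS.subspace_scale[OF subspace_V] by blast
    show ?thesis
    proof (cases "r2 = r")
      case True
      then have "fun_scale (r2 - r0) x0 = 0" using z by (simp add: plus_fun_def zero_fun_def)
      then have "r2 = r0" using FS.scale_eq_0_iff[of "r2 - r0" x0] x0(2) by simp
      then show ?thesis using r True by simp
    next
      case False
      have "x = fun_scale (- (r2 - r0) / (r2 - r)) x0"
      proof
        fix b
        have "(r2 - r0) * x0 b + (r2 - r) * x b = 0" using fun_cong[OF z, of b] by simp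
        then have "(r2 - r) * x b = - ((r2 - r0) * x0 b)" by (rule add_eq_0_iff[THEN iffD1])
        then show "x b = - (r2 - r0) / (r2 - r) * x0 b" using False by (simp add: field_simps)
      qed
      then obtain c where c: "x = fun_scale c x0" by blast
      have "P \<star> x = fun_scale c (fun_scale r0 (U \<star> x0))" by (simp only: c mul_scale_right r0)
      also have "\<dots> = fun_scale r0 (U \<star> x)" unfolding c mul_scale_right by (simp only: mult_ac)
      finally show ?thesis .
    qed
  qed
  then show ?thesis by blast
qed

text \<open>A left inverse of x gives y = (y c) x, so V is C x, and C is spanned by the image of
  \<open>B\<close>.\<close>

lemma V_generated: assumes "x \<in> V" "x \<noteq> 0" "y \<in> V" shows "\<exists>c. y = (\<Sum>b\<in>B. fun_scale (c b) (\<iota> b \<star> x))"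
proof -
  obtain c where c: "c \<in> W" "c \<star> x = e" using left_inverse_V assms by blast
  define d where "d = y \<star> c"
  have y: "y = d \<star> x" using assms(3) c(2) by (simp add: d_def mul_assoc V_def)
  have "d \<star> x = (\<Sum>b\<in>B. fun_scale (d b) (\<iota> b)) \<star> x"
    by (rule arg_cong[OF C_expand]) (simp add: d_def mul_C)
  also have "\<dots> = (\<Sum>b\<in>B. fun_scale (d b) (\<iota> b \<star> x))" by (simp only: mul_sum_left mul_scale_left)
  finally show ?thesis using y by (intro exI[of _ d]) (simp only:)
qed

lemma mul_eq_0_of_V: assumes "x \<in> C" "\<And>y. y \<in> V \<Longrightarrow> x \<star> y = 0" shows "x = 0"
proof -
  have "(\<Sum>i<n. (x \<star> v i) \<star> w i) = (\<Sum>i<n. 0 \<star> w i)" by (intro sum.cong) (auto simp: assms(2) vw(1))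
  then show ?thesis using expand_right[OF assms(1)] by simp
qed

context
  fixes a :: 'a and h :: "'k poly" and z :: "nat \<Rightarrow> 'k alg_closure" and y :: "nat \<Rightarrow> 'a \<Rightarrow> 'k alg_closure"
  assumes h: "lead_coeff h = 1" "degree h = n" and z: "inj_on z {..<n}"
    "\<And>i. i < n \<Longrightarrow> poly (map_poly to_ac h) (z i) = 0"
    and y: "\<And>i. i < n \<Longrightarrow> y i \<in> V \<and> y i \<noteq> 0 \<and> \<iota> a \<star> y i = fun_scale (z i) (y i)"
    and spany: "V \<subseteq> FS.span (y ` {..<n})"
begin

lemma diffquot_nonzero: assumes "i < n" shows "diffquot h (z i) (z i) \<noteq> 0"
proof -
  have d: "degree (map_poly to_ac h) = degree h" by (rule degree_map_poly) simp
  show ?thesis unfolding diffquot_diag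
    by (rule monic_roots_pderiv[OF _ _ z assms]) (use h in \<open>simp_all add: d coeff_map_poly\<close>)
qed

text \<open>The eigenvector \<open>y j\<close> is multiplied by the divided difference of h at the
  roots \<open>z i\<close> and \<open>z j\<close>, which vanishes for distinct roots.\<close>

lemma eps_y: assumes "i < n" "j < n"
  shows "eps a h (z i) \<star> y j = (if i = j then fun_scale (diffquot h (z i) (z i)) (y i) else 0)"
proof -
  have yj: "y j \<in> C" "\<iota> a \<star> y j = fun_scale (z j) (y j)" using y[OF assms(2)] VC by auto
  have "diffquot h (z i) (z j) = 0" if "i \<noteq> j"
  proof -
    have "(z j - z i) * diffquot h (z i) (z j) = 0" by (simp only: diffquot z(2)[OF assms(1)] z(2)[OF assms(2)]) simp
    moreover have "z j \<noteq> z i" using z(1) assms that by (auto simp: inj_on_def)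
    ultimately show ?thesis by simp
  qed
  then show ?thesis using eps_eigen[OF yj, of h "z i"] by (cases "i = j") (simp_all add: zero_fun_def)
qed

lemma eps_V: assumes i: "i < n" and x: "x \<in> V" shows "\<exists>r. eps a h (z i) \<star> x = fun_scale r (y i)"
proof -
  define S where "S = {x. \<exists>r. eps a h (z i) \<star> x = fun_scale r (y i)}"
  have sub: "FS.subspace S"
  proof (rule FS.subspaceI)
    show "0 \<in> S" unfolding S_def by (rule CollectI, rule exI[of _ 0]) (simp add: zero_fun_def[symmetric])
    show "x + x' \<in> S" if "x \<in> S" "x' \<in> S" for x x'
      using that unfolding S_def by (auto simp: mul_add_right simp flip: FS.scale_left_distrib)
    show "fun_scale c x \<in> S" if "x \<in> S" for c x
      using that unfolding S_def by (auto simp: mul_scale_right simp flip: mult.assoc)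
  qed
  have "y j \<in> S" if "j < n" for j
  proof (cases "i = j")
    case True then show ?thesis unfolding S_def using eps_y[OF i that] by auto
  next
    case False
    then have "eps a h (z i) \<star> y j = fun_scale 0 (y i)" using eps_y[OF i that] by (simp add: zero_fun_def)
    then show ?thesis unfolding S_def by blast
  qed
  then have "FS.span (y ` {..<n}) \<subseteq> S" by (intro FS.span_minimal sub) auto
  then show ?thesis using x spany by (auto simp: S_def)
qed

text \<open>On V the element maps everything to the line of \<open>y i\<close>, so it has rank one
  and factors as a vector times a covector.\<close>

lemma eps_factor: assumes i: "i < n"
  obtains \<omega> where "\<omega> \<in> W" "eps a h (z i) = y i \<star> \<omega>" "\<omega> \<star> y i = fun_scale (diffquot h (z i) (z i)) e"
proof -
  have yi: "y i \<in> V" "y i \<noteq> 0" using y[OF i] by auto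
  have "\<forall>l. \<exists>r. l < n \<longrightarrow> eps a h (z i) \<star> v l = fun_scale r (y i)" using eps_V[OF i] vw(1) by blast
  then obtain r where r: "\<And>l. l < n \<Longrightarrow> eps a h (z i) \<star> v l = fun_scale (r l) (y i)" by metis
  define \<omega> where "\<omega> = (\<Sum>l<n. fun_scale (r l) (w l))"
  have subW: "FS.subspace W"
    by (rule FS.subspaceI)
      (auto simp: W_def mul_add_right mul_scale_right FS.subspace_0[OF subspace_C] FS.subspace_add[OF subspace_C] FS.subspace_scale[OF subspace_C])
  have W: "\<omega> \<in> W" unfolding \<omega>_def by (intro FS.subspace_sum FS.subspace_scale subW vw(2)) simp
  have "eps a h (z i) = (\<Sum>l<n. (eps a h (z i) \<star> v l) \<star> w l)" by (rule expand_right[OF eps_C])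
  also have "\<dots> = (\<Sum>l<n. fun_scale (r l) (y i \<star> w l))"
    by (rule sum.cong[OF refl]) (use r in \<open>simp add: mul_scale_left\<close>)
  also have "\<dots> = y i \<star> \<omega>" by (simp only: \<omega>_def mul_sum_right mul_scale_right)
  finally have eq: "eps a h (z i) = y i \<star> \<omega>" .
  obtain t where t: "\<omega> \<star> y i = fun_scale t e" using pairing[OF W yi(1)] by blast
  have "fun_scale (diffquot h (z i) (z i)) (y i) = eps a h (z i) \<star> y i" using eps_y[OF i i] by simp
  also have "\<dots> = y i \<star> fun_scale t e" by (simp only: eq mul_assoc t)
  also have "\<dots> = fun_scale t (y i)" using yi(1) by (simp add: mul_scale_right V_def)
  finally have "t = diffquot h (z i) (z i)" using FS.scale_cancel_right yi(2) by metis
  then show ?thesis using that[OF W eq] t by simp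
qed

text \<open>The ideal of s y i is s eps C, hence spanned by the products with elements of
  \<open>B\<close>, and n of these form a basis. Its point is that all entries are polynomials over
  K in the root.\<close>

lemma pt_family_basis:
  assumes i: "i < n" and s: "s \<noteq> 0"
  obtains b where "family_basis n (\<lambda>k. \<iota> s \<star> eps a h (z i) \<star> \<iota> (b k)) (pt (\<iota> s \<star> y i))"
proof -
  have yi: "y i \<in> V" "y i \<noteq> 0" using y[OF i] by auto
  define x where "x = \<iota> s \<star> y i"
  define g where "g c = \<iota> s \<star> eps a h (z i) \<star> c" for c
  have x: "x \<in> V" "x \<noteq> 0" using mul_V yi \<iota>_nonzero_left[OF s VC[OF yi(1)] yi(2)] by (auto simp: x_def)
  obtain \<omega> where \<omega>: "\<omega> \<in> W" "eps a h (z i) = y i \<star> \<omega>" "\<omega> \<star> y i = fun_scale (diffquot h (z i) (z i)) e"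
    by (rule eps_factor[OF i])
  have gpt: "g c \<in> pt x" for c
    unfolding g_def \<omega>(2) pt_def x_def by (rule image_eqI[of _ _ "\<omega> \<star> c"]) (simp_all add: mul_assoc mul_C)
  have "pt x \<subseteq> FS.span (g ` \<iota> ` B)"
  proof
    fix u assume "u \<in> pt x"
    then obtain c where c: "u = x \<star> c" "c \<in> C" by (auto simp: pt_def)
    let ?d = "inverse (diffquot h (z i) (z i))"
    define c' where "c' = fun_scale ?d (y i \<star> c)"
    have "g c' = fun_scale ?d (\<iota> s \<star> (y i \<star> ((\<omega> \<star> y i) \<star> c)))"
      by (simp only: g_def c'_def mul_scale_right \<omega>(2) mul_assoc)
    also have "(\<omega> \<star> y i) \<star> c = fun_scale (diffquot h (z i) (z i)) (e \<star> c)" by (simp only: \<omega>(3) mul_scale_left)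
    also have "fun_scale ?d (\<iota> s \<star> (y i \<star> fun_scale (diffquot h (z i) (z i)) (e \<star> c)))
        = fun_scale (?d * diffquot h (z i) (z i)) (\<iota> s \<star> (y i \<star> (e \<star> c)))"
      by (simp only: mul_scale_right FS.scale_scale)
    also have "\<dots> = \<iota> s \<star> (y i \<star> (e \<star> c))" using diffquot_nonzero[OF i] by simp
    also have "\<dots> = u" using yi(1) by (simp add: c(1) x_def V_def flip: mul_assoc)
    finally have u: "u = g c'" by simp
    have "c' \<in> C" unfolding c'_def by (intro FS.subspace_scale subspace_C mul_C)
    from C_expand[OF this] have "g c' = (\<Sum>b\<in>B. fun_scale (c' b) (g (\<iota> b)))"
      unfolding g_def by (simp only: flip: mul_sum_right mul_scale_right)
    then show "u \<in> FS.span (g ` \<iota> ` B)"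
      unfolding u by (simp only:) (intro FS.span_sum FS.span_scale FS.span_base imageI)
  qed
  moreover obtain H where H: "H \<subseteq> g ` \<iota> ` B" "FS.independent H" "g ` \<iota> ` B \<subseteq> FS.span H"
    by (rule FS.maximal_independent_subset)
  ultimately have "pt x \<subseteq> FS.span H" using FS.span_minimal[OF H(3) FS.subspace_span] by blast
  moreover have "FS.span H \<subseteq> pt x" using H(1) gpt by (intro FS.span_minimal subspace_pt x(1)) auto
  ultimately have spanH: "FS.span H = pt x" by blast
  have finH: "finite H" using finite_subset[OF H(1)] finite_B by simp
  have "card H = n" using FS.dim_span_eq_card_independent[OF H(2)] spanH dim_pt[OF x] by simp
  then obtain k where k: "bij_betw k {..<n} H" using ex_bij_betw_nat_finite[OF finH] by (auto simp: atLeast0LessThan)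
  have "\<exists>c. k i = g (\<iota> c)" if "i < n" for i using k H(1) that by (auto simp: bij_betw_def)
  then obtain b where b: "\<And>i. i < n \<Longrightarrow> k i = g (\<iota> (b i))" by metis
  have im: "(\<lambda>i. g (\<iota> (b i))) ` {..<n} = H"
    using k b by (auto simp: bij_betw_def image_iff)
  have "inj_on (\<lambda>i. g (\<iota> (b i))) {..<n}"
    using k b by (auto simp: bij_betw_def inj_on_def)
  then have "family_basis n (\<lambda>i. g (\<iota> (b i))) (pt x)"
    unfolding family_basis_def im using H(2) spanH by blast
  then show ?thesis using that unfolding g_def x_def by blast
qed

text \<open>To be used with a tuple \<open>b\<close> chosen for one root. At another root the same
  vectors still lie in the ideal but may be dependent, so the factor may be 0.\<close>

lemma minor_pt:
  assumes i: "i < n" and s: "s \<noteq> 0"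
  shows "\<exists>\<kappa>. minor n (\<lambda>k. \<iota> s \<star> eps a h (z i) \<star> \<iota> (b k)) = (\<lambda>J. \<kappa> * plucker n (pt (\<iota> s \<star> y i)) J)"
proof -
  have yi: "y i \<in> V" "y i \<noteq> 0" using y[OF i] by auto
  define x where "x = \<iota> s \<star> y i"
  define M where "M k = \<iota> s \<star> eps a h (z i) \<star> \<iota> (b k)" for k
  have x: "x \<in> V" "x \<noteq> 0" using mul_V yi \<iota>_nonzero_left[OF s VC[OF yi(1)] yi(2)] by (auto simp: x_def)
  obtain \<omega> where \<omega>: "eps a h (z i) = y i \<star> \<omega>" using eps_factor[OF i] by metis
  have "M k \<in> pt x" for k
    unfolding M_def \<omega> pt_def x_def by (rule image_eqI[of _ _ "\<omega> \<star> \<iota> (b k)"]) (simp_all add: mul_assoc mul_C)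
  then have "\<exists>c. M k = (\<lambda>b. \<Sum>l<n. c l * (x \<star> w l) b)" for k
    by (rule family_basis_span[OF family_basis_pt[OF x]])
  then have "\<forall>k. \<exists>c. M k = (\<lambda>b. \<Sum>l<n. c l * (x \<star> w l) b)" by blast
  from choice[OF this] obtain m where m: "\<forall>k. M k = (\<lambda>b. \<Sum>l<n. m k l * (x \<star> w l) b)" by blast
  have mM: "minor n M J = det (mat n n (\<lambda>(i, k). m i k)) * minor n (\<lambda>l. x \<star> w l) J" for J
    by (rule minor_change_basis) (simp only: m[rule_format])
  obtain \<kappa> where \<kappa>: "\<kappa> \<noteq> 0" "\<And>J. plucker n (pt x) J = \<kappa> * minor n (\<lambda>l. x \<star> w l) J"
    using plucker_minor(1)[OF family_basis_pt[OF x] pt_supp] by blast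
  have "minor n M J = det (mat n n (\<lambda>(i, k). m i k)) / \<kappa> * plucker n (pt x) J" for J
    using \<kappa>(1) by (simp add: mM \<kappa>(2))
  then have "minor n M = (\<lambda>J. det (mat n n (\<lambda>(i, k). m i k)) / \<kappa> * plucker n (pt x) J)" by (rule ext)
  then show ?thesis unfolding x_def M_def[abs_def] by blast
qed

end

text \<open>Feeding minors of these polynomial families into the forms of \<phi> yields a vector
  \<open>Q t\<close>, polynomial in t over K, that at every root \<open>z i\<close> is a multiple of
  U s eps. The vanishing of the 2 by 2 minors of the two vectors is linear in U with coefficients
  polynomial over K in the root, and it holds at all n roots; so it persists when the coordinates of
  U are replaced by their images under \<open>\<pi>\<close>. At the root with index 0 the vector is
  arranged to be nonzero, and there the minors give proportionality.\<close>

lemma rational_at: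
  fixes a :: 'a and h :: "'k poly" and z :: "nat \<Rightarrow> 'k alg_closure" and y :: "nat \<Rightarrow> 'a \<Rightarrow> 'k alg_closure"
  assumes h: "lead_coeff h = 1" "degree h = n" and z: "inj_on z {..<n}"
    "\<And>i. i < n \<Longrightarrow> poly (map_poly to_ac h) (z i) = 0"
    and y: "\<And>i. i < n \<Longrightarrow> y i \<in> V \<and> y i \<noteq> 0 \<and> \<iota> a \<star> y i = fun_scale (z i) (y i)"
    and spany: "V \<subseteq> FS.span (y ` {..<n})"
    and \<phi>: "endomorphism T (plucker n) Y \<phi>"
    and U: "U \<in> C" "\<And>x. x \<in> V \<Longrightarrow> x \<noteq> 0 \<Longrightarrow> U \<star> x \<noteq> 0" "\<And>x. x \<in> V \<Longrightarrow> x \<noteq> 0 \<Longrightarrow> \<phi> (pt x) = pt (U \<star> x)"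
    and \<pi>: "\<And>x y. \<pi> (x + y) = \<pi> x + \<pi> y" "\<And>c x. \<pi> (to_ac c * x) = (c :: 'k) * \<pi> x"
    and s: "s \<noteq> 0"
  shows "\<exists>r. \<iota> (\<Sum>c\<in>B. scale (\<pi> (U c)) c) \<star> (\<iota> s \<star> y 0) = fun_scale r (U \<star> (\<iota> s \<star> y 0))"
proof -
  note sep = h z y spany
  define E where "E i = eps a h (z i)" for i
  define x where "x i = \<iota> s \<star> y i" for i
  have yV: "y i \<in> V" "y i \<noteq> 0" if "i < n" for i using y[OF that] by auto
  have x: "x i \<in> V" "x i \<noteq> 0" if "i < n" for i
    using mul_V yV[OF that] \<iota>_nonzero_left[OF s VC[OF yV(1)[OF that]] yV(2)[OF that]] by (auto simp: x_def)
  obtain D R J1 where R: "\<forall>J\<in>T. form T D (R J)" "J1 \<in> T" "R J1 (plucker n (pt (x 0))) \<noteq> 0"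
    "\<forall>I\<in>Y. (\<lambda>b. if b \<in> B then R (J1(n - 1 := b)) (plucker n I) else 0) \<in> \<phi> I"
    using endomorphism_plucker[OF \<phi> x[OF n_pos]] by blast
  have J1b: "J1(n - 1 := b) \<in> T" if "b \<in> B" for b
    using R(2) that n_pos by (auto simp: PiE_iff extensional_def)
  obtain b where b: "family_basis n (\<lambda>k. \<iota> s \<star> eps a h (z 0) \<star> \<iota> (b k)) (pt (x 0))"
    unfolding x_def by (rule pt_family_basis[OF sep n_pos s])
  define P where "P t = minor n (\<lambda>k. \<iota> s \<star> eps a h t \<star> \<iota> (b k))" for t
  define q where "q t = (\<lambda>c. if c \<in> B then R (J1(n - 1 := c)) (P t) else 0)" for t
  have kP: "kpoly (\<lambda>t. P t J)" for J unfolding P_def by (intro kpoly_minor kpoly_mul kpoly_\<iota> kpoly_eps)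
  have kq: "kpoly (\<lambda>t. q t c)" for c
  proof (cases "c \<in> B")
    case True
    then show ?thesis unfolding q_def using kpoly_form[OF R(1)[rule_format, OF J1b] kP] by simp
  qed (simp add: q_def kpoly_0)
  have Rh: "R J (\<lambda>J. \<kappa> * p J) = \<kappa> ^ D * R J p" if "J \<in> T" for J \<kappa> p
    by (rule form_homogeneous[OF R(1)[rule_format, OF that]])
  have q_pt: "q (z i) \<in> pt (U \<star> x i)" if i: "i < n" for i
  proof -
    obtain \<kappa> where \<kappa>: "P (z i) = (\<lambda>J. \<kappa> * plucker n (pt (x i)) J)"
      using minor_pt[OF sep i s, of b] unfolding P_def x_def by blast
    have "q (z i) = fun_scale (\<kappa> ^ D) (\<lambda>c. if c \<in> B then R (J1(n - 1 := c)) (plucker n (pt (x i))) else 0)"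
    proof
      fix c show "q (z i) c = \<kappa> ^ D * (if c \<in> B then R (J1(n - 1 := c)) (plucker n (pt (x i))) else 0)"
        by (cases "c \<in> B") (simp_all only: q_def \<kappa> Rh[OF J1b] if_True if_False mult_zero_right)
    qed
    also have "\<dots> \<in> pt (U \<star> x i)"
      using FS.subspace_scale[OF subspace_pt[OF mul_V[OF x(1)[OF i], of U]] R(4)[rule_format, OF pt_SB[OF x[OF i]], unfolded U(3)[OF x[OF i]]], of "\<kappa> ^ D"] .
    finally show ?thesis .
  qed
  have "q (z 0) (J1 (n - 1)) \<noteq> 0"
  proof -
    obtain \<kappa> where \<kappa>: "\<And>J. plucker n (pt (x 0)) J = \<kappa> * P (z 0) J"
      using plucker_minor(1)[OF b pt_supp] unfolding P_def by blast
    have "plucker n (pt (x 0)) = (\<lambda>J. \<kappa> * P (z 0) J)" by (rule ext) (rule \<kappa>)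
    then have "R J1 (P (z 0)) \<noteq> 0" using R(3) by (auto simp: Rh[OF R(2)])
    moreover have "J1 (n - 1) \<in> B" using PiE_mem[OF R(2), of "n - 1"] n_pos by simp
    ultimately show ?thesis unfolding q_def fun_upd_triv by simp
  qed
  then have q0: "q (z 0) \<noteq> 0" by (metis zero_fun_def)
  have qC: "q t \<in> C" for t by (auto simp: q_def ext_carrier_def)
  \<comment> \<open>Otherwise \<open>q (z 0)\<close> would kill C eps y 0, which is all of V, and
    would itself be 0.\<close>
  have "\<exists>d\<in>B. q (z 0) \<star> \<iota> d \<star> E 0 \<noteq> 0"
  proof (rule ccontr)
    assume no: "\<not> ?thesis"
    have all: "q (z 0) \<star> c \<star> E 0 = 0" if "c \<in> C" for c
    proof -
      have "q (z 0) \<star> (\<Sum>d\<in>B. fun_scale (c d) (\<iota> d)) \<star> E 0 = (\<Sum>d\<in>B. fun_scale (c d) (q (z 0) \<star> \<iota> d \<star> E 0))"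
        by (simp only: mul_sum_left mul_sum_right mul_scale_left mul_scale_right)
      also have "\<dots> = (\<Sum>d\<in>B. 0)"
        by (rule sum.cong[OF refl]) (use no in \<open>simp add: zero_fun_def[symmetric]\<close>)
      finally show ?thesis unfolding C_expand[OF that, symmetric] by simp
    qed
    obtain l where l: "l \<in> W" "l \<star> y 0 = e" using left_inverse_V yV n_pos by blast
    have "q (z 0) \<star> u = 0" if u: "u \<in> V" for u
    proof -
      have "fun_scale (diffquot h (z 0) (z 0)) (q (z 0) \<star> u) = q (z 0) \<star> (u \<star> l) \<star> (fun_scale (diffquot h (z 0) (z 0)) (y 0))"
        using u l by (simp add: mul_scale_right mul_assoc V_def)
      also have "\<dots> = q (z 0) \<star> (u \<star> l) \<star> (E 0 \<star> y 0)" using eps_y[OF sep n_pos n_pos] by (simp add: E_def)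
      also have "\<dots> = (q (z 0) \<star> (u \<star> l) \<star> E 0) \<star> y 0" by (simp only: mul_assoc)
      also have "\<dots> = 0" by (simp only: all[OF mul_C] mul_0)
      finally show ?thesis using diffquot_nonzero[OF sep n_pos] FS.scale_eq_0_iff by blast
    qed
    then show False using mul_eq_0_of_V[OF qC] q0 by blast
  qed
  then obtain d where d: "q (z 0) \<star> \<iota> d \<star> E 0 \<noteq> 0" by blast
  define Q where "Q t = q t \<star> \<iota> d \<star> eps a h t" for t
  have kQ: "kpoly (\<lambda>t. Q t c)" for c unfolding Q_def by (intro kpoly_mul kq kpoly_\<iota> kpoly_eps)
  have Qi: "\<exists>r. Q (z i) = fun_scale r (U \<star> (\<iota> s \<star> E i))" if i: "i < n" for i
  proof -
    obtain c where c: "q (z i) = U \<star> x i \<star> c" using q_pt[OF i] by (auto simp: pt_def)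
    obtain \<omega> where \<omega>: "E i = y i \<star> \<omega>" unfolding E_def by (rule eps_factor[OF sep i]) blast
    obtain r where r: "(e \<star> (c \<star> \<iota> d)) \<star> y i = fun_scale r e" using pairing[OF mul_e_W yV(1)[OF i]] by blast
    have "U \<star> x i = U \<star> x i \<star> e" using x(1)[OF i] by (simp add: V_def mul_assoc)
    then have "Q (z i) = (U \<star> x i \<star> e) \<star> c \<star> \<iota> d \<star> (y i \<star> \<omega>)" unfolding Q_def c E_def[symmetric] \<omega> by simp
    also have "\<dots> = U \<star> x i \<star> ((e \<star> (c \<star> \<iota> d)) \<star> y i) \<star> \<omega>" by (simp only: mul_assoc)
    also have "\<dots> = fun_scale r (U \<star> x i \<star> e \<star> \<omega>)" by (simp only: r mul_scale_left mul_scale_right)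
    also have "U \<star> x i \<star> e \<star> \<omega> = U \<star> (\<iota> s \<star> E i)"
      using x(1)[OF i] by (simp add: V_def mul_assoc x_def \<omega>)
    finally show ?thesis by blast
  qed
  define a' where "a' = (\<Sum>c\<in>B. scale (\<pi> (U c)) c)"
  define F where "F c t = \<iota> c \<star> (\<iota> s \<star> eps a h t)" for c t
  have kF: "kpoly (\<lambda>t. F c t b)" for c b unfolding F_def by (intro kpoly_mul kpoly_\<iota> kpoly_eps)
  have UE: "U \<star> (\<iota> s \<star> E i) = (\<Sum>c\<in>B. fun_scale (U c) (F c (z i)))" for i
  proof -
    have "U \<star> (\<iota> s \<star> E i) = (\<Sum>c\<in>B. fun_scale (U c) (\<iota> c)) \<star> (\<iota> s \<star> E i)" by (rule arg_cong[OF C_expand[OF U(1)]])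
    then show ?thesis by (simp only: F_def mul_sum_left mul_scale_left E_def)
  qed
  have aE: "\<iota> a' \<star> (\<iota> s \<star> E i) = (\<Sum>c\<in>B. fun_scale (to_ac (\<pi> (U c))) (F c (z i)))" for i
    by (simp only: a'_def \<iota>_sum \<iota>_scale F_def mul_sum_left mul_scale_left E_def)
  have minors: "Q (z i) b1 * (\<iota> a' \<star> (\<iota> s \<star> E i)) b2 = Q (z i) b2 * (\<iota> a' \<star> (\<iota> s \<star> E i)) b1" if i: "i < n" for i b1 b2
  proof -
    \<comment> \<open>A 2 by 2 minor of \<open>Q\<close> against the summand of U s eps that belongs
      to \<open>c\<close>. Weighted by the coordinates of U, these add up to the minor against U s
      eps itself.\<close>
    define t where "t c \<zeta> = Q \<zeta> b1 * F c \<zeta> b2 - Q \<zeta> b2 * F c \<zeta> b1" for c \<zeta>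
    have expand: "(\<Sum>c\<in>B. g c * t c \<zeta>) = Q \<zeta> b1 * (\<Sum>c\<in>B. fun_scale (g c) (F c \<zeta>)) b2 - Q \<zeta> b2 * (\<Sum>c\<in>B. fun_scale (g c) (F c \<zeta>)) b1" for g \<zeta>
      unfolding t_def sum_fun_apply sum_distrib_left sum_subtractf[symmetric]
      by (rule sum.cong[OF refl]) (simp add: algebra_simps)
    have "(\<Sum>c\<in>B. U c * t c (z j)) = 0" if j: "j < n" for j
    proof -
      obtain r where r: "Q (z j) = fun_scale r (U \<star> (\<iota> s \<star> E j))" using Qi[OF j] by blast
      show ?thesis unfolding expand UE[symmetric] r by simp
    qed
    moreover have "kpoly (t c)" for c
    proof -
      have "kpoly (\<lambda>\<zeta>. Q \<zeta> b1 * F c \<zeta> b2 - Q \<zeta> b2 * F c \<zeta> b1)" by (intro kpoly_diff kpoly_mult kQ kF)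
      then show ?thesis by (simp only: t_def[abs_def])
    qed
    ultimately have "(\<Sum>c\<in>B. to_ac (\<pi> (U c)) * t c (z i)) = 0"
      by (intro kpoly_descent[where h = h and z = z and n = n and t = t and u = U]) (use \<pi> h z i in auto)
    then show ?thesis unfolding expand aE[symmetric] by simp
  qed
  have "Q (z 0) \<noteq> 0" using d by (simp add: Q_def E_def)
  then obtain b1 where b1: "Q (z 0) b1 \<noteq> 0" by (auto simp: fun_eq_iff)
  define r1 where "r1 = (\<iota> a' \<star> (\<iota> s \<star> E 0)) b1 / Q (z 0) b1"
  have "\<iota> a' \<star> (\<iota> s \<star> E 0) = fun_scale r1 (Q (z 0))"
  proof
    fix b2 show "(\<iota> a' \<star> (\<iota> s \<star> E 0)) b2 = r1 * Q (z 0) b2"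
      using minors[OF n_pos, of b1 b2] b1 by (simp add: r1_def field_simps)
  qed
  moreover obtain r2 where "Q (z 0) = fun_scale r2 (U \<star> (\<iota> s \<star> E 0))" using Qi[OF n_pos] by blast
  ultimately have r: "\<iota> a' \<star> (\<iota> s \<star> E 0) = fun_scale (r1 * r2) (U \<star> (\<iota> s \<star> E 0))" by (simp only: FS.scale_scale)
  define \<gamma> where "\<gamma> = diffquot h (z 0) (z 0)"
  have \<gamma>: "\<gamma> \<noteq> 0" "E 0 \<star> y 0 = fun_scale \<gamma> (y 0)"
    using diffquot_nonzero[OF sep n_pos] eps_y[OF sep n_pos n_pos] by (simp_all add: \<gamma>_def E_def)
  have "fun_scale \<gamma> (\<iota> a' \<star> x 0) = (\<iota> a' \<star> (\<iota> s \<star> E 0)) \<star> y 0" by (simp only: x_def mul_assoc \<gamma>(2) mul_scale_right)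
  also have "\<dots> = fun_scale (r1 * r2) ((U \<star> (\<iota> s \<star> E 0)) \<star> y 0)" by (simp only: r mul_scale_left)
  also have "(U \<star> (\<iota> s \<star> E 0)) \<star> y 0 = fun_scale \<gamma> (U \<star> x 0)" by (simp only: x_def mul_assoc \<gamma>(2) mul_scale_right)
  finally have "fun_scale \<gamma> (\<iota> a' \<star> x 0) = fun_scale \<gamma> (fun_scale (r1 * r2) (U \<star> x 0))" by (simp only: mult_ac)
  then have "\<iota> a' \<star> x 0 = fun_scale (r1 * r2) (U \<star> x 0)" using \<gamma>(1) FS.scale_cancel_left by blast
  then show ?thesis unfolding a'_def x_def by blast
qed

text \<open>On the vectors s y 0 with s in A, the element obtained from U through
  \<open>\<pi>\<close> acts proportionally to U. These vectors are closed under addition, so the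
  factor is the same for all, and they span V over the closure. As \<open>\<pi>\<close> is 1 on a
  nonzero coordinate of U, the element is not 0.\<close>

theorem automorphism_rational:
  assumes inf: "infinite (UNIV :: 'k set)" and \<phi>: "\<phi> \<in> carrier (SB_Aut scale B n)"
  shows "\<exists>a. a \<noteq> 0 \<and> (\<forall>x\<in>V - {0}. \<phi> (pt x) = pt (\<iota> a \<star> x))"
proof -
  obtain U where U: "U \<in> C" "\<And>x. x \<in> V \<Longrightarrow> x \<noteq> 0 \<Longrightarrow> U \<star> x \<noteq> 0" "\<And>x. x \<in> V \<Longrightarrow> x \<noteq> 0 \<Longrightarrow> \<phi> (pt x) = pt (U \<star> x)"
    using automorphism_left_mult[OF \<phi>] by (metis Diff_iff singletonD)
  have endo: "endomorphism T (plucker n) Y \<phi>" using \<phi> by (auto simp: SB_Aut_def Aut_variety_def)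
  obtain a h z y where sep: "lead_coeff h = 1" "degree h = n" "peval a h = 0" "inj_on z {..<n}"
    "\<And>i. i < n \<Longrightarrow> poly (map_poly to_ac h) (z i) = 0"
    "\<And>i. i < n \<Longrightarrow> y i \<in> V \<and> y i \<noteq> 0 \<and> \<iota> a \<star> y i = fun_scale (z i) (y i)"
    "V \<subseteq> FS.span (y ` {..<n})"
    by (rule separable_element[OF inf]) blast
  have y0: "y 0 \<in> V" "y 0 \<noteq> 0" using sep(6)[OF n_pos] by auto
  have "U \<noteq> 0" using U(2)[OF y0] by auto
  then obtain c0 where c0: "U c0 \<noteq> 0" by (auto simp: fun_eq_iff)
  have c0B: "c0 \<in> B" using c0 U(1) by (auto simp: ext_carrier_def)
  obtain \<pi> :: "'k alg_closure \<Rightarrow> 'k" where \<pi>: "\<And>x y. \<pi> (x + y) = \<pi> x + \<pi> y" "\<And>c x. \<pi> (to_ac c * x) = c * \<pi> x" "\<pi> (U c0) = 1"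
    by (rule linear_functional_to_ac[OF c0]) blast
  define a' where "a' = (\<Sum>c\<in>B. scale (\<pi> (U c)) c)"
  have "a' \<noteq> 0"
  proof
    assume "a' = 0"
    then have "\<pi> (U c0) = 0" unfolding a'_def by (rule independentD[OF B(1) finite_B subset_refl _ c0B])
    then show False using \<pi>(3) by simp
  qed
  define S where "S = range (\<lambda>s. \<iota> s \<star> y 0)"
  have "\<exists>r. \<forall>x\<in>S. \<iota> a' \<star> x = fun_scale r (U \<star> x)"
  proof (rule common_eigenvalue)
    show "S \<subseteq> V" using mul_V y0(1) by (auto simp: S_def)
    show "x + x' \<in> S" if "x \<in> S" "x' \<in> S" for x x'
      using that unfolding S_def by (auto simp flip: mul_add_left \<iota>_add)
    show "U \<star> x \<noteq> 0" if "x \<in> V" "x \<noteq> 0" for x by (rule U(2)[OF that])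
    fix x assume "x \<in> S"
    then obtain s where s: "x = \<iota> s \<star> y 0" by (auto simp: S_def)
    show "\<exists>r. \<iota> a' \<star> x = fun_scale r (U \<star> x)"
    proof (cases "s = 0")
      case True
      then show ?thesis unfolding s by (simp add: zero_fun_def[symmetric])
    next
      case False
      show ?thesis unfolding s a'_def
        by (rule rational_at[OF sep(1,2,4-7) endo U \<pi>(1,2) False])
    qed
  qed
  then obtain r where r: "\<And>s. \<iota> a' \<star> (\<iota> s \<star> y 0) = fun_scale r (U \<star> (\<iota> s \<star> y 0))" unfolding S_def by blast
  have rV: "\<iota> a' \<star> x = fun_scale r (U \<star> x)" if x: "x \<in> V" for x
  proof -
    obtain c where c: "x = (\<Sum>b\<in>B. fun_scale (c b) (\<iota> b \<star> y 0))" using V_generated[OF y0 x] by blast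
    have "\<iota> a' \<star> x = (\<Sum>b\<in>B. fun_scale (c b) (fun_scale r (U \<star> (\<iota> b \<star> y 0))))"
      unfolding c by (simp only: mul_sum_right mul_scale_right r)
    also have "\<dots> = fun_scale r (U \<star> x)"
      unfolding c by (simp only: mul_sum_right mul_scale_right FS.scale_sum_right) (simp only: mult_ac)
    finally show ?thesis .
  qed
  have "\<phi> (pt x) = pt (\<iota> a' \<star> x)" if x: "x \<in> V" "x \<noteq> 0" for x
  proof -
    have "\<iota> a' \<star> x \<noteq> 0" by (rule \<iota>_nonzero_left[OF \<open>a' \<noteq> 0\<close> VC[OF x(1)] x(2)])
    moreover have "par (\<iota> a' \<star> x) (U \<star> x)" unfolding par_def using rV[OF x(1)] by blast
    ultimately have "pt (\<iota> a' \<star> x) = pt (U \<star> x)" by (intro pt_eqI)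
    then show ?thesis using U(3)[OF x] by simp
  qed
  then show ?thesis using \<open>a' \<noteq> 0\<close> by blast
qed

text \<open>Acting alike on all lines forces a common factor r in the closure; as a quotient of
  coordinates of two elements of A it lies in K.\<close>

lemma proportional_of_same_action:
  assumes a: "a \<noteq> 0" "a' \<noteq> 0" and eq: "\<And>x. x \<in> V - {0} \<Longrightarrow> pt (\<iota> a \<star> x) = pt (\<iota> a' \<star> x)"
  shows "\<exists>c. a = scale c a'"
proof -
  have "\<exists>r. \<forall>x\<in>V. \<iota> a \<star> x = fun_scale r (\<iota> a' \<star> x)"
  proof (rule common_eigenvalue)
    show "x + y \<in> V" if "x \<in> V" "y \<in> V" for x y by (rule FS.subspace_add[OF subspace_V that])
    show "\<iota> a' \<star> x \<noteq> 0" if "x \<in> V" "x \<noteq> 0" for x by (rule \<iota>_nonzero_left[OF a(2) VC[OF that(1)] that(2)])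
    fix x assume x: "x \<in> V"
    show "\<exists>r. \<iota> a \<star> x = fun_scale r (\<iota> a' \<star> x)"
    proof (cases "x = 0")
      case True
      then show ?thesis by (simp add: zero_fun_def[symmetric])
    next
      case False
      have "par (\<iota> a \<star> x) (\<iota> a' \<star> x)" by (rule pt_eqD[OF mul_V[OF x] mul_V[OF x] eq]) (use x False in simp)
      then show ?thesis by (simp add: par_def)
    qed
  qed simp
  then obtain r where r: "\<And>x. x \<in> V \<Longrightarrow> \<iota> a \<star> x = fun_scale r (\<iota> a' \<star> x)" by blast
  have "\<iota> a + fun_scale (- r) (\<iota> a') = 0"
  proof (rule mul_eq_0_of_V)
    show "\<iota> a + fun_scale (- r) (\<iota> a') \<in> C"
      by (intro FS.subspace_add[OF subspace_C] FS.subspace_scale[OF subspace_C] \<iota>_C)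
    show "(\<iota> a + fun_scale (- r) (\<iota> a')) \<star> x = 0" if "x \<in> V" for x
      unfolding mul_add_left mul_scale_left r[OF that] by (rule ext) simp
  qed
  then have ra: "\<iota> a b = r * \<iota> a' b" for b using fun_cong[of _ _ b] by (fastforce simp: add_eq_0_iff)
  have "\<iota> a' \<noteq> 0" using \<iota>_inj[of a' 0] a(2) by auto
  then obtain b where b: "\<iota> a' b \<noteq> 0" by (auto simp: fun_eq_iff)
  have "r = to_ac (representation B a b / representation B a' b)"
    using ra[of b] b by (simp add: \<iota>_def)
  then have "\<iota> a = \<iota> (scale (representation B a b / representation B a' b) a')"
    unfolding \<iota>_scale using ra by (intro ext) simp
  then show ?thesis using \<iota>_inj by blast
qed

lemma automorphism_group_structure:
  fixes n' m p :: nat and G :: "(('a \<Rightarrow> 'k alg_closure) set \<Rightarrow> ('a \<Rightarrow> 'k alg_closure) set) set"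
  assumes p: "CHAR('k) = p" "p > 0" and roots: "contains_all_roots_of_unity TYPE('k)"
    and n: "n = n' * p ^ m" "coprime n' p"
    and G: "subgroup G (SB_Aut scale B n)" "finite G"
  shows "\<exists>H S. internal_semidirect_product (SB_Aut scale B n\<lparr>carrier := G\<rparr>) H S \<and>
     coprime (card H) p \<and> card H \<le> n' ^ (2 * (n - 1)) \<and>
     comm_group (SB_Aut scale B n\<lparr>carrier := S\<rparr>) \<and> (\<exists>k. card S = p ^ k) \<and>
     group_exp (SB_Aut scale B n\<lparr>carrier := S\<rparr>) \<le> p ^ m"
proof -
  let ?A = "SB_Aut scale B n"
  let ?G = "?A\<lparr>carrier := G\<rparr>"
  have inf: "infinite (UNIV :: 'k set)" by (rule infinite_of_roots_of_unity[OF roots]) (use p in simp)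
  have grA: "Group.group ?A" unfolding SB_Aut_def by (rule group_Aut_variety)
  have grG: "Group.group ?G" by (rule group.subgroup_imp_group[OF grA G(1)])
  have sub: "g \<in> carrier ?A" if "g \<in> G" for g using subgroup.subset[OF G(1)] that by blast
  have bij: "g \<in> Bij Y" if "g \<in> G" for g using sub[OF that] by (auto simp: SB_Aut_def Aut_variety_def)
  have mult: "g \<otimes>\<^bsub>?G\<^esub> h = compose Y g h" if "g \<in> G" "h \<in> G" for g h
    using bij[OF that(1)] bij[OF that(2)] by (simp add: SB_Aut_def Aut_variety_def BijGroup_def)
  have one: "\<one>\<^bsub>?G\<^esub> = (\<lambda>I\<in>Y. I)" by (simp add: SB_Aut_def Aut_variety_def BijGroup_def)
  \<comment> \<open>A lift of the automorphism to A, determined only up to scalars; this is why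
    products of lifts agree with lifts of products just up to a factor.\<close>
  define \<alpha> where "\<alpha> g = (SOME a. a \<noteq> 0 \<and> (\<forall>x\<in>V - {0}. g (pt x) = pt (\<iota> a \<star> x)))" for g
  have \<alpha>: "\<alpha> g \<noteq> 0 \<and> (\<forall>x\<in>V - {0}. g (pt x) = pt (\<iota> (\<alpha> g) \<star> x))" if "g \<in> G" for g
    unfolding \<alpha>_def by (rule someI_ex[OF automorphism_rational[OF inf sub[OF that]]])
  have \<alpha>0: "\<alpha> g \<noteq> 0" and \<alpha>pt: "x \<in> V - {0} \<Longrightarrow> g (pt x) = pt (\<iota> (\<alpha> g) \<star> x)" if "g \<in> G" for g x
    using \<alpha>[OF that] by auto
  have nz: "\<iota> (\<alpha> g) \<star> x \<in> V - {0}" if "g \<in> G" "x \<in> V - {0}" for g x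
    using mul_V \<iota>_nonzero_left[OF \<alpha>0[OF that(1)] VC] that(2) by auto
  have \<alpha>_mult: "\<exists>c. \<alpha> g * \<alpha> h = scale c (\<alpha> (g \<otimes>\<^bsub>?G\<^esub> h))" if gh: "g \<in> carrier ?G" "h \<in> carrier ?G" for g h
  proof -
    have g: "g \<in> G" "h \<in> G" using gh by auto
    have k: "g \<otimes>\<^bsub>?G\<^esub> h \<in> G" using subgroup.m_closed[OF G(1) g] by simp
    show ?thesis
    proof (rule proportional_of_same_action)
      show "\<alpha> g * \<alpha> h \<noteq> 0" using \<alpha>0 g by simp
      show "\<alpha> (g \<otimes>\<^bsub>?G\<^esub> h) \<noteq> 0" by (rule \<alpha>0[OF k])
      fix x assume x: "x \<in> V - {0}"
      have "pt (\<iota> (\<alpha> g * \<alpha> h) \<star> x) = g (h (pt x))"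
        by (simp only: \<iota>_mult mul_assoc \<alpha>pt[OF g(2) x] \<alpha>pt[OF g(1) nz[OF g(2) x]])
      also have "\<dots> = (g \<otimes>\<^bsub>?G\<^esub> h) (pt x)"
        using pt_SB x by (simp only: mult[OF g]) (simp add: compose_def)
      also have "\<dots> = pt (\<iota> (\<alpha> (g \<otimes>\<^bsub>?G\<^esub> h)) \<star> x)" by (rule \<alpha>pt[OF k x])
      finally show "pt (\<iota> (\<alpha> g * \<alpha> h) \<star> x) = pt (\<iota> (\<alpha> (g \<otimes>\<^bsub>?G\<^esub> h)) \<star> x)" .
    qed
  qed
  have \<alpha>_inj: "g = \<one>\<^bsub>?G\<^esub>" if g: "g \<in> carrier ?G" and c: "\<alpha> g = scale c 1" for g c
  proof -
    have gG: "g \<in> G" using g by simp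
    have c0: "c \<noteq> 0" using \<alpha>0[OF gG] c by auto
    have "g I = I" if I: "I \<in> Y" for I
    proof -
      obtain x where x: "x \<in> V" "x \<noteq> 0" "I = pt x" by (rule SB_point_exists[OF I])
      have e: "\<iota> (\<alpha> g) \<star> x = fun_scale (to_ac c) x"
        using mul_one(1)[OF VC[OF x(1)]] by (simp only: c \<iota>_scale mul_scale_left)
      have "pt (fun_scale (to_ac c) x) = pt x"
      proof (rule pt_eqI)
        show "par (fun_scale (to_ac c) x) x" by (auto simp: par_def)
        show "fun_scale (to_ac c) x \<noteq> 0" using FS.scale_eq_0_iff[of "to_ac c" x] c0 x(2) by simp
      qed
      then show ?thesis using \<alpha>pt[OF gG, of x] x e by simp
    qed
    moreover have "g \<in> extensional Y" using bij[OF gG] by (simp add: Bij_def)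
    ultimately have "g = (\<lambda>I\<in>Y. I)" by (intro extensionalityI[of g Y]) auto
    then show ?thesis using one by simp
  qed
  have "\<exists>H S. internal_semidirect_product ?G H S \<and> coprime (card H) CHAR('k) \<and> card H \<le> n' ^ (2 * (n - 1)) \<and>
     comm_group (?G\<lparr>carrier := S\<rparr>) \<and> (\<exists>k. card S = CHAR('k) ^ k) \<and> group_exp (?G\<lparr>carrier := S\<rparr>) \<le> CHAR('k) ^ m"
  proof (rule projective_group_structure[where \<alpha> = \<alpha>, OF roots grG])
    show "finite (carrier ?G)" using G(2) by simp
    show "\<alpha> g \<noteq> 0" if "g \<in> carrier ?G" for g using \<alpha>0 that by simp
    show "\<exists>c. \<alpha> g * \<alpha> h = scale c (\<alpha> (g \<otimes>\<^bsub>?G\<^esub> h))" if "g \<in> carrier ?G" "h \<in> carrier ?G" for g h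
      by (rule \<alpha>_mult[OF that])
    show "g = \<one>\<^bsub>?G\<^esub>" if "g \<in> carrier ?G" "\<alpha> g = scale c 1" for g c by (rule \<alpha>_inj[OF that])
    show "CHAR('k) > 0" "n = n' * CHAR('k) ^ m" "coprime n' CHAR('k)" using p n by auto
    show "dim (UNIV :: 'a set) = n\<^sup>2" by (rule dim_A)
  qed
  then show ?thesis by (simp add: p(1))
qed

end

theorem proposition1p10:
  fixes scale :: "'k::field \<Rightarrow> 'a::division_ring \<Rightarrow> 'a"
    and B :: "'a set" and p n n' m :: nat
    and G :: "(('a \<Rightarrow> 'k alg_closure) set \<Rightarrow> ('a \<Rightarrow> 'k alg_closure) set) set"
  assumes "CHAR('k) = p" and "p > 0"
    and "contains_all_roots_of_unity TYPE('k)"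
    and "central_division_algebra scale"
    and "vector_space.dim scale (UNIV :: 'a set) = n\<^sup>2"
    and "is_basis scale B"
    and "n = n' * p ^ m" and "coprime n' p"
    and "subgroup G (SB_Aut scale B n)" and "finite G"
  shows "\<exists>H S. internal_semidirect_product (SB_Aut scale B n\<lparr>carrier := G\<rparr>) H S \<and>
     coprime (card H) p \<and> card H \<le> n' ^ (2 * (n - 1)) \<and>
     comm_group (SB_Aut scale B n\<lparr>carrier := S\<rparr>) \<and> (\<exists>k. card S = p ^ k) \<and>
     group_exp (SB_Aut scale B n\<lparr>carrier := S\<rparr>) \<le> p ^ m"
proof -
  have sb: "severi_brauer scale B n"
    by (intro severi_brauer.intro severi_brauer_axioms.intro assms(4,5,6))
  \<comment> \<open>The idempotent serves to identify the points of the variety with lines of a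
    module; the group in the conclusion does not involve it.\<close>
  obtain e where e: "e \<in> ext_carrier B" "e \<noteq> 0" "severi_brauer.mul scale B e e = e"
    "\<And>c. c \<in> ext_carrier B \<Longrightarrow> \<exists>r. severi_brauer.mul scale B (severi_brauer.mul scale B e c) e = fun_scale r e"
    by (rule severi_brauer.primitive_idempotent[OF sb]) blast
  have "severi_brauer_split scale B n e"
    by (intro severi_brauer_split.intro severi_brauer_split_axioms.intro sb e)
  then show ?thesis
    by (rule severi_brauer_split.automorphism_group_structure[OF _ assms(1-3,7-10)])
qed

end
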